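(* Let $\mathcal D=\langle\mathcal D_1,\mathcal D_2\rangle$ be a semiorthogonal decomposition of a triangulated category $\mathcal D$, and let $\sigma_1=(Z_1,P_1)$ and $\sigma_2=(Z_2,P_2)$ be locally finite stability conditions on $\mathcal D_1$ and $\mathcal D_2$ respectively, with hearts $H_1=P_1(0,1]$ and $H_2=P_2(0,1]$. Assume that $\operatorname{Hom}_{\mathcal D}^{\le 0}(H_1,H_2)=0$, let $H$ be the heart in $\mathcal D$ glued from $H_1$ and $H_2$, and consider the stability function $Z(E)=Z_1(\lambda_1(E))+Z_2(\rho_2(E))$ on $H$. Assume in addition that one of the following two conditions holds: (a) $0$ is an isolated point of $\operatorname{Im} Z_i(H_i)\subset\mathbb R_{\ge 0}$ for $i=1,2$; (b) $\operatorname{Hom}_{\mathcal D}^{\le 1}(H_1,P_2(0,1))=0$. Then $Z$ has the Harder-Narasimhan property on $H$ (so that there is a stability condition $\sigma=(Z,P)$ on $\mathcal D$ with heart $H$, glued from $\sigma_1$ and $\sigma_2$). Furthermore, in case (a) the category $P(0,1)$ for the glued stability condition $\sigma=(Z,P)$ is of finite length. In case (b) the stability condition $\sigma$ is locally finite.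
   Context: $\operatorname{Hom}^i(A,B)=\operatorname{Hom}(A,B[i])$; $\operatorname{Hom}^{\le m}(\mathcal A,\mathcal B)=0$ means $\operatorname{Hom}^i(A,B)=0$ for all $A\in\mathcal A$, $B\in\mathcal B$, $i\le m$. Stability conditions. A stability condition $\sigma=(Z,P)$ on a triangulated category $\mathcal D$ is a homomorphism $Z:K_0(\mathcal D)\to\mathbb C$ and a slicing $P$: full additive subcategories $P(\phi)\subset\mathcal D$, $\phi\in\mathbb R$ (semistable objects of phase $\phi$), with $P(\phi)[1]=P(\phi+1)$, $\operatorname{Hom}(P(\phi_1),P(\phi_2))=0$ for $\phi_1>\phi_2$, $Z(E)\in\mathbb R_{>0}e^{i\pi\phi}$ for $0\ne E\in P(\phi)$, and such that every nonzero object has a finite Harder-Narasimhan (HN) filtration by exact triangles with semistable factors of decreasing phases. For an interval $I\subset\mathbb R$, $PI$ (e.g. $P(0,1]$, $P(0,1)$) is the extension-closed full subcategory generated by the $P(\phi)$, $\phi\in I$. The heart of $\sigma$ is $P(0,1]$, the heart of a bounded $t$-structure. A stability function on an abelian category $H$ is a homomorphism $Z:K_0(H)\to\mathbb C$ sending every nonzero object into $\{\operatorname{Im} z>0\}\cup\mathbb R_{<0}$; it has the Harder-Narasimhan property if every nonzero object has an HN filtration with respect to the phases $\phi(E)=\frac1\pi\arg Z(E)\in(0,1]$. Giving a stability condition is the same as giving the heart $H$ of a bounded $t$-structure with a stability function having the Harder-Narasimhan property. A quasi-abelian category is of finite length if ascending and descending chains of strict subobjects stabilize; $\sigma$ is locally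 finite if there is $\eta>0$ such that $P(\phi-\eta,\phi+\eta)$ is of finite length for every $\phi\in\mathbb R$. Gluing. $\mathcal D=\langle\mathcal D_1,\mathcal D_2\rangle$ is a semiorthogonal decomposition if $\mathcal D_1,\mathcal D_2$ are triangulated subcategories, $\operatorname{Hom}(E_2,E_1)=0$ for $E_i\in\mathcal D_i$, and each $E\in\mathcal D$ fits into an exact triangle $E_2\to E\to E_1\to E_2[1]$ with $E_i\in\mathcal D_i$. Then $E_1=\lambda_1(E)$, $E_2=\rho_2(E)$, where $\lambda_1$ is left adjoint to $\mathcal D_1\hookrightarrow\mathcal D$ and $\rho_2$ is right adjoint to $\mathcal D_2\hookrightarrow\mathcal D$. If $H_i\subset\mathcal D_i$ are hearts of bounded $t$-structures with $\operatorname{Hom}^{\le 0}(H_1,H_2)=0$, the glued heart is $H=\{E\in\mathcal D:\lambda_1(E)\in H_1,\ \rho_2(E)\in H_2\}$, the heart of a $t$-structure on $\mathcal D$. A stability condition $\sigma$ on $\mathcal D$ is glued from $\sigma_1,\sigma_2$ if $\operatorname{Hom}^{\le 0}(H_1,H_2)=0$ for their hearts, its heart is this $H$, and its central charge is $Z(E)=Z_1(\lambda_1(E))+Z_2(\rho_2(E))$. *)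

theory Defs
  imports
    "HOL-Algebra.Free_Abelian_Groups"
    "HOL-Algebra.Generated_Groups"
    "HOL-Analysis.Isolated"
    Complex_Main
begin

section \<open>Preadditive and additive categories\<close>

text \<open>Every arrow carries its source and target, so hom-sets are disjoint.
  \<open>cmp C g f\<close> is the composite ``\<open>f\<close> first, then \<open>g\<close>''; \<open>cmp\<close> and \<open>add_arr\<close> are
  only meaningful on composable, respectively parallel, arrows.\<close>

record ('o, 'm) preadd =
  obj :: "'o set"
  arr :: "'m set"
  src :: "'m \<Rightarrow> 'o"
  tgt :: "'m \<Rightarrow> 'o"
  ident :: "'o \<Rightarrow> 'm"
  cmp :: "'m \<Rightarrow> 'm \<Rightarrow> 'm"
  zero_arr :: "'o \<Rightarrow> 'o \<Rightarrow> 'm"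
  add_arr :: "'m \<Rightarrow> 'm \<Rightarrow> 'm"

definition hom_set :: "('o, 'm, 'z) preadd_scheme \<Rightarrow> 'o \<Rightarrow> 'o \<Rightarrow> 'm set" where
  "hom_set C A B = {f \<in> arr C. src C f = A \<and> tgt C f = B}"

definition hom_group :: "('o, 'm, 'z) preadd_scheme \<Rightarrow> 'o \<Rightarrow> 'o \<Rightarrow> 'm monoid" where
  "hom_group C A B =
     \<lparr>carrier = hom_set C A B, monoid.mult = add_arr C, one = zero_arr C A B\<rparr>"

definition neg_arr :: "('o, 'm, 'z) preadd_scheme \<Rightarrow> 'm \<Rightarrow> 'm" where
  "neg_arr C f = m_inv (hom_group C (src C f) (tgt C f)) f"

locale preadditive_category =
  fixes C :: "('o, 'm, 'z) preadd_scheme"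
  assumes src_obj: "f \<in> arr C \<Longrightarrow> src C f \<in> obj C"
    and tgt_obj: "f \<in> arr C \<Longrightarrow> tgt C f \<in> obj C"
    and ident_hom: "X \<in> obj C \<Longrightarrow> ident C X \<in> hom_set C X X"
    and cmp_hom: "\<lbrakk>f \<in> hom_set C X Y; g \<in> hom_set C Y W\<rbrakk> \<Longrightarrow> cmp C g f \<in> hom_set C X W"
    and cmp_ident_right: "f \<in> hom_set C X Y \<Longrightarrow> cmp C f (ident C X) = f"
    and cmp_ident_left: "f \<in> hom_set C X Y \<Longrightarrow> cmp C (ident C Y) f = f"
    and cmp_assoc: "\<lbrakk>f \<in> hom_set C X Y; g \<in> hom_set C Y W; h \<in> hom_set C W V\<rbrakk>
      \<Longrightarrow> cmp C h (cmp C g f) = cmp C (cmp C h g) f"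
    and hom_comm_group: "\<lbrakk>X \<in> obj C; Y \<in> obj C\<rbrakk> \<Longrightarrow> comm_group (hom_group C X Y)"
    and precompose_hom: "\<lbrakk>f \<in> hom_set C X Y; W \<in> obj C\<rbrakk>
      \<Longrightarrow> (\<lambda>g. cmp C g f) \<in> hom (hom_group C Y W) (hom_group C X W)"
    and postcompose_hom: "\<lbrakk>g \<in> hom_set C Y W; X \<in> obj C\<rbrakk>
      \<Longrightarrow> (\<lambda>f. cmp C g f) \<in> hom (hom_group C X Y) (hom_group C X W)"

definition zero_object :: "('o, 'm, 'z) preadd_scheme \<Rightarrow> 'o \<Rightarrow> bool" where
  "zero_object C Z \<longleftrightarrow> Z \<in> obj C \<and>
     (\<forall>X \<in> obj C. (\<exists>!f. f \<in> hom_set C X Z) \<and> (\<exists>!f. f \<in> hom_set C Z X))"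

definition is_biproduct ::
  "('o, 'm, 'z) preadd_scheme \<Rightarrow> 'o \<Rightarrow> 'o \<Rightarrow> 'o \<Rightarrow> bool" where
  "is_biproduct C A1 A2 B \<longleftrightarrow>
     (\<exists>i1 \<in> hom_set C A1 B. \<exists>i2 \<in> hom_set C A2 B.
      \<exists>p1 \<in> hom_set C B A1. \<exists>p2 \<in> hom_set C B A2.
        cmp C p1 i1 = ident C A1 \<and> cmp C p2 i2 = ident C A2 \<and>
        cmp C p1 i2 = zero_arr C A2 A1 \<and> cmp C p2 i1 = zero_arr C A1 A2 \<and>
        add_arr C (cmp C i1 p1) (cmp C i2 p2) = ident C B)"

locale additive_category = preadditive_category +
  assumes ex_zero_object: "\<exists>Z. zero_object C Z"
    and ex_biproduct: "\<lbrakk>A1 \<in> obj C; A2 \<in> obj C\<rbrakk> \<Longrightarrow> \<exists>B \<in> obj C. is_biproduct C A1 A2 B"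

definition is_iso :: "('o, 'm, 'z) preadd_scheme \<Rightarrow> 'm \<Rightarrow> bool" where
  "is_iso C f \<longleftrightarrow> f \<in> arr C \<and>
     (\<exists>g \<in> hom_set C (tgt C f) (src C f).
        cmp C g f = ident C (src C f) \<and> cmp C f g = ident C (tgt C f))"

definition isomorphic :: "('o, 'm, 'z) preadd_scheme \<Rightarrow> 'o \<Rightarrow> 'o \<Rightarrow> bool" where
  "isomorphic C A B \<longleftrightarrow> (\<exists>f \<in> hom_set C A B. is_iso C f)"

definition monic :: "('o, 'm, 'z) preadd_scheme \<Rightarrow> 'm \<Rightarrow> bool" where
  "monic C f \<longleftrightarrow> f \<in> arr C \<and>
     (\<forall>X. \<forall>x \<in> hom_set C X (src C f). \<forall>y \<in> hom_set C X (src C f).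
        cmp C f x = cmp C f y \<longrightarrow> x = y)"

definition epic :: "('o, 'm, 'z) preadd_scheme \<Rightarrow> 'm \<Rightarrow> bool" where
  "epic C f \<longleftrightarrow> f \<in> arr C \<and>
     (\<forall>X. \<forall>x \<in> hom_set C (tgt C f) X. \<forall>y \<in> hom_set C (tgt C f) X.
        cmp C x f = cmp C y f \<longrightarrow> x = y)"

definition is_kernel :: "('o, 'm, 'z) preadd_scheme \<Rightarrow> 'm \<Rightarrow> 'm \<Rightarrow> bool" where
  "is_kernel C k f \<longleftrightarrow> k \<in> arr C \<and> f \<in> arr C \<and> tgt C k = src C f \<and>
     cmp C f k = zero_arr C (src C k) (tgt C f) \<and>
     (\<forall>X. \<forall>x \<in> hom_set C X (src C f). cmp C f x = zero_arr C X (tgt C f) \<longrightarrow>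
        (\<exists>!u. u \<in> hom_set C X (src C k) \<and> cmp C k u = x))"

definition is_cokernel :: "('o, 'm, 'z) preadd_scheme \<Rightarrow> 'm \<Rightarrow> 'm \<Rightarrow> bool" where
  "is_cokernel C c f \<longleftrightarrow> c \<in> arr C \<and> f \<in> arr C \<and> src C c = tgt C f \<and>
     cmp C c f = zero_arr C (src C f) (tgt C c) \<and>
     (\<forall>X. \<forall>x \<in> hom_set C (tgt C f) X. cmp C x f = zero_arr C (src C f) X \<longrightarrow>
        (\<exists>!u. u \<in> hom_set C (tgt C c) X \<and> cmp C u c = x))"

definition short_exact :: "('o, 'm, 'z) preadd_scheme \<Rightarrow> 'm \<Rightarrow> 'm \<Rightarrow> bool" where
  "short_exact C f g \<longleftrightarrow> is_kernel C f g \<and> is_cokernel C g f"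

text \<open>An arrow is strict if the canonical arrow from its coimage (cokernel of the kernel)
  to its image (kernel of the cokernel) is an isomorphism.\<close>

definition strict :: "('o, 'm, 'z) preadd_scheme \<Rightarrow> 'm \<Rightarrow> bool" where
  "strict C f \<longleftrightarrow>
     (\<exists>k c d i u. is_kernel C k f \<and> is_cokernel C c k \<and>
        is_cokernel C d f \<and> is_kernel C i d \<and>
        u \<in> hom_set C (tgt C c) (src C i) \<and> f = cmp C i (cmp C u c) \<and> is_iso C u)"

definition strict_monic :: "('o, 'm, 'z) preadd_scheme \<Rightarrow> 'm \<Rightarrow> bool" where
  "strict_monic C f \<longleftrightarrow> monic C f \<and> strict C f"

definition strict_epic :: "('o, 'm, 'z) preadd_scheme \<Rightarrow> 'm \<Rightarrow> bool" where
  "strict_epic C f \<longleftrightarrow> epic C f \<and> strict C f"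

locale preabelian_category = additive_category +
  assumes ex_kernel: "f \<in> arr C \<Longrightarrow> \<exists>k. is_kernel C k f"
    and ex_cokernel: "f \<in> arr C \<Longrightarrow> \<exists>c. is_cokernel C c f"

locale abelian_category = preabelian_category +
  assumes all_strict: "f \<in> arr C \<Longrightarrow> strict C f"

text \<open>In both squares \<open>q\<close> is the side opposite to \<open>f\<close>: it is the base change of \<open>f\<close>
  along \<open>g\<close>, respectively the cobase change.\<close>

definition is_pullback ::
  "('o, 'm, 'z) preadd_scheme \<Rightarrow> 'm \<Rightarrow> 'm \<Rightarrow> 'm \<Rightarrow> 'm \<Rightarrow> bool" where
  "is_pullback C f g p q \<longleftrightarrow>
     f \<in> arr C \<and> g \<in> arr C \<and> p \<in> arr C \<and> q \<in> arr C \<and>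
     tgt C f = tgt C g \<and> src C p = src C q \<and> tgt C p = src C f \<and> tgt C q = src C g \<and>
     cmp C f p = cmp C g q \<and>
     (\<forall>X. \<forall>x \<in> hom_set C X (src C f). \<forall>y \<in> hom_set C X (src C g).
        cmp C f x = cmp C g y \<longrightarrow>
        (\<exists>!u. u \<in> hom_set C X (src C p) \<and> cmp C p u = x \<and> cmp C q u = y))"

definition is_pushout ::
  "('o, 'm, 'z) preadd_scheme \<Rightarrow> 'm \<Rightarrow> 'm \<Rightarrow> 'm \<Rightarrow> 'm \<Rightarrow> bool" where
  "is_pushout C f g p q \<longleftrightarrow>
     f \<in> arr C \<and> g \<in> arr C \<and> p \<in> arr C \<and> q \<in> arr C \<and>
     src C f = src C g \<and> tgt C p = tgt C q \<and> src C p = tgt C f \<and> src C q = tgt C g \<and>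
     cmp C p f = cmp C q g \<and>
     (\<forall>X. \<forall>x \<in> hom_set C (tgt C f) X. \<forall>y \<in> hom_set C (tgt C g) X.
        cmp C x f = cmp C y g \<longrightarrow>
        (\<exists>!u. u \<in> hom_set C (tgt C p) X \<and> cmp C u p = x \<and> cmp C u q = y))"

locale quasi_abelian_category = preabelian_category +
  assumes strict_epic_pullback:
      "\<lbrakk>is_pullback C f g p q; strict_epic C f\<rbrakk> \<Longrightarrow> strict_epic C q"
    and strict_monic_pushout:
      "\<lbrakk>is_pushout C f g p q; strict_monic C f\<rbrakk> \<Longrightarrow> strict_monic C q"

text \<open>\<open>factors_through C m n\<close> is the order \<open>m \<le> n\<close> on subobjects of a common target.\<close>

definition factors_through :: "('o, 'm, 'z) preadd_scheme \<Rightarrow> 'm \<Rightarrow> 'm \<Rightarrow> bool" where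
  "factors_through C m n \<longleftrightarrow> (\<exists>u \<in> hom_set C (src C m) (src C n). m = cmp C n u)"

definition finite_length :: "('o, 'm, 'z) preadd_scheme \<Rightarrow> bool" where
  "finite_length C \<longleftrightarrow> quasi_abelian_category C \<and>
     (\<forall>E \<in> obj C. \<forall>s :: nat \<Rightarrow> 'm.
        (\<forall>n. strict_monic C (s n) \<and> tgt C (s n) = E) \<longrightarrow>
        ((\<forall>n. factors_through C (s n) (s (Suc n))) \<longrightarrow>
           (\<exists>N. \<forall>n\<ge>N. factors_through C (s n) (s N))) \<and>
        ((\<forall>n. factors_through C (s (Suc n)) (s n)) \<longrightarrow>
           (\<exists>N. \<forall>n\<ge>N. factors_through C (s N) (s n))))"

definition full_sub ::
  "('o, 'm, 'z) preadd_scheme \<Rightarrow> 'o set \<Rightarrow> ('o, 'm, 'z) preadd_scheme" where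
  "full_sub C S = C\<lparr>obj := S, arr := {f \<in> arr C. src C f \<in> S \<and> tgt C f \<in> S}\<rparr>"

definition additive_subcategory :: "('o, 'm, 'z) preadd_scheme \<Rightarrow> 'o set \<Rightarrow> bool" where
  "additive_subcategory C S \<longleftrightarrow> S \<subseteq> obj C \<and>
     (\<forall>Z. zero_object C Z \<longrightarrow> Z \<in> S) \<and>
     (\<forall>A \<in> S. \<forall>B \<in> obj C. isomorphic C A B \<longrightarrow> B \<in> S) \<and>
     (\<forall>A1 \<in> S. \<forall>A2 \<in> S. \<forall>B \<in> obj C. is_biproduct C A1 A2 B \<longrightarrow> B \<in> S)"


section \<open>Triangulated categories\<close>

text \<open>The shift is a strict action of the integers by additive automorphisms;
  \<open>shift_obj D i A\<close> is \<open>A[i]\<close>. A triangle \<open>A \<rightarrow> B \<rightarrow> C \<rightarrow> A[1]\<close> is given by its three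
  arrows.\<close>

record ('o, 'm) tricat = "('o, 'm) preadd" +
  shift_obj :: "int \<Rightarrow> 'o \<Rightarrow> 'o"
  shift_arr :: "int \<Rightarrow> 'm \<Rightarrow> 'm"
  distinguished :: "('m \<times> 'm \<times> 'm) set"

definition is_triangle ::
  "('o, 'm, 'z) tricat_scheme \<Rightarrow> 'm \<Rightarrow> 'm \<Rightarrow> 'm \<Rightarrow> bool" where
  "is_triangle D f g h \<longleftrightarrow> f \<in> arr D \<and> g \<in> arr D \<and> h \<in> arr D \<and>
     tgt D f = src D g \<and> tgt D g = src D h \<and> tgt D h = shift_obj D 1 (src D f)"

locale triangulated_category = additive_category D
  for D :: "('o, 'm, 'z) tricat_scheme" +
  assumes shift_obj_closed: "X \<in> obj D \<Longrightarrow> shift_obj D n X \<in> obj D"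
    and shift_arr_hom: "f \<in> hom_set D X Y
      \<Longrightarrow> shift_arr D n f \<in> hom_set D (shift_obj D n X) (shift_obj D n Y)"
    and shift_ident: "X \<in> obj D \<Longrightarrow> shift_arr D n (ident D X) = ident D (shift_obj D n X)"
    and shift_cmp: "\<lbrakk>f \<in> hom_set D X Y; g \<in> hom_set D Y W\<rbrakk>
      \<Longrightarrow> shift_arr D n (cmp D g f) = cmp D (shift_arr D n g) (shift_arr D n f)"
    and shift_add: "\<lbrakk>f \<in> hom_set D X Y; g \<in> hom_set D X Y\<rbrakk>
      \<Longrightarrow> shift_arr D n (add_arr D f g) = add_arr D (shift_arr D n f) (shift_arr D n g)"
    and shift_obj_0: "X \<in> obj D \<Longrightarrow> shift_obj D 0 X = X"
    and shift_arr_0: "f \<in> arr D \<Longrightarrow> shift_arr D 0 f = f"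
    and shift_obj_add: "X \<in> obj D \<Longrightarrow> shift_obj D (m + n) X = shift_obj D m (shift_obj D n X)"
    and shift_arr_add: "f \<in> arr D \<Longrightarrow> shift_arr D (m + n) f = shift_arr D m (shift_arr D n f)"
    and distinguished_triangle: "(f, g, h) \<in> distinguished D \<Longrightarrow> is_triangle D f g h"
    and TR1_ident: "\<lbrakk>X \<in> obj D; zero_object D Z\<rbrakk>
      \<Longrightarrow> (ident D X, zero_arr D X Z, zero_arr D Z (shift_obj D 1 X)) \<in> distinguished D"
    and TR1_cone: "f \<in> arr D \<Longrightarrow> \<exists>g h. (f, g, h) \<in> distinguished D"
    and TR1_iso: "\<lbrakk>(f, g, h) \<in> distinguished D; is_triangle D f' g' h';
        a \<in> hom_set D (src D f) (src D f'); is_iso D a;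
        b \<in> hom_set D (src D g) (src D g'); is_iso D b;
        c \<in> hom_set D (src D h) (src D h'); is_iso D c;
        cmp D b f = cmp D f' a; cmp D c g = cmp D g' b;
        cmp D (shift_arr D 1 a) h = cmp D h' c\<rbrakk>
      \<Longrightarrow> (f', g', h') \<in> distinguished D"
    and TR2: "is_triangle D f g h
      \<Longrightarrow> (f, g, h) \<in> distinguished D \<longleftrightarrow> (g, h, neg_arr D (shift_arr D 1 f)) \<in> distinguished D"
    and TR3: "\<lbrakk>(f, g, h) \<in> distinguished D; (f', g', h') \<in> distinguished D;
        a \<in> hom_set D (src D f) (src D f'); b \<in> hom_set D (src D g) (src D g');
        cmp D b f = cmp D f' a\<rbrakk>
      \<Longrightarrow> \<exists>c \<in> hom_set D (src D h) (src D h').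
            cmp D c g = cmp D g' b \<and> cmp D (shift_arr D 1 a) h = cmp D h' c"
    and TR4: "\<lbrakk>(f, p, p') \<in> distinguished D; (g, q, q') \<in> distinguished D;
        tgt D f = src D g; (cmp D g f, r, r') \<in> distinguished D\<rbrakk>
      \<Longrightarrow> \<exists>u \<in> hom_set D (tgt D p) (tgt D r). \<exists>v \<in> hom_set D (tgt D r) (tgt D q).
            (u, v, cmp D (shift_arr D 1 p) q') \<in> distinguished D \<and>
            cmp D u p = cmp D r g \<and> cmp D r' u = p' \<and>
            cmp D v r = q \<and> cmp D q' v = cmp D (shift_arr D 1 f) r'"

text \<open>Triangulated subcategories are full; closure under cones makes them closed under
  isomorphism.\<close>

definition triangulated_subcategory :: "('o, 'm, 'z) tricat_scheme \<Rightarrow> 'o set \<Rightarrow> bool" where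
  "triangulated_subcategory D S \<longleftrightarrow> S \<subseteq> obj D \<and> S \<noteq> {} \<and>
     (\<forall>A \<in> S. \<forall>n. shift_obj D n A \<in> S) \<and>
     (\<forall>f g h. (f, g, h) \<in> distinguished D \<and> src D f \<in> S \<and> tgt D f \<in> S \<longrightarrow> tgt D g \<in> S)"

definition tri_sub ::
  "('o, 'm, 'z) tricat_scheme \<Rightarrow> 'o set \<Rightarrow> ('o, 'm, 'z) tricat_scheme" where
  "tri_sub D S = (full_sub D S)\<lparr>distinguished :=
     {(f, g, h) \<in> distinguished D. src D f \<in> S \<and> src D g \<in> S \<and> src D h \<in> S}\<rparr>"

definition hom_vanish_le ::
  "('o, 'm, 'z) tricat_scheme \<Rightarrow> int \<Rightarrow> 'o set \<Rightarrow> 'o set \<Rightarrow> bool" where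
  "hom_vanish_le D m S T \<longleftrightarrow>
     (\<forall>A \<in> S. \<forall>B \<in> T. \<forall>i \<le> m.
        hom_set D A (shift_obj D i B) = {zero_arr D A (shift_obj D i B)})"


section \<open>Grothendieck groups\<close>

text \<open>\<open>R\<close> is the set of triples \<open>(A, B, C)\<close> imposing the relation \<open>[B] = [A] + [C]\<close>.\<close>

definition groth_rel :: "'o set \<Rightarrow> ('o \<times> 'o \<times> 'o) set \<Rightarrow> ('o \<Rightarrow>\<^sub>0 int) set" where
  "groth_rel S R = generate (free_Abelian_group S)
     {frag_of B - frag_of A - frag_of C | A B C. (A, B, C) \<in> R}"

definition groth_group ::
  "'o set \<Rightarrow> ('o \<times> 'o \<times> 'o) set \<Rightarrow> ('o \<Rightarrow>\<^sub>0 int) set monoid" where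
  "groth_group S R = free_Abelian_group S Mod groth_rel S R"

definition groth_class ::
  "'o set \<Rightarrow> ('o \<times> 'o \<times> 'o) set \<Rightarrow> 'o \<Rightarrow> ('o \<Rightarrow>\<^sub>0 int) set" where
  "groth_class S R E = groth_rel S R #>\<^bsub>free_Abelian_group S\<^esub> frag_of E"

definition triangle_rel :: "('o, 'm, 'z) tricat_scheme \<Rightarrow> ('o \<times> 'o \<times> 'o) set" where
  "triangle_rel D = {(src D f, src D g, src D h) | f g h. (f, g, h) \<in> distinguished D}"

definition short_exact_rel :: "('o, 'm, 'z) preadd_scheme \<Rightarrow> ('o \<times> 'o \<times> 'o) set" where
  "short_exact_rel C = {(src C f, tgt C f, tgt C g) | f g. short_exact C f g}"

definition K0_tri :: "('o, 'm, 'z) tricat_scheme \<Rightarrow> ('o \<Rightarrow>\<^sub>0 int) set monoid" where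
  "K0_tri D = groth_group (obj D) (triangle_rel D)"

definition cls_tri :: "('o, 'm, 'z) tricat_scheme \<Rightarrow> 'o \<Rightarrow> ('o \<Rightarrow>\<^sub>0 int) set" where
  "cls_tri D E = groth_class (obj D) (triangle_rel D) E"

definition K0_ab :: "('o, 'm, 'z) preadd_scheme \<Rightarrow> ('o \<Rightarrow>\<^sub>0 int) set monoid" where
  "K0_ab C = groth_group (obj C) (short_exact_rel C)"

definition cls_ab :: "('o, 'm, 'z) preadd_scheme \<Rightarrow> 'o \<Rightarrow> ('o \<Rightarrow>\<^sub>0 int) set" where
  "cls_ab C E = groth_class (obj C) (short_exact_rel C) E"

definition complex_add_group :: "complex monoid" where
  "complex_add_group = \<lparr>carrier = UNIV, monoid.mult = (+), one = 0\<rparr>"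


section \<open>Stability functions on abelian categories\<close>

definition stability_function ::
  "('o, 'm, 'z) preadd_scheme \<Rightarrow> (('o \<Rightarrow>\<^sub>0 int) set \<Rightarrow> complex) \<Rightarrow> bool" where
  "stability_function A W \<longleftrightarrow> abelian_category A \<and> W \<in> hom (K0_ab A) complex_add_group \<and>
     (\<forall>E \<in> obj A. \<not> zero_object A E \<longrightarrow>
        Im (W (cls_ab A E)) > 0 \<or> (W (cls_ab A E) \<in> \<real> \<and> Re (W (cls_ab A E)) < 0))"

text \<open>On the values of a stability function \<open>Arg\<close> lies in \<open>(0, \<pi>]\<close>, so the phase lies
  in \<open>(0, 1]\<close>.\<close>

definition phase ::
  "('o, 'm, 'z) preadd_scheme \<Rightarrow> (('o \<Rightarrow>\<^sub>0 int) set \<Rightarrow> complex) \<Rightarrow> 'o \<Rightarrow> real" where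
  "phase A W E = Arg (W (cls_ab A E)) / pi"

definition semistable ::
  "('o, 'm, 'z) preadd_scheme \<Rightarrow> (('o \<Rightarrow>\<^sub>0 int) set \<Rightarrow> complex) \<Rightarrow> 'o \<Rightarrow> bool" where
  "semistable A W E \<longleftrightarrow> E \<in> obj A \<and> \<not> zero_object A E \<and>
     (\<forall>m. monic A m \<and> tgt A m = E \<and> \<not> zero_object A (src A m) \<longrightarrow>
        phase A W (src A m) \<le> phase A W E)"

text \<open>A filtration \<open>0 = F 0 \<subset> F 1 \<subset> ... \<subset> F n = E\<close> with \<open>F (i + 1) / F i\<close> represented
  by \<open>Q i\<close>.\<close>

definition HN_property ::
  "('o, 'm, 'z) preadd_scheme \<Rightarrow> (('o \<Rightarrow>\<^sub>0 int) set \<Rightarrow> complex) \<Rightarrow> bool" where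
  "HN_property A W \<longleftrightarrow>
     (\<forall>E \<in> obj A. \<not> zero_object A E \<longrightarrow>
        (\<exists>(n :: nat) F Q. zero_object A (F 0) \<and> F n = E \<and>
           (\<forall>i<n. semistable A W (Q i) \<and>
              (\<exists>f \<in> hom_set A (F i) (F (Suc i)). \<exists>g \<in> hom_set A (F (Suc i)) (Q i).
                 short_exact A f g)) \<and>
           (\<forall>i j. i < j \<and> j < n \<longrightarrow> phase A W (Q i) > phase A W (Q j))))"


section \<open>Stability conditions on triangulated categories\<close>

type_synonym 'o stab = "(('o \<Rightarrow>\<^sub>0 int) set \<Rightarrow> complex) \<times> (real \<Rightarrow> 'o set)"

definition stability_condition :: "('o, 'm, 'z) tricat_scheme \<Rightarrow> 'o stab \<Rightarrow> bool" where
  "stability_condition D \<sigma> \<longleftrightarrow> (case \<sigma> of (Z, P) \<Rightarrow>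
     Z \<in> hom (K0_tri D) complex_add_group \<and>
     (\<forall>\<phi>. additive_subcategory D (P \<phi>)) \<and>
     (\<forall>\<phi>. shift_obj D 1 ` P \<phi> = P (\<phi> + 1)) \<and>
     (\<forall>\<phi>\<^sub>1 \<phi>\<^sub>2. \<phi>\<^sub>1 > \<phi>\<^sub>2 \<longrightarrow>
        (\<forall>A \<in> P \<phi>\<^sub>1. \<forall>B \<in> P \<phi>\<^sub>2. hom_set D A B = {zero_arr D A B})) \<and>
     (\<forall>\<phi>. \<forall>E \<in> P \<phi>. \<not> zero_object D E \<longrightarrow>
        (\<exists>r::real. r > 0 \<and> Z (cls_tri D E) = of_real r * cis (pi * \<phi>))) \<and>
     (\<forall>E \<in> obj D. \<not> zero_object D E \<longrightarrow>
        (\<exists>(n :: nat) F Q \<phi>. zero_object D (F 0) \<and> F n = E \<and>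
           (\<forall>i<n. Q i \<in> P (\<phi> i) \<and> \<not> zero_object D (Q i) \<and>
              (\<exists>f g h. (f, g, h) \<in> distinguished D \<and>
                 src D f = F i \<and> src D g = F (Suc i) \<and> src D h = Q i)) \<and>
           (\<forall>i j. i < j \<and> j < n \<longrightarrow> \<phi> i > \<phi> j))))"

text \<open>The extension closure \<open>P I\<close>. Since each \<open>P \<phi>\<close> contains all zero objects and extensions
  by zero objects are allowed, it is closed under isomorphism.\<close>

inductive_set interval_cat ::
  "('o, 'm, 'z) tricat_scheme \<Rightarrow> (real \<Rightarrow> 'o set) \<Rightarrow> real set \<Rightarrow> 'o set"
  for D :: "('o, 'm, 'z) tricat_scheme" and P :: "real \<Rightarrow> 'o set" and I :: "real set"
where
  base: "\<lbrakk>\<phi> \<in> I; E \<in> P \<phi>\<rbrakk> \<Longrightarrow> E \<in> interval_cat D P I"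
| ext: "\<lbrakk>(f, g, h) \<in> distinguished D; src D f \<in> interval_cat D P I;
         src D h \<in> interval_cat D P I\<rbrakk> \<Longrightarrow> src D g \<in> interval_cat D P I"

definition stab_heart :: "('o, 'm, 'z) tricat_scheme \<Rightarrow> 'o stab \<Rightarrow> 'o set" where
  "stab_heart D \<sigma> = interval_cat D (snd \<sigma>) {0<..1}"

text \<open>No upper bound on \<open>\<eta>\<close> is imposed; being quasi-abelian is part of \<open>finite_length\<close>.\<close>

definition locally_finite :: "('o, 'm, 'z) tricat_scheme \<Rightarrow> 'o stab \<Rightarrow> bool" where
  "locally_finite D \<sigma> \<longleftrightarrow>
     (\<exists>\<eta>>0. \<forall>\<phi>. finite_length (full_sub D (interval_cat D (snd \<sigma>) {\<phi> - \<eta><..<\<phi> + \<eta>})))"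


section \<open>Gluing\<close>

definition semiorthogonal_decomposition ::
  "('o, 'm, 'z) tricat_scheme \<Rightarrow> 'o set \<Rightarrow> 'o set \<Rightarrow> bool" where
  "semiorthogonal_decomposition D D1 D2 \<longleftrightarrow>
     triangulated_subcategory D D1 \<and> triangulated_subcategory D D2 \<and>
     (\<forall>E1 \<in> D1. \<forall>E2 \<in> D2. hom_set D E2 E1 = {zero_arr D E2 E1}) \<and>
     (\<forall>E \<in> obj D. \<exists>f g h. (f, g, h) \<in> distinguished D \<and>
        src D f \<in> D2 \<and> src D g = E \<and> src D h \<in> D1)"

text \<open>The outer terms of the triangle \<open>E\<^sub>2 \<rightarrow> E \<rightarrow> E\<^sub>1 \<rightarrow> E\<^sub>2[1]\<close>; they are determined by \<open>E\<close>
  up to isomorphism, and a representative is chosen.\<close>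

definition lambda1 :: "('o, 'm, 'z) tricat_scheme \<Rightarrow> 'o set \<Rightarrow> 'o set \<Rightarrow> 'o \<Rightarrow> 'o" where
  "lambda1 D D1 D2 E = (SOME E1. E1 \<in> D1 \<and>
     (\<exists>f g h. (f, g, h) \<in> distinguished D \<and> src D f \<in> D2 \<and> src D g = E \<and> src D h = E1))"

definition rho2 :: "('o, 'm, 'z) tricat_scheme \<Rightarrow> 'o set \<Rightarrow> 'o set \<Rightarrow> 'o \<Rightarrow> 'o" where
  "rho2 D D1 D2 E = (SOME E2. E2 \<in> D2 \<and>
     (\<exists>f g h. (f, g, h) \<in> distinguished D \<and> src D f = E2 \<and> src D g = E \<and> src D h \<in> D1))"

definition glued_heart ::
  "('o, 'm, 'z) tricat_scheme \<Rightarrow> 'o set \<Rightarrow> 'o set \<Rightarrow> 'o set \<Rightarrow> 'o set \<Rightarrow> 'o set" where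
  "glued_heart D D1 D2 H1 H2 =
     {E \<in> obj D. lambda1 D D1 D2 E \<in> H1 \<and> rho2 D D1 D2 E \<in> H2}"

definition glued_charge ::
  "('o, 'm, 'z) tricat_scheme \<Rightarrow> 'o set \<Rightarrow> 'o set \<Rightarrow> 'o stab \<Rightarrow> 'o stab \<Rightarrow> 'o \<Rightarrow> complex" where
  "glued_charge D D1 D2 \<sigma>1 \<sigma>2 E =
     fst \<sigma>1 (cls_tri (tri_sub D D1) (lambda1 D D1 D2 E)) +
     fst \<sigma>2 (cls_tri (tri_sub D D2) (rho2 D D1 D2 E))"

definition glued_from ::
  "('o, 'm, 'z) tricat_scheme \<Rightarrow> 'o set \<Rightarrow> 'o set \<Rightarrow> 'o stab \<Rightarrow> 'o stab \<Rightarrow> 'o stab \<Rightarrow> bool" where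
  "glued_from D D1 D2 \<sigma>1 \<sigma>2 \<sigma> \<longleftrightarrow>
     hom_vanish_le D 0 (stab_heart (tri_sub D D1) \<sigma>1) (stab_heart (tri_sub D D2) \<sigma>2) \<and>
     stab_heart D \<sigma> =
       glued_heart D D1 D2 (stab_heart (tri_sub D D1) \<sigma>1) (stab_heart (tri_sub D D2) \<sigma>2) \<and>
     (\<forall>E \<in> obj D. fst \<sigma> (cls_tri D E) = glued_charge D D1 D2 \<sigma>1 \<sigma>2 E)"

end

theory Submission
  imports Defs "HOL-Analysis.Complex_Transcendental"
begin

text \<open>
  The functors \<open>\<lambda>\<^sub>1\<close> and \<open>\<rho>\<^sub>2\<close> send triangles to triangles, so the glued charge is
  additive. A nonzero object of \<open>H\<close> has \<open>\<lambda>\<^sub>1 E\<close> and \<open>\<rho>\<^sub>2 E\<close> in the two hearts, not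
  both zero, and the half-plane of admissible values is closed under addition. That
  \<open>H\<close> is a heart is a computation with the product \<open>X \<star> Y\<close> of classes of objects,
  formed by the extensions of objects of \<open>Y\<close> by objects of \<open>X\<close>. The octahedral axiom
  is the associativity of this product (\<open>star_assoc\<close>), and \<open>Y \<star> X\<close> contains \<open>X \<star> Y\<close> as
  soon as all connecting arrows from \<open>Y\<close> to \<open>X[1]\<close> vanish (\<open>star_swap\<close>). Truncating
  both sides at a phase gives \<open>\<D> = \<D>\<^sub>2 \<star> \<D>\<^sub>1 = (A\<^sub>2 \<star> B\<^sub>2) \<star> (A\<^sub>1 \<star> B\<^sub>1)\<close>, and the
  vanishing between the hearts allows \<open>B\<^sub>2\<close> and \<open>A\<^sub>1\<close> to be exchanged, which is the
  truncation for the glued t-structure (\<open>glued_t_pair\<close>). Everything then depends on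
  Harder-Narasimhan filtrations of the objects of \<open>H\<close>: once they exist, the shifts of
  the semistable objects form a slicing (\<open>stability_from_heart\<close>). No other slicing is
  possible, since orthogonal classes of objects of the right phases that filter all of
  \<open>H\<close> can only be the semistable objects (\<open>HN_data_semistable\<close>).

  In case (a) the imaginary part of \<open>Z\<close> on \<open>H\<close> is either 0 or at least some \<open>c > 0\<close>.
  Dividing by a subobject of larger phase, or passing to it, lowers the imaginary part
  by at least \<open>c\<close>, except for the division by subobjects on which it vanishes. The
  latter have phase 1, and their chains stabilize: \<open>\<lambda>\<^sub>1\<close> and \<open>\<rho>\<^sub>2\<close> reduce this to
  \<open>H\<^sub>1\<close> and \<open>H\<^sub>2\<close>, where the phase-1 parts of such a chain form a chain in \<open>P\<^sub>i(1)\<close>,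
  and this category inherits the chain conditions from local finiteness
  (\<open>heart_Im_zero_chain\<close>). So maximal destabilizing quotients are found by induction
  (\<open>mdq_exists\<close>), and with them the filtrations (\<open>discrete_HN\<close>). Every nonzero object
  of \<open>P(0,1)\<close> contributes at least \<open>c\<close> to the imaginary part, which bounds the length
  of chains (\<open>discrete_finite_length\<close>).

  In case (b) the semistable objects of phase \<open>\<phi>\<close> in \<open>(0,1]\<close> are the nonzero objects
  of \<open>P\<^sub>2(\<phi>) \<star> P\<^sub>1(\<phi>)\<close>. The filtration of \<open>\<rho>\<^sub>2 E\<close> followed by that of \<open>\<lambda>\<^sub>1 E\<close> has its
  phases in the wrong order, and the extra vanishing allows a factor in \<open>P\<^sub>2(\<phi>)\<close> to be
  moved past one in \<open>P\<^sub>1(\<psi>)\<close> when \<open>\<phi> < \<psi>\<close>, so the two filtrations can be merged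
  (\<open>merge_HN\<close>). Therefore \<open>\<lambda>\<^sub>1\<close> and \<open>\<rho>\<^sub>2\<close> send \<open>P I\<close> to \<open>P\<^sub>1 I\<close> and \<open>P\<^sub>2 I\<close>, and
  chains in a small interval stabilize because their images do
  (\<open>vanishing_locally_finite\<close>).

  Finite length refers to strict subobjects in quasi-abelian categories. An interval
  category of length at most 1 lies between two t-structures; there, kernels,
  cokernels and strict subobjects are expressed by triangles (\<open>quasi_abelian_T\<close>), and
  finite length becomes a chain condition on objects linked by triangles
  (\<open>finite_lengthI\<close>, \<open>finite_length_chains\<close>). In this form it can be transported along
  \<open>\<lambda>\<^sub>1\<close> and \<open>\<rho>\<^sub>2\<close>, which are only given on objects. Since local finiteness is
  formulated with a window of any width, it first has to be brought to windows of
  length at most 1, where this description holds (\<open>small_chains\<close>).\<close>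

section \<open>Arithmetic of arrows in a preadditive category\<close>

lemma hom_setD:
  assumes "f \<in> hom_set C A B"
  shows "f \<in> arr C" "src C f = A" "tgt C f = B"
  using assms by (auto simp: hom_set_def)

definition sub_arr :: "('o, 'm, 'z) preadd_scheme \<Rightarrow> 'm \<Rightarrow> 'm \<Rightarrow> 'm" where
  "sub_arr C f g = add_arr C f (neg_arr C g)"

context preadditive_category
begin

abbreviation compose (infixr \<open>\<cdot>\<close> 70) where "g \<cdot> f \<equiv> cmp C g f"
abbreviation "hm \<equiv> hom_set C"
abbreviation "zr \<equiv> zero_arr C"
abbreviation "idt \<equiv> ident C"

lemma hom_obj: "f \<in> hm A B \<Longrightarrow> A \<in> obj C" "f \<in> hm A B \<Longrightarrow> B \<in> obj C"
  using src_obj tgt_obj by (auto simp: hom_set_def)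

lemma arr_hom: "f \<in> arr C \<Longrightarrow> f \<in> hm (src C f) (tgt C f)"
  by (simp add: hom_set_def)

lemma zero_hom: "A \<in> obj C \<Longrightarrow> B \<in> obj C \<Longrightarrow> zr A B \<in> hm A B"
  using comm_group.axioms(2)[OF hom_comm_group, of A B] group.is_monoid monoid.one_closed
  unfolding hom_group_def by fastforce

lemma add_hom: "f \<in> hm A B \<Longrightarrow> g \<in> hm A B \<Longrightarrow> add_arr C f g \<in> hm A B"
  using comm_group.axioms(2)[OF hom_comm_group, OF hom_obj, of f A B f A B]
    group.is_monoid monoid.m_closed[of "hom_group C A B" f g]
  unfolding hom_group_def by fastforce

lemma neg_hom: assumes "f \<in> hm A B" shows "neg_arr C f \<in> hm A B"
proof -
  have "group (hom_group C A B)"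
    using comm_group.axioms(2)[OF hom_comm_group] hom_obj assms by blast
  then show ?thesis
    using group.inv_closed[of "hom_group C A B" f] assms hom_setD[OF assms]
    by (simp add: neg_arr_def hom_group_def)
qed

lemma sub_hom: "f \<in> hm A B \<Longrightarrow> g \<in> hm A B \<Longrightarrow> sub_arr C f g \<in> hm A B"
  by (simp add: sub_arr_def add_hom neg_hom)

lemma neg_add: assumes "f \<in> hm A B" shows "add_arr C (neg_arr C f) f = zr A B"
    "add_arr C f (neg_arr C f) = zr A B"
proof -
  interpret G: comm_group "hom_group C A B"
    using hom_comm_group hom_obj assms by blast
  show "add_arr C (neg_arr C f) f = zr A B" "add_arr C f (neg_arr C f) = zr A B"
    using G.l_inv[of f] G.r_inv[of f] assms hom_setD[OF assms]
    by (simp_all add: neg_arr_def hom_group_def)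
qed

lemma add_zero: assumes "f \<in> hm A B" shows "add_arr C (zr A B) f = f" "add_arr C f (zr A B) = f"
proof -
  interpret G: comm_group "hom_group C A B"
    using hom_comm_group hom_obj assms by blast
  show "add_arr C (zr A B) f = f" "add_arr C f (zr A B) = f"
    using G.l_one[of f] G.r_one[of f] assms by (simp_all add: hom_group_def)
qed

lemma add_assoc: assumes "f \<in> hm A B" "g \<in> hm A B" "h \<in> hm A B"
  shows "add_arr C (add_arr C f g) h = add_arr C f (add_arr C g h)"
proof -
  interpret G: comm_group "hom_group C A B"
    using hom_comm_group hom_obj assms by blast
  show ?thesis
    using G.m_assoc[of f g h] assms by (simp_all add: hom_group_def)
qed

lemma sub_zero_iff: assumes "f \<in> hm A B" "g \<in> hm A B"
  shows "sub_arr C f g = zr A B \<longleftrightarrow> f = g"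
proof
  assume "sub_arr C f g = zr A B"
  then have "add_arr C (add_arr C f (neg_arr C g)) g = add_arr C (zr A B) g"
    by (simp add: sub_arr_def)
  then show "f = g"
    using assms by (simp add: add_assoc[OF assms(1) neg_hom[OF assms(2)] assms(2)] neg_add[OF assms(2)]
        add_zero[OF assms(1)] add_zero[OF assms(2)])
next
  assume "f = g" then show "sub_arr C f g = zr A B"
    using neg_add[OF assms(1)] by (simp add: sub_arr_def)
qed

lemma neg_unique: assumes "f \<in> hm A B" "g \<in> hm A B" "add_arr C f g = zr A B" shows "g = neg_arr C f"
proof -
  have "g = add_arr C (add_arr C (neg_arr C f) f) g"
    using assms by (simp add: neg_add[OF assms(1)] add_zero)
  also have "\<dots> = neg_arr C f"
    using assms by (simp add: add_assoc[OF neg_hom[OF assms(1)] assms(1,2)] add_zero[OF neg_hom[OF assms(1)]])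
  finally show ?thesis .
qed

lemma neg_neg: "f \<in> hm A B \<Longrightarrow> neg_arr C (neg_arr C f) = f"
  using neg_unique[OF neg_hom, of f A B f] neg_add by simp

lemma cmp_add_right: assumes "f \<in> hm A B" "g \<in> hm A B" "h \<in> hm B D"
  shows "h \<cdot> add_arr C f g = add_arr C (h \<cdot> f) (h \<cdot> g)"
  using postcompose_hom[OF assms(3) hom_obj(1)[OF assms(1)]] assms
  by (auto simp: hom_group_def hom_def)

lemma cmp_add_left: assumes "f \<in> hm B D" "g \<in> hm B D" "h \<in> hm A B"
  shows "add_arr C f g \<cdot> h = add_arr C (f \<cdot> h) (g \<cdot> h)"
  using precompose_hom[OF assms(3) hom_obj(2)[OF assms(1)]] assms
  by (auto simp: hom_group_def hom_def)

lemma add_cancel_zero: assumes "f \<in> hm A B" "add_arr C f f = f" shows "f = zr A B"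
proof -
  have "f = add_arr C (neg_arr C f) (add_arr C f f)"
    using assms(1) by (simp add: add_assoc[OF neg_hom[OF assms(1)] assms(1,1), symmetric] neg_add add_zero)
  then show ?thesis using assms neg_add(1)[OF assms(1)] by simp
qed

lemma cmp_zero_right: assumes "f \<in> hm B D" "A \<in> obj C" shows "f \<cdot> zr A B = zr A D"
proof (rule add_cancel_zero)
  have z: "zr A B \<in> hm A B" using assms hom_obj zero_hom by blast
  show "f \<cdot> zr A B \<in> hm A D" using cmp_hom[OF z assms(1)] .
  show "add_arr C (f \<cdot> zr A B) (f \<cdot> zr A B) = f \<cdot> zr A B"
    using cmp_add_right[OF z z assms(1)] add_zero[OF z] by simp
qed

lemma cmp_zero_left: assumes "f \<in> hm A B" "D \<in> obj C" shows "zr B D \<cdot> f = zr A D"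
proof (rule add_cancel_zero)
  have z: "zr B D \<in> hm B D" using assms hom_obj zero_hom by blast
  show "zr B D \<cdot> f \<in> hm A D" using cmp_hom[OF assms(1) z] .
  show "add_arr C (zr B D \<cdot> f) (zr B D \<cdot> f) = zr B D \<cdot> f"
    using cmp_add_left[OF z z assms(1)] add_zero[OF z] by simp
qed

lemma cmp_neg_right: assumes "f \<in> hm A B" "h \<in> hm B D"
  shows "h \<cdot> neg_arr C f = neg_arr C (h \<cdot> f)"
proof (rule neg_unique)
  show "h \<cdot> f \<in> hm A D" "h \<cdot> neg_arr C f \<in> hm A D" using assms cmp_hom neg_hom by blast+
  show "add_arr C (h \<cdot> f) (h \<cdot> neg_arr C f) = zr A D"
    using assms cmp_zero_right hom_obj
    by (simp add: cmp_add_right[OF assms(1) neg_hom[OF assms(1)] assms(2), symmetric] neg_add[OF assms(1)])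
qed

lemma cmp_neg_left: assumes "f \<in> hm B D" "h \<in> hm A B"
  shows "neg_arr C f \<cdot> h = neg_arr C (f \<cdot> h)"
proof (rule neg_unique)
  show "f \<cdot> h \<in> hm A D" "neg_arr C f \<cdot> h \<in> hm A D" using assms cmp_hom neg_hom by blast+
  show "add_arr C (f \<cdot> h) (neg_arr C f \<cdot> h) = zr A D"
    using assms cmp_zero_left hom_obj
    by (simp add: cmp_add_left[OF assms(1) neg_hom[OF assms(1)] assms(2), symmetric] neg_add[OF assms(1)])
qed

lemma cmp_sub_right: assumes "f \<in> hm A B" "g \<in> hm A B" "h \<in> hm B D"
  shows "h \<cdot> sub_arr C f g = sub_arr C (h \<cdot> f) (h \<cdot> g)"
  using assms by (simp add: sub_arr_def cmp_add_right[OF assms(1) neg_hom[OF assms(2)]] cmp_neg_right)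

lemma cmp_sub_left: assumes "f \<in> hm B D" "g \<in> hm B D" "h \<in> hm A B"
  shows "sub_arr C f g \<cdot> h = sub_arr C (f \<cdot> h) (g \<cdot> h)"
  using assms by (simp add: sub_arr_def cmp_add_left[OF assms(1) neg_hom[OF assms(2)]] cmp_neg_left)

lemma neg_zero: "A \<in> obj C \<Longrightarrow> B \<in> obj C \<Longrightarrow> neg_arr C (zr A B) = zr A B"
  using neg_unique[OF zero_hom zero_hom] add_zero zero_hom by metis

lemma neg_zero_iff: "f \<in> hm A B \<Longrightarrow> neg_arr C f = zr A B \<longleftrightarrow> f = zr A B"
  using neg_neg neg_zero hom_obj by metis

lemma zero_obj_iff: "zero_object C Z \<longleftrightarrow> Z \<in> obj C \<and> idt Z = zr Z Z"
proof
  assume z: "zero_object C Z"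
  then show "Z \<in> obj C \<and> idt Z = zr Z Z"
    unfolding zero_object_def using ident_hom zero_hom by metis
next
  assume z: "Z \<in> obj C \<and> idt Z = zr Z Z"
  have a: "f = zr X Z" if "f \<in> hm X Z" for f X
    using cmp_ident_left[OF that] cmp_zero_left[OF that, of Z] z by simp
  have b: "f = zr Z X" if "f \<in> hm Z X" for f X
    using cmp_ident_right[OF that] cmp_zero_right[OF that, of Z] z by simp
  show "zero_object C Z" unfolding zero_object_def using a b z zero_hom by metis
qed

lemma zero_objD: assumes "zero_object C Z"
  shows "Z \<in> obj C" "f \<in> hm X Z \<Longrightarrow> f = zr X Z" "f \<in> hm Z X \<Longrightarrow> f = zr Z X"
  using assms unfolding zero_object_def using zero_hom hom_obj by metis+

lemma isoI: assumes "f \<in> hm A B" "g \<in> hm B A" "g \<cdot> f = idt A" "f \<cdot> g = idt B"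
  shows "is_iso C f" "isomorphic C A B"
  using assms hom_setD[OF assms(1)] unfolding is_iso_def isomorphic_def by auto

lemma isoE: assumes "is_iso C f" "f \<in> hm A B"
  obtains g where "g \<in> hm B A" "g \<cdot> f = idt A" "f \<cdot> g = idt B" "is_iso C g"
proof -
  obtain g where g: "g \<in> hm B A" "g \<cdot> f = idt A" "f \<cdot> g = idt B"
    using assms hom_setD[OF assms(2)] unfolding is_iso_def by auto
  then show thesis using that isoI(1)[OF g(1) assms(2)] by blast
qed

lemma isomorphicE: assumes "isomorphic C A B"
  obtains f g where "f \<in> hm A B" "g \<in> hm B A" "g \<cdot> f = idt A" "f \<cdot> g = idt B" "is_iso C f" "is_iso C g"
proof -
  obtain f where f: "f \<in> hm A B" "is_iso C f" using assms unfolding isomorphic_def by blast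
  obtain g where "g \<in> hm B A" "g \<cdot> f = idt A" "f \<cdot> g = idt B" "is_iso C g"
    using isoE[OF f(2,1)] by blast
  then show thesis using that f by blast
qed

lemma iso_ident: "A \<in> obj C \<Longrightarrow> is_iso C (idt A)"
  using isoI(1)[OF ident_hom ident_hom] cmp_ident_left[OF ident_hom] by metis

lemma isomorphic_refl: "A \<in> obj C \<Longrightarrow> isomorphic C A A"
  using iso_ident ident_hom unfolding isomorphic_def by blast

lemma isomorphic_sym: "isomorphic C A B \<Longrightarrow> isomorphic C B A"
  by (erule isomorphicE) (rule isoI(2))

lemma assoc_arr: "\<lbrakk>f \<in> arr C; g \<in> arr C; h \<in> arr C; tgt C f = src C g; tgt C g = src C h\<rbrakk>
    \<Longrightarrow> (h \<cdot> g) \<cdot> f = h \<cdot> (g \<cdot> f)"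
  using cmp_assoc[of f "src C f" "tgt C f" g "tgt C g" h "tgt C h"] by (simp add: hom_set_def)

lemma cmp_arr: "\<lbrakk>f \<in> arr C; g \<in> arr C; tgt C f = src C g\<rbrakk>
    \<Longrightarrow> g \<cdot> f \<in> arr C \<and> src C (g \<cdot> f) = src C f \<and> tgt C (g \<cdot> f) = tgt C g"
  using cmp_hom[of f "src C f" "tgt C f" g "tgt C g"] by (simp add: hom_set_def)

lemma ident_arr: "X \<in> obj C \<Longrightarrow> idt X \<in> arr C \<and> src C (idt X) = X \<and> tgt C (idt X) = X"
  using ident_hom by (auto simp: hom_set_def)

lemma zero_arrow: "X \<in> obj C \<Longrightarrow> Y \<in> obj C \<Longrightarrow> zr X Y \<in> arr C \<and> src C (zr X Y) = X \<and> tgt C (zr X Y) = Y"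
  using zero_hom by (auto simp: hom_set_def)

lemma ident_cmp_arr: "f \<in> arr C \<Longrightarrow> src C f = X \<Longrightarrow> f \<cdot> idt X = f"
    "f \<in> arr C \<Longrightarrow> tgt C f = X \<Longrightarrow> idt X \<cdot> f = f"
  using cmp_ident_left[OF arr_hom] cmp_ident_right[OF arr_hom] by auto

lemma zero_cmp_arr: "f \<in> arr C \<Longrightarrow> src C f = X \<Longrightarrow> A \<in> obj C \<Longrightarrow> f \<cdot> zr A X = zr A (tgt C f)"
    "f \<in> arr C \<Longrightarrow> tgt C f = X \<Longrightarrow> A \<in> obj C \<Longrightarrow> zr X A \<cdot> f = zr (src C f) A"
  using cmp_zero_right[OF arr_hom] cmp_zero_left[OF arr_hom] by auto

text \<open>With these rules composites are associated to the right; the side conditions of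
  typing are found from the sources and targets that arrows carry.\<close>

lemmas cat_simps = hom_set_def assoc_arr cmp_arr ident_arr zero_arrow ident_cmp_arr zero_cmp_arr src_obj tgt_obj

text \<open>With composites associated to the right, an equation \<open>g \<cdot> f = e\<close> has to be applied below a
  further arrow.\<close>

lemma cmp_eq_under: "\<lbrakk>g \<cdot> f = e; f \<in> hm A B; g \<in> hm B D; x \<in> hm X A\<rbrakk> \<Longrightarrow> g \<cdot> (f \<cdot> x) = e \<cdot> x"
  using cmp_assoc by metis

lemma iso_cmp:
  assumes "f \<in> hm A B" "g \<in> hm B D" "is_iso C f" "is_iso C g"
  shows "is_iso C (g \<cdot> f)"
proof -
  obtain f' where f': "f' \<in> hm B A" "f' \<cdot> f = idt A" "f \<cdot> f' = idt B" using isoE assms by blast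
  obtain g' where g': "g' \<in> hm D B" "g' \<cdot> g = idt B" "g \<cdot> g' = idt D" using isoE assms by blast
  show ?thesis
  proof (rule isoI)
    show "g \<cdot> f \<in> hm A D" "f' \<cdot> g' \<in> hm D A" using assms f' g' cmp_hom by blast+
    have "g' \<cdot> (g \<cdot> f) = f" "f \<cdot> (f' \<cdot> g') = g'"
      using cmp_eq_under[OF g'(2) assms(2) g'(1) assms(1)] cmp_eq_under[OF f'(3) f'(1) assms(1) g'(1)]
        assms f' g' cmp_ident_left by metis+
    then show "(f' \<cdot> g') \<cdot> (g \<cdot> f) = idt A" "(g \<cdot> f) \<cdot> (f' \<cdot> g') = idt D"
      using assms f' g' by (simp_all add: cat_simps)
  qed
qed

lemma isomorphic_trans: "isomorphic C A B \<Longrightarrow> isomorphic C B D \<Longrightarrow> isomorphic C A D"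
  using iso_cmp cmp_hom unfolding isomorphic_def by metis

lemma isomorphic_obj: "isomorphic C A B \<Longrightarrow> A \<in> obj C" "isomorphic C A B \<Longrightarrow> B \<in> obj C"
  using hom_obj unfolding isomorphic_def by blast+

lemma isomorphic_zero: assumes "isomorphic C A B" "zero_object C A" shows "zero_object C B"
proof -
  obtain f g where fg: "f \<in> hm A B" "g \<in> hm B A" "f \<cdot> g = idt B"
    using isomorphicE[OF assms(1)] by blast
  have "f = zr A B" using zero_objD(3)[OF assms(2) fg(1)] .
  then have "idt B = zr B B" using fg cmp_zero_left hom_obj by metis
  then show ?thesis using zero_obj_iff hom_obj fg by metis
qed

lemma zero_isomorphic: assumes "zero_object C A" "zero_object C B" shows "isomorphic C A B"
proof (rule isoI)
  have o: "A \<in> obj C" "B \<in> obj C" using assms zero_objD by auto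
  show "zr A B \<in> hm A B" "zr B A \<in> hm B A" using o zero_hom by auto
  show "zr B A \<cdot> zr A B = idt A" "zr A B \<cdot> zr B A = idt B"
    using o assms zero_obj_iff cmp_zero_left zero_hom by metis+
qed

end

section \<open>Exact triangles\<close>

text \<open>Most of the argument needs only the objects of a triangle. Forgetting the arrows
  turns the octahedral axiom into an associativity law for classes of objects.\<close>

definition triangle_on :: "('o, 'm, 'z) tricat_scheme \<Rightarrow> 'o \<Rightarrow> 'o \<Rightarrow> 'o \<Rightarrow> bool" where
  "triangle_on D A E B \<longleftrightarrow> (\<exists>f g h. (f, g, h) \<in> distinguished D \<and> src D f = A \<and> src D g = E \<and> src D h = B)"

definition hom_zero :: "('o, 'm, 'z) preadd_scheme \<Rightarrow> 'o \<Rightarrow> 'o \<Rightarrow> bool" where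
  "hom_zero D A B \<longleftrightarrow> (\<forall>f \<in> hom_set D A B. f = zero_arr D A B)"

context triangulated_category
begin

abbreviation tcomp (infixr \<open>\<cdot>\<close> 70) where "g \<cdot> f \<equiv> cmp D g f"
abbreviation sh where "sh n A \<equiv> shift_obj D n A"
abbreviation sa where "sa n f \<equiv> shift_arr D n f"
abbreviation "tr \<equiv> triangle_on D"
abbreviation "hz \<equiv> hom_zero D"
abbreviation "neg \<equiv> neg_arr D"

definition tri where
  "tri A B E f g h \<longleftrightarrow> (f, g, h) \<in> distinguished D \<and> f \<in> hm A B \<and> g \<in> hm B E \<and> h \<in> hm E (sh 1 A)"

lemma distinguished_tri: "(f, g, h) \<in> distinguished D \<Longrightarrow> tri (src D f) (src D g) (src D h) f g h"
  using distinguished_triangle[of f g h] unfolding tri_def is_triangle_def hom_set_def by auto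

lemma tr_iff: "tr A E B \<longleftrightarrow> (\<exists>f g h. tri A E B f g h)"
  unfolding triangle_on_def tri_def using distinguished_tri[unfolded tri_def] hom_setD by metis

lemma triD: assumes "tri A B E f g h"
  shows "(f, g, h) \<in> distinguished D" "f \<in> hm A B" "g \<in> hm B E" "h \<in> hm E (sh 1 A)"
    "A \<in> obj D" "B \<in> obj D" "E \<in> obj D"
  using assms hom_obj unfolding tri_def by auto

lemma tr_obj: "tr A B E \<Longrightarrow> A \<in> obj D" "tr A B E \<Longrightarrow> B \<in> obj D" "tr A B E \<Longrightarrow> E \<in> obj D"
  using triD(5-7) tr_iff by metis+

lemma tri_is_triangle: assumes "f \<in> hm A B" "g \<in> hm B E" "h \<in> hm E (sh 1 A)"
  shows "is_triangle D f g h"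
  using assms unfolding is_triangle_def hom_set_def by auto

lemma shift_simps [simp]: assumes "X \<in> obj D"
  shows "sh n X \<in> obj D" "sh 0 X = X" "sh n (sh m X) = sh (n + m) X"
  using assms shift_obj_closed shift_obj_0 shift_obj_add by auto

lemma shift_back [simp]: assumes "f \<in> hm A B"
  shows "sa n (sa (- n) f) = f" "sa (- n) (sa n f) = f"
  using assms shift_arr_add[of f n "- n"] shift_arr_add[of f "- n" n] shift_arr_0 by (auto simp: hom_set_def)

lemma shift_hom_back: assumes "f \<in> hm (sh n A) (sh n B)" "A \<in> obj D" "B \<in> obj D"
  obtains g where "g \<in> hm A B" "sa n g = f"
  using shift_arr_hom[OF assms(1), of "- n"] assms shift_back[OF assms(1), of n] that by simp

lemma shift_zero_arr: assumes "A \<in> obj D" "B \<in> obj D"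
  shows "sa n (zr A B) = zr (sh n A) (sh n B)"
proof (rule add_cancel_zero)
  show "sa n (zr A B) \<in> hm (sh n A) (sh n B)" using assms shift_arr_hom zero_hom by blast
  show "add_arr D (sa n (zr A B)) (sa n (zr A B)) = sa n (zr A B)"
    using shift_add[OF zero_hom zero_hom] add_zero[OF zero_hom] assms by metis
qed

lemma shift_neg: assumes "f \<in> hm A B" shows "sa n (neg f) = neg (sa n f)"
proof (rule neg_unique)
  show "sa n f \<in> hm (sh n A) (sh n B)" "sa n (neg f) \<in> hm (sh n A) (sh n B)"
    using assms shift_arr_hom neg_hom by blast+
  show "add_arr D (sa n f) (sa n (neg f)) = zr (sh n A) (sh n B)"
    using shift_add[OF assms neg_hom[OF assms], symmetric] neg_add[OF assms] shift_zero_arr hom_obj assms by metis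
qed

lemma shift_zero_iff: assumes "f \<in> hm A B" shows "sa n f = zr (sh n A) (sh n B) \<longleftrightarrow> f = zr A B"
  using assms shift_back(2)[OF assms] shift_zero_arr hom_obj
  by (metis zero_hom shift_back(2))

lemma shift_zero_object: "zero_object D Z \<Longrightarrow> zero_object D (sh n Z)"
  using zero_obj_iff shift_ident shift_zero_arr by (metis shift_obj_closed)

lemma shift_isomorphic: assumes "isomorphic D A B" shows "isomorphic D (sh n A) (sh n B)"
proof -
  obtain f g where fg: "f \<in> hm A B" "g \<in> hm B A" "g \<cdot> f = idt A" "f \<cdot> g = idt B"
    using isomorphicE[OF assms] by blast
  show ?thesis
    using isoI(2)[OF shift_arr_hom[OF fg(1), of n] shift_arr_hom[OF fg(2), of n]]
      shift_cmp[OF fg(1,2), of n] shift_cmp[OF fg(2,1), of n] fg shift_ident hom_obj by metis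
qed

lemma tri_rot: assumes "tri A B E f g h" shows "tri B E (sh 1 A) g h (neg (sa 1 f))"
  using assms TR2[OF tri_is_triangle] neg_hom shift_arr_hom unfolding tri_def by blast

lemma tri_unrot: assumes "tri A B E f g h" shows "tri (sh (-1) E) A B (neg (sa (-1) h)) f g"
proof -
  note t = triD[OF assms]
  have h: "sa (-1) h \<in> hm (sh (-1) E) A" using shift_arr_hom[OF t(4), of "-1"] t by simp
  have n: "neg (sa (-1) h) \<in> hm (sh (-1) E) A" using neg_hom[OF h] .
  have b: "sa 1 (neg (sa (-1) h)) = neg h"
    using shift_neg[OF h] shift_back(1)[OF t(4), of 1] by simp
  have "neg (sa 1 (neg (sa (-1) h))) = h"
    unfolding b by (rule neg_neg[OF t(4)])
  moreover have "is_triangle D (neg (sa (-1) h)) f g"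
    using tri_is_triangle[OF n t(2), of g] t by simp
  ultimately show ?thesis
    using TR2[of "neg (sa (-1) h)" f g] t n unfolding tri_def by simp
qed

lemma tri_ident: "X \<in> obj D \<Longrightarrow> zero_object D Z \<Longrightarrow> tri X X Z (idt X) (zr X Z) (zr Z (sh 1 X))"
  using TR1_ident zero_objD(1) zero_hom ident_hom unfolding tri_def by auto

lemma tri_exists: "f \<in> hm A B \<Longrightarrow> \<exists>E g h. tri A B E f g h"
  using TR1_cone[of f] distinguished_tri triD(2) hom_setD by metis

lemma tri_map:
  assumes "tri A B E f g h" "tri A' B' E' f' g' h'" "a \<in> hm A A'" "b \<in> hm B B'" "b \<cdot> f = f' \<cdot> a"
  obtains c where "c \<in> hm E E'" "c \<cdot> g = g' \<cdot> b" "sa 1 a \<cdot> h = h' \<cdot> c"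
  using TR3[OF triD(1)[OF assms(1)] triD(1)[OF assms(2)], of a b] assms
    hom_setD[OF triD(2)[OF assms(1)]] hom_setD[OF triD(2)[OF assms(2)]]
    hom_setD[OF triD(3)[OF assms(1)]] hom_setD[OF triD(3)[OF assms(2)]]
    hom_setD[OF triD(4)[OF assms(1)]] hom_setD[OF triD(4)[OF assms(2)]] by auto

lemma tri_comp: assumes "tri A B E f g h" shows "g \<cdot> f = zr A E" "h \<cdot> g = zr B (sh 1 A)"
proof -
  have *: "g \<cdot> f = zr A E" if t: "tri A B E f g h" for A B E f g h
  proof -
    obtain Z where Z: "zero_object D Z" using ex_zero_object by blast
    note d = triD[OF t]
    obtain c where c: "c \<in> hm Z E" "c \<cdot> zr A Z = g \<cdot> f"
      by (rule tri_map[OF tri_ident[OF d(5) Z] t ident_hom[OF d(5)] d(2)]) auto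
    then show ?thesis using cmp_zero_right d by metis
  qed
  show "g \<cdot> f = zr A E" "h \<cdot> g = zr B (sh 1 A)" using *[OF assms] *[OF tri_rot[OF assms]] by auto
qed

text \<open>The arrow \<open>x\<close> and the zero arrow map the triangle on the identity of \<open>X\<close> to the
  given one. Completing this map in the rotated triangles and shifting back gives the
  lift.\<close>

lemma weak_kernel: assumes t: "tri A B E f g h" and x: "x \<in> hm X B" "g \<cdot> x = zr X E"
  obtains y where "y \<in> hm X A" "f \<cdot> y = x"
proof -
  obtain Z where Z: "zero_object D Z" using ex_zero_object by blast
  note d = triD[OF t]
  have X: "X \<in> obj D" using x hom_obj by blast
  have z: "zr Z E \<in> hm Z E" using Z d zero_objD zero_hom by blast
  have c: "zr Z E \<cdot> zr X Z = g \<cdot> x"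
    using x X cmp_zero_right[OF z X] by simp
  obtain c where c: "c \<in> hm (sh 1 X) (sh 1 A)" "sa 1 x \<cdot> neg (sa 1 (idt X)) = neg (sa 1 f) \<cdot> c"
    by (rule tri_map[OF tri_rot[OF tri_ident[OF X Z]] tri_rot[OF t] x(1) z c]) auto
  obtain y where y: "y \<in> hm X A" "sa 1 y = c" using shift_hom_back[OF c(1)] X d by blast
  have i: "idt (sh 1 X) \<in> hm (sh 1 X) (sh 1 X)" using X ident_hom shift_simps by blast
  have "neg (sa 1 x) = neg (sa 1 f \<cdot> c)"
    using c cmp_neg_right[OF i shift_arr_hom[OF x(1)]] cmp_neg_left[OF shift_arr_hom[OF d(2)] c(1)]
      shift_ident[OF X] cmp_ident_right[OF shift_arr_hom[OF x(1)]] by metis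
  then have "sa 1 x = sa 1 f \<cdot> c"
    using neg_neg shift_arr_hom[OF x(1)] cmp_hom[OF c(1) shift_arr_hom[OF d(2)]] by metis
  then have "sa 1 x = sa 1 (f \<cdot> y)" using shift_cmp[OF y(1) d(2)] y by simp
  then have "x = f \<cdot> y" using shift_back(2) x(1) cmp_hom[OF y(1) d(2)] by metis
  then show thesis using y that by blast
qed

lemma tri_zero_ident: assumes "X \<in> obj D" "zero_object D Z"
  shows "tri (sh (-1) Z) X X (neg (sa (-1) (zr Z (sh 1 X)))) (idt X) (zr X Z)"
  using tri_unrot[OF tri_ident[OF assms]] .

lemma weak_cokernel: assumes t: "tri A B E f g h" and x: "x \<in> hm B X" "x \<cdot> f = zr A X"
  obtains y where "y \<in> hm E X" "y \<cdot> g = x"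
proof -
  obtain Z where Z: "zero_object D Z" using ex_zero_object by blast
  note d = triD[OF t]
  have X: "X \<in> obj D" using x hom_obj by blast
  let ?W = "sh (-1) Z" and ?w = "neg (sa (-1) (zr Z (sh 1 X)))"
  note u = tri_zero_ident[OF X Z]
  have W: "zero_object D ?W" using Z shift_zero_object by blast
  have a: "zr A ?W \<in> hm A ?W" using W d zero_objD zero_hom by blast
  have "x \<cdot> f = ?w \<cdot> zr A ?W" using x cmp_zero_right[OF triD(2)[OF u]] d by simp
  then obtain c where "c \<in> hm E X" "c \<cdot> g = idt X \<cdot> x"
    by (rule tri_map[OF t u a x(1)])
  then show thesis using that cmp_ident_left x by metis
qed

lemma weak_kernel2: assumes "tri A B E f g h" "x \<in> hm X E" "h \<cdot> x = zr X (sh 1 A)"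
  obtains y where "y \<in> hm X B" "g \<cdot> y = x"
  using weak_kernel[OF tri_rot[OF assms(1)] assms(2,3)] .

lemma weak_cokernel2: assumes "tri A B E f g h" "x \<in> hm E X" "x \<cdot> g = zr B X"
  obtains y where "y \<in> hm (sh 1 A) X" "y \<cdot> h = x"
  using weak_cokernel[OF tri_rot[OF assms(1)] assms(2,3)] .

lemma weak_kernel0: assumes "tri A B E f g h" "x \<in> hm X A" "f \<cdot> x = zr X B"
  obtains y where "y \<in> hm X (sh (-1) E)" "neg (sa (-1) h) \<cdot> y = x"
  using weak_kernel[OF tri_unrot[OF assms(1)] assms(2,3)] .

lemma hzD: "hz A B \<Longrightarrow> f \<in> hm A B \<Longrightarrow> f = zr A B"
  by (simp add: hom_zero_def)

lemma hz_set: "A \<in> obj D \<Longrightarrow> B \<in> obj D \<Longrightarrow> hz A B \<longleftrightarrow> hm A B = {zr A B}"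
  unfolding hom_zero_def using zero_hom by auto

lemma hz_tr_left: assumes "tr A E B" "hz A Y" "hz B Y" shows "hz E Y"
  unfolding hom_zero_def
proof
  fix x assume x: "x \<in> hm E Y"
  obtain f g h where t: "tri A E B f g h" using assms tr_iff by blast
  note d = triD[OF t]
  have "x \<cdot> f = zr A Y" using hzD[OF assms(2) cmp_hom[OF d(2) x]] .
  then obtain y where y: "y \<in> hm B Y" "y \<cdot> g = x" using weak_cokernel[OF t x] by blast
  then show "x = zr E Y" using hzD[OF assms(3)] cmp_zero_left[OF d(3)] hom_obj x by metis
qed

lemma hz_tr_right: assumes "tr A E B" "hz X A" "hz X B" shows "hz X E"
  unfolding hom_zero_def
proof
  fix x assume x: "x \<in> hm X E"
  obtain f g h where t: "tri A E B f g h" using assms tr_iff by blast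
  note d = triD[OF t]
  have "g \<cdot> x = zr X B" using hzD[OF assms(3) cmp_hom[OF x d(3)]] .
  then obtain y where y: "y \<in> hm X A" "f \<cdot> y = x" using weak_kernel[OF t x] by blast
  then show "x = zr X E" using hzD[OF assms(2)] cmp_zero_right[OF d(2)] hom_obj x by metis
qed

lemma hz_shift: assumes "A \<in> obj D" "B \<in> obj D" shows "hz (sh n A) (sh n B) \<longleftrightarrow> hz A B"
proof
  assume "hz A B"
  then show "hz (sh n A) (sh n B)" unfolding hom_zero_def
    using shift_hom_back assms shift_zero_arr by metis
next
  assume "hz (sh n A) (sh n B)"
  then show "hz A B" unfolding hom_zero_def using shift_arr_hom shift_zero_iff by metis
qed

lemma hz_shift1: assumes "A \<in> obj D" "B \<in> obj D" shows "hz (sh n A) B \<longleftrightarrow> hz A (sh (- n) B)"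
  using hz_shift[of "sh n A" B "- n"] assms by simp

lemma hz_zero: "zero_object D A \<Longrightarrow> hz A B" "zero_object D A \<Longrightarrow> hz B A"
  unfolding hom_zero_def using zero_objD by blast+

lemma hz_ident_zero: "A \<in> obj D \<Longrightarrow> hz A A \<Longrightarrow> zero_object D A"
  using hzD ident_hom zero_obj_iff by blast

lemma hz_iso: assumes "isomorphic D A A'" "isomorphic D B B'" "hz A B" shows "hz A' B'"
  unfolding hom_zero_def
proof
  fix x assume x: "x \<in> hm A' B'"
  obtain a a' where a: "a \<in> hm A A'" "a' \<in> hm A' A" "a \<cdot> a' = idt A'" using isomorphicE[OF assms(1)] by blast
  obtain b b' where b: "b \<in> hm B B'" "b' \<in> hm B' B" "b \<cdot> b' = idt B'" using isomorphicE[OF assms(2)] by blast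
  have o: "A \<in> obj D" "B \<in> obj D" "A' \<in> obj D" "B' \<in> obj D" using a b hom_obj by blast+
  have "b' \<cdot> (x \<cdot> a) = zr A B" using hzD[OF assms(3) cmp_hom[OF cmp_hom[OF a(1) x] b(2)]] .
  then have "b \<cdot> (b' \<cdot> (x \<cdot> a)) \<cdot> a' = zr A' B'"
    using a b x o by (simp add: cat_simps)
  moreover have "b \<cdot> (b' \<cdot> (x \<cdot> a)) \<cdot> a' = x"
    using cmp_eq_under[OF b(3) b(2) b(1) cmp_hom[OF cmp_hom[OF a(2) a(1)] x]] a b x
    by (simp add: cat_simps)
  ultimately show "x = zr A' B'" by simp
qed

lemma tri_iso_mid: assumes t: "tri A E B f g h" and e: "e \<in> hm E E'" "e' \<in> hm E' E" "e' \<cdot> e = idt E" "e \<cdot> e' = idt E'"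
  shows "tri A E' B (e \<cdot> f) (g \<cdot> e') h"
proof -
  note d = triD[OF t]
  have h: "e \<cdot> f \<in> hm A E'" "g \<cdot> e' \<in> hm E' B" using d e cmp_hom by blast+
  have "g \<cdot> e' \<cdot> e = g" using e d by (simp add: cat_simps)
  then have "(e \<cdot> f, g \<cdot> e', h) \<in> distinguished D"
    using TR1_iso[OF d(1) tri_is_triangle[OF h d(4)], of "idt A" e "idt B"]
      hom_setD[OF d(2)] hom_setD[OF d(3)] hom_setD[OF d(4)] hom_setD[OF h(1)] hom_setD[OF h(2)]
      iso_ident ident_hom d(4-7) e isoI(1)[OF e] shift_ident[OF d(5)]
      cmp_ident_right[OF h(1)] cmp_ident_left[OF d(3)] cmp_ident_left[OF d(4)] cmp_ident_right[OF d(4)]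
      assoc_arr[of e e' g] hom_setD[OF e(1)] hom_setD[OF e(2)] by simp
  then show ?thesis using h d unfolding tri_def by blast
qed

lemma tri_iso_left: assumes t: "tri A E B f g h" and e: "e \<in> hm A A'" "e' \<in> hm A' A" "e' \<cdot> e = idt A" "e \<cdot> e' = idt A'"
  shows "tri A' E B (f \<cdot> e') g (sa 1 e \<cdot> h)"
proof -
  note d = triD[OF t]
  have h: "f \<cdot> e' \<in> hm A' E" "sa 1 e \<cdot> h \<in> hm B (sh 1 A')" using d e cmp_hom shift_arr_hom by blast+
  have "f \<cdot> e' \<cdot> e = f" using e d by (simp add: cat_simps)
  then have "(f \<cdot> e', g, sa 1 e \<cdot> h) \<in> distinguished D"
    using TR1_iso[OF d(1) tri_is_triangle[OF h(1) d(3) h(2)], of e "idt E" "idt B"]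
      hom_setD[OF d(2)] hom_setD[OF d(3)] hom_setD[OF d(4)] hom_setD[OF h(1)] hom_setD[OF h(2)]
      iso_ident ident_hom d(4-7) e isoI(1)[OF e]
      cmp_ident_left[OF d(2)] cmp_ident_right[OF h(2)] cmp_ident_left[OF d(3)] cmp_ident_right[OF d(3)]
      assoc_arr[of e e' f] hom_setD[OF e(1)] hom_setD[OF e(2)] by simp
  then show ?thesis using h d unfolding tri_def by blast
qed

lemma tri_iso_right: assumes t: "tri A E B f g h" and e: "e \<in> hm B B'" "e' \<in> hm B' B" "e' \<cdot> e = idt B" "e \<cdot> e' = idt B'"
  shows "tri A E B' f (e \<cdot> g) (h \<cdot> e')"
proof -
  note d = triD[OF t]
  have h: "e \<cdot> g \<in> hm E B'" "h \<cdot> e' \<in> hm B' (sh 1 A)" using d e cmp_hom by blast+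
  have "h \<cdot> e' \<cdot> e = h" using e d by (simp add: cat_simps)
  then have "(f, e \<cdot> g, h \<cdot> e') \<in> distinguished D"
    using TR1_iso[OF d(1) tri_is_triangle[OF d(2) h], of "idt A" "idt E" e]
      hom_setD[OF d(2)] hom_setD[OF d(3)] hom_setD[OF d(4)] hom_setD[OF h(1)] hom_setD[OF h(2)]
      iso_ident ident_hom d(4-7) e isoI(1)[OF e] shift_ident[OF d(5)]
      cmp_ident_left[OF d(2)] cmp_ident_right[OF d(2)] cmp_ident_right[OF h(1)] cmp_ident_left[OF d(4)]
      assoc_arr[of e e' h] hom_setD[OF e(1)] hom_setD[OF e(2)] by simp
  then show ?thesis using h d unfolding tri_def by blast
qed

lemma tr_iso: assumes "tr A E B" "isomorphic D A A'" "isomorphic D E E'" "isomorphic D B B'" shows "tr A' E' B'"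
proof -
  have "tr A' E B" using assms tri_iso_left isomorphicE[OF assms(2)] unfolding tr_iff by metis
  then have "tr A' E' B" using assms tri_iso_mid isomorphicE[OF assms(3)] unfolding tr_iff by metis
  then show ?thesis using assms tri_iso_right isomorphicE[OF assms(4)] unfolding tr_iff by metis
qed

lemma tr_rot: "tr A E B \<Longrightarrow> tr E B (sh 1 A)"
  unfolding tr_iff using tri_rot by blast

lemma tr_unrot: "tr A E B \<Longrightarrow> tr (sh (-1) B) A E"
  unfolding tr_iff using tri_unrot by blast

lemma tr_shift: assumes "tr A E B" shows "tr (sh n A) (sh n E) (sh n B)"
proof -
  have p: "tr (sh (int k) A) (sh (int k) E) (sh (int k) B)" for k
  proof (induction k)
    case (Suc k)
    show ?case using tr_rot[OF tr_rot[OF tr_rot[OF Suc]]] tr_obj[OF assms] by (simp add: add.commute)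
  qed (use assms tr_obj[OF assms] in simp)
  have m: "tr (sh (- int k) A) (sh (- int k) E) (sh (- int k) B)" for k
  proof (induction k)
    case (Suc k)
    show ?case using tr_unrot[OF tr_unrot[OF tr_unrot[OF Suc]]] tr_obj[OF assms] by (simp add: add.commute)
  qed (use assms tr_obj[OF assms] in simp)
  show ?thesis using p[of "nat n"] m[of "nat (- n)"] by (cases "n \<ge> 0") auto
qed

lemma tr_rot_iff: "A \<in> obj D \<Longrightarrow> tr E B (sh 1 A) \<longleftrightarrow> tr A E B"
  using tr_rot[of A E B] tr_unrot[of E B "sh 1 A"] by auto

lemma tri_zero_right_iso: assumes "tri A E B f g h" "zero_object D B" shows "is_iso D f" "isomorphic D A E"
proof -
  note d = triD[OF assms(1)]
  have "g \<cdot> idt E = zr E B" using zero_objD(2)[OF assms(2)] cmp_hom[OF ident_hom d(3)] d by blast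
  then obtain s where s: "s \<in> hm E A" "f \<cdot> s = idt E"
    using weak_kernel[OF assms(1) ident_hom] d by metis
  let ?x = "sub_arr D (s \<cdot> f) (idt A)"
  have sf: "s \<cdot> f \<in> hm A A" using cmp_hom[OF d(2) s(1)] .
  have x: "?x \<in> hm A A" using sub_hom[OF sf ident_hom] d by blast
  have "f \<cdot> s \<cdot> f = f" using cmp_assoc[OF d(2) s(1) d(2)] s d cmp_ident_left by metis
  then have "f \<cdot> ?x = zr A E"
    using cmp_sub_right[OF sf ident_hom[OF d(5)] d(2)] sub_zero_iff[OF d(2) d(2)] cmp_ident_right[OF d(2)] by simp
  then obtain y where y: "y \<in> hm A (sh (-1) B)" "neg (sa (-1) h) \<cdot> y = ?x"
    using weak_kernel0[OF assms(1) x] by blast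
  have "y = zr A (sh (-1) B)" using y shift_zero_object[OF assms(2)] zero_objD by blast
  then have "?x = zr A A" using y cmp_zero_right[OF triD(2)[OF tri_unrot[OF assms(1)]] d(5)] by simp
  then have "s \<cdot> f = idt A" using sub_zero_iff[OF sf ident_hom] d by blast
  then show "is_iso D f" "isomorphic D A E" using isoI[OF d(2) s(1)] s by auto
qed

lemma tr_zero_right_iso: "tr A E B \<Longrightarrow> zero_object D B \<Longrightarrow> isomorphic D A E"
  using tri_zero_right_iso(2) unfolding tr_iff by blast

lemma tr_zero_left_iso: "tr A E B \<Longrightarrow> zero_object D A \<Longrightarrow> isomorphic D E B"
  using tr_rot tr_zero_right_iso shift_zero_object by blast

lemma tr_zero_mid_iso: "tr A E B \<Longrightarrow> zero_object D E \<Longrightarrow> isomorphic D B (sh 1 A)"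
  using tr_rot tr_zero_left_iso by blast

lemma tr_zero_right: "isomorphic D A A' \<Longrightarrow> zero_object D Z \<Longrightarrow> tr A A' Z"
  using tr_iso[of A A Z A A' Z] tri_ident[of A Z] isomorphic_refl isomorphic_obj zero_objD(1)
  unfolding tr_iff by metis

lemma tr_zero_left: assumes "isomorphic D A A'" "zero_object D Z" shows "tr Z A A'"
  using tr_rot[OF tr_unrot[OF tr_unrot[OF tr_zero_right[OF assms]]]] tr_unrot[OF tr_zero_right[OF assms]]
    tr_iso[of "sh (-1) Z" A A' Z A A'] zero_isomorphic[OF shift_zero_object[OF assms(2)] assms(2)]
    isomorphic_refl isomorphic_obj[OF assms(1)] by blast

lemma tr_zero_zero: "tr A E B \<Longrightarrow> zero_object D A \<Longrightarrow> zero_object D B \<Longrightarrow> zero_object D E"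
  using tr_zero_left_iso isomorphic_zero isomorphic_sym by blast

lemma octahedral1: assumes "tri X M Y f p p'" "tri M E Z g q q'"
  obtains R u v w r r' where "tri X E R (g \<cdot> f) r r'" "tri Y R Z u v w" "u \<cdot> p = r \<cdot> g" "v \<cdot> r = q"
    "r' \<cdot> u = p'" "q' \<cdot> v = sa 1 f \<cdot> r'"
proof -
  note a = triD[OF assms(1)] and b = triD[OF assms(2)]
  obtain R r r' where r: "tri X E R (g \<cdot> f) r r'" using tri_exists[OF cmp_hom[OF a(2) b(2)]] by blast
  note c = triD[OF r]
  obtain u v where uv: "u \<in> hm (tgt D p) (tgt D r)" "v \<in> hm (tgt D r) (tgt D q)"
    "(u, v, sa 1 p \<cdot> q') \<in> distinguished D" "u \<cdot> p = r \<cdot> g" "r' \<cdot> u = p'" "v \<cdot> r = q" "q' \<cdot> v = sa 1 f \<cdot> r'"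
    using TR4[OF a(1) b(1) _ c(1)] a b hom_setD by metis
  have "tri Y R Z u v (sa 1 p \<cdot> q')"
    using uv hom_setD[OF a(3)] hom_setD[OF b(3)] hom_setD[OF c(3)] cmp_hom[OF b(4) shift_arr_hom[OF a(3)]]
    unfolding tri_def by simp
  then show thesis using that r uv by blast
qed

lemma tr_assoc1: assumes "tr X M Y" "tr M E Z" obtains R where "tr Y R Z" "tr X E R"
  using assms octahedral1 unfolding tr_iff by metis

lemma tri_neg: assumes "tri A E B f g h" shows "tri A E B (neg f) (neg g) h"
proof -
  note d = triD[OF assms]
  have i: "idt E \<in> hm E E" using d ident_hom by blast
  have n: "neg (idt E) \<cdot> neg (idt E) = idt E"
    using cmp_neg_left[OF i neg_hom[OF i]] cmp_neg_right[OF i i] cmp_ident_left[OF i] neg_neg[OF i] by simp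
  show ?thesis
    using tri_iso_mid[OF assms neg_hom[OF i] neg_hom[OF i] n n]
      cmp_neg_left[OF i d(2)] cmp_neg_right[OF i d(3)] cmp_ident_left[OF d(2)] cmp_ident_right[OF d(3)] by simp
qed

text \<open>The octahedral axiom read from the other end: it is applied to the rotated
  triangles, whose arrows compose, and the resulting triangles are rotated back. The
  signs of the rotations cancel by \<open>tri_neg\<close>.\<close>

lemma octahedral2: assumes "tri X E R f r h" "tri Y R Z u v w"
  obtains W a b p p' q where "tri X W Y a p p'" "tri W E Z b (v \<cdot> r) q" "b \<cdot> a = f" "u \<cdot> p = r \<cdot> b"
proof -
  note a = triD[OF assms(1)] and b = triD[OF assms(2)]
  obtain S U V w' s t where st: "tri E Z S (v \<cdot> r) s t" "tri (sh 1 X) S (sh 1 Y) U V w'"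
    "U \<cdot> h = s \<cdot> v" "V \<cdot> s = w" "t \<cdot> U = neg (sa 1 f)" "neg (sa 1 u) \<cdot> V = sa 1 r \<cdot> t"
    using octahedral1[OF tri_rot[OF assms(1)] tri_rot[OF assms(2)]] by metis
  note c = triD[OF st(1)] and d = triD[OF st(2)]
  let ?W = "sh (-1) S"
  have b': "tri ?W E Z (neg (sa (-1) t)) (v \<cdot> r) s" using tri_unrot[OF st(1)] .
  note e = triD[OF b']
  have "tri X ?W Y (neg (sa (-1) U)) (neg (sa (-1) V)) (neg (sa (-1) w'))"
    using tri_unrot[OF tri_unrot[OF tri_unrot[OF st(2)]]] a b by simp
  note a' = tri_neg[OF this]
  have U1: "sa (-1) U \<in> hm X ?W" using shift_arr_hom[OF d(2), of "-1"] a by simp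
  have V1: "sa (-1) V \<in> hm ?W Y" using shift_arr_hom[OF d(3), of "-1"] b by simp
  have t1: "sa (-1) t \<in> hm ?W E" using shift_arr_hom[OF c(4), of "-1"] c by simp
  have a'': "tri X ?W Y (sa (-1) U) (sa (-1) V) (neg (sa (-1) w'))"
    using a' neg_neg[OF U1] neg_neg[OF V1] by simp
  have sf: "sa 1 f \<in> hm (sh 1 X) (sh 1 E)" "sa 1 u \<in> hm (sh 1 Y) (sh 1 R)" "sa 1 r \<in> hm (sh 1 E) (sh 1 R)"
    using shift_arr_hom a(2,3) b(2) by blast+
  have "sa (-1) t \<cdot> sa (-1) U = sa (-1) (neg (sa 1 f))"
    using shift_cmp[OF d(2) c(4), of "-1"] st(5) by simp
  also have "\<dots> = neg f" using shift_neg[OF sf(1)] shift_back(2)[OF a(2), of 1] by simp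
  finally have "sa (-1) t \<cdot> sa (-1) U = neg f" .
  then have i: "neg (sa (-1) t) \<cdot> sa (-1) U = f"
    using cmp_neg_left[OF t1 U1] neg_neg[OF a(2)] by simp
  have "sa (-1) (neg (sa 1 u) \<cdot> V) = neg u \<cdot> sa (-1) V"
    using shift_cmp[OF d(3) neg_hom[OF sf(2)], of "-1"] shift_neg[OF sf(2)] shift_back(2)[OF b(2), of 1] by simp
  moreover have "sa (-1) (sa 1 r \<cdot> t) = r \<cdot> sa (-1) t"
    using shift_cmp[OF c(4) sf(3), of "-1"] shift_back(2)[OF a(3), of 1] by simp
  ultimately have "neg u \<cdot> sa (-1) V = r \<cdot> sa (-1) t" using st(6) by simp
  then have "u \<cdot> sa (-1) V = r \<cdot> neg (sa (-1) t)"
    using cmp_neg_left[OF b(2) V1] cmp_neg_right[OF t1 a(3)] neg_neg[OF cmp_hom[OF V1 b(2)]] by simp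
  then show thesis using that a'' b' i by blast
qed

lemma tr_assoc2: assumes "tr X E R" "tr Y R Z" obtains W where "tr X W Y" "tr W E Z"
  using assms octahedral2 unfolding tr_iff by metis

text \<open>The connecting arrow vanishes, so \<open>E \<rightarrow> B\<close> has a section. By the octahedral axiom its
  cone is isomorphic to \<open>A\<close>, because the cone of the identity of \<open>B\<close> is zero.\<close>

lemma tr_split: assumes "tr A E B" "hz B (sh 1 A)" shows "tr B E A"
proof -
  obtain f g h where t: "tri A E B f g h" using assms tr_iff by blast
  note d = triD[OF t]
  have "h \<cdot> idt B = zr B (sh 1 A)" using hzD[OF assms(2) cmp_hom[OF ident_hom[OF d(7)] d(4)]] .
  then obtain s where s: "s \<in> hm B E" "g \<cdot> s = idt B" using weak_kernel2[OF t ident_hom[OF d(7)]] by blast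
  obtain R p p' where R: "tri B E R s p p'" using tri_exists[OF s(1)] by blast
  obtain R' u v w r r' where o: "tri B B R' (idt B) r r'" "tri R R' (sh 1 A) u v w"
    using octahedral1[OF R tri_rot[OF t]] s by metis
  obtain Z where Z: "zero_object D Z" using ex_zero_object by blast
  obtain e where e: "e \<in> hm B B" "is_iso D (idt B)" using iso_ident ident_hom d by blast
  have "zero_object D R'"
  proof -
    have "r = zr B R'" using tri_comp(1)[OF o(1)] triD(3)[OF o(1)] cmp_ident_right by metis
    moreover have "r' = zr R' (sh 1 B)"
    proof -
      have "neg (sa 1 (idt B)) \<cdot> r' = zr R' (sh 1 B)" using tri_comp(2)[OF tri_rot[OF o(1)]] .
      moreover have "neg (sa 1 (idt B)) \<cdot> r' = neg r'"
        using cmp_neg_left[OF shift_arr_hom[OF ident_hom[OF d(7)]] triD(4)[OF o(1)]] shift_ident[OF d(7)]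
          cmp_ident_left[OF triD(4)[OF o(1)]] by simp
      ultimately show ?thesis using neg_zero_iff[OF triD(4)[OF o(1)]] by simp
    qed
    ultimately have "hz R' R'"
      unfolding hom_zero_def
      using weak_cokernel2[OF o(1)] weak_cokernel[OF o(1)] cmp_zero_right triD[OF o(1)] zero_hom
      by (metis cmp_zero_left shift_simps(1))
    then show ?thesis using hz_ident_zero triD[OF o(1)] by blast
  qed
  then have "isomorphic D (sh 1 A) (sh 1 R)" using tr_zero_mid_iso o(2) tr_iff by blast
  then have "isomorphic D R A"
    using isomorphic_sym shift_isomorphic[of "sh 1 A" "sh 1 R" "-1"] d triD(7)[OF R] by simp
  then show ?thesis using tr_iso[of B E R B E A] R tr_iff isomorphic_refl d by blast
qed

text \<open>If \<open>E \<rightarrow> B\<close> is zero, the identity of \<open>B\<close> factors through \<open>A[1]\<close>. Orthogonality then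
  forces the last term of a truncation triangle to vanish.\<close>

lemma tr_quotient_zero: assumes "tr A E B" "hz E B" "hz (sh 1 A) B" shows "zero_object D B"
proof -
  obtain f g h where t: "tri A E B f g h" using assms tr_iff by blast
  note d = triD[OF t]
  have "idt B \<cdot> g = zr E B" using hzD[OF assms(2) cmp_hom[OF d(3) ident_hom[OF d(7)]]] .
  then obtain y where y: "y \<in> hm (sh 1 A) B" "y \<cdot> h = idt B"
    using weak_cokernel2[OF t ident_hom[OF d(7)]] by blast
  then have "idt B = zr B B" using hzD[OF assms(3)] cmp_zero_left[OF d(4)] d by metis
  then show ?thesis using zero_obj_iff d by blast
qed

lemma tr_sub_zero: assumes "tr A E B" "hz A E" "hz A (sh (-1) B)" shows "zero_object D A"
proof -
  obtain f g h where t: "tri A E B f g h" using assms tr_iff by blast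
  note d = triD[OF t]
  have "f \<cdot> idt A = zr A E" using hzD[OF assms(2) cmp_hom[OF ident_hom[OF d(5)] d(2)]] .
  then obtain y where y: "y \<in> hm A (sh (-1) B)" "neg (sa (-1) h) \<cdot> y = idt A"
    using weak_kernel0[OF t ident_hom[OF d(5)]] by blast
  then have "idt A = zr A A"
    using hzD[OF assms(3)] cmp_zero_right[OF triD(2)[OF tri_unrot[OF t]] d(5)] by metis
  then show ?thesis using zero_obj_iff d by blast
qed

text \<open>The first two vanishings produce arrows between the two triangles in both
  directions, and the vanishings into the shifts make such arrows unique, hence
  mutually inverse.\<close>

lemma truncation_unique:
  assumes "tr A E B" "tr A' E B'" "hz A B'" "hz A' B" "hz A (sh (-1) B)" "hz A' (sh (-1) B')"
  shows "isomorphic D A A'" "isomorphic D B B'"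
proof -
  obtain f g h where t: "tri A E B f g h" using assms tr_iff by blast
  obtain f' g' h' where t': "tri A' E B' f' g' h'" using assms tr_iff by blast
  note d = triD[OF t] and d' = triD[OF t']
  have z: "g' \<cdot> f = zr A B'" "g \<cdot> f' = zr A' B"
    using hzD[OF assms(3) cmp_hom[OF d(2) d'(3)]] hzD[OF assms(4) cmp_hom[OF d'(2) d(3)]] .
  obtain a where a: "a \<in> hm A A'" "f' \<cdot> a = f" using weak_kernel[OF t' d(2) z(1)] .
  obtain a' where a': "a' \<in> hm A' A" "f \<cdot> a' = f'" using weak_kernel[OF t d'(2) z(2)] .
  obtain b where b: "b \<in> hm B B'" "b \<cdot> g = g'" using weak_cokernel[OF t d'(3) z(1)] .
  obtain b' where b': "b' \<in> hm B' B" "b' \<cdot> g' = g" using weak_cokernel[OF t' d(3) z(2)] .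
  have ker: "x = idt A" if t: "tri A E B f g h" and v: "hz A (sh (-1) B)" and x: "x \<in> hm A A" "f \<cdot> x = f"
    for A B f g h x
  proof -
    note d = triD[OF t]
    let ?y = "sub_arr D x (idt A)"
    have y: "?y \<in> hm A A" using sub_hom[OF x(1) ident_hom] d by blast
    have "f \<cdot> ?y = zr A E"
      using cmp_sub_right[OF x(1) ident_hom[OF d(5)] d(2)] sub_zero_iff[OF d(2) d(2)] cmp_ident_right[OF d(2)] x by simp
    then obtain w where w: "w \<in> hm A (sh (-1) B)" "neg (sa (-1) h) \<cdot> w = ?y" using weak_kernel0[OF t y] by blast
    then have "?y = zr A A" using hzD[OF v w(1)] cmp_zero_right[OF triD(2)[OF tri_unrot[OF t]] d(5)] by simp
    then show ?thesis using sub_zero_iff[OF x(1) ident_hom] d by blast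
  qed
  have cok: "x = idt B" if t: "tri A E B f g h" and v: "hz A (sh (-1) B)" and x: "x \<in> hm B B" "x \<cdot> g = g"
    for A B f g h x
  proof -
    note d = triD[OF t]
    let ?y = "sub_arr D x (idt B)"
    have y: "?y \<in> hm B B" using sub_hom[OF x(1) ident_hom] d by blast
    have "?y \<cdot> g = zr E B"
      using cmp_sub_left[OF x(1) ident_hom[OF d(7)] d(3)] sub_zero_iff[OF d(3) d(3)] cmp_ident_left[OF d(3)] x by simp
    then obtain w where w: "w \<in> hm (sh 1 A) B" "w \<cdot> h = ?y" using weak_cokernel2[OF t y] by blast
    moreover have "hz (sh 1 A) B" using v hz_shift1 d by simp
    ultimately have "?y = zr B B" using hzD cmp_zero_left[OF d(4)] d by metis
    then show ?thesis using sub_zero_iff[OF x(1) ident_hom] d by blast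
  qed
  have "f \<cdot> a' \<cdot> a = f" "f' \<cdot> a \<cdot> a' = f'"
    using cmp_assoc[OF a(1) a'(1) d(2)] cmp_assoc[OF a'(1) a(1) d'(2)] a a' by auto
  then show "isomorphic D A A'"
    using isoI(2)[OF a(1) a'(1)] ker[OF t assms(5)] ker[OF t' assms(6)] cmp_hom a a' by metis
  have "(b' \<cdot> b) \<cdot> g = g" "(b \<cdot> b') \<cdot> g' = g'"
    using cmp_assoc[OF d(3) b(1) b'(1)] cmp_assoc[OF d'(3) b'(1) b(1)] b b' by auto
  then show "isomorphic D B B'"
    using isoI(2)[OF b(1) b'(1)] cok[OF t assms(5)] cok[OF t' assms(6)] cmp_hom b b' by metis
qed

text \<open>The projection to \<open>A2\<close> factors through the cone of the inclusion of \<open>A1\<close>. The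
  inclusion is split, so the connecting arrow vanishes, and the factor is inverse to
  the composite of \<open>A2 \<rightarrow> B\<close> with the cone arrow.\<close>

lemma biproduct_tr: assumes "is_biproduct D A1 A2 B" "A1 \<in> obj D" "A2 \<in> obj D" shows "tr A1 B A2"
proof -
  obtain i1 i2 p1 p2 where b: "i1 \<in> hm A1 B" "i2 \<in> hm A2 B" "p1 \<in> hm B A1" "p2 \<in> hm B A2"
    "p1 \<cdot> i1 = idt A1" "p2 \<cdot> i2 = idt A2" "p1 \<cdot> i2 = zr A2 A1" "p2 \<cdot> i1 = zr A1 A2"
    "add_arr D (i1 \<cdot> p1) (i2 \<cdot> p2) = idt B"
    using assms unfolding is_biproduct_def by blast
  obtain E g h where t: "tri A1 B E i1 g h" using tri_exists[OF b(1)] by blast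
  note d = triD[OF t]
  obtain c where c: "c \<in> hm E A2" "c \<cdot> g = p2" using weak_cokernel[OF t b(4) b(8)] .
  have gi: "g \<cdot> i2 \<in> hm A2 E" using cmp_hom b d by blast
  have "c \<cdot> (g \<cdot> i2) = idt A2" using cmp_assoc[OF b(2) d(3) c(1)] c b by simp
  have "(g \<cdot> i2) \<cdot> c = idt E"
  proof -
    have e: "(g \<cdot> i2) \<cdot> c \<in> hm E E" using cmp_hom[OF c(1) gi] .
    let ?y = "sub_arr D ((g \<cdot> i2) \<cdot> c) (idt E)"
    have y: "?y \<in> hm E E" using sub_hom[OF e ident_hom] d by blast
    have g0: "g \<cdot> i1 \<cdot> p1 = zr B E"
      using cmp_assoc[OF b(3) b(1) d(3)] tri_comp(1)[OF t] cmp_zero_left[OF b(3)] d by simp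
    have "g = g \<cdot> add_arr D (i1 \<cdot> p1) (i2 \<cdot> p2)" using b(9) cmp_ident_right[OF d(3)] by simp
    also have "\<dots> = g \<cdot> i2 \<cdot> p2"
      using cmp_add_right[OF cmp_hom[OF b(3,1)] cmp_hom[OF b(4,2)] d(3)] g0
        add_zero[OF cmp_hom[OF cmp_hom[OF b(4,2)] d(3)]] by simp
    finally have "((g \<cdot> i2) \<cdot> c) \<cdot> g = g"
      using b c d by (simp add: cat_simps)
    then have "?y \<cdot> g = zr B E"
      using cmp_sub_left[OF e ident_hom[OF d(7)] d(3)] sub_zero_iff[OF d(3) d(3)] cmp_ident_left[OF d(3)] by simp
    then obtain w where w: "w \<in> hm (sh 1 A1) E" "w \<cdot> h = ?y" using weak_cokernel2[OF t y] by blast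
    have "neg (sa 1 i1) \<cdot> h = zr E (sh 1 B)" using tri_comp(2)[OF tri_rot[OF t]] .
    then have "sa 1 i1 \<cdot> h = zr E (sh 1 B)"
      using cmp_neg_left[OF shift_arr_hom[OF b(1)] d(4)] neg_zero_iff[OF cmp_hom[OF d(4) shift_arr_hom[OF b(1)]]] by metis
    then have "(sa 1 p1 \<cdot> sa 1 i1) \<cdot> h = zr E (sh 1 A1)"
      using cmp_assoc[OF d(4) shift_arr_hom[OF b(1)] shift_arr_hom[OF b(3)]]
        cmp_zero_right[OF shift_arr_hom[OF b(3)] d(7)] by metis
    then have "h = zr E (sh 1 A1)"
      using shift_cmp[OF b(1,3), of 1] b(5) shift_ident[OF d(5)] cmp_ident_left[OF d(4)] by simp
    then have "?y = zr E E" using w cmp_zero_right[OF w(1) d(7)] by simp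
    then show ?thesis using sub_zero_iff[OF e ident_hom] d by blast
  qed
  then have "isomorphic D E A2" using isoI(2)[OF c(1) gi] \<open>c \<cdot> (g \<cdot> i2) = idt A2\<close> by blast
  then show ?thesis using tr_iso[of A1 B E A1 B A2] t tr_iff isomorphic_refl d by blast
qed

end

section \<open>Full subcategories, products of classes of objects and t-structures\<close>

lemma full_sub_simps [simp]:
  "obj (full_sub C S) = S" "src (full_sub C S) = src C" "tgt (full_sub C S) = tgt C"
  "ident (full_sub C S) = ident C" "cmp (full_sub C S) = cmp C" "zero_arr (full_sub C S) = zero_arr C"
  "add_arr (full_sub C S) = add_arr C"
  by (simp_all add: full_sub_def)

lemma arr_full_sub: "f \<in> arr (full_sub C S) \<longleftrightarrow> f \<in> arr C \<and> src C f \<in> S \<and> tgt C f \<in> S"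
  by (simp add: full_sub_def)

lemma hom_set_full_sub: "f \<in> hom_set (full_sub C S) A B \<longleftrightarrow> f \<in> hom_set C A B \<and> A \<in> S \<and> B \<in> S"
  by (auto simp: hom_set_def arr_full_sub)

lemma hom_set_full_sub_eq: "A \<in> S \<Longrightarrow> B \<in> S \<Longrightarrow> hom_set (full_sub C S) A B = hom_set C A B"
  by (auto simp: hom_set_def arr_full_sub)

lemma hom_group_full_sub: "A \<in> S \<Longrightarrow> B \<in> S \<Longrightarrow> hom_group (full_sub C S) A B = hom_group C A B"
  by (simp add: hom_group_def hom_set_full_sub_eq)

lemma (in preadditive_category) preadditive_full_sub:
  assumes "S \<subseteq> obj C" shows "preadditive_category (full_sub C S)"
proof (rule preadditive_category.intro, goal_cases)
  case (1 f) then show ?case by (auto simp: arr_full_sub)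
next
  case (2 f) then show ?case by (auto simp: arr_full_sub)
next
  case (3 X) then show ?case using ident_hom assms by (auto simp: hom_set_full_sub)
next
  case (4 f X Y g W) then show ?case using cmp_hom[of f X Y g W] by (simp add: hom_set_full_sub)
next
  case (5 f X Y) then show ?case using cmp_ident_right[of f X Y] by (simp add: hom_set_full_sub)
next
  case (6 f X Y) then show ?case using cmp_ident_left[of f X Y] by (simp add: hom_set_full_sub)
next
  case (7 f X Y g W h V) then show ?case using cmp_assoc[of f X Y g W h V] by (simp add: hom_set_full_sub)
next
  case (8 X Y)
  then have "X \<in> obj C" "Y \<in> obj C" using assms by auto
  then show ?case using 8 hom_comm_group[of X Y] by (simp add: hom_group_full_sub)
next
  case (9 f X Y W)
  then have "X \<in> S" "Y \<in> S" "W \<in> S" "W \<in> obj C" "f \<in> hom_set C X Y" using assms by (auto simp: hom_set_full_sub)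
  then show ?case using precompose_hom[of f X Y W] by (simp add: hom_group_full_sub)
next
  case (10 g Y W X)
  then have "X \<in> S" "Y \<in> S" "W \<in> S" "X \<in> obj C" "g \<in> hom_set C Y W" using assms by (auto simp: hom_set_full_sub)
  then show ?case using postcompose_hom[of g Y W X] by (simp add: hom_group_full_sub)
qed

lemma (in preadditive_category) zero_object_full_sub:
  assumes "S \<subseteq> obj C" shows "zero_object (full_sub C S) Z \<longleftrightarrow> zero_object C Z \<and> Z \<in> S"
proof -
  interpret F: preadditive_category "full_sub C S" using preadditive_full_sub[OF assms] .
  show ?thesis using F.zero_obj_iff[of Z] zero_obj_iff[of Z] assms by auto
qed

lemma is_iso_full_sub: "src C f \<in> S \<Longrightarrow> tgt C f \<in> S \<Longrightarrow> is_iso (full_sub C S) f \<longleftrightarrow> is_iso C f"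
  unfolding is_iso_def by (simp add: hom_set_full_sub_eq arr_full_sub)

lemma isomorphic_full_sub:
  "isomorphic (full_sub C S) A B \<longleftrightarrow> isomorphic C A B \<and> A \<in> S \<and> B \<in> S"
proof -
  have "is_iso (full_sub C S) f = is_iso C f" if "f \<in> hom_set C A B" "A \<in> S" "B \<in> S" for f
    using is_iso_full_sub[of C f S] hom_setD[OF that(1)] that by simp
  then show ?thesis unfolding isomorphic_def hom_set_full_sub Bex_def by blast
qed

lemma is_biproduct_full_sub:
  "A1 \<in> S \<Longrightarrow> A2 \<in> S \<Longrightarrow> B \<in> S \<Longrightarrow> is_biproduct (full_sub C S) A1 A2 B \<longleftrightarrow> is_biproduct C A1 A2 B"
  unfolding is_biproduct_def by (simp add: hom_set_full_sub_eq)

text \<open>The product of classes of objects of Beilinson, Bernstein and Deligne.\<close>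

definition star :: "('o, 'm, 'z) tricat_scheme \<Rightarrow> 'o set \<Rightarrow> 'o set \<Rightarrow> 'o set" where
  "star D X Y = {E. \<exists>A\<in>X. \<exists>B\<in>Y. triangle_on D A E B}"

definition iso_closed :: "('o, 'm, 'z) preadd_scheme \<Rightarrow> 'o set \<Rightarrow> bool" where
  "iso_closed D X \<longleftrightarrow> X \<subseteq> obj D \<and> (\<forall>A\<in>X. \<forall>B. isomorphic D A B \<longrightarrow> B \<in> X)"

definition orthogonal :: "('o, 'm, 'z) preadd_scheme \<Rightarrow> 'o set \<Rightarrow> 'o set \<Rightarrow> bool" where
  "orthogonal D X Y \<longleftrightarrow> (\<forall>A\<in>X. \<forall>B\<in>Y. hom_zero D A B)"

text \<open>A t-structure with aisle \<open>U\<close> and coaisle \<open>V\<close>, that is \<open>U = \<D>\<^sup>\<le>\<^sup>0\<close> and \<open>V = \<D>\<^sup>\<ge>\<^sup>1\<close>.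
  Describing each of the two as the orthogonal of the other makes closure under
  extensions, shifts and isomorphisms immediate; \<open>t_pairI\<close> obtains this from
  orthogonality and the existence of truncations.\<close>

definition t_pair :: "('o, 'm, 'z) tricat_scheme \<Rightarrow> 'o set \<Rightarrow> 'o set \<Rightarrow> bool" where
  "t_pair D U V \<longleftrightarrow> (\<forall>E. E \<in> U \<longleftrightarrow> E \<in> obj D \<and> (\<forall>B\<in>V. hom_zero D E B)) \<and>
     (\<forall>E. E \<in> V \<longleftrightarrow> E \<in> obj D \<and> (\<forall>A\<in>U. hom_zero D A E)) \<and>
     obj D \<subseteq> star D U V \<and> (\<forall>E\<in>U. shift_obj D 1 E \<in> U)"

lemma star_mono: "X \<subseteq> X' \<Longrightarrow> Y \<subseteq> Y' \<Longrightarrow> star D X Y \<subseteq> star D X' Y'"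
  unfolding star_def by blast

lemma starI: "triangle_on D A E B \<Longrightarrow> A \<in> X \<Longrightarrow> B \<in> Y \<Longrightarrow> E \<in> star D X Y"
  unfolding star_def by blast

lemma starE: assumes "E \<in> star D X Y" obtains A B where "triangle_on D A E B" "A \<in> X" "B \<in> Y"
  using assms unfolding star_def by blast

context triangulated_category
begin

abbreviation star_in (infixr \<open>\<star>\<close> 75) where "X \<star> Y \<equiv> star D X Y"
abbreviation "zeros \<equiv> {Z. zero_object D Z}"
abbreviation "isoc \<equiv> iso_closed D"

lemma star_obj: "E \<in> X \<star> Y \<Longrightarrow> E \<in> obj D"
  by (elim starE) (rule tr_obj)

text \<open>The two forms of the octahedral axiom give the two inclusions.\<close>

lemma star_assoc: "(X \<star> Y) \<star> Z = X \<star> (Y \<star> Z)"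
proof (intro Set.set_eqI iffI)
  fix E assume "E \<in> (X \<star> Y) \<star> Z"
  then obtain M C where "tr M E C" "M \<in> X \<star> Y" "C \<in> Z" by (rule starE)
  moreover from this(2) obtain A B where "tr A M B" "A \<in> X" "B \<in> Y" by (rule starE)
  ultimately have t: "tr M E C" "tr A M B" "A \<in> X" "B \<in> Y" "C \<in> Z" by auto
  obtain R where "tr B R C" "tr A E R" using tr_assoc1[OF t(2,1)] .
  then show "E \<in> X \<star> (Y \<star> Z)" using t starI by metis
next
  fix E assume "E \<in> X \<star> (Y \<star> Z)"
  then obtain A R where "tr A E R" "A \<in> X" "R \<in> Y \<star> Z" by (rule starE)
  moreover from this(3) obtain B C where "tr B R C" "B \<in> Y" "C \<in> Z" by (rule starE)
  ultimately have t: "tr A E R" "tr B R C" "A \<in> X" "B \<in> Y" "C \<in> Z" by auto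
  obtain W where "tr A W B" "tr W E C" using tr_assoc2[OF t(1,2)] .
  then show "E \<in> (X \<star> Y) \<star> Z" using t starI by metis
qed

lemma star_iso: "E \<in> X \<star> Y \<Longrightarrow> isomorphic D E E' \<Longrightarrow> E' \<in> X \<star> Y"
  by (elim starE) (rule starI, rule tr_iso, auto intro: isomorphic_refl dest: tr_obj)

lemma isocD: "isoc X \<Longrightarrow> A \<in> X \<Longrightarrow> isomorphic D A B \<Longrightarrow> B \<in> X" "isoc X \<Longrightarrow> A \<in> X \<Longrightarrow> A \<in> obj D"
  unfolding iso_closed_def by blast+

lemma star_isoc: "isoc (X \<star> Y)"
  unfolding iso_closed_def using star_iso star_obj by blast

lemma zeros_isoc: "isoc zeros"
  unfolding iso_closed_def using isomorphic_zero zero_objD(1) by blast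

lemma star_zeros_left: assumes "isoc X" shows "zeros \<star> X = X"
proof (intro Set.set_eqI iffI)
  fix E assume "E \<in> zeros \<star> X"
  then obtain Z B where "tr Z E B" "zero_object D Z" "B \<in> X" by (auto elim: starE)
  then show "E \<in> X" using tr_zero_left_iso isomorphic_sym isocD(1)[OF assms] by blast
next
  fix E assume "E \<in> X"
  moreover obtain Z where Z: "zero_object D Z" using ex_zero_object by blast
  ultimately have "tr Z E E" using tr_zero_left[OF isomorphic_refl] isocD(2)[OF assms] by blast
  then show "E \<in> zeros \<star> X" using \<open>E \<in> X\<close> Z by (auto intro: starI)
qed

lemma star_zeros_right: assumes "isoc X" shows "X \<star> zeros = X"
proof (intro Set.set_eqI iffI)
  fix E assume "E \<in> X \<star> zeros"
  then obtain Z B where "tr B E Z" "zero_object D Z" "B \<in> X" by (auto elim: starE)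
  then show "E \<in> X" using tr_zero_right_iso isocD(1)[OF assms] by blast
next
  fix E assume "E \<in> X"
  moreover obtain Z where Z: "zero_object D Z" using ex_zero_object by blast
  ultimately have "tr E E Z" using tr_zero_right[OF isomorphic_refl] isocD(2)[OF assms] by blast
  then show "E \<in> X \<star> zeros" using \<open>E \<in> X\<close> Z by (auto intro: starI)
qed

lemma star_left_mem: "isoc X \<Longrightarrow> E \<in> X \<Longrightarrow> zeros \<subseteq> Y \<Longrightarrow> E \<in> X \<star> Y"
  using star_zeros_right star_mono[of X X zeros Y D] by blast

lemma star_right_mem: "isoc Y \<Longrightarrow> E \<in> Y \<Longrightarrow> zeros \<subseteq> X \<Longrightarrow> E \<in> X \<star> Y"
  using star_zeros_left star_mono[of zeros X Y Y D] by blast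

text \<open>All uses of the vanishing of first extensions go through this exchange of two
  factors.\<close>

lemma star_swap: assumes "\<And>A B. A \<in> X \<Longrightarrow> B \<in> Y \<Longrightarrow> hz B (sh 1 A)" shows "X \<star> Y \<subseteq> Y \<star> X"
  using tr_split assms by (fastforce elim: starE intro: starI)

lemma orthD: "orthogonal D X Y \<Longrightarrow> A \<in> X \<Longrightarrow> B \<in> Y \<Longrightarrow> hz A B"
  unfolding orthogonal_def by blast

lemma orth_star_left: "orthogonal D X Z \<Longrightarrow> orthogonal D Y Z \<Longrightarrow> orthogonal D (X \<star> Y) Z"
  unfolding orthogonal_def by (auto elim!: starE intro: hz_tr_left)

lemma orth_star_right: "orthogonal D Z X \<Longrightarrow> orthogonal D Z Y \<Longrightarrow> orthogonal D Z (X \<star> Y)"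
  unfolding orthogonal_def by (auto elim!: starE intro: hz_tr_right)

lemma star_shift: assumes "E \<in> X \<star> Y" shows "sh n E \<in> (sh n ` X) \<star> (sh n ` Y)"
  using assms by (auto elim!: starE intro!: starI tr_shift)

text \<open>If \<open>E\<close> is orthogonal to \<open>V\<close>, the second term of its truncation triangle receives
  only zero arrows from \<open>E\<close> and from the shifted first term, so it vanishes.\<close>

lemma t_pairI:
  assumes "isoc U" "isoc V" "orthogonal D U V" "obj D \<subseteq> U \<star> V" "\<And>E. E \<in> U \<Longrightarrow> sh 1 E \<in> U"
  shows "t_pair D U V"
proof -
  have u: "E \<in> U" if E: "E \<in> obj D" "\<forall>B\<in>V. hz E B" for E
  proof -
    obtain A B where t: "tr A E B" "A \<in> U" "B \<in> V" using subsetD[OF assms(4) E(1)] by (rule starE)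
    then have "zero_object D B" using tr_quotient_zero[OF t(1)] E(2) orthD[OF assms(3) assms(5)] t(2,3) by blast
    then show ?thesis using tr_zero_right_iso[OF t(1)] isocD(1)[OF assms(1) t(2)] by blast
  qed
  have v: "E \<in> V" if E: "E \<in> obj D" "\<forall>A\<in>U. hz A E" for E
  proof -
    obtain A B where t: "tr A E B" "A \<in> U" "B \<in> V" using subsetD[OF assms(4) E(1)] by (rule starE)
    have "hz A (sh (-1) B)" using hz_shift1[of A B 1] orthD[OF assms(3) assms(5)[OF t(2)] t(3)] tr_obj[OF t(1)] by simp
    then have "zero_object D A" using tr_sub_zero t E by blast
    then show ?thesis using tr_zero_left_iso[OF t(1)] t isocD(1)[OF assms(2) t(3)] isomorphic_sym by blast
  qed
  have *: "E \<in> U \<longleftrightarrow> E \<in> obj D \<and> (\<forall>B\<in>V. hz E B)" "E \<in> V \<longleftrightarrow> E \<in> obj D \<and> (\<forall>A\<in>U. hz A E)" for E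
    using u[of E] v[of E] isocD(2)[OF assms(1), of E] isocD(2)[OF assms(2), of E] orthD[OF assms(3)] by blast+
  show ?thesis unfolding t_pair_def by (intro conjI allI ballI * assms(4) assms(5))
qed

lemma t_pairD:
  assumes "t_pair D U V"
  shows "E \<in> U \<longleftrightarrow> E \<in> obj D \<and> (\<forall>B\<in>V. hz E B)" "E \<in> V \<longleftrightarrow> E \<in> obj D \<and> (\<forall>A\<in>U. hz A E)"
    "E \<in> obj D \<Longrightarrow> E \<in> U \<star> V" "E \<in> U \<Longrightarrow> sh 1 E \<in> U"
proof -
  note a = assms[unfolded t_pair_def]
  show "E \<in> U \<longleftrightarrow> E \<in> obj D \<and> (\<forall>B\<in>V. hz E B)" by (rule a[THEN conjunct1, rule_format])
  show "E \<in> V \<longleftrightarrow> E \<in> obj D \<and> (\<forall>A\<in>U. hz A E)" by (rule a[THEN conjunct2, THEN conjunct1, rule_format])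
  show "E \<in> obj D \<Longrightarrow> E \<in> U \<star> V" by (rule subsetD[OF a[THEN conjunct2, THEN conjunct2, THEN conjunct1]])
  show "E \<in> U \<Longrightarrow> sh 1 E \<in> U" by (rule bspec[OF a[THEN conjunct2, THEN conjunct2, THEN conjunct2]])
qed

lemma t_pair_orth: "t_pair D U V \<Longrightarrow> A \<in> U \<Longrightarrow> B \<in> V \<Longrightarrow> hz A B"
  by (simp add: t_pairD(1)[of U V])

lemma t_pair_obj: "t_pair D U V \<Longrightarrow> A \<in> U \<Longrightarrow> A \<in> obj D" "t_pair D U V \<Longrightarrow> B \<in> V \<Longrightarrow> B \<in> obj D"
  by (simp add: t_pairD(1)[of U V]) (simp add: t_pairD(2)[of U V])

lemma t_pair_ext1: assumes "t_pair D U V" "tr A E B" "A \<in> U" "B \<in> U" shows "E \<in> U"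
  unfolding t_pairD(1)[OF assms(1)]
  using hz_tr_left[OF assms(2)] t_pair_orth[OF assms(1)] assms(3,4) tr_obj[OF assms(2)] by simp

lemma t_pair_ext2: assumes "t_pair D U V" "tr A E B" "A \<in> V" "B \<in> V" shows "E \<in> V"
  unfolding t_pairD(2)[OF assms(1)]
  using hz_tr_right[OF assms(2)] t_pair_orth[OF assms(1)] assms(3,4) tr_obj[OF assms(2)] by simp

lemma t_pair_isoc: assumes "t_pair D U V" shows "isoc U" "isoc V"
proof -
  have "B \<in> U" if "A \<in> U" "isomorphic D A B" for A B
    unfolding t_pairD(1)[OF assms]
    using hz_iso[OF that(2) isomorphic_refl] t_pair_orth[OF assms that(1)] t_pair_obj[OF assms] isomorphic_obj[OF that(2)]
    by simp
  then show "isoc U" using t_pair_obj[OF assms] unfolding iso_closed_def by blast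
  have "B \<in> V" if "A \<in> V" "isomorphic D A B" for A B
    unfolding t_pairD(2)[OF assms]
    using hz_iso[OF isomorphic_refl that(2)] t_pair_orth[OF assms _ that(1)] t_pair_obj[OF assms] isomorphic_obj[OF that(2)]
    by simp
  then show "isoc V" using t_pair_obj[OF assms] unfolding iso_closed_def by blast
qed

lemma t_pair_zeros: assumes "t_pair D U V" "zero_object D Z" shows "Z \<in> U" "Z \<in> V"
  unfolding t_pairD(1)[OF assms(1)] t_pairD(2)[OF assms(1)] using hz_zero assms(2) zero_objD(1) by auto

lemma t_pair_shift: assumes "t_pair D U V" "E \<in> V" shows "sh (-1) E \<in> V"
proof -
  have "hz A (sh (-1) E)" if "A \<in> U" for A
    using hz_shift1[of A E 1] t_pair_orth[OF assms(1) t_pairD(4)[OF assms(1) that] assms(2)]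
      t_pair_obj[OF assms(1)] that assms(2) by simp
  then show ?thesis unfolding t_pairD(2)[OF assms(1)] using t_pair_obj(2)[OF assms] by simp
qed

text \<open>Two lifts of the same arrow along \<open>f\<close> differ by an arrow that factors through
  \<open>E[-1]\<close>.\<close>

lemma mono_under_hz: assumes "tri A B E f g h" "hz X (sh (-1) E)" "u \<in> hm X A" "v \<in> hm X A" "f \<cdot> u = f \<cdot> v"
  shows "u = v"
proof -
  note d = triD[OF assms(1)]
  have X: "X \<in> obj D" using assms(3) hom_obj by blast
  have y: "sub_arr D u v \<in> hm X A" using sub_hom[OF assms(3,4)] .
  have "f \<cdot> sub_arr D u v = zr X B"
    using cmp_sub_right[OF assms(3,4) d(2)] sub_zero_iff[OF cmp_hom[OF assms(3) d(2)] cmp_hom[OF assms(4) d(2)]] assms(5) by simp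
  then obtain w where w: "w \<in> hm X (sh (-1) E)" "neg (sa (-1) h) \<cdot> w = sub_arr D u v"
    using weak_kernel0[OF assms(1) y] by blast
  then have "sub_arr D u v = zr X A"
    using hzD[OF assms(2) w(1)] cmp_zero_right[OF triD(2)[OF tri_unrot[OF assms(1)]] X] by simp
  then show ?thesis using sub_zero_iff[OF assms(3,4)] by blast
qed

lemma epi_under_hz: assumes "tri A B E f g h" "hz (sh 1 A) X" "u \<in> hm E X" "v \<in> hm E X" "u \<cdot> g = v \<cdot> g"
  shows "u = v"
proof -
  note d = triD[OF assms(1)]
  have X: "X \<in> obj D" using assms(3) hom_obj by blast
  have y: "sub_arr D u v \<in> hm E X" using sub_hom[OF assms(3,4)] .
  have "sub_arr D u v \<cdot> g = zr B X"
    using cmp_sub_left[OF assms(3,4) d(3)] sub_zero_iff[OF cmp_hom[OF d(3) assms(3)] cmp_hom[OF d(3) assms(4)]] assms(5) by simp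
  then obtain w where w: "w \<in> hm (sh 1 A) X" "w \<cdot> h = sub_arr D u v"
    using weak_cokernel2[OF assms(1) y] by blast
  then have "sub_arr D u v = zr E X"
    using hzD[OF assms(2) w(1)] cmp_zero_left[OF d(4) X] by simp
  then show ?thesis using sub_zero_iff[OF assms(3,4)] by blast
qed

text \<open>A triangle provides weak kernels; in a full subcategory against which \<open>f\<close> is monic,
  they are kernels.\<close>

lemma tri_is_kernel:
  assumes t: "tri A B E f g h" and S: "A \<in> S" "B \<in> S" "E \<in> S"
    and m: "\<And>X u v. X \<in> S \<Longrightarrow> u \<in> hm X A \<Longrightarrow> v \<in> hm X A \<Longrightarrow> f \<cdot> u = f \<cdot> v \<Longrightarrow> u = v"
  shows "is_kernel (full_sub D S) f g"
proof -
  note d = triD[OF t]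
  have e: "\<exists>!u. u \<in> hm X A \<and> f \<cdot> u = x" if X: "X \<in> S" "x \<in> hm X B" "g \<cdot> x = zr X E" for X x
  proof -
    obtain y where "y \<in> hm X A" "f \<cdot> y = x" using weak_kernel[OF t X(2,3)] .
    then show ?thesis using m[OF X(1)] by blast
  qed
  show ?thesis
    unfolding is_kernel_def using S e tri_comp(1)[OF t] hom_setD[OF d(2)] hom_setD[OF d(3)]
    by (simp add: hom_set_full_sub arr_full_sub)
qed

lemma tri_is_cokernel:
  assumes t: "tri A B E f g h" and S: "A \<in> S" "B \<in> S" "E \<in> S"
    and m: "\<And>X u v. X \<in> S \<Longrightarrow> u \<in> hm E X \<Longrightarrow> v \<in> hm E X \<Longrightarrow> u \<cdot> g = v \<cdot> g \<Longrightarrow> u = v"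
  shows "is_cokernel (full_sub D S) g f"
proof -
  note d = triD[OF t]
  have e: "\<exists>!u. u \<in> hm E X \<and> u \<cdot> g = x" if X: "X \<in> S" "x \<in> hm B X" "x \<cdot> f = zr A X" for X x
  proof -
    obtain y where "y \<in> hm E X" "y \<cdot> g = x" using weak_cokernel[OF t X(2,3)] .
    then show ?thesis using m[OF X(1)] by blast
  qed
  show ?thesis
    unfolding is_cokernel_def using S e tri_comp(1)[OF t] hom_setD[OF d(2)] hom_setD[OF d(3)]
    by (simp add: hom_set_full_sub arr_full_sub)
qed

text \<open>The kernel of \<open>f\<close> is zero, so its coimage is \<open>A\<close>, while its image, the kernel of its
  cokernel \<open>g\<close>, is \<open>A\<close> again.\<close>

lemma tri_strict_monic:
  assumes t: "tri A B E f g h" and S: "A \<in> S" "B \<in> S" "E \<in> S" "S \<subseteq> obj D" "Z \<in> S" "zero_object D Z"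
    and m: "\<And>X u v. X \<in> S \<Longrightarrow> u \<in> hm X A \<Longrightarrow> v \<in> hm X A \<Longrightarrow> f \<cdot> u = f \<cdot> v \<Longrightarrow> u = v"
    and n: "\<And>X u v. X \<in> S \<Longrightarrow> u \<in> hm E X \<Longrightarrow> v \<in> hm E X \<Longrightarrow> u \<cdot> g = v \<cdot> g \<Longrightarrow> u = v"
  shows "strict_monic (full_sub D S) f"
proof -
  note d = triD[OF t]
  let ?F = "full_sub D S"
  have fS: "src D f = A" "tgt D f = B" "f \<in> arr D" using hom_setD[OF d(2)] by auto
  have mo: "monic ?F f" unfolding monic_def using m fS S by (auto simp: hom_set_full_sub arr_full_sub)
  have z: "zr Z A \<in> hm Z A" using zero_hom S by blast
  note zS = hom_setD[OF z] and iS = hom_setD[OF ident_hom[OF d(5)]]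
  have k: "is_kernel ?F (zr Z A) f"
  proof -
    have e: "\<exists>!u. u \<in> hm X Z \<and> zr Z A \<cdot> u = x" if X: "X \<in> S" "x \<in> hm X A" "f \<cdot> x = zr X B" for X x
    proof -
      have "x = zr X A" using m[OF X(1,2) zero_hom] X S cmp_zero_right[OF d(2)] by (metis subsetD)
      then show ?thesis
        using zero_objD(2)[OF S(6)] zero_hom[of X Z] cmp_zero_right[OF z, of X] X S by (metis subsetD)
    qed
    show ?thesis unfolding is_kernel_def
      using fS zS S e cmp_zero_right[OF d(2), of Z] by (auto simp: hom_set_full_sub arr_full_sub)
  qed
  have "\<exists>!u. u \<in> hm A X \<and> u \<cdot> idt A = x" if "x \<in> hm A X" for X x
    using cmp_ident_right that by metis
  then have c: "is_cokernel ?F (idt A) (zr Z A)"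
    unfolding is_cokernel_def using zS iS S fS cmp_ident_left[OF z]
    by (simp add: hom_set_full_sub arr_full_sub)
  have i: "is_iso ?F (idt A)"
    unfolding is_iso_def using iS S ident_hom[OF d(5)] cmp_ident_right[OF ident_hom[OF d(5)]]
    by (auto simp: hom_set_full_sub arr_full_sub)
  have eq: "f = cmp ?F f (cmp ?F (idt A) (idt A))"
    using cmp_ident_right[OF d(2)] cmp_ident_right[OF ident_hom[OF d(5)]] by simp
  have u: "idt A \<in> hom_set ?F (tgt ?F (idt A)) (src ?F f)"
    using iS fS S ident_hom[OF d(5)] by (simp add: hom_set_full_sub)
  have "is_kernel ?F f g" by (rule tri_is_kernel[OF t S(1-3)]) (rule m)
  moreover have "is_cokernel ?F g f" by (rule tri_is_cokernel[OF t S(1-3)]) (rule n)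
  ultimately have "strict ?F f"
    unfolding strict_def using k c u eq i by blast
  then show ?thesis using mo by (simp add: strict_monic_def)
qed

lemma tri_strict_epic:
  assumes t: "tri A B E f g h" and S: "A \<in> S" "B \<in> S" "E \<in> S" "S \<subseteq> obj D" "Z \<in> S" "zero_object D Z"
    and m: "\<And>X u v. X \<in> S \<Longrightarrow> u \<in> hm X A \<Longrightarrow> v \<in> hm X A \<Longrightarrow> f \<cdot> u = f \<cdot> v \<Longrightarrow> u = v"
    and n: "\<And>X u v. X \<in> S \<Longrightarrow> u \<in> hm E X \<Longrightarrow> v \<in> hm E X \<Longrightarrow> u \<cdot> g = v \<cdot> g \<Longrightarrow> u = v"
  shows "strict_epic (full_sub D S) g"
proof -
  note d = triD[OF t]
  let ?F = "full_sub D S"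
  have gS: "src D g = B" "tgt D g = E" "g \<in> arr D" using hom_setD[OF d(3)] by auto
  have mo: "epic ?F g" unfolding epic_def using n gS S by (auto simp: hom_set_full_sub arr_full_sub)
  have z: "zr E Z \<in> hm E Z" using zero_hom S by blast
  note zS = hom_setD[OF z] and iS = hom_setD[OF ident_hom[OF d(7)]]
  have k: "is_cokernel ?F (zr E Z) g"
  proof -
    have e: "\<exists>!u. u \<in> hm Z X \<and> u \<cdot> zr E Z = x" if X: "X \<in> S" "x \<in> hm E X" "x \<cdot> g = zr B X" for X x
    proof -
      have "x = zr E X" using n[OF X(1,2) zero_hom] X S cmp_zero_left[OF d(3)] by (metis subsetD)
      then show ?thesis
        using zero_objD(3)[OF S(6)] zero_hom[of Z X] cmp_zero_left[OF z, of X] X S by (metis subsetD)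
    qed
    show ?thesis unfolding is_cokernel_def
      using gS zS S e cmp_zero_left[OF d(3), of Z] by (auto simp: hom_set_full_sub arr_full_sub)
  qed
  have "\<exists>!u. u \<in> hm X E \<and> idt E \<cdot> u = x" if "x \<in> hm X E" for X x
    using cmp_ident_left that by metis
  then have c: "is_kernel ?F (idt E) (zr E Z)"
    unfolding is_kernel_def using zS iS S gS cmp_ident_right[OF z]
    by (simp add: hom_set_full_sub arr_full_sub)
  have i: "is_iso ?F (idt E)"
    unfolding is_iso_def using iS S ident_hom[OF d(7)] cmp_ident_right[OF ident_hom[OF d(7)]]
    by (auto simp: hom_set_full_sub arr_full_sub)
  have eq: "g = cmp ?F (idt E) (cmp ?F (idt E) g)"
    using cmp_ident_left[OF d(3)] by simp
  have u: "idt E \<in> hom_set ?F (tgt ?F g) (src ?F (idt E))"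
    using iS gS S ident_hom[OF d(7)] by (simp add: hom_set_full_sub)
  have "is_kernel ?F f g" by (rule tri_is_kernel[OF t S(1-3)]) (rule m)
  moreover have "is_cokernel ?F g f" by (rule tri_is_cokernel[OF t S(1-3)]) (rule n)
  ultimately have "strict ?F g"
    unfolding strict_def using k c u eq i by blast
  then show ?thesis using mo by (simp add: strict_epic_def)
qed

end

section \<open>The category between two t-structures\<close>

context triangulated_category
begin

lemma tri_cocone: assumes "g \<in> hm B E" obtains A f h where "tri A B E f g h"
proof -
  obtain N s t where "tri B E N g s t" using tri_exists[OF assms] by blast
  then show thesis using tri_unrot that by blast
qed

text \<open>Triangles with a prescribed connecting arrow provide base change: the connecting
  arrow of an extension can be composed with another arrow and completed again.\<close>

lemma tri_connecting: assumes h: "h \<in> hm X (sh 1 K)" and K: "K \<in> obj D"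
  obtains E k q where "tri K E X k q h"
proof -
  obtain N s t where N: "tri X (sh 1 K) N h s t" using tri_exists[OF h] by blast
  have "tri K (sh (-1) N) X (neg (sa (-1) s)) (neg (sa (-1) t)) h"
    using tri_unrot[OF tri_unrot[OF N]] K by simp
  then show thesis using that by blast
qed

lemma octahedral3:
  assumes "tri X M Y f p p'" "tri M E Z g q q'" "tri X E R (g \<cdot> f) r r'"
  obtains u v w where "tri Y R Z u v w" "u \<cdot> p = r \<cdot> g" "v \<cdot> r = q"
proof -
  note a = triD[OF assms(1)] and b = triD[OF assms(2)] and c = triD[OF assms(3)]
  obtain u v where uv: "u \<in> hm (tgt D p) (tgt D r)" "v \<in> hm (tgt D r) (tgt D q)"
    "(u, v, sa 1 p \<cdot> q') \<in> distinguished D" "u \<cdot> p = r \<cdot> g" "v \<cdot> r = q"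
    using TR4[OF a(1) b(1) _ c(1)] a b hom_setD by metis
  have "tri Y R Z u v (sa 1 p \<cdot> q')"
    using uv hom_setD[OF a(3)] hom_setD[OF b(3)] hom_setD[OF c(3)] cmp_hom[OF b(4) shift_arr_hom[OF a(3)]]
    unfolding tri_def by simp
  then show thesis using that uv by blast
qed

end

text \<open>For \<open>V = U[1]\<close> the class \<open>T\<close> is the heart of a t-structure. For the t-structures of
  a slicing cut at \<open>a < b \<le> a + 1\<close> it is the interval category \<open>P(a,b)\<close>. The condition
  \<open>U[1] \<subseteq> V\<close>, that the interval has length at most 1, excludes nonzero arrows
  \<open>A[1] \<rightarrow> B\<close> between objects of \<open>T\<close> (\<open>T_hz\<close>); this makes triangles with all terms in
  \<open>T\<close> into short exact sequences.\<close>

locale t_window = triangulated_category D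
  for D :: "('o, 'm, 'z) tricat_scheme" +
  fixes U U' V V' T :: "'o set"
  assumes tU: "t_pair D U U'" and tV: "t_pair D V V'"
    and shift_U_V: "E \<in> U \<Longrightarrow> shift_obj D 1 E \<in> V" and V_sub_U: "V \<subseteq> U" and T_eq: "T = U \<inter> V'"
begin

abbreviation "F \<equiv> full_sub D T"

lemma T_obj: "A \<in> T \<Longrightarrow> A \<in> obj D"
  using T_eq t_pair_obj(1)[OF tU] by blast

lemma T_subset: "T \<subseteq> obj D"
  using T_obj by blast

lemma TI: "A \<in> U \<Longrightarrow> A \<in> V' \<Longrightarrow> A \<in> T" and TD: "A \<in> T \<Longrightarrow> A \<in> U" "A \<in> T \<Longrightarrow> A \<in> V'"
  using T_eq by auto

lemma U'_sub_V': "A \<in> U' \<Longrightarrow> A \<in> V'"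
  using t_pairD(2)[OF tU] t_pairD(2)[OF tV] V_sub_U by blast

lemma T_hz: assumes "A \<in> T" "B \<in> T" shows "hz (sh 1 A) B" "hz A (sh (-1) B)"
proof -
  show h: "hz (sh 1 A) B" using t_pair_orth[OF tV shift_U_V] TD assms by blast
  then show "hz A (sh (-1) B)" using hz_shift1[of A B 1] T_obj assms by simp
qed

lemma T_ext: assumes "tr A E B" "A \<in> T" "B \<in> T" shows "E \<in> T"
  using t_pair_ext1[OF tU assms(1)] t_pair_ext2[OF tV assms(1)] TI TD assms by blast

lemma T_zero: "zero_object D Z \<Longrightarrow> Z \<in> T"
  using TI t_pair_zeros[OF tU] t_pair_zeros[OF tV] by blast

lemma T_iso: "A \<in> T \<Longrightarrow> isomorphic D A B \<Longrightarrow> B \<in> T"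
  using TI TD isocD(1)[OF t_pair_isoc(1)[OF tU]] isocD(1)[OF t_pair_isoc(2)[OF tV]] by blast

lemma U_shift: "A \<in> U \<Longrightarrow> sh 1 A \<in> U" and V'_shift: "A \<in> V' \<Longrightarrow> sh (-1) A \<in> V'"
  using t_pairD(4)[OF tU] t_pair_shift[OF tV] by blast+

lemma T_mono: assumes "tri A B E f g h" "A \<in> T" "E \<in> T" "X \<in> T" "u \<in> hm X A" "v \<in> hm X A" "f \<cdot> u = f \<cdot> v"
  shows "u = v"
  using mono_under_hz[OF assms(1) T_hz(2)[OF assms(4,3)] assms(5-7)] .

lemma T_epi: assumes "tri A B E f g h" "A \<in> T" "E \<in> T" "X \<in> T" "u \<in> hm E X" "v \<in> hm E X" "u \<cdot> g = v \<cdot> g"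
  shows "u = v"
  using epi_under_hz[OF assms(1) T_hz(1)[OF assms(2,4)] assms(5-7)] .

lemma tri_kernel_T: assumes "tri A B E f g h" "A \<in> T" "B \<in> T" "E \<in> T"
  shows "is_kernel F f g" "is_cokernel F g f"
  by (rule tri_is_kernel[OF assms], rule T_mono[OF assms(1,2,4)], assumption+)
    (rule tri_is_cokernel[OF assms], rule T_epi[OF assms(1,2,4)], assumption+)

lemma tri_strict_T: assumes "tri A B E f g h" "A \<in> T" "B \<in> T" "E \<in> T"
  shows "strict_monic F f" "strict_epic F g"
proof -
  obtain Z where Z: "zero_object D Z" using ex_zero_object by blast
  show "strict_monic F f"
    by (rule tri_strict_monic[OF assms T_subset T_zero[OF Z] Z])
      (rule T_mono[OF assms(1,2,4)] T_epi[OF assms(1,2,4)]; assumption)+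
  show "strict_epic F g"
    by (rule tri_strict_epic[OF assms T_subset T_zero[OF Z] Z])
      (rule T_mono[OF assms(1,2,4)] T_epi[OF assms(1,2,4)]; assumption)+
qed

lemma is_kernelD:
  assumes "is_kernel F k f" "k \<in> hm K A" "f \<in> hm A B"
  shows "f \<cdot> k = zr K B" "X \<in> T \<Longrightarrow> x \<in> hm X A \<Longrightarrow> f \<cdot> x = zr X B \<Longrightarrow> \<exists>u. u \<in> hm X K \<and> k \<cdot> u = x"
    "X \<in> T \<Longrightarrow> u \<in> hm X K \<Longrightarrow> v \<in> hm X K \<Longrightarrow> k \<cdot> u = k \<cdot> v \<Longrightarrow> u = v"
proof -
  note k = hom_setD[OF assms(2)] and f = hom_setD[OF assms(3)]
  have T: "K \<in> T" "A \<in> T" "B \<in> T" using assms(1) k f unfolding is_kernel_def by (auto simp: arr_full_sub)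
  show fk: "f \<cdot> k = zr K B" using assms(1) k f unfolding is_kernel_def by simp
  have e: "\<exists>!u. u \<in> hm X K \<and> k \<cdot> u = x" if "X \<in> T" "x \<in> hm X A" "f \<cdot> x = zr X B" for X x
    using assms(1) that k f T unfolding is_kernel_def by (simp add: hom_set_full_sub)
  show "\<exists>u. u \<in> hm X K \<and> k \<cdot> u = x" if "X \<in> T" "x \<in> hm X A" "f \<cdot> x = zr X B"
    using e[OF that] by blast
  show "u = v" if h: "X \<in> T" "u \<in> hm X K" "v \<in> hm X K" "k \<cdot> u = k \<cdot> v"
  proof -
    have "f \<cdot> (k \<cdot> u) = zr X B" using cmp_assoc[OF h(2) assms(2,3)] fk cmp_zero_left[OF h(2)] T_obj T by simp
    then show ?thesis using e[OF h(1) cmp_hom[OF h(2) assms(2)]] h by metis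
  qed
qed

lemma is_cokernelD:
  assumes "is_cokernel F c f" "c \<in> hm B K" "f \<in> hm A B"
  shows "c \<cdot> f = zr A K" "X \<in> T \<Longrightarrow> x \<in> hm B X \<Longrightarrow> x \<cdot> f = zr A X \<Longrightarrow> \<exists>u. u \<in> hm K X \<and> u \<cdot> c = x"
    "X \<in> T \<Longrightarrow> u \<in> hm K X \<Longrightarrow> v \<in> hm K X \<Longrightarrow> u \<cdot> c = v \<cdot> c \<Longrightarrow> u = v"
proof -
  note k = hom_setD[OF assms(2)] and f = hom_setD[OF assms(3)]
  have T: "K \<in> T" "A \<in> T" "B \<in> T" using assms(1) k f unfolding is_cokernel_def by (auto simp: arr_full_sub)
  show fk: "c \<cdot> f = zr A K" using assms(1) k f unfolding is_cokernel_def by simp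
  have e: "\<exists>!u. u \<in> hm K X \<and> u \<cdot> c = x" if "X \<in> T" "x \<in> hm B X" "x \<cdot> f = zr A X" for X x
    using assms(1) that k f T unfolding is_cokernel_def by (simp add: hom_set_full_sub)
  show "\<exists>u. u \<in> hm K X \<and> u \<cdot> c = x" if "X \<in> T" "x \<in> hm B X" "x \<cdot> f = zr A X"
    using e[OF that] by blast
  show "u = v" if h: "X \<in> T" "u \<in> hm K X" "v \<in> hm K X" "u \<cdot> c = v \<cdot> c"
  proof -
    have "(u \<cdot> c) \<cdot> f = zr A X" using cmp_assoc[OF assms(3,2) h(2)] fk cmp_zero_right[OF h(2)] T_obj T by simp
    then show ?thesis using e[OF h(1) cmp_hom[OF assms(2) h(2)]] h by metis
  qed
qed

text \<open>The cokernel of \<open>f\<close> is the \<open>V'\<close>-truncation \<open>Q\<close> of its cone \<open>C\<close>. The octahedral axiom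
  for the two steps \<open>B \<rightarrow> C \<rightarrow> Q\<close> factors \<open>f\<close> through the fibre \<open>I\<close> of \<open>B \<rightarrow> Q\<close>, its
  image. The cone \<open>W\<close> of \<open>A \<rightarrow> I\<close> is kept in the statement: in an abelian heart it is
  the shifted kernel.\<close>

lemma coimage_cokernel:
  assumes f: "f \<in> hm A B" and T: "A \<in> T" "B \<in> T"
  obtains I Q W i c d p q r where "tri I B Q i d p" "tri A I W c q r" "i \<cdot> c = f" "I \<in> T" "Q \<in> T" "W \<in> V"
    "sh (-1) W \<in> V'" "is_cokernel F d f"
proof -
  obtain C g h where t: "tri A B C f g h" using tri_exists[OF f] by blast
  note d = triD[OF t]
  have "C \<in> V \<star> V'" using t_pairD(3)[OF tV d(7)] .
  then obtain W Q where "tr W C Q" and WQ: "W \<in> V" "Q \<in> V'" by (rule starE)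
  then obtain a b w where w: "tri W C Q a b w" using tr_iff by blast
  note e = triD[OF w]
  obtain I c i q r p where I: "tri A I W c q r" "tri I B Q i (b \<cdot> g) p" "i \<cdot> c = f"
    using octahedral2[OF t w] .
  have trt: "tr A B C" "tr W C Q" "tr A I W" "tr I B Q" using t w I tr_iff by blast+
  have CU: "C \<in> U" using t_pair_ext1[OF tU tr_rot[OF trt(1)]] TD T U_shift by blast
  have "Q \<in> U" using t_pair_ext1[OF tU tr_rot[OF trt(2)]] CU WQ V_sub_U U_shift by blast
  then have Q: "Q \<in> T" using TI WQ by blast
  have "I \<in> U" using t_pair_ext1[OF tU trt(3)] TD T WQ V_sub_U by blast
  moreover have "I \<in> V'" using t_pair_ext2[OF tV tr_unrot[OF trt(4)]] TD T WQ V'_shift by blast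
  ultimately have IT: "I \<in> T" using TI by blast
  have "sh (-1) C \<in> V'" using t_pair_ext2[OF tV tr_unrot[OF tr_unrot[OF trt(1)]]] TD T V'_shift by blast
  moreover have "tr (sh (-1) (sh (-1) Q)) (sh (-1) W) (sh (-1) C)"
    using tr_shift[OF tr_unrot[OF trt(2)], of "-1"] .
  ultimately have W': "sh (-1) W \<in> V'" using t_pair_ext2[OF tV] V'_shift WQ by blast
  let ?d = "b \<cdot> g"
  have dh: "?d \<in> hm B Q" using cmp_hom[OF d(3) e(3)] .
  have df: "?d \<cdot> f = zr A Q"
    using cmp_assoc[OF d(2,3) e(3)] tri_comp(1)[OF t] cmp_zero_right[OF e(3) d(5)] by simp
  have ex: "\<exists>!u. u \<in> hm Q X \<and> u \<cdot> ?d = x" if X: "X \<in> T" "x \<in> hm B X" "x \<cdot> f = zr A X" for X x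
  proof -
    obtain y where y: "y \<in> hm C X" "y \<cdot> g = x" using weak_cokernel[OF t X(2,3)] .
    have "y \<cdot> a = zr W X" using hzD[OF t_pair_orth[OF tV WQ(1)] cmp_hom[OF e(2) y(1)]] TD X by blast
    then obtain z where z: "z \<in> hm Q X" "z \<cdot> b = y" using weak_cokernel[OF w y(1)] by blast
    have "z \<cdot> ?d = x" using cmp_assoc[OF d(3) e(3) z(1)] z y by simp
    then show ?thesis using z T_epi[OF I(2) IT Q X(1)] by blast
  qed
  have "is_cokernel F ?d f"
    unfolding is_cokernel_def using hom_setD[OF dh] hom_setD[OF f] df ex T Q
    by (simp add: arr_full_sub hom_set_full_sub)
  then show thesis using that[OF I(2,1,3) IT Q WQ(1) W'] by blast
qed

text \<open>Dually, the kernel of \<open>f\<close> is the \<open>U\<close>-truncation of its shifted cone.\<close>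

lemma kernel_image:
  assumes f: "f \<in> hm A B" and T: "A \<in> T" "B \<in> T"
  obtains K M k c p i where "tri K A M k c p" "i \<in> hm M B" "i \<cdot> c = f" "K \<in> T" "M \<in> T" "is_kernel F k f"
proof -
  obtain C g h where t0: "tri A B C f g h" using tri_exists[OF f] by blast
  let ?C = "sh (-1) C"
  obtain e where t: "tri ?C A B e f g" using tri_unrot[OF t0] by blast
  note d = triD[OF t]
  have "?C \<in> U \<star> U'" using t_pairD(3)[OF tU d(5)] .
  then obtain K L where "tr K ?C L" and KL: "K \<in> U" "L \<in> U'" by (rule starE)
  then obtain a b w where w: "tri K ?C L a b w" using tr_iff by blast
  note e = triD[OF w]
  obtain M u v w' r r' where M: "tri K A M (e \<cdot> a) r r'" "tri L M B u v w'" "v \<cdot> r = f"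
    using octahedral1[OF w t] by metis
  have trt: "tr ?C A B" "tr K ?C L" "tr K A M" "tr L M B" using t w M tr_iff by blast+
  have CV: "?C \<in> V'" using t_pair_ext2[OF tV tr_unrot[OF trt(1)]] TD T V'_shift by blast
  have "K \<in> V'" using t_pair_ext2[OF tV tr_unrot[OF trt(2)]] CV KL U'_sub_V' V'_shift by blast
  then have K: "K \<in> T" using TI KL by blast
  have "M \<in> V'" using t_pair_ext2[OF tV trt(4)] TD T KL U'_sub_V' by blast
  moreover have "M \<in> U" using t_pair_ext1[OF tU tr_rot[OF trt(3)]] TD T KL U_shift by blast
  ultimately have MT: "M \<in> T" using TI by blast
  let ?k = "e \<cdot> a"
  have kh: "?k \<in> hm K A" using cmp_hom[OF e(2) d(2)] .
  have fk: "f \<cdot> ?k = zr K B"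
    using cmp_assoc[OF e(2) d(2,3)] tri_comp(1)[OF t] cmp_zero_left[OF e(2) d(7)] by simp
  have ex: "\<exists>!u. u \<in> hm X K \<and> ?k \<cdot> u = x" if X: "X \<in> T" "x \<in> hm X A" "f \<cdot> x = zr X B" for X x
  proof -
    obtain y where y: "y \<in> hm X ?C" "e \<cdot> y = x" using weak_kernel[OF t X(2,3)] .
    have "b \<cdot> y = zr X L" using hzD[OF t_pair_orth[OF tU _ KL(2)] cmp_hom[OF y(1) e(3)]] TD X by blast
    then obtain z where z: "z \<in> hm X K" "a \<cdot> z = y" using weak_kernel[OF w y(1)] by blast
    have "?k \<cdot> z = x" using cmp_assoc[OF z(1) e(2) d(2)] z y by simp
    then show ?thesis using z T_mono[OF M(1) K MT X(1)] by blast
  qed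
  have "is_kernel F ?k f"
    unfolding is_kernel_def using hom_setD[OF kh] hom_setD[OF f] fk ex T K
    by (simp add: arr_full_sub hom_set_full_sub)
  then show thesis using that[OF M(1) triD(3)[OF M(2)] M(3) K MT] by blast
qed

lemma additive_T: "additive_category F"
proof -
  interpret P: preadditive_category F using preadditive_full_sub[OF T_subset] .
  show ?thesis
  proof
    show "\<exists>Z. zero_object F Z"
      using ex_zero_object T_zero zero_object_full_sub[OF T_subset] by blast
    fix A1 A2 assume A: "A1 \<in> obj F" "A2 \<in> obj F"
    then obtain B where B: "B \<in> obj D" "is_biproduct D A1 A2 B" using ex_biproduct[of A1 A2] T_obj[of A1] T_obj[of A2] by auto
    have "B \<in> T" using T_ext[OF biproduct_tr[OF B(2)]] A T_obj by auto
    then show "\<exists>B\<in>obj F. is_biproduct F A1 A2 B" using B A is_biproduct_full_sub[of A1 T A2 B D] by auto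
  qed
qed

lemma preabelian_T: "preabelian_category F"
proof -
  interpret P: additive_category F by (rule additive_T)
  show ?thesis
  proof
    fix f assume "f \<in> arr F"
    then have f: "f \<in> hm (src D f) (tgt D f)" "src D f \<in> T" "tgt D f \<in> T"
      by (auto simp: arr_full_sub hom_set_def)
    show "\<exists>k. is_kernel F k f" using kernel_image[OF f] by blast
    show "\<exists>c. is_cokernel F c f" using coimage_cokernel[OF f] by blast
  qed
qed

text \<open>A kernel \<open>f = i c\<close> agrees with its image \<open>i\<close>: an arrow of which \<open>f\<close> is the kernel
  kills \<open>i\<close>, because it factors through the cokernel of \<open>f\<close>. So \<open>i\<close> factors through
  \<open>f\<close>, and this factor is inverse to \<open>c\<close>. The image completes to a triangle in \<open>T\<close> by
  construction.\<close>

lemma kernel_tri: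
  assumes "is_kernel F f g" "f \<in> hm A B"
  obtains E d h where "tri A B E f d h" "A \<in> T" "B \<in> T" "E \<in> T"
proof -
  obtain Y where g: "g \<in> hm B Y" using assms hom_setD[OF assms(2)] unfolding is_kernel_def
    by (auto simp: arr_full_sub hom_set_def)
  have T: "A \<in> T" "B \<in> T" "Y \<in> T" using assms hom_setD[OF assms(2)] hom_setD[OF g] unfolding is_kernel_def
    by (auto simp: arr_full_sub)
  note k = is_kernelD[OF assms g]
  obtain I Q W i c d p q r where I: "tri I B Q i d p" "tri A I W c q r" "i \<cdot> c = f" "I \<in> T" "Q \<in> T"
    "is_cokernel F d f" using coimage_cokernel[OF assms(2) T(1,2)] by metis
  note t = triD[OF I(1)] and s = triD[OF I(2)]
  obtain g2 where g2: "g2 \<in> hm Q Y" "g2 \<cdot> d = g"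
    using is_cokernelD(2)[OF I(6) t(3) assms(2) T(3) g k(1)] by blast
  have "g \<cdot> i = zr I Y"
    using cmp_assoc[OF t(2,3) g2(1)] g2(2) tri_comp(1)[OF I(1)] cmp_zero_right[OF g2(1) t(5)] by simp
  then obtain w where w: "w \<in> hm I A" "f \<cdot> w = i" using k(2)[OF I(4) t(2)] by blast
  have "f \<cdot> (w \<cdot> c) = f \<cdot> idt A"
    using cmp_assoc[OF s(2) w(1) assms(2)] w I(3) cmp_ident_right[OF assms(2)] by simp
  then have wc: "w \<cdot> c = idt A" using k(3)[OF T(1) cmp_hom[OF s(2) w(1)] ident_hom] s by blast
  have "i \<cdot> (c \<cdot> w) = i \<cdot> idt I"
    using cmp_assoc[OF w(1) s(2) t(2)] w I(3) cmp_ident_right[OF t(2)] by simp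
  then have cw: "c \<cdot> w = idt I" using T_mono[OF I(1) I(4,5) I(4) cmp_hom[OF w(1) s(2)] ident_hom] t by blast
  show thesis using tri_iso_left[OF I(1) w(1) s(2) cw wc] I(3,5) T that by simp
qed

lemma cokernel_tri:
  assumes "is_cokernel F g f" "g \<in> hm B E"
  obtains A k h where "tri A B E k g h" "A \<in> T" "B \<in> T" "E \<in> T"
proof -
  obtain Y where f: "f \<in> hm Y B" using assms hom_setD[OF assms(2)] unfolding is_cokernel_def
    by (auto simp: arr_full_sub hom_set_def)
  have T: "B \<in> T" "E \<in> T" "Y \<in> T" using assms hom_setD[OF assms(2)] hom_setD[OF f] unfolding is_cokernel_def
    by (auto simp: arr_full_sub)
  note k = is_cokernelD[OF assms f]
  obtain K M j c p i where I: "tri K B M j c p" "i \<in> hm M E" "i \<cdot> c = g" "K \<in> T" "M \<in> T" "is_kernel F j g"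
    using kernel_image[OF assms(2) T(1,2)] .
  note t = triD[OF I(1)]
  obtain f2 where f2: "f2 \<in> hm Y K" "j \<cdot> f2 = f"
    using is_kernelD(2)[OF I(6) t(2) assms(2) T(3) f k(1)] by blast
  have "c \<cdot> f = zr Y M"
    using cmp_assoc[OF f2(1) t(2,3)] f2(2) tri_comp(1)[OF I(1)] cmp_zero_left[OF f2(1) t(7)] by simp
  then obtain w where w: "w \<in> hm E M" "w \<cdot> g = c" using k(2)[OF I(5) t(3)] by blast
  have "(i \<cdot> w) \<cdot> g = idt E \<cdot> g"
    using cmp_assoc[OF assms(2) w(1) I(2)] w I(3) cmp_ident_left[OF assms(2)] by simp
  then have iw: "i \<cdot> w = idt E" using k(3)[OF T(2) cmp_hom[OF w(1) I(2)] ident_hom] T T_obj by blast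
  have "(w \<cdot> i) \<cdot> c = idt M \<cdot> c"
    using cmp_assoc[OF t(3) I(2) w(1)] w I(3) cmp_ident_left[OF t(3)] by simp
  then have wi: "w \<cdot> i = idt M" using T_epi[OF I(1) I(4,5) I(5) cmp_hom[OF I(2) w(1)] ident_hom] t by blast
  show thesis using tri_iso_right[OF I(1) I(2) w(1) wi iw] I(3,4) T that by simp
qed

lemma short_exact_tri: assumes "short_exact F f g" "f \<in> hm A B" "g \<in> hm B E"
  shows "\<exists>h. tri A B E f g h" "A \<in> T" "B \<in> T" "E \<in> T"
proof -
  have kc: "is_kernel F f g" "is_cokernel F g f" using assms unfolding short_exact_def by auto
  obtain E' d h where t: "tri A B E' f d h" "A \<in> T" "B \<in> T" "E' \<in> T" using kernel_tri[OF kc(1) assms(2)] .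
  note d = triD[OF t(1)]
  show "A \<in> T" "B \<in> T" using t by auto
  show E: "E \<in> T" using kc(1) hom_setD[OF assms(3)] unfolding is_kernel_def by (auto simp: arr_full_sub)
  note k = is_cokernelD[OF kc(2) assms(3,2)] and k' = is_cokernelD[OF tri_kernel_T(2)[OF t] d(3,2)]
  obtain u where u: "u \<in> hm E E'" "u \<cdot> g = d" using k(2)[OF t(4) d(3) k'(1)] by blast
  obtain v where v: "v \<in> hm E' E" "v \<cdot> d = g" using k'(2)[OF E assms(3) k(1)] by blast
  have "(v \<cdot> u) \<cdot> g = idt E \<cdot> g"
    using cmp_assoc[OF assms(3) u(1) v(1)] u v cmp_ident_left[OF assms(3)] by simp
  then have vu: "v \<cdot> u = idt E" using k(3)[OF E cmp_hom[OF u(1) v(1)] ident_hom] E T_obj by blast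
  have "(u \<cdot> v) \<cdot> d = idt E' \<cdot> d"
    using cmp_assoc[OF d(3) v(1) u(1)] u v cmp_ident_left[OF d(3)] by simp
  then have uv: "u \<cdot> v = idt E'" using k'(3)[OF t(4) cmp_hom[OF v(1) u(1)] ident_hom] d by blast
  show "\<exists>h. tri A B E f g h" using tri_iso_right[OF t(1) v(1) u(1) uv vu] v by auto
qed

lemma tri_short_exact: assumes "tri A B E f g h" "A \<in> T" "B \<in> T" "E \<in> T" shows "short_exact F f g"
  using tri_kernel_T[OF assms] unfolding short_exact_def by blast

lemma strictD: assumes "strict F f" "f \<in> hm A B"
  obtains k K c C d Q i I u where "is_kernel F k f" "is_cokernel F c k" "is_cokernel F d f" "is_kernel F i d"
    "k \<in> hm K A" "c \<in> hm A C" "u \<in> hm C I" "i \<in> hm I B" "d \<in> hm B Q" "f = i \<cdot> (u \<cdot> c)" "is_iso D u"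
    "K \<in> T" "A \<in> T" "C \<in> T" "I \<in> T" "B \<in> T" "Q \<in> T"
proof -
  obtain k c d i u where s: "is_kernel F k f" "is_cokernel F c k" "is_cokernel F d f" "is_kernel F i d"
    "u \<in> hom_set F (tgt F c) (src F i)" "f = cmp F i (cmp F u c)" "is_iso F u"
    using assms(1) unfolding strict_def by blast
  note a = hom_setD[OF assms(2)]
  show thesis
  proof (rule that[OF s(1-4)])
    show "k \<in> hm (src D k) A" "c \<in> hm A (tgt D c)" "d \<in> hm B (tgt D d)" "i \<in> hm (src D i) B"
      using s(1-4) a unfolding is_kernel_def is_cokernel_def by (auto simp: hom_set_def arr_full_sub)
    show u: "u \<in> hm (tgt D c) (src D i)" using s(5) by (simp add: hom_set_full_sub)
    show "f = i \<cdot> (u \<cdot> c)" using s(6) by simp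
    show "src D k \<in> T" "A \<in> T" "tgt D c \<in> T" "src D i \<in> T" "B \<in> T" "tgt D d \<in> T"
      using s(1-4) a unfolding is_kernel_def is_cokernel_def by (auto simp: hom_set_def arr_full_sub)
    then show "is_iso D u" using s(7) is_iso_full_sub[of D u T] hom_setD[OF u] by simp
  qed
qed

text \<open>The coimage of a monic arrow is its source, so a strict monic arrow is the kernel of
  its cokernel up to isomorphism.\<close>

lemma strict_monic_tri:
  assumes "strict_monic F f" "f \<in> hm A B"
  obtains E g h where "tri A B E f g h" "A \<in> T" "B \<in> T" "E \<in> T"
proof -
  have s: "strict F f" and m: "monic F f" using assms unfolding strict_monic_def by auto
  obtain k K c C d Q i I u where x: "is_kernel F k f" "is_cokernel F c k" "is_kernel F i d"
    "k \<in> hm K A" "c \<in> hm A C" "u \<in> hm C I" "i \<in> hm I B" "d \<in> hm B Q" "f = i \<cdot> (u \<cdot> c)" "is_iso D u"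
    "K \<in> T" "A \<in> T" "C \<in> T" "I \<in> T" "B \<in> T" using strictD[OF s assms(2)] by metis
  have o: "K \<in> obj D" "A \<in> obj D" "C \<in> obj D" using x T_obj by auto
  have mm: "a = b" if "X \<in> T" "a \<in> hm X A" "b \<in> hm X A" "f \<cdot> a = f \<cdot> b" for X a b
    using m that x hom_setD[OF assms(2)] unfolding monic_def by (auto simp: hom_set_full_sub)
  have "f \<cdot> k = f \<cdot> zr K A"
    using is_kernelD(1)[OF x(1,4) assms(2)] cmp_zero_right[OF assms(2) o(1)] by simp
  then have k0: "k = zr K A" using mm[OF x(11,4) zero_hom] o by blast
  have "idt A \<cdot> k = zr K A" using k0 cmp_ident_left[OF x(4)] by simp
  then obtain r where r: "r \<in> hm C A" "r \<cdot> c = idt A"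
    using is_cokernelD(2)[OF x(2,5,4) x(12) ident_hom] o by blast
  have "(c \<cdot> r) \<cdot> c = idt C \<cdot> c"
    using cmp_assoc[OF x(5) r(1) x(5)] r cmp_ident_left[OF x(5)] cmp_ident_right[OF x(5)] by simp
  then have "c \<cdot> r = idt C" using is_cokernelD(3)[OF x(2,5,4) x(13) cmp_hom[OF r(1) x(5)] ident_hom] o by blast
  then have "is_iso D c" using isoI(1)[OF x(5) r(1)] r by blast
  then have uc: "is_iso D (u \<cdot> c)" using iso_cmp[OF x(5,6)] x by blast
  obtain e where e: "e \<in> hm I A" "e \<cdot> (u \<cdot> c) = idt A" "(u \<cdot> c) \<cdot> e = idt I"
    using isoE[OF uc cmp_hom[OF x(5,6)]] by blast
  obtain E d' h where t: "tri I B E i d' h" "I \<in> T" "B \<in> T" "E \<in> T" using kernel_tri[OF x(3,7)] .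
  show thesis using tri_iso_left[OF t(1) e(1) cmp_hom[OF x(5,6)] e(3,2)] x(9,12) t(3,4) that by simp
qed

lemma strict_epic_tri:
  assumes "strict_epic F g" "g \<in> hm B E"
  obtains A f h where "tri A B E f g h" "A \<in> T" "B \<in> T" "E \<in> T"
proof -
  have s: "strict F g" and m: "epic F g" using assms unfolding strict_epic_def by auto
  obtain k K c C d Q i I u where x: "is_cokernel F c k" "is_cokernel F d g" "is_kernel F i d"
    "k \<in> hm K B" "c \<in> hm B C" "u \<in> hm C I" "i \<in> hm I E" "d \<in> hm E Q" "g = i \<cdot> (u \<cdot> c)" "is_iso D u"
    "B \<in> T" "C \<in> T" "I \<in> T" "E \<in> T" "Q \<in> T" using strictD[OF s assms(2)] by metis
  have o: "E \<in> obj D" "Q \<in> obj D" "I \<in> obj D" using x T_obj by auto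
  have mm: "a = b" if "X \<in> T" "a \<in> hm E X" "b \<in> hm E X" "a \<cdot> g = b \<cdot> g" for X a b
    using m that x hom_setD[OF assms(2)] unfolding epic_def by (auto simp: hom_set_full_sub)
  have "d \<cdot> g = zr E Q \<cdot> g"
    using is_cokernelD(1)[OF x(2,8) assms(2)] cmp_zero_left[OF assms(2) o(2)] by simp
  then have k0: "d = zr E Q" using mm[OF x(15,8) zero_hom] o by blast
  have "d \<cdot> idt E = zr E Q" using k0 cmp_ident_right[OF x(8)] by simp
  then obtain r where r: "r \<in> hm E I" "i \<cdot> r = idt E"
    using is_kernelD(2)[OF x(3,7,8) x(14) ident_hom] o by blast
  have "i \<cdot> (r \<cdot> i) = i \<cdot> idt I"
    using cmp_assoc[OF x(7) r(1) x(7)] r cmp_ident_left[OF x(7)] cmp_ident_right[OF x(7)] by simp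
  then have "r \<cdot> i = idt I" using is_kernelD(3)[OF x(3,7,8) x(13) cmp_hom[OF x(7) r(1)] ident_hom] o by blast
  then have "is_iso D i" using isoI(1)[OF x(7) r(1)] r by blast
  then have iu: "is_iso D (i \<cdot> u)" using iso_cmp[OF x(6,7)] x by blast
  obtain e where e: "e \<in> hm E C" "e \<cdot> (i \<cdot> u) = idt C" "(i \<cdot> u) \<cdot> e = idt E"
    using isoE[OF iu cmp_hom[OF x(6,7)]] by blast
  obtain A k' h where t: "tri A B C k' c h" "A \<in> T" "B \<in> T" "C \<in> T" using cokernel_tri[OF x(1,5)] .
  have "g = (i \<cdot> u) \<cdot> c" using cmp_assoc[OF x(5-7)] x(9) by simp
  then show thesis using tri_iso_right[OF t(1) cmp_hom[OF x(6,7)] e(1) e(2,3)] x(14) t(2,3) that by simp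
qed

text \<open>Let \<open>K\<close> be the kernel of \<open>f\<close>. Composing the connecting arrow \<open>W \<rightarrow> K[1]\<close> with \<open>g\<close> and
  completing gives a triangle \<open>K \<rightarrow> E \<rightarrow> X\<close> in \<open>T\<close> whose arrow \<open>E \<rightarrow> X\<close> factors through
  the pullback \<open>P\<close>. The octahedral axiom compares the fibre \<open>M\<close> of \<open>P \<rightarrow> X\<close> with \<open>K\<close>
  and the cone \<open>G\<close> of \<open>E \<rightarrow> P\<close>, which places \<open>M\<close> in \<open>U\<close>. So \<open>P \<rightarrow> X\<close> belongs to a
  triangle in \<open>T\<close>.\<close>

lemma strict_epic_pullback_T:
  assumes "is_pullback F f g p q" "strict_epic F f" shows "strict_epic F q"
proof -
  have T: "src D f \<in> T" "src D g \<in> T" "tgt D f \<in> T" "src D q \<in> T"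
    using assms(1) unfolding is_pullback_def by (auto simp: arr_full_sub)
  obtain Y W X P where h: "f \<in> hm Y W" "g \<in> hm X W" "p \<in> hm P Y" "q \<in> hm P X"
    and T: "Y \<in> T" "W \<in> T" "X \<in> T" "P \<in> T"
    and ex: "\<And>A x y. A \<in> T \<Longrightarrow> x \<in> hm A Y \<Longrightarrow> y \<in> hm A X \<Longrightarrow> f \<cdot> x = g \<cdot> y \<Longrightarrow> \<exists>u \<in> hm A P. p \<cdot> u = x \<and> q \<cdot> u = y"
  proof (rule that[of "src D f" "tgt D f" "src D g" "src D q"])
    fix A x y assume a: "A \<in> T" "x \<in> hm A (src D f)" "y \<in> hm A (src D g)" "f \<cdot> x = g \<cdot> y"
    have "\<forall>X. \<forall>x\<in>hom_set F X (src D f). \<forall>y\<in>hom_set F X (src D g). f \<cdot> x = g \<cdot> y \<longrightarrow>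
        (\<exists>!u. u \<in> hom_set F X (src D p) \<and> p \<cdot> u = x \<and> q \<cdot> u = y)"
      using assms(1) unfolding is_pullback_def full_sub_simps by blast
    moreover have "src D p = src D q" using assms(1) unfolding is_pullback_def by simp
    moreover have "x \<in> hom_set F A (src D f)" "y \<in> hom_set F A (src D g)"
      using a T by (simp_all add: hom_set_full_sub)
    ultimately have "\<exists>!u. u \<in> hom_set F A (src D q) \<and> p \<cdot> u = x \<and> q \<cdot> u = y" using a(4) by simp
    then show "\<exists>u \<in> hm A (src D q). p \<cdot> u = x \<and> q \<cdot> u = y" by (auto simp: hom_set_full_sub)
  qed (use assms(1) T in \<open>auto simp: is_pullback_def arr_full_sub hom_set_def\<close>)
  obtain K k e where K: "tri K Y W k f e" "K \<in> T" using strict_epic_tri[OF assms(2) h(1)] by metis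
  note dK = triD[OF K(1)]
  obtain E k0 q0 where E: "tri K E X k0 q0 (e \<cdot> g)" using tri_connecting[OF cmp_hom[OF h(2) dK(4)] dK(5)] .
  note dE = triD[OF E]
  have ET: "E \<in> T" using T_ext[of K E X] E tr_iff K(2) T by blast
  have "e \<cdot> (g \<cdot> q0) = zr E (sh 1 K)" using cmp_assoc[OF dE(3) h(2) dK(4)] tri_comp(2)[OF E] by simp
  then obtain y where y: "y \<in> hm E Y" "f \<cdot> y = g \<cdot> q0" using weak_kernel2[OF K(1) cmp_hom[OF dE(3) h(2)]] by blast
  obtain u where u: "u \<in> hm E P" "q \<cdot> u = q0" using ex[OF ET y(1) dE(3) y(2)] by blast
  obtain M m n where M: "tri M P X m q n" using tri_cocone[OF h(4)] .
  obtain G s t where G: "tri E P G u s t" using tri_exists[OF u(1)] by blast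
  obtain a b w where o: "tri G (sh 1 K) (sh 1 M) a b w"
    using octahedral3[OF G tri_rot[OF M]] tri_rot[OF E] u by metis
  have "tr G (sh 1 K) (sh 1 M)" using o tr_iff by blast
  then have r: "tr K M G" using tr_rot[OF tr_shift[of G "sh 1 K" "sh 1 M" "-1"]] dK triD[OF M] triD[OF G] by simp
  have r': "tr E P G" "tr M P X" using G M tr_iff by blast+
  have "G \<in> U" using t_pair_ext1[OF tU tr_rot[OF r'(1)] TD(1)[OF T(4)] U_shift[OF TD(1)[OF ET]]] .
  then have "M \<in> U" using t_pair_ext1[OF tU r TD(1)[OF K(2)]] by blast
  moreover have "M \<in> V'" using t_pair_ext2[OF tV tr_unrot[OF r'(2)] V'_shift[OF TD(2)[OF T(3)]] TD(2)[OF T(4)]] .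
  ultimately have "M \<in> T" using TI by blast
  then show ?thesis using tri_strict_T(2)[OF M] T by blast
qed

lemma strict_monic_pushout_T:
  assumes "is_pushout F f g p q" "strict_monic F f" shows "strict_monic F q"
proof -
  have T: "tgt D f \<in> T" "tgt D g \<in> T" "src D f \<in> T" "tgt D q \<in> T"
    using assms(1) unfolding is_pushout_def by (auto simp: arr_full_sub)
  obtain Y W X P where h: "f \<in> hm Y W" "g \<in> hm Y X" "p \<in> hm W P" "q \<in> hm X P"
    and T: "Y \<in> T" "W \<in> T" "X \<in> T" "P \<in> T"
    and ex: "\<And>A x y. A \<in> T \<Longrightarrow> x \<in> hm W A \<Longrightarrow> y \<in> hm X A \<Longrightarrow> x \<cdot> f = y \<cdot> g \<Longrightarrow> \<exists>u \<in> hm P A. u \<cdot> p = x \<and> u \<cdot> q = y"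
  proof (rule that[of "src D f" "tgt D f" "tgt D g" "tgt D q"])
    fix A x y assume a: "A \<in> T" "x \<in> hm (tgt D f) A" "y \<in> hm (tgt D g) A" "x \<cdot> f = y \<cdot> g"
    have "\<forall>X. \<forall>x\<in>hom_set F (tgt D f) X. \<forall>y\<in>hom_set F (tgt D g) X. x \<cdot> f = y \<cdot> g \<longrightarrow>
        (\<exists>!u. u \<in> hom_set F (tgt D p) X \<and> u \<cdot> p = x \<and> u \<cdot> q = y)"
      using assms(1) unfolding is_pushout_def full_sub_simps by blast
    moreover have "tgt D p = tgt D q" using assms(1) unfolding is_pushout_def by simp
    moreover have "x \<in> hom_set F (tgt D f) A" "y \<in> hom_set F (tgt D g) A"
      using a T by (simp_all add: hom_set_full_sub)
    ultimately have "\<exists>!u. u \<in> hom_set F (tgt D q) A \<and> u \<cdot> p = x \<and> u \<cdot> q = y" using a(4) by simp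
    then show "\<exists>u \<in> hm (tgt D q) A. u \<cdot> p = x \<and> u \<cdot> q = y" by (auto simp: hom_set_full_sub)
  qed (use assms(1) T in \<open>auto simp: is_pushout_def arr_full_sub hom_set_def\<close>)
  obtain C c e where C: "tri Y W C f c e" "C \<in> T" using strict_monic_tri[OF assms(2) h(1)] by metis
  note dC = triD[OF C(1)]
  have sg: "sa 1 g \<in> hm (sh 1 Y) (sh 1 X)" using shift_arr_hom[OF h(2)] .
  obtain E k0 q0 where E: "tri X E C k0 q0 (sa 1 g \<cdot> e)"
    using tri_connecting[OF cmp_hom[OF dC(4) sg]] T T_obj by blast
  note dE = triD[OF E]
  have ET: "E \<in> T" using T_ext[of X E C] E tr_iff C(2) T by blast
  have kg: "k0 \<cdot> g \<in> hm Y E" using cmp_hom[OF h(2) dE(2)] .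
  have "neg (sa 1 k0) \<cdot> (sa 1 g \<cdot> e) = zr C (sh 1 E)" using tri_comp(2)[OF tri_rot[OF E]] .
  then have "sa 1 k0 \<cdot> (sa 1 g \<cdot> e) = zr C (sh 1 E)"
    using cmp_neg_left[OF shift_arr_hom[OF dE(2)] dE(4)] neg_zero_iff[OF cmp_hom[OF dE(4) shift_arr_hom[OF dE(2)]]] by metis
  then have "sa 1 (k0 \<cdot> g) \<cdot> e = zr C (sh 1 E)"
    using cmp_assoc[OF dC(4) sg shift_arr_hom[OF dE(2)]] shift_cmp[OF h(2) dE(2)] by metis
  then have "sa (-1) (sa 1 (k0 \<cdot> g) \<cdot> e) = zr (sh (-1) C) E"
    using shift_zero_arr[of C "sh 1 E" "-1"] dC dE by simp
  then have "(k0 \<cdot> g) \<cdot> sa (-1) e = zr (sh (-1) C) E"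
    using shift_cmp[OF dC(4) shift_arr_hom[OF kg], of "-1"] shift_back(2)[OF kg, of 1] by simp
  moreover have e1: "sa (-1) e \<in> hm (sh (-1) C) Y" using shift_arr_hom[OF dC(4), of "-1"] dC by simp
  ultimately have "(k0 \<cdot> g) \<cdot> neg (sa (-1) e) = zr (sh (-1) C) E"
    using cmp_neg_right[OF e1 kg] neg_zero_iff[OF cmp_hom[OF e1 kg]] by simp
  then obtain y where y: "y \<in> hm W E" "y \<cdot> f = k0 \<cdot> g" using weak_cokernel[OF tri_unrot[OF C(1)] kg] by blast
  obtain u where u: "u \<in> hm P E" "u \<cdot> q = k0" using ex[OF ET y(1) dE(2) y(2)] by blast
  obtain N m n where N: "tri X P N q m n" using tri_exists[OF h(4)] by blast
  obtain G s t where G: "tri P E G u s t" using tri_exists[OF u(1)] by blast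
  obtain a b w where o: "tri N C G a b w"
    using octahedral3[OF N G] E u by metis
  have r: "tr N C G" "tr P E G" "tr X P N" using o G N tr_iff by blast+
  have "sh (-1) G \<in> V'" using t_pair_ext2[OF tV tr_unrot[OF tr_unrot[OF r(2)]]] TD T ET V'_shift by blast
  then have "N \<in> V'" using t_pair_ext2[OF tV tr_unrot[OF r(1)]] TD C(2) by blast
  moreover have "N \<in> U" using t_pair_ext1[OF tU tr_rot[OF r(3)]] TD T U_shift by blast
  ultimately have "N \<in> T" using TI by blast
  then show ?thesis using tri_strict_T(1)[OF N] T by blast
qed

theorem quasi_abelian_T: "quasi_abelian_category F"
proof -
  interpret P: preabelian_category F by (rule preabelian_T)
  show ?thesis by unfold_locales (rule strict_epic_pullback_T strict_monic_pushout_T; assumption)+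
qed

text \<open>If \<open>V = U[1]\<close>, the shifted cone \<open>W[-1]\<close> of \<open>A \<rightarrow> I\<close> lies in \<open>T\<close> as well, so \<open>A \<rightarrow> I\<close>
  is the cokernel of the kernel: image and coimage coincide.\<close>

theorem abelian_T: assumes "\<And>E. E \<in> V \<Longrightarrow> sh (-1) E \<in> U" shows "abelian_category F"
proof -
  interpret P: preabelian_category F by (rule preabelian_T)
  show ?thesis
  proof
    fix f assume "f \<in> arr F"
    then have f: "f \<in> hm (src D f) (tgt D f)" "src D f \<in> T" "tgt D f \<in> T"
      by (auto simp: arr_full_sub hom_set_def)
    obtain I Q W i c d p q r where I: "tri I (tgt D f) Q i d p" "tri (src D f) I W c q r" "i \<cdot> c = f" "I \<in> T" "Q \<in> T"
      "W \<in> V" "sh (-1) W \<in> V'" "is_cokernel F d f" using coimage_cokernel[OF f] .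
    have K: "sh (-1) W \<in> T" using TI assms I by blast
    let ?k = "neg (sa (-1) r)" and ?K = "sh (-1) W"
    have t: "tri ?K (src D f) I ?k c q" using tri_unrot[OF I(2)] .
    note dt = triD[OF t] and dI = triD[OF I(1)]
    note kc = tri_kernel_T[OF t K f(2) I(4)]
    have z: "c \<cdot> x = zr X I" if x: "X \<in> T" "x \<in> hm X (src D f)" "f \<cdot> x = zr X (tgt D f)" for X x
    proof -
      have "i \<cdot> (c \<cdot> x) = i \<cdot> zr X I"
        using cmp_assoc[OF x(2) dt(3) dI(2)] I(3) x(3) cmp_zero_right[OF dI(2)] T_obj[OF x(1)] by simp
      then show ?thesis
        using T_mono[OF I(1) I(4,5) x(1) cmp_hom[OF x(2) dt(3)] zero_hom] T_obj[OF x(1)] dI by blast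
    qed
    have fk: "f \<cdot> ?k = zr ?K (tgt D f)"
      using cmp_assoc[OF dt(2,3) dI(2)] I(3) tri_comp(1)[OF t] cmp_zero_right[OF dI(2) dt(5)] by simp
    have "is_kernel F ?k f"
      unfolding is_kernel_def
    proof (intro conjI allI ballI impI)
      show "?k \<in> arr F" "f \<in> arr F" "tgt F ?k = src F f" "cmp F f ?k = zero_arr F (src F ?k) (tgt F f)"
        using fk hom_setD[OF dt(2)] hom_setD[OF f(1)] f K by (simp_all add: arr_full_sub)
      fix X x assume "x \<in> hom_set F X (src F f)" "cmp F f x = zero_arr F X (tgt F f)"
      then have x: "X \<in> T" "x \<in> hm X (src D f)" "f \<cdot> x = zr X (tgt D f)" by (auto simp: hom_set_full_sub)
      show "\<exists>!u. u \<in> hom_set F X (src F ?k) \<and> cmp F ?k u = x"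
        using kc(1) x z[OF x] hom_setD[OF dt(3)] f(2) unfolding is_kernel_def by (auto simp: hom_set_full_sub)
    qed
    moreover have "is_iso F (idt I)" "idt I \<in> hom_set F (tgt F c) (src F i)"
      using is_iso_full_sub[of D "idt I" T] iso_ident[of I] hom_setD[OF ident_hom[OF dI(5)]] dI(5) I(4)
        hom_setD[OF dt(3)] hom_setD[OF dI(2)] ident_hom[OF dI(5)] by (auto simp: hom_set_full_sub)
    moreover have "f = cmp F i (cmp F (idt I) c)" using I(3) cmp_ident_left[OF dt(3)] by simp
    ultimately show "strict F f"
      unfolding strict_def using kc(2) I(8) tri_kernel_T(1)[OF I(1) I(4) f(3) I(5)] by blast
  qed
qed

lemma monic_tri: assumes "\<And>E. E \<in> V \<Longrightarrow> sh (-1) E \<in> U" "monic F m" "m \<in> hm A B"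
  obtains E g h where "tri A B E m g h" "A \<in> T" "B \<in> T" "E \<in> T"
proof -
  interpret P: abelian_category F by (rule abelian_T[OF assms(1)])
  have "strict_monic F m" using P.all_strict assms(2) unfolding strict_monic_def monic_def by blast
  then show thesis using strict_monic_tri[OF _ assms(3)] that by blast
qed

end

section \<open>Chain conditions on objects\<close>

text \<open>An ascending chain of subobjects \<open>A n\<close> of a fixed object is recorded by its
  quotients \<open>C n\<close> and the successive subquotients \<open>G n\<close>; for descending chains, the
  subobjects themselves take the place of the quotients. Since consecutive objects are
  only required to fit into a triangle, no arrows have to be compared when a functor
  is applied to a chain.\<close>

definition acc_obj :: "('o, 'm, 'z) tricat_scheme \<Rightarrow> 'o set \<Rightarrow> bool" where
  "acc_obj D T \<longleftrightarrow> (\<forall>C G :: nat \<Rightarrow> 'o.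
     (\<forall>n. C n \<in> T \<and> G n \<in> T \<and> triangle_on D (G n) (C n) (C (Suc n))) \<longrightarrow> (\<exists>N. \<forall>n\<ge>N. zero_object D (G n)))"

definition dcc_obj :: "('o, 'm, 'z) tricat_scheme \<Rightarrow> 'o set \<Rightarrow> bool" where
  "dcc_obj D T \<longleftrightarrow> (\<forall>A G :: nat \<Rightarrow> 'o.
     (\<forall>n. A n \<in> T \<and> G n \<in> T \<and> triangle_on D (A (Suc n)) (A n) (G n)) \<longrightarrow> (\<exists>N. \<forall>n\<ge>N. zero_object D (G n)))"

context triangulated_category
begin

lemma iso_cone_zero: assumes t: "tri A B E f g h" and e: "e \<in> hm B A" "e \<cdot> f = idt A" "f \<cdot> e = idt B"
  shows "zero_object D E"
proof -
  note d = triD[OF t]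
  have "g = (g \<cdot> f) \<cdot> e" using cmp_assoc[OF e(1) d(2,3)] e cmp_ident_right[OF d(3)] by simp
  then have g: "g = zr B E" using tri_comp(1)[OF t] cmp_zero_left[OF e(1) d(7)] by simp
  have f1: "sa 1 f \<in> hm (sh 1 A) (sh 1 B)" "sa 1 e \<in> hm (sh 1 B) (sh 1 A)" using shift_arr_hom d e by blast+
  have "neg (sa 1 f) \<cdot> h = zr E (sh 1 B)" using tri_comp(2)[OF tri_rot[OF t]] .
  then have fh: "sa 1 f \<cdot> h = zr E (sh 1 B)"
    using cmp_neg_left[OF f1(1) d(4)] neg_zero_iff[OF cmp_hom[OF d(4) f1(1)]] by simp
  have "sa 1 e \<cdot> sa 1 f = idt (sh 1 A)" using shift_cmp[OF d(2) e(1), of 1] e shift_ident[OF d(5)] by simp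
  then have "h = sa 1 e \<cdot> (sa 1 f \<cdot> h)"
    using cmp_assoc[OF d(4) f1] cmp_ident_left[OF d(4)] by simp
  then have h: "h = zr E (sh 1 A)" using fh cmp_zero_right[OF f1(2) d(7)] by simp
  have "idt E \<cdot> g = zr B E" using g cmp_ident_left[OF d(3)] by simp
  then obtain y where y: "y \<in> hm (sh 1 A) E" "y \<cdot> h = idt E" using weak_cokernel2[OF t ident_hom[OF d(7)]] by blast
  then have "idt E = zr E E" using h cmp_zero_right[OF y(1) d(7)] by simp
  then show ?thesis using zero_obj_iff d by blast
qed

end

context t_window
begin

text \<open>An inclusion between two strict subobjects of \<open>B\<close> is again strict, since the
  octahedral axiom places its cone between the two quotients.\<close>

lemma T_sub_strict:
  assumes "tri A B E (s' \<cdot> u) g h" "tri A' B E' s' g' h'" "u \<in> hm A A'"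
    "A \<in> T" "B \<in> T" "E \<in> T" "A' \<in> T" "E' \<in> T"
  obtains G p q where "tri A A' G u p q" "tr G E E'" "G \<in> T"
proof -
  obtain G p q where G: "tri A A' G u p q" using tri_exists[OF assms(3)] by blast
  obtain a b w where "tri G E E' a b w" using octahedral3[OF G assms(2,1)] .
  then have r: "tr A A' G" "tr G E E'" using G tr_iff by blast+
  have "G \<in> U" using t_pair_ext1[OF tU tr_rot[OF r(1)] TD(1)[OF assms(7)] U_shift[OF TD(1)[OF assms(4)]]] .
  moreover have "G \<in> V'" using t_pair_ext2[OF tV tr_unrot[OF r(2)] V'_shift[OF TD(2)[OF assms(8)]] TD(2)[OF assms(6)]] .
  ultimately show thesis using that[OF G r(2)] TI by blast
qed

lemma finite_lengthI: assumes "acc_obj D T" "dcc_obj D T" shows "finite_length F"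
  unfolding finite_length_def
proof (intro conjI ballI allI impI quasi_abelian_T)
  fix E and s :: "nat \<Rightarrow> 'm"
  assume ET: "E \<in> obj F" and s: "\<forall>n. strict_monic F (s n) \<and> tgt F (s n) = E"
  let ?A = "\<lambda>n. src D (s n)"
  have sh: "s n \<in> hm (?A n) E" for n
    using s unfolding strict_monic_def monic_def by (simp add: hom_set_def arr_full_sub)
  have "\<exists>C. \<exists>g h. tri (?A n) E C (s n) g h \<and> ?A n \<in> T \<and> E \<in> T \<and> C \<in> T" for n
    using strict_monic_tri[OF _ sh] s by metis
  then obtain C where C: "\<And>n. \<exists>g h. tri (?A n) E (C n) (s n) g h" and T: "\<And>n. ?A n \<in> T" "E \<in> T" "\<And>n. C n \<in> T"
    by metis
  { assume "\<forall>n. factors_through F (s n) (s (Suc n))"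
    then have "\<forall>n. \<exists>u. u \<in> hm (?A n) (?A (Suc n)) \<and> s n = s (Suc n) \<cdot> u"
      unfolding factors_through_def Bex_def hom_set_full_sub by auto
    then obtain u where u: "\<And>n. u n \<in> hm (?A n) (?A (Suc n))" "\<And>n. s n = s (Suc n) \<cdot> u n" by metis
    have "\<exists>G. \<exists>p q. tri (?A n) (?A (Suc n)) G (u n) p q \<and> tr G (C n) (C (Suc n)) \<and> G \<in> T" for n
    proof -
      obtain g h where 1: "tri (?A n) E (C n) (s (Suc n) \<cdot> u n) g h" using C u(2) by metis
      obtain g' h' where 2: "tri (?A (Suc n)) E (C (Suc n)) (s (Suc n)) g' h'" using C by metis
      show ?thesis using T_sub_strict[OF 1 2 u(1) T(1-3) T(1,3)] by blast
    qed
    then obtain G where G: "\<And>n. \<exists>p q. tri (?A n) (?A (Suc n)) (G n) (u n) p q" "\<And>n. tr (G n) (C n) (C (Suc n))"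
      "\<And>n. G n \<in> T" by metis
    obtain N where N: "\<And>n. n \<ge> N \<Longrightarrow> zero_object D (G n)" using assms(1) G T unfolding acc_obj_def by meson
    have "factors_through F (s n) (s N)" if "n \<ge> N" for n
      using that
    proof (induction n rule: dec_induct)
      case base
      show ?case unfolding factors_through_def
        using ident_hom[OF T_obj[OF T(1)]] cmp_ident_right[OF sh] T(1)
        by (intro bexI[of _ "idt (?A N)"]) (simp_all add: hom_set_full_sub)
    next
      case (step n)
      obtain w where w: "w \<in> hm (?A n) (?A N)" "s n = s N \<cdot> w"
        using step(3) unfolding factors_through_def Bex_def hom_set_full_sub by auto
      have "is_iso D (u n)" using tri_zero_right_iso(1) G(1) N[OF step(1)] by blast
      then obtain e where e: "e \<in> hm (?A (Suc n)) (?A n)" "u n \<cdot> e = idt (?A (Suc n))" using isoE[OF _ u(1)] by blast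
      have "s (Suc n) = s n \<cdot> e"
        using cmp_assoc[OF e(1) u(1) sh] u(2) e(2) cmp_ident_right[OF sh] by metis
      also have "\<dots> = s N \<cdot> (w \<cdot> e)" using cmp_assoc[OF e(1) w(1) sh] w by simp
      finally have eq: "s (Suc n) = s N \<cdot> (w \<cdot> e)" .
      have "w \<cdot> e \<in> hom_set F (src F (s (Suc n))) (src F (s N))"
        using cmp_hom[OF e(1) w(1)] T(1) unfolding hom_set_full_sub by simp
      then show ?case unfolding factors_through_def using eq by (intro bexI[of _ "w \<cdot> e"]) simp_all
    qed
    then show "\<exists>N. \<forall>n\<ge>N. factors_through F (s n) (s N)" by blast }
  { assume "\<forall>n. factors_through F (s (Suc n)) (s n)"
    then have "\<forall>n. \<exists>u. u \<in> hm (?A (Suc n)) (?A n) \<and> s (Suc n) = s n \<cdot> u"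
      unfolding factors_through_def Bex_def hom_set_full_sub by auto
    then obtain u where u: "\<And>n. u n \<in> hm (?A (Suc n)) (?A n)" "\<And>n. s (Suc n) = s n \<cdot> u n" by metis
    have "\<exists>G. \<exists>p q. tri (?A (Suc n)) (?A n) G (u n) p q \<and> G \<in> T" for n
    proof -
      obtain g h where 1: "tri (?A (Suc n)) E (C (Suc n)) (s n \<cdot> u n) g h" using C u(2) by metis
      obtain g' h' where 2: "tri (?A n) E (C n) (s n) g' h'" using C by metis
      show ?thesis using T_sub_strict[OF 1 2 u(1) T(1-3) T(1,3)] by blast
    qed
    then obtain G where G: "\<And>n. \<exists>p q. tri (?A (Suc n)) (?A n) (G n) (u n) p q" "\<And>n. G n \<in> T" by metis
    then have "\<And>n. tr (?A (Suc n)) (?A n) (G n)" using tr_iff by blast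
    then obtain N where N: "\<And>n. n \<ge> N \<Longrightarrow> zero_object D (G n)" using assms(2) G T unfolding dcc_obj_def by meson
    have "factors_through F (s N) (s n)" if "n \<ge> N" for n
      using that
    proof (induction n rule: dec_induct)
      case base
      show ?case unfolding factors_through_def
        using ident_hom[OF T_obj[OF T(1)]] cmp_ident_right[OF sh] T(1)
        by (intro bexI[of _ "idt (?A N)"]) (simp_all add: hom_set_full_sub)
    next
      case (step n)
      obtain w where w: "w \<in> hm (?A N) (?A n)" "s N = s n \<cdot> w"
        using step(3) unfolding factors_through_def Bex_def hom_set_full_sub by auto
      have "is_iso D (u n)" using tri_zero_right_iso(1) G(1) N[OF step(1)] by blast
      then obtain e where e: "e \<in> hm (?A n) (?A (Suc n))" "u n \<cdot> e = idt (?A n)" using isoE[OF _ u(1)] by blast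
      have "s n = s (Suc n) \<cdot> e"
        using cmp_assoc[OF e(1) u(1) sh] u(2) e(2) cmp_ident_right[OF sh] by metis
      then have eq: "s N = s (Suc n) \<cdot> (e \<cdot> w)" using cmp_assoc[OF w(1) e(1) sh] w by simp
      have "e \<cdot> w \<in> hom_set F (src F (s N)) (src F (s (Suc n)))"
        using cmp_hom[OF w(1) e(1)] T(1) unfolding hom_set_full_sub by simp
      then show ?case unfolding factors_through_def using eq by (intro bexI[of _ "e \<cdot> w"]) simp_all
    qed
    then show "\<exists>N. \<forall>n\<ge>N. factors_through F (s N) (s n)" by blast }
qed

text \<open>A chain of objects linked by triangles is realized, by repeated use of the
  octahedral axiom, as a chain of subobjects of its first term. The larger class \<open>S\<close>
  serves intervals of length greater than 1: the assumptions \<open>m\<close> and \<open>e\<close> ask that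
  triangles in \<open>T\<close> remain short exact in \<open>S\<close>.\<close>

lemma finite_length_chains:
  assumes fl: "finite_length (full_sub D S)" and S: "T \<subseteq> S" "S \<subseteq> obj D"
    and m: "\<And>A B E f g h X u v. tri A B E f g h \<Longrightarrow> A \<in> T \<Longrightarrow> B \<in> T \<Longrightarrow> E \<in> T \<Longrightarrow> X \<in> S \<Longrightarrow>
      u \<in> hm X A \<Longrightarrow> v \<in> hm X A \<Longrightarrow> f \<cdot> u = f \<cdot> v \<Longrightarrow> u = v"
    and e: "\<And>A B E f g h X u v. tri A B E f g h \<Longrightarrow> A \<in> T \<Longrightarrow> B \<in> T \<Longrightarrow> E \<in> T \<Longrightarrow> X \<in> S \<Longrightarrow>
      u \<in> hm E X \<Longrightarrow> v \<in> hm E X \<Longrightarrow> u \<cdot> g = v \<cdot> g \<Longrightarrow> u = v"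
  shows "acc_obj D T" "dcc_obj D T"
proof -
  let ?S = "full_sub D S"
  obtain Z where Z: "zero_object D Z" using ex_zero_object by blast
  have sm: "strict_monic ?S f" if t: "tri A B E f g h" "A \<in> T" "B \<in> T" "E \<in> T" for A B E f g h
  proof (rule tri_strict_monic[OF t(1) _ _ _ S(2) _ Z])
    show "A \<in> S" "B \<in> S" "E \<in> S" "Z \<in> S" using t S T_zero[OF Z] by blast+
  qed (rule m[OF t] e[OF t]; assumption)+
  \<comment> \<open>Two subobjects that factor through each other differ by a zero subquotient.\<close>
  have iso: "zero_object D G"
    if t: "tri A A' G a p q" "s \<in> hm A E" "s' \<in> hm A' E" "c \<in> hm A' A" "s = s' \<cdot> a" "s' = s \<cdot> c"
      and mm: "\<And>u v. u \<in> hm A A \<Longrightarrow> v \<in> hm A A \<Longrightarrow> s \<cdot> u = s \<cdot> v \<Longrightarrow> u = v"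
        "\<And>u v. u \<in> hm A' A' \<Longrightarrow> v \<in> hm A' A' \<Longrightarrow> s' \<cdot> u = s' \<cdot> v \<Longrightarrow> u = v" for A A' G a p q s s' c E
  proof -
    note d = triD[OF t(1)]
    have "s \<cdot> (c \<cdot> a) = s \<cdot> idt A" using cmp_assoc[OF d(2) t(4,2)] t(5,6)[symmetric] cmp_ident_right[OF t(2)] by simp
    then have "c \<cdot> a = idt A" using mm(1)[OF cmp_hom[OF d(2) t(4)] ident_hom] d by blast
    moreover have "s' \<cdot> (a \<cdot> c) = s' \<cdot> idt A'" using cmp_assoc[OF t(4) d(2) t(3)] t(5,6)[symmetric] cmp_ident_right[OF t(3)] by simp
    then have "a \<cdot> c = idt A'" using mm(2)[OF cmp_hom[OF t(4) d(2)] ident_hom] d by blast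
    ultimately show ?thesis using iso_cone_zero[OF t(1,4)] by blast
  qed
  have chain: "(\<forall>n. factors_through ?S (s n) (s (Suc n))) \<longrightarrow> (\<exists>N. \<forall>n\<ge>N. factors_through ?S (s n) (s N))"
     "(\<forall>n. factors_through ?S (s (Suc n)) (s n)) \<longrightarrow> (\<exists>N. \<forall>n\<ge>N. factors_through ?S (s N) (s n))"
    if "E \<in> S" "\<And>n. strict_monic ?S (s n)" "\<And>n. tgt D (s n) = E" for E and s :: "nat \<Rightarrow> 'm"
    using fl that unfolding finite_length_def by auto
  show "acc_obj D T"
    unfolding acc_obj_def
  proof (intro allI impI)
    fix C G :: "nat \<Rightarrow> 'o" assume CG: "\<forall>n. C n \<in> T \<and> G n \<in> T \<and> tr (G n) (C n) (C (Suc n))"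
    \<comment> \<open>The pair \<open>f n\<close> is the subobject \<open>A n\<close> of \<open>C 0\<close> with quotient \<open>C n\<close> and its
        inclusion.\<close>
    have "\<exists>f. \<forall>n. ((\<exists>P h. tri (fst (f n)) (C 0) (C n) (snd (f n)) P h) \<and> fst (f n) \<in> T) \<and>
       (\<exists>a p q. tri (fst (f n)) (fst (f (Suc n))) (G n) a p q \<and> snd (f n) = snd (f (Suc n)) \<cdot> a)"
    proof (rule dependent_nat_choice)
      have "tr Z (C 0) (C 0)" using tr_zero_left[OF isomorphic_refl Z] CG T_obj by blast
      then show "\<exists>x. (\<exists>P h. tri (fst x) (C 0) (C 0) (snd x) P h) \<and> fst x \<in> T"
        using T_zero[OF Z] unfolding tr_iff by auto
      fix x n assume x: "(\<exists>P h. tri (fst x) (C 0) (C n) (snd x) P h) \<and> fst x \<in> T"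
      then obtain P h where P: "tri (fst x) (C 0) (C n) (snd x) P h" by blast
      obtain k p h' where k: "tri (G n) (C n) (C (Suc n)) k p h'" using CG tr_iff by blast
      obtain W a b q q' r where W: "tri (fst x) W (G n) a q q'" "tri W (C 0) (C (Suc n)) b (p \<cdot> P) r" "b \<cdot> a = snd x"
        using octahedral2[OF P k] .
      have "W \<in> T" using T_ext[of "fst x" W "G n"] W(1) tr_iff x CG by blast
      then show "\<exists>y. ((\<exists>P h. tri (fst y) (C 0) (C (Suc n)) (snd y) P h) \<and> fst y \<in> T) \<and>
         (\<exists>a p q. tri (fst x) (fst y) (G n) a p q \<and> snd x = snd y \<cdot> a)"
        using W(1,2) W(3)[symmetric] by (intro exI[of _ "(W, b)"]) (unfold fst_conv snd_conv, blast)
    qed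
    then obtain f where f: "\<And>n. \<exists>P h. tri (fst (f n)) (C 0) (C n) (snd (f n)) P h" "\<And>n. fst (f n) \<in> T"
      "\<And>n. \<exists>a p q. tri (fst (f n)) (fst (f (Suc n))) (G n) a p q \<and> snd (f n) = snd (f (Suc n)) \<cdot> a" by blast
    let ?s = "\<lambda>n. snd (f n)" and ?A = "\<lambda>n. fst (f n)"
    have s: "?s n \<in> hm (?A n) (C 0)" for n using f(1) triD(2) by blast
    have mm: "u = v" if "u \<in> hm X (?A n)" "v \<in> hm X (?A n)" "?s n \<cdot> u = ?s n \<cdot> v" "X \<in> T" for u v n X
    proof -
      obtain P h where "tri (?A n) (C 0) (C n) (?s n) P h" using f(1) by blast
      then show ?thesis using T_mono f(2) CG that by blast
    qed
    have ft: "factors_through ?S (?s n) (?s m) \<longleftrightarrow> (\<exists>u \<in> hm (?A n) (?A m). ?s n = ?s m \<cdot> u)" for n m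
      unfolding factors_through_def using hom_setD[OF s] f(2) S by (auto simp: Bex_def hom_set_full_sub subset_iff)
    have "factors_through ?S (?s n) (?s (Suc n))" for n
      unfolding ft using f(3)[of n] triD(2) by blast
    moreover have "strict_monic ?S (?s n)" for n using f(1)[of n] sm f(2) CG by blast
    moreover have "tgt D (?s n) = C 0" "C 0 \<in> S" for n using hom_setD[OF s] CG S by auto
    ultimately obtain N where N: "\<And>n. n \<ge> N \<Longrightarrow> factors_through ?S (?s n) (?s N)" using chain(1)[of "C 0" ?s] by blast
    have "zero_object D (G n)" if n: "n \<ge> N" for n
    proof -
      have "\<exists>b \<in> hm (?A N) (?A n). ?s N = ?s n \<cdot> b"
        using n
      proof (induction n rule: dec_induct)
        case base
        show ?case using ident_hom[OF T_obj[OF f(2)]] cmp_ident_right[OF s] by metis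
      next
        case (step n)
        obtain b where b: "b \<in> hm (?A N) (?A n)" "?s N = ?s n \<cdot> b" using step by blast
        obtain a where a: "a \<in> hm (?A n) (?A (Suc n))" "?s n = ?s (Suc n) \<cdot> a" using f(3) triD(2) by metis
        show ?case using cmp_hom[OF b(1) a(1)] cmp_assoc[OF b(1) a(1) s] a b by metis
      qed
      then obtain b where b: "b \<in> hm (?A N) (?A n)" "?s N = ?s n \<cdot> b" by blast
      obtain w where w: "w \<in> hm (?A (Suc n)) (?A N)" "?s (Suc n) = ?s N \<cdot> w" using N[of "Suc n"] n ft by auto
      obtain a p q where a: "tri (?A n) (?A (Suc n)) (G n) a p q" "?s n = ?s (Suc n) \<cdot> a" using f(3) by blast
      have "?s (Suc n) = ?s n \<cdot> (b \<cdot> w)" using cmp_assoc[OF w(1) b(1) s] w b by simp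
      then show ?thesis
        using iso[OF a(1) s s cmp_hom[OF w(1) b(1)] a(2)] mm f(2) by blast
    qed
    then show "\<exists>N. \<forall>n\<ge>N. zero_object D (G n)" by blast
  qed
  show "dcc_obj D T"
    unfolding dcc_obj_def
  proof (intro allI impI)
    fix A G :: "nat \<Rightarrow> 'o" assume AG: "\<forall>n. A n \<in> T \<and> G n \<in> T \<and> tr (A (Suc n)) (A n) (G n)"
    then have "\<forall>n. \<exists>u p q. tri (A (Suc n)) (A n) (G n) u p q" using tr_iff by blast
    then obtain u where u: "\<And>n. \<exists>p q. tri (A (Suc n)) (A n) (G n) (u n) p q" by metis
    then have uh: "u n \<in> hm (A (Suc n)) (A n)" for n using triD(2) by blast
    define s where "s = rec_nat (idt (A 0)) (\<lambda>n x. x \<cdot> u n)"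
    have ss: "s 0 = idt (A 0)" "s (Suc n) = s n \<cdot> u n" for n unfolding s_def by auto
    have f: "\<exists>C g h. tri (A n) (A 0) C (s n) g h \<and> C \<in> T" for n
    proof (induction n)
      case 0 then show ?case using tri_ident[OF _ Z] AG T_obj T_zero[OF Z] ss by metis
    next
      case (Suc n)
      then obtain C g h where C: "tri (A n) (A 0) C (s n) g h" "C \<in> T" by blast
      obtain p q where p: "tri (A (Suc n)) (A n) (G n) (u n) p q" using u by blast
      obtain R a b w r r' where R: "tri (A (Suc n)) (A 0) R (s n \<cdot> u n) r r'" "tri (G n) R C a b w"
        using octahedral1[OF p C(1)] .
      have "R \<in> T" using T_ext[of "G n" R C] R(2) tr_iff AG C by blast
      then show ?case using R ss by metis
    qed
    have s: "s n \<in> hm (A n) (A 0)" for n using f triD(2) by blast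
    have mm: "u = v" if "u \<in> hm X (A n)" "v \<in> hm X (A n)" "s n \<cdot> u = s n \<cdot> v" "X \<in> T" for u v n X
    proof -
      obtain C P h where "tri (A n) (A 0) C (s n) P h" "C \<in> T" using f by blast
      then show ?thesis using T_mono AG that by blast
    qed
    have ft: "factors_through ?S (s n) (s m) \<longleftrightarrow> (\<exists>u \<in> hm (A n) (A m). s n = s m \<cdot> u)" for n m
      unfolding factors_through_def using hom_setD[OF s] AG S by (auto simp: Bex_def hom_set_full_sub subset_iff)
    have "factors_through ?S (s (Suc n)) (s n)" for n
      unfolding ft using ss(2) uh by blast
    moreover have "strict_monic ?S (s n)" for n using f[of n] sm AG by blast
    moreover have "tgt D (s n) = A 0" "A 0 \<in> S" for n using hom_setD[OF s] AG S by auto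
    ultimately obtain N where N: "\<And>n. n \<ge> N \<Longrightarrow> factors_through ?S (s N) (s n)" using chain(2)[of "A 0" s] by blast
    have "zero_object D (G n)" if n: "n \<ge> N" for n
    proof -
      have "\<exists>b \<in> hm (A n) (A N). s n = s N \<cdot> b"
        using n
      proof (induction n rule: dec_induct)
        case base
        show ?case using ident_hom[OF T_obj] AG cmp_ident_right[OF s] by metis
      next
        case (step n)
        obtain b where b: "b \<in> hm (A n) (A N)" "s n = s N \<cdot> b" using step by blast
        show ?case using cmp_hom[OF uh b(1)] cmp_assoc[OF uh b(1) s] b ss(2) by metis
      qed
      then obtain b where b: "b \<in> hm (A n) (A N)" "s n = s N \<cdot> b" by blast
      obtain w where w: "w \<in> hm (A N) (A (Suc n))" "s N = s (Suc n) \<cdot> w" using N[of "Suc n"] n ft by auto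
      obtain p q where a: "tri (A (Suc n)) (A n) (G n) (u n) p q" using u by blast
      have "s n = s (Suc n) \<cdot> (w \<cdot> b)" using cmp_assoc[OF b(1) w(1) s] w b by simp
      then show ?thesis
        using iso[OF a s s cmp_hom[OF b(1) w(1)] ss(2)] mm AG by blast
    qed
    then show "\<exists>N. \<forall>n\<ge>N. zero_object D (G n)" by blast
  qed
qed

end

section \<open>Homomorphisms on Grothendieck groups\<close>

lemma groth_rel_subgroup:
  assumes "R \<subseteq> S \<times> S \<times> S"
  shows "groth_rel S R \<lhd> free_Abelian_group S"
proof -
  interpret G: comm_group "free_Abelian_group S" by (rule abelian_free_Abelian_group)
  have "subgroup (groth_rel S R) (free_Abelian_group S)"
    unfolding groth_rel_def
  proof (rule G.generate_is_subgroup, clarify)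
    fix A B C assume "(A, B, C) \<in> R"
    then have "A \<in> S" "B \<in> S" "C \<in> S" using assms by auto
    then show "frag_of B - frag_of A - frag_of C \<in> carrier (free_Abelian_group S)"
      using keys_diff[of "frag_of B - frag_of A" "frag_of C"] keys_diff[of "frag_of B" "frag_of A"] by auto
  qed
  then show ?thesis by (rule G.subgroup_imp_normal)
qed

lemma groth_additive:
  assumes R: "R \<subseteq> S \<times> S \<times> S" and W: "W \<in> hom (groth_group S R) complex_add_group" and "(A, B, C) \<in> R"
  shows "W (groth_class S R B) = W (groth_class S R A) + W (groth_class S R C)"
proof -
  let ?G = "free_Abelian_group S" and ?N = "groth_rel S R"
  interpret G: comm_group ?G by (rule abelian_free_Abelian_group)
  interpret N: normal ?N ?G by (rule groth_rel_subgroup[OF R])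
  have S: "A \<in> S" "B \<in> S" "C \<in> S" using assms by auto
  have c: "frag_of A \<in> carrier ?G" "frag_of B \<in> carrier ?G" "frag_of C \<in> carrier ?G" using S by auto
  have "frag_of B - frag_of A - frag_of C \<in> ?N"
    unfolding groth_rel_def using assms(3) by (intro generate.incl) blast
  then have "(frag_of B - frag_of A - frag_of C) \<otimes>\<^bsub>?G\<^esub> (frag_of A \<otimes>\<^bsub>?G\<^esub> frag_of C) \<in> ?N #>\<^bsub>?G\<^esub> (frag_of A \<otimes>\<^bsub>?G\<^esub> frag_of C)"
    unfolding r_coset_def by blast
  then have "frag_of B \<in> ?N #>\<^bsub>?G\<^esub> (frag_of A \<otimes>\<^bsub>?G\<^esub> frag_of C)" by (simp add: algebra_simps)
  then have "?N #>\<^bsub>?G\<^esub> (frag_of A \<otimes>\<^bsub>?G\<^esub> frag_of C) = ?N #>\<^bsub>?G\<^esub> frag_of B"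
    by (rule G.repr_independence[OF _ G.m_closed[OF c(1,3)] N.subgroup_axioms])
  then have eq: "groth_class S R B = groth_class S R A <#>\<^bsub>?G\<^esub> groth_class S R C"
    unfolding groth_class_def using N.rcos_sum[OF c(1,3)] by simp
  have "groth_class S R X \<in> carrier (groth_group S R)" if "X \<in> S" for X
    unfolding groth_class_def groth_group_def FactGroup_def using that by (auto simp: RCOSETS_def)
  then have "W (groth_class S R A \<otimes>\<^bsub>groth_group S R\<^esub> groth_class S R C) = W (groth_class S R A) + W (groth_class S R C)"
    using W S unfolding hom_def by (simp add: complex_add_group_def)
  then show ?thesis using eq unfolding groth_group_def by (simp add: FactGroup_def)
qed

lemma comm_group_complex: "comm_group complex_add_group"
proof (rule comm_groupI)
  fix x :: complex assume "x \<in> carrier complex_add_group"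
  show "\<exists>y\<in>carrier complex_add_group. y \<otimes>\<^bsub>complex_add_group\<^esub> x = \<one>\<^bsub>complex_add_group\<^esub>"
    by (rule bexI[of _ "- x"]) (auto simp: complex_add_group_def)
qed (auto simp: complex_add_group_def)

text \<open>By the universal property of the free abelian group; the relations lie in the
  kernel.\<close>

lemma groth_hom_exists:
  fixes z :: "'o \<Rightarrow> complex"
  assumes R: "R \<subseteq> S \<times> S \<times> S" and z: "\<And>A B C. (A, B, C) \<in> R \<Longrightarrow> z B = z A + z C"
  shows "\<exists>W \<in> hom (groth_group S R) complex_add_group. \<forall>E \<in> S. W (groth_class S R E) = z E"
proof -
  let ?G = "free_Abelian_group S" and ?N = "groth_rel S R"
  interpret G: comm_group ?G by (rule abelian_free_Abelian_group)
  interpret C: comm_group complex_add_group by (rule comm_group_complex)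
  have "z ` S \<subseteq> carrier complex_add_group" by (auto simp: complex_add_group_def)
  then obtain h where h: "h \<in> hom ?G complex_add_group" "\<And>x. x \<in> S \<Longrightarrow> h (frag_of x) = z x"
    using C.free_Abelian_group_universal[of z S] by blast
  interpret gh: group_hom ?G complex_add_group h
    using h by (unfold_locales) auto
  have hd: "h (x + y) = h x + h y" if "x \<in> carrier ?G" "y \<in> carrier ?G" for x y
    using gh.hom_mult[OF that] by (simp add: complex_add_group_def)
  have hm: "h (x - y) = h x - h y" if "x \<in> carrier ?G" "y \<in> carrier ?G" for x y
  proof -
    have "x - y \<in> carrier ?G" using that keys_diff[of x y] by auto
    then show ?thesis using hd[of "x - y" y] that by simp
  qed
  have "frag_of B - frag_of A - frag_of C \<in> kernel ?G complex_add_group h" if "(A, B, C) \<in> R" for A B C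
  proof -
    have S: "A \<in> S" "B \<in> S" "C \<in> S" using that R by auto
    have 1: "frag_of B - frag_of A \<in> carrier ?G" using S keys_diff[of "frag_of B" "frag_of A"] by auto
    then have 2: "frag_of B - frag_of A - frag_of C \<in> carrier ?G"
      using S keys_diff[of "frag_of B - frag_of A" "frag_of C"] by auto
    have "h (frag_of B - frag_of A - frag_of C) = z B - z A - z C"
      using hm[OF 1, of "frag_of C"] hm[of "frag_of B" "frag_of A"] h(2) S by simp
    then show ?thesis using 2 z[OF that] unfolding kernel_def by (simp add: complex_add_group_def)
  qed
  then have "?N \<subseteq> kernel ?G complex_add_group h"
    unfolding groth_rel_def by (intro G.generate_subgroup_incl gh.subgroup_kernel) auto
  then obtain g where g: "g \<in> hom (?G Mod ?N) complex_add_group"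
    "\<And>x. x \<in> carrier ?G \<Longrightarrow> g (?N #>\<^bsub>?G\<^esub> x) = h x"
    using gh.FactGroup_universal_kernel[OF groth_rel_subgroup[OF R]] by metis
  then show ?thesis unfolding groth_group_def groth_class_def using h(2) by (intro bexI[of _ g]) auto
qed

section \<open>Triangulated subcategories\<close>

lemma tri_sub_simps [simp]:
  "obj (tri_sub D S) = S" "src (tri_sub D S) = src D" "tgt (tri_sub D S) = tgt D"
  "ident (tri_sub D S) = ident D" "cmp (tri_sub D S) = cmp D" "zero_arr (tri_sub D S) = zero_arr D"
  "add_arr (tri_sub D S) = add_arr D" "shift_obj (tri_sub D S) = shift_obj D" "shift_arr (tri_sub D S) = shift_arr D"
  "arr (tri_sub D S) = arr (full_sub D S)" "hom_set (tri_sub D S) = hom_set (full_sub D S)"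
  by (auto simp: tri_sub_def full_sub_def hom_set_def fun_eq_iff)

lemma distinguished_tri_sub: "(f, g, h) \<in> distinguished (tri_sub D S) \<longleftrightarrow>
    (f, g, h) \<in> distinguished D \<and> src D f \<in> S \<and> src D g \<in> S \<and> src D h \<in> S"
  by (simp add: tri_sub_def)

lemma triangle_on_tri_sub: "triangle_on (tri_sub D S) A E B \<longleftrightarrow> triangle_on D A E B \<and> A \<in> S \<and> E \<in> S \<and> B \<in> S"
  unfolding triangle_on_def by (auto simp: distinguished_tri_sub)

lemma hom_group_tri_sub: "hom_group (tri_sub D S) A B = hom_group (full_sub D S) A B"
  by (simp add: hom_group_def)

lemma is_iso_tri_sub: "is_iso (tri_sub D S) f = is_iso (full_sub D S) f"
  by (simp add: is_iso_def)

lemma isomorphic_tri_sub: "isomorphic (tri_sub D S) A B \<longleftrightarrow> isomorphic D A B \<and> A \<in> S \<and> B \<in> S"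
  using isomorphic_full_sub[of D S A B] by (simp add: isomorphic_def is_iso_tri_sub)

lemma zero_object_tri_sub: "zero_object (tri_sub D S) Z = zero_object (full_sub D S) Z"
  by (simp add: zero_object_def)

lemma is_biproduct_tri_sub: "is_biproduct (tri_sub D S) A B E = is_biproduct (full_sub D S) A B E"
  by (simp add: is_biproduct_def)

context triangulated_category
begin

lemma subcategory_closed:
  assumes "triangulated_subcategory D S"
  shows "S \<subseteq> obj D" "zero_object D Z \<Longrightarrow> Z \<in> S" "A \<in> S \<Longrightarrow> sh n A \<in> S"
    "tr A E B \<Longrightarrow> A \<in> S \<Longrightarrow> B \<in> S \<Longrightarrow> E \<in> S" "tr A E B \<Longrightarrow> A \<in> S \<Longrightarrow> E \<in> S \<Longrightarrow> B \<in> S" "isoc S"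
proof -
  show S: "S \<subseteq> obj D" and sh: "\<And>A n. A \<in> S \<Longrightarrow> sh n A \<in> S"
    using assms unfolding triangulated_subcategory_def by auto
  show c: "B \<in> S" if AEB: "tr A E B" "A \<in> S" "E \<in> S" for A E B
  proof -
    obtain f g h where t: "tri A E B f g h" using AEB(1) tr_iff by blast
    then show ?thesis using assms AEB(2,3) hom_setD[OF triD(2)[OF t]] hom_setD[OF triD(3)[OF t]] triD(1)[OF t]
      unfolding triangulated_subcategory_def by metis
  qed
  show z: "Z \<in> S" if "zero_object D Z" for Z
  proof -
    obtain A where "A \<in> S" using assms unfolding triangulated_subcategory_def by blast
    then show ?thesis using c[of A A Z] tr_zero_right[OF isomorphic_refl that] S by blast
  qed
  show "E \<in> S" if "tr A E B" "A \<in> S" "B \<in> S" for A E B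
    using c[OF tr_unrot[OF that(1)]] sh that by blast
  show "isoc S" unfolding iso_closed_def
  proof (intro conjI S ballI allI impI)
    fix A B assume "A \<in> S" "isomorphic D A B"
    moreover obtain Z where "zero_object D Z" using ex_zero_object by blast
    ultimately show "B \<in> S" using c[of Z A B] tr_zero_left z by blast
  qed
qed

lemma neg_tri_sub: assumes "f \<in> hm A B" "A \<in> S" "B \<in> S" shows "neg_arr (tri_sub D S) f = neg f"
  using assms hom_setD[OF assms(1)] hom_group_full_sub[of A S B D] by (simp add: neg_arr_def hom_group_tri_sub)

text \<open>By closure under cones, the objects whose existence the axioms assert, namely
  biproducts, cones and the terms of an octahedron, stay in \<open>S\<close>.\<close>

lemma triangulated_tri_sub:
  assumes S: "triangulated_subcategory D S"
  shows "triangulated_category (tri_sub D S)"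
proof -
  note c = subcategory_closed[OF S]
  interpret P: preadditive_category "full_sub D S" using preadditive_full_sub[OF c(1)] .
  have pre: "preadditive_category (tri_sub D S)"
    using P.preadditive_category_axioms
    unfolding preadditive_category_def tri_sub_simps full_sub_simps hom_group_tri_sub .
  have z: "zero_object (tri_sub D S) Z \<longleftrightarrow> zero_object D Z" for Z
    unfolding zero_object_tri_sub zero_object_full_sub[OF c(1)] using c(2)[of Z] by blast
  have add: "additive_category (tri_sub D S)"
  proof (rule additive_category.intro[OF pre], unfold_locales)
    show "\<exists>Z. zero_object (tri_sub D S) Z" using ex_zero_object z by blast
    fix A1 A2 assume A: "A1 \<in> obj (tri_sub D S)" "A2 \<in> obj (tri_sub D S)"
    then have o: "A1 \<in> S" "A2 \<in> S" "A1 \<in> obj D" "A2 \<in> obj D" using c(1) by auto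
    obtain B where B: "B \<in> obj D" "is_biproduct D A1 A2 B" using ex_biproduct[OF o(3,4)] by blast
    have "B \<in> S" using c(4)[OF biproduct_tr[OF B(2) o(3,4)] o(1,2)] .
    then show "\<exists>B\<in>obj (tri_sub D S). is_biproduct (tri_sub D S) A1 A2 B"
      using B o is_biproduct_full_sub[of A1 S A2 B D] by (auto simp: is_biproduct_tri_sub)
  qed
  have hS: "f \<in> hom_set (full_sub D S) A B \<longleftrightarrow> f \<in> hm A B \<and> A \<in> S \<and> B \<in> S" for f A B
    by (rule hom_set_full_sub)
  have tS: "is_triangle (tri_sub D S) f g h \<longleftrightarrow> is_triangle D f g h \<and> src D f \<in> S \<and> src D g \<in> S \<and> src D h \<in> S" for f g h
    unfolding is_triangle_def using c(3) by (auto simp: arr_full_sub)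
  have dd: "(f, g, h) \<in> distinguished (tri_sub D S) \<longleftrightarrow>
    (f, g, h) \<in> distinguished D \<and> src D f \<in> S \<and> src D g \<in> S \<and> src D h \<in> S" for f g h
    by (rule distinguished_tri_sub)
  have iso: "is_iso (tri_sub D S) f \<longleftrightarrow> is_iso D f" if "f \<in> hm A B" "A \<in> S" "B \<in> S" for f A B
    using is_iso_full_sub[of D f S] hom_setD[OF that(1)] that by (simp add: is_iso_tri_sub)
  show ?thesis
  proof (rule triangulated_category.intro[OF add], unfold_locales, goal_cases)
    case (1 X n) then show ?case using c(3) by simp
  next
    case (2 f X Y n) then show ?case using shift_arr_hom[of f X Y n] c(3) by (simp add: hS)
  next
    case (3 X n) then show ?case using shift_ident[of X n] c(1) by auto
  next
    case (4 f X Y g W n) then show ?case using shift_cmp[of f X Y g W n] by (simp add: hS)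
  next
    case (5 f X Y g n) then show ?case using shift_add[of f X Y g n] by (simp add: hS)
  next
    case (6 X) then show ?case using shift_obj_0[of X] c(1) by auto
  next
    case (7 f) then show ?case using shift_arr_0[of f] by (simp add: arr_full_sub)
  next
    case (8 X m n) then show ?case using shift_obj_add[of X m n] c(1) by auto
  next
    case (9 f m n) then show ?case using shift_arr_add[of f m n] by (simp add: arr_full_sub)
  next
    case (10 f g h) then show ?case using distinguished_triangle[of f g h] by (simp add: tS dd)
  next
    case (11 X Z)
    then have "X \<in> obj D" "zero_object D Z" "Z \<in> S" "X \<in> S" using c z by auto
    moreover note tri_ident[OF this(1,2)]
    ultimately show ?case using TR1_ident[of X Z] hom_setD(2)[OF triD(2)] hom_setD(2)[OF triD(3)] hom_setD(2)[OF triD(4)]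
      by (simp add: dd)
  next
    case (12 f)
    then have f: "f \<in> hm (src D f) (tgt D f)" "src D f \<in> S" "tgt D f \<in> S" by (auto simp: arr_full_sub hom_set_def)
    obtain E g h where t: "tri (src D f) (tgt D f) E f g h" using tri_exists[OF f(1)] by blast
    have "E \<in> S" using c(5) f t tr_iff by blast
    then show ?case using t f hom_setD[OF triD(3)[OF t]] hom_setD[OF triD(4)[OF t]] triD(1)[OF t]
      by (intro exI[of _ g] exI[of _ h]) (simp add: dd)
  next
    case (13 f g h f' g' h' a b e)
    then have h: "(f, g, h) \<in> distinguished D" "is_triangle D f' g' h'" "a \<in> hm (src D f) (src D f')"
      "b \<in> hm (src D g) (src D g')" "e \<in> hm (src D h) (src D h')" by (auto simp: dd tS hS)
    then have "is_iso D a" "is_iso D b" "is_iso D e" using 13 iso by (auto simp: dd tS)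
    then show ?case using TR1_iso[OF h(1-3) _ h(4) _ h(5)] 13 by (simp add: dd tS)
  next
    case (14 f g h)
    then have t: "is_triangle D f g h" "src D f \<in> S" "src D g \<in> S" "src D h \<in> S" by (auto simp: tS)
    have f: "f \<in> hm (src D f) (src D g)" using t unfolding is_triangle_def hom_set_def by simp
    have "neg_arr (tri_sub D S) (sa 1 f) = neg (sa 1 f)" using neg_tri_sub[OF shift_arr_hom[OF f]] c(3) t by simp
    moreover have "src D (neg (sa 1 f)) = sh 1 (src D f)" using hom_setD[OF neg_hom[OF shift_arr_hom[OF f]]] by simp
    ultimately show ?case using TR2[OF t(1)] t c(3) by (simp add: dd)
  next
    case (15 f g h f' g' h' a b)
    then have "\<exists>e\<in>hm (src D h) (src D h'). e \<cdot> g = g' \<cdot> b \<and> sa 1 a \<cdot> h = h' \<cdot> e"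
      using TR3[of f g h f' g' h' a b] by (auto simp: dd hS)
    then show ?case using 15 by (auto simp: dd hS)
  next
    case (16 f p p' g q q' r r')
    then have d: "(f, p, p') \<in> distinguished D" "(g, q, q') \<in> distinguished D" "tgt D f = src D g"
      "(g \<cdot> f, r, r') \<in> distinguished D" by (auto simp: dd)
    have t: "tgt D p = src D p'" "tgt D r = src D r'" "tgt D q = src D q'"
      using distinguished_triangle[OF d(1)] distinguished_triangle[OF d(2)] distinguished_triangle[OF d(4)]
      unfolding is_triangle_def by auto
    obtain u v where uv: "u \<in> hm (tgt D p) (tgt D r)" "v \<in> hm (tgt D r) (tgt D q)"
      "(u, v, sa 1 p \<cdot> q') \<in> distinguished D" "u \<cdot> p = r \<cdot> g" "r' \<cdot> u = p'" "v \<cdot> r = q" "q' \<cdot> v = sa 1 f \<cdot> r'"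
      using TR4[OF d] by blast
    have "tgt D p \<in> S" "tgt D r \<in> S" "tgt D q \<in> S" using 16 t by (auto simp: dd)
    moreover from this have "u \<in> hom_set (tri_sub D S) (tgt D p) (tgt D r)" "v \<in> hom_set (tri_sub D S) (tgt D r) (tgt D q)"
      using uv by (simp_all add: hom_set_full_sub)
    moreover have "src D (sa 1 p \<cdot> q') = tgt D v"
      using distinguished_triangle[OF uv(3)] unfolding is_triangle_def by simp
    ultimately show ?case using uv(3-7) hom_setD[OF uv(1)] hom_setD[OF uv(2)] unfolding tri_sub_simps(2-10)
      by (intro bexI[of _ u] bexI[of _ v]) (simp_all add: dd)
  qed
qed

end

section \<open>Iterated products and split triangles\<close>

text \<open>A Harder-Narasimhan filtration, seen through its factors: \<open>E\<close> has a filtration with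
  successive factors in \<open>X\<^sub>1, \<dots>, X\<^sub>n\<close> iff it lies in the product. Nothing requires the
  factors to be nonzero.\<close>

primrec star_list :: "('o, 'm, 'z) tricat_scheme \<Rightarrow> 'o set list \<Rightarrow> 'o set" where
  "star_list D [] = {Z. zero_object D Z}"
| "star_list D (X # Xs) = star D X (star_list D Xs)"

text \<open>Cutting the phases of a filtration at a lower set splits the filtration into two
  consecutive pieces.\<close>

lemma filter_lower_split:
  fixes xs :: "'a :: linorder list"
  assumes "sorted_wrt (>) xs" "\<And>x y. x \<in> K \<Longrightarrow> y < x \<Longrightarrow> y \<in> K"
  shows "xs = filter (\<lambda>x. x \<notin> K) xs @ filter (\<lambda>x. x \<in> K) xs"
  using assms(1)
proof (induction xs)
  case (Cons x xs)
  show ?case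
  proof (cases "x \<in> K")
    case True
    then have "\<forall>y\<in>set xs. y \<in> K" using Cons.prems assms(2) by auto
    then show ?thesis using True by (simp add: filter_empty_conv)
  qed (use Cons in simp)
qed simp

context triangulated_category
begin

abbreviation "starl \<equiv> star_list D"

lemma starl_isoc: "isoc (starl Xs)"
  by (cases Xs) (simp_all add: zeros_isoc star_isoc)

lemma starl_append: "starl (Xs @ Ys) = starl Xs \<star> starl Ys"
  by (induction Xs) (simp_all add: star_zeros_left[OF starl_isoc] star_assoc)

lemma starl_single: "isoc X \<Longrightarrow> starl [X] = X"
  by (simp add: star_zeros_right)

lemma starl_mono: "(\<And>X Y. (X, Y) \<in> set (zip Xs Ys) \<Longrightarrow> X \<subseteq> Y) \<Longrightarrow> length Xs = length Ys \<Longrightarrow> starl Xs \<subseteq> starl Ys"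
proof (induction Xs Ys rule: list_induct2')
  case (4 X Xs Y Ys)
  then show ?case using star_mono[of X Y "starl Xs" "starl Ys" D] by auto
qed auto

lemma starl_closed:
  assumes "\<And>X. X \<in> set Xs \<Longrightarrow> X \<subseteq> T" "\<And>A E B. tr A E B \<Longrightarrow> A \<in> T \<Longrightarrow> B \<in> T \<Longrightarrow> E \<in> T"
    "zeros \<subseteq> T"
  shows "starl Xs \<subseteq> T"
  using assms(1)
proof (induction Xs)
  case (Cons X Xs)
  show ?case
  proof
    fix E assume "E \<in> starl (X # Xs)"
    then obtain A B where t: "tr A E B" "A \<in> X" "B \<in> starl Xs" by (auto elim: starE)
    then have "A \<in> T" "B \<in> T" using Cons.IH Cons.prems by auto
    then show "E \<in> T" by (rule assms(2)[OF t(1)])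
  qed
qed (use assms(3) in simp)

lemma starl_orth_right: "(\<And>X. X \<in> set Xs \<Longrightarrow> orthogonal D Y X) \<Longrightarrow> orthogonal D Y (starl Xs)"
proof (induction Xs)
  case (Cons X Xs) then show ?case using orth_star_right[of Y X "starl Xs"] by simp
qed (simp add: orthogonal_def hz_zero)

lemma triangle_rel_tr: "(A, E, B) \<in> triangle_rel D \<longleftrightarrow> tr A E B"
  unfolding triangle_rel_def triangle_on_def by blast

lemma triangle_rel_sub: "triangle_rel D \<subseteq> obj D \<times> obj D \<times> obj D"
  using triangle_rel_tr tr_obj by auto

lemma charge_additive:
  assumes "W \<in> hom (K0_tri D) complex_add_group"
  shows "tr A E B \<Longrightarrow> W (cls_tri D E) = W (cls_tri D A) + W (cls_tri D B)"
    "zero_object D A \<Longrightarrow> W (cls_tri D A) = 0"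
    "isomorphic D A B \<Longrightarrow> W (cls_tri D A) = W (cls_tri D B)"
    "A \<in> obj D \<Longrightarrow> W (cls_tri D (sh 1 A)) = - W (cls_tri D A)"
proof -
  show t: "W (cls_tri D E) = W (cls_tri D A) + W (cls_tri D B)" if "tr A E B" for A E B
    using groth_additive[OF triangle_rel_sub assms[unfolded K0_tri_def]] that
    unfolding cls_tri_def triangle_rel_tr by blast
  show z: "W (cls_tri D A) = 0" if "zero_object D A" for A
    using t[OF tr_zero_left[OF isomorphic_refl that]] that zero_objD(1) by fastforce
  show "W (cls_tri D A) = W (cls_tri D B)" if "isomorphic D A B" for A B
    using t tr_zero_left[OF that] z ex_zero_object by fastforce
  show "W (cls_tri D (sh 1 A)) = - W (cls_tri D A)" if A: "A \<in> obj D" for A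
  proof -
    obtain Z where Z: "zero_object D Z" using ex_zero_object by blast
    have "tr A Z (sh 1 A)" using tr_rot[OF tr_zero_left[OF isomorphic_refl[OF A] Z]]
      tr_rot[OF tr_zero_right[OF isomorphic_refl[OF A] Z]] tr_unrot
      by (metis A tr_rot)
    then show ?thesis using t z[OF Z] by (metis add_eq_0_iff)
  qed
qed

lemma tri_split_left: assumes t: "tri A B E f g h" and "h = zr E (sh 1 A)"
  obtains r where "r \<in> hm B A" "r \<cdot> f = idt A"
proof -
  note d = triD[OF t]
  have "neg (sa (-1) h) = zr (sh (-1) E) A"
    using assms(2) shift_zero_arr[of E "sh 1 A" "-1"] neg_zero d by simp
  then have "idt A \<cdot> neg (sa (-1) h) = zr (sh (-1) E) A"
    using cmp_zero_right[OF ident_hom[OF d(5)], of "sh (-1) E"] d by simp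
  then show thesis using weak_cokernel[OF tri_unrot[OF t] ident_hom[OF d(5)]] that by blast
qed

lemma tri_split_right: assumes t: "tri A B E f g h" and "h = zr E (sh 1 A)"
  obtains r where "r \<in> hm E B" "g \<cdot> r = idt E"
proof -
  note d = triD[OF t]
  have "h \<cdot> idt E = zr E (sh 1 A)" using assms(2) cmp_ident_right[OF d(4)] by simp
  then show thesis using weak_kernel2[OF t ident_hom[OF d(7)]] that by blast
qed

text \<open>Suppose that \<open>E[-1]\<close> also lies in \<open>S\<close>, and let \<open>c\<close> be a cokernel in \<open>S\<close> of the arrow
  \<open>E[-1] \<rightarrow> A\<close>. Then \<open>f\<close> factors as \<open>b c\<close>, and \<open>g b = 0\<close> because \<open>c\<close> is epic, so
  \<open>b = f r\<close>. As \<open>f\<close> is monic on arrows from \<open>A\<close>, this gives \<open>r c = 1\<close>, and \<open>c\<close> kills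
  \<open>E[-1] \<rightarrow> A\<close>. This is used for an interval of length greater than 1.\<close>

lemma cokernel_forces_split:
  assumes S: "S \<subseteq> obj D" and ck: "\<And>f. f \<in> arr (full_sub D S) \<Longrightarrow> \<exists>c. is_cokernel (full_sub D S) c f"
    and t: "tri A B E f g h" and T: "A \<in> S" "B \<in> S" "E \<in> S" "sh (-1) E \<in> S" and AE: "hz A (sh (-1) E)"
  shows "h = zr E (sh 1 A)"
proof -
  let ?g = "neg (sa (-1) h)" and ?C = "sh (-1) E"
  note d = triD[OF t]
  note u = tri_unrot[OF t]
  note du = triD[OF u]
  have "?g \<in> arr (full_sub D S)" using hom_setD[OF du(2)] T by (simp add: arr_full_sub)
  then obtain c where c: "is_cokernel (full_sub D S) c ?g" using ck by blast
  let ?K = "tgt D c"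
  have cK: "c \<in> hm A ?K" "?K \<in> S" and c0: "c \<cdot> ?g = zr ?C ?K"
    using c hom_setD[OF du(2)] unfolding is_cokernel_def by (auto simp: arr_full_sub hom_set_def)
  have un: "\<exists>!u. u \<in> hm ?K X \<and> u \<cdot> c = x" if X: "X \<in> S" "x \<in> hm A X" "x \<cdot> ?g = zr ?C X" for X x
    using c X hom_setD[OF du(2)] cK T unfolding is_cokernel_def by (simp add: hom_set_full_sub)
  obtain b where b: "b \<in> hm ?K B" "b \<cdot> c = f" using un[OF T(2) d(2) tri_comp(1)[OF u]] by blast
  obtain k where k: "k \<in> hm B ?K" "k \<cdot> f = c" using weak_cokernel[OF u cK(1) c0] .
  have K: "?K \<in> obj D" using cK S by blast
  have gb: "g \<cdot> b \<in> hm ?K E" using cmp_hom[OF b(1) d(3)] .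
  have "(g \<cdot> b) \<cdot> c = zr A E" using cmp_assoc[OF cK(1) b(1) d(3)] b tri_comp(1)[OF t] by simp
  moreover have "zr ?K E \<cdot> c = zr A E" using cmp_zero_left[OF cK(1) d(7)] .
  moreover have "zr A E \<cdot> ?g = zr ?C E" using cmp_zero_left[OF du(2) d(7)] .
  ultimately have "g \<cdot> b = zr ?K E" using un[OF T(3) zero_hom[OF d(5,7)]] gb zero_hom[OF K d(7)] by metis
  then obtain r where r: "r \<in> hm ?K A" "f \<cdot> r = b" using weak_kernel[OF t b(1)] by blast
  have "f \<cdot> (r \<cdot> c) = f \<cdot> idt A" using cmp_assoc[OF cK(1) r(1) d(2)] r b cmp_ident_right[OF d(2)] by simp
  then have rc: "r \<cdot> c = idt A" using mono_under_hz[OF t AE cmp_hom[OF cK(1) r(1)] ident_hom] d by blast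
  have "?g = (r \<cdot> c) \<cdot> ?g" using rc cmp_ident_left[OF du(2)] by simp
  also have "\<dots> = zr ?C A" using cmp_assoc[OF du(2) cK(1) r(1)] c0 cmp_zero_right[OF r(1)] du by simp
  finally have "?g = zr ?C A" .
  moreover have s: "sa (-1) h \<in> hm ?C A" using shift_arr_hom[OF d(4), of "-1"] d by simp
  ultimately have "sa (-1) h = zr ?C A" using neg_zero_iff by blast
  then show ?thesis using shift_zero_iff[OF d(4), of "-1"] d by simp
qed

end

section \<open>Slicings and interval categories\<close>

locale stability_on = triangulated_category D
  for D :: "('o, 'm, 'z) tricat_scheme" +
  fixes Z :: "('o \<Rightarrow>\<^sub>0 int) set \<Rightarrow> complex" and P :: "real \<Rightarrow> 'o set"
  assumes stab: "stability_condition D (Z, P)"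
begin

abbreviation "PI \<equiv> interval_cat D P"
abbreviation "charge E \<equiv> Z (cls_tri D E)"

lemma Z_hom: "Z \<in> hom (K0_tri D) complex_add_group"
  using stab unfolding stability_condition_def by simp

lemmas charge_simps = charge_additive[OF Z_hom]

lemma P_add: "additive_subcategory D (P \<phi>)"
  using stab unfolding stability_condition_def by simp

lemma P_isoc: "isoc (P \<phi>)"
  using P_add[of \<phi>] isomorphic_obj(2) unfolding additive_subcategory_def iso_closed_def by blast

lemma P_obj: "E \<in> P \<phi> \<Longrightarrow> E \<in> obj D"
  using isocD(2)[OF P_isoc] .

lemma P_zero: "zero_object D E \<Longrightarrow> E \<in> P \<phi>"
  using P_add[of \<phi>] unfolding additive_subcategory_def by blast

lemma P_shift1: "shift_obj D 1 ` P \<phi> = P (\<phi> + 1)"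
  using stab unfolding stability_condition_def by simp

lemma P_shift: assumes "E \<in> P \<phi>" shows "sh n E \<in> P (\<phi> + real_of_int n)"
proof -
  have p: "sh (int k) E \<in> P (\<phi> + real k)" if "E \<in> P \<phi>" for k E \<phi>
  proof (induction k)
    case (Suc k)
    then have "sh 1 (sh (int k) E) \<in> P (\<phi> + real k + 1)" using P_shift1 by blast
    then show ?case using P_obj[OF that] by (simp add: algebra_simps)
  qed (use that P_obj[OF that] in simp)
  have m1: "sh (-1) E \<in> P (\<phi> - 1)" if E: "E \<in> P \<phi>" for E \<phi>
  proof -
    have "E \<in> shift_obj D 1 ` P (\<phi> - 1)" using P_shift1[of "\<phi> - 1"] E by simp
    then obtain A where "A \<in> P (\<phi> - 1)" "E = sh 1 A" by blast
    then show ?thesis using P_obj by simp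
  qed
  have m: "sh (- int k) E \<in> P (\<phi> - real k)" if "E \<in> P \<phi>" for k E \<phi>
  proof (induction k)
    case (Suc k)
    then have "sh (-1) (sh (- int k) E) \<in> P (\<phi> - real k - 1)" using m1 by blast
    then show ?case using P_obj[OF that] by (simp add: algebra_simps)
  qed (use that P_obj[OF that] in simp)
  show ?thesis using p[OF assms, of "nat n"] m[OF assms, of "nat (- n)"] by (cases "n \<ge> 0") auto
qed

lemma P_orth: assumes "\<phi> > \<psi>" "A \<in> P \<phi>" "B \<in> P \<psi>" shows "hz A B"
proof -
  have "hm A B = {zr A B}" using stab assms unfolding stability_condition_def by simp
  then show ?thesis by (simp add: hom_zero_def)
qed

lemma P_charge: "E \<in> P \<phi> \<Longrightarrow> \<not> zero_object D E \<Longrightarrow> \<exists>r>0. charge E = of_real r * cis (pi * \<phi>)"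
  using stab unfolding stability_condition_def by simp

lemma HN_exists: assumes E: "E \<in> obj D" shows "\<exists>\<phi>s. sorted_wrt (>) \<phi>s \<and> E \<in> starl (map P \<phi>s)"
proof (cases "zero_object D E")
  case True then show ?thesis by (intro exI[of _ "[]"]) simp
next
  case False
  then have "\<exists>(n :: nat) F Q \<phi>. zero_object D (F 0) \<and> F n = E \<and>
           (\<forall>i<n. Q i \<in> P (\<phi> i) \<and> \<not> zero_object D (Q i) \<and>
              (\<exists>f g h. (f, g, h) \<in> distinguished D \<and>
                 src D f = F i \<and> src D g = F (Suc i) \<and> src D h = Q i)) \<and>
           (\<forall>i j. i < j \<and> j < n \<longrightarrow> \<phi> i > \<phi> j)"
    using stab E unfolding stability_condition_def by auto
  then obtain n :: nat and F Q \<phi> where H: "zero_object D (F 0)" "F n = E"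
    "\<And>i. i < n \<Longrightarrow> Q i \<in> P (\<phi> i) \<and> tr (F i) (F (Suc i)) (Q i)" "\<And>i j. i < j \<Longrightarrow> j < n \<Longrightarrow> \<phi> i > \<phi> j"
    unfolding triangle_on_def by blast
  have "F i \<in> starl (map P (map \<phi> [0..<i]))" if "i \<le> n" for i
    using that
  proof (induction i)
    case (Suc i)
    then have "F (Suc i) \<in> starl (map P (map \<phi> [0..<i])) \<star> starl [P (\<phi> i)]"
      using H(3)[of i] starl_single[OF P_isoc] by (auto intro: starI)
    then show ?case by (simp add: starl_append)
  qed (use H in simp)
  moreover have "sorted_wrt (>) (map \<phi> [0..<n])"
    using H(4) by (simp add: sorted_wrt_iff_nth_less)
  ultimately show ?thesis using H(2) by blast
qed

lemma PI_base: "\<phi> \<in> I \<Longrightarrow> E \<in> P \<phi> \<Longrightarrow> E \<in> PI I"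
  by (rule interval_cat.base)

lemma PI_ext: assumes "tr A E B" "A \<in> PI I" "B \<in> PI I" shows "E \<in> PI I"
proof -
  obtain f g h where "(f, g, h) \<in> distinguished D" "src D f = A" "src D g = E" "src D h = B"
    using assms(1) unfolding triangle_on_def by blast
  then show ?thesis using interval_cat.ext[of f g h D P I] assms(2,3) by simp
qed

lemma PI_induct [consumes 1, case_names base ext]:
  assumes "E \<in> PI I" "\<And>\<phi> E. \<phi> \<in> I \<Longrightarrow> E \<in> P \<phi> \<Longrightarrow> Q E"
    "\<And>A E B. tr A E B \<Longrightarrow> A \<in> PI I \<Longrightarrow> B \<in> PI I \<Longrightarrow> Q A \<Longrightarrow> Q B \<Longrightarrow> Q E"
  shows "Q E"
  using assms(1)
proof (induction rule: interval_cat.induct)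
  case (base \<phi> E) then show ?case using assms(2) by blast
next
  case (ext f g h)
  then have "tr (src D f) (src D g) (src D h)" unfolding triangle_on_def by blast
  then show ?case by (rule assms(3)) (rule ext)+
qed

lemma PI_obj: "E \<in> PI I \<Longrightarrow> E \<in> obj D"
  by (induction rule: PI_induct) (auto dest: P_obj tr_obj)

lemma PI_mono: assumes "I \<subseteq> J" shows "PI I \<subseteq> PI J"
proof
  fix E assume "E \<in> PI I"
  then show "E \<in> PI J"
  proof (induction rule: PI_induct)
    case (base \<phi> E) then show ?case using PI_base assms by blast
  next
    case (ext A E B) show ?case by (rule PI_ext) (rule ext)+
  qed
qed

lemma PI_zero: "\<phi> \<in> I \<Longrightarrow> zero_object D E \<Longrightarrow> E \<in> PI I"
  using PI_base P_zero by blast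

lemma PI_isoc: assumes "I \<noteq> {}" shows "isoc (PI I)"
  unfolding iso_closed_def
proof (intro conjI ballI allI impI subsetI)
  fix A B assume A: "A \<in> PI I" and i: "isomorphic D A B"
  obtain X where X: "zero_object D X" using ex_zero_object by blast
  have "tr X B A" using tr_zero_left[OF isomorphic_sym[OF i] X] .
  then show "B \<in> PI I" using PI_ext PI_zero X A assms by blast
qed (rule PI_obj)

lemma PI_shift: assumes "E \<in> PI I" shows "sh n E \<in> PI ((\<lambda>x. x + real_of_int n) ` I)"
  using assms
proof (induction rule: PI_induct)
  case (base \<phi> E)
  then have "\<phi> + real_of_int n \<in> (\<lambda>x. x + real_of_int n) ` I" by simp
  then show ?case by (rule PI_base) (rule P_shift[OF base(2)])
next
  case (ext A E B) show ?case by (rule PI_ext[OF tr_shift[OF ext(1)]]) (rule ext)+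
qed

lemma PI_orth: assumes "\<And>\<phi> \<psi>. \<phi> \<in> I \<Longrightarrow> \<psi> \<in> J \<Longrightarrow> \<phi> > \<psi>" "A \<in> PI I" "B \<in> PI J" shows "hz A B"
proof -
  have 1: "hz A B" if "A \<in> P \<phi>" "\<phi> \<in> I" "B \<in> PI J" for \<phi> A B
    using that(3)
  proof (induction rule: PI_induct)
    case (base \<psi> B) then show ?case using P_orth[OF assms(1)[OF that(2)] that(1)] by blast
  next
    case (ext X E Y) show ?case by (rule hz_tr_right[OF ext(1)]) (rule ext)+
  qed
  show ?thesis using assms(2)
  proof (induction rule: PI_induct)
    case (base \<phi> A) show ?case by (rule 1[OF base(2,1) assms(3)])
  next
    case (ext X E Y) show ?case by (rule hz_tr_left[OF ext(1)]) (rule ext)+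
  qed
qed

lemma starl_PI: assumes "set \<phi>s \<subseteq> I" "I \<noteq> {}" shows "starl (map P \<phi>s) \<subseteq> PI I"
proof (rule starl_closed)
  show "zeros \<subseteq> PI I" using assms(2) PI_zero by blast
qed (use assms(1) PI_base PI_ext in auto)

text \<open>An up-closed set of phases gives a t-structure: the filtration of an object is cut
  at the boundary.\<close>

lemma t_pair_PI: assumes up: "\<And>x y. x \<in> J \<Longrightarrow> x < y \<Longrightarrow> y \<in> J" and ne: "J \<noteq> {}" "- J \<noteq> {}"
  shows "t_pair D (PI J) (PI (- J))"
proof (rule t_pairI[OF PI_isoc[OF ne(1)] PI_isoc[OF ne(2)]])
  have "\<phi> > \<psi>" if "\<phi> \<in> J" "\<psi> \<in> - J" for \<phi> \<psi>
    using up[of \<phi> \<psi>] that by (metis ComplD linorder_cases)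
  then show "orthogonal D (PI J) (PI (- J))" unfolding orthogonal_def using PI_orth by blast
  show "obj D \<subseteq> PI J \<star> PI (- J)"
  proof
    fix E assume "E \<in> obj D"
    then obtain \<phi>s where \<phi>s: "sorted_wrt (>) \<phi>s" "E \<in> starl (map P \<phi>s)" using HN_exists by blast
    have s: "\<phi>s = filter (\<lambda>x. x \<notin> - J) \<phi>s @ filter (\<lambda>x. x \<in> - J) \<phi>s"
      by (rule filter_lower_split[OF \<phi>s(1)]) (use up in blast)
    have "E \<in> starl (map P (filter (\<lambda>x. x \<notin> - J) \<phi>s)) \<star> starl (map P (filter (\<lambda>x. x \<in> - J) \<phi>s))"
      using \<phi>s(2) arg_cong[OF s, where f = "\<lambda>l. starl (map P l)"] unfolding map_append starl_append by blast
    moreover have "starl (map P (filter (\<lambda>x. x \<notin> - J) \<phi>s)) \<subseteq> PI J" "starl (map P (filter (\<lambda>x. x \<in> - J) \<phi>s)) \<subseteq> PI (- J)"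
      by (rule starl_PI; use ne in auto)+
    ultimately show "E \<in> PI J \<star> PI (- J)" using star_mono by blast
  qed
  fix E assume "E \<in> PI J"
  then have "sh 1 E \<in> PI ((\<lambda>x. x + real_of_int 1) ` J)" by (rule PI_shift)
  moreover have "(\<lambda>x. x + real_of_int 1) ` J \<subseteq> J" using up by force
  ultimately show "sh 1 E \<in> PI J" using PI_mono by blast
qed

text \<open>The filtration is cut at both ends of \<open>J \<inter> K\<close>. The outer pieces vanish by
  orthogonality, as \<open>E\<close> lies in \<open>P J\<close> and in \<open>P K\<close>.\<close>

lemma HN_in_interval:
  assumes up: "\<And>x y. x \<in> J \<Longrightarrow> x < y \<Longrightarrow> y \<in> J" and lo: "\<And>x y. x \<in> K \<Longrightarrow> y < x \<Longrightarrow> y \<in> K"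
    and ne: "J \<inter> K \<noteq> {}" "- J \<noteq> {}" "- K \<noteq> {}" and E: "E \<in> PI J" "E \<in> PI K"
  shows "\<exists>\<phi>s. sorted_wrt (>) \<phi>s \<and> set \<phi>s \<subseteq> J \<inter> K \<and> E \<in> starl (map P \<phi>s)"
proof -
  have upK: "\<phi> > \<psi>" if "\<phi> \<in> - K" "\<psi> \<in> K" for \<phi> \<psi>
    using lo[of \<psi> \<phi>] that by (metis ComplD linorder_cases)
  have upJ: "\<phi> > \<psi>" if "\<phi> \<in> J" "\<psi> \<in> - J" for \<phi> \<psi>
    using up[of \<phi> \<psi>] that by (metis ComplD linorder_cases)
  obtain \<phi>s where \<phi>s: "sorted_wrt (>) \<phi>s" "E \<in> starl (map P \<phi>s)" using HN_exists PI_obj E by blast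
  have s1: "\<phi>s = filter (\<lambda>x. x \<notin> K) \<phi>s @ filter (\<lambda>x. x \<in> K) \<phi>s"
    by (rule filter_lower_split[OF \<phi>s(1)]) (rule lo)
  let ?A = "filter (\<lambda>x. x \<notin> K) \<phi>s" and ?B = "filter (\<lambda>x. x \<in> K) \<phi>s"
  have sB: "sorted_wrt (>) ?B" using \<phi>s(1) by (rule sorted_wrt_filter)
  let ?C = "filter (\<lambda>x. x \<notin> - J) ?B" and ?D = "filter (\<lambda>x. x \<in> - J) ?B"
  have s2: "?B = ?C @ ?D" by (rule filter_lower_split[OF sB]) (use up in blast)
  have ne': "K \<noteq> {}" "J \<noteq> {}" using ne by auto
  have sub: "starl (map P ?A) \<subseteq> PI (- K)" "starl (map P ?B) \<subseteq> PI K" "starl (map P ?C) \<subseteq> PI J" "starl (map P ?D) \<subseteq> PI (- J)"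
    by (rule starl_PI; use ne ne' in auto)+
  have "E \<in> starl (map P ?A) \<star> starl (map P ?B)"
    using \<phi>s(2) arg_cong[OF s1, where f = "\<lambda>l. starl (map P l)"] unfolding map_append starl_append by blast
  then obtain X Y where X: "tr X E Y" "X \<in> starl (map P ?A)" "Y \<in> starl (map P ?B)" by (rule starE)
  have "sh (-1) Y \<in> PI ((\<lambda>x. x + real_of_int (-1)) ` K)" using PI_shift sub X by blast
  moreover have "(\<lambda>x. x + real_of_int (-1)) ` K \<subseteq> K" using lo by force
  ultimately have "sh (-1) Y \<in> PI K" using PI_mono by blast
  then have "zero_object D X" using tr_sub_zero[OF X(1)] PI_orth[OF upK] sub X E by blast
  then have EY: "isomorphic D E Y" using tr_zero_left_iso X by blast
  have "Y \<in> starl (map P ?C) \<star> starl (map P ?D)"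
    using X(3) arg_cong[OF s2, where f = "\<lambda>l. starl (map P l)"] unfolding map_append starl_append by blast
  then obtain U V where U: "tr U Y V" "U \<in> starl (map P ?C)" "V \<in> starl (map P ?D)" by (rule starE)
  have "hz E V" using PI_orth[OF upJ] E U sub by blast
  then have yv: "hz Y V" using hz_iso[OF EY isomorphic_refl] U tr_obj by blast
  have "sh 1 U \<in> PI ((\<lambda>x. x + real_of_int 1) ` J)" using PI_shift U sub by blast
  moreover have "(\<lambda>x. x + real_of_int 1) ` J \<subseteq> J" using up by force
  ultimately have "sh 1 U \<in> PI J" using PI_mono by blast
  then have "zero_object D V" using tr_quotient_zero[OF U(1) yv] PI_orth[OF upJ] U sub by blast
  then have "isomorphic D U E" using tr_zero_right_iso[OF U(1)] isomorphic_trans isomorphic_sym[OF EY] by blast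
  then have "E \<in> starl (map P ?C)" using isocD(1)[OF starl_isoc U(2)] by blast
  moreover have "sorted_wrt (>) ?C" using sB by (rule sorted_wrt_filter)
  moreover have "set ?C \<subseteq> J \<inter> K" by auto
  ultimately show ?thesis by blast
qed

lemma PI_Int:
  assumes up: "\<And>x y. x \<in> J \<Longrightarrow> x < y \<Longrightarrow> y \<in> J" and lo: "\<And>x y. x \<in> K \<Longrightarrow> y < x \<Longrightarrow> y \<in> K"
    and ne: "J \<inter> K \<noteq> {}" "- J \<noteq> {}" "- K \<noteq> {}"
  shows "PI (J \<inter> K) = PI J \<inter> PI K"
proof
  show "PI (J \<inter> K) \<subseteq> PI J \<inter> PI K" using PI_mono by blast
  show "PI J \<inter> PI K \<subseteq> PI (J \<inter> K)"
  proof
    fix E assume "E \<in> PI J \<inter> PI K"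
    then obtain \<phi>s where "set \<phi>s \<subseteq> J \<inter> K" "E \<in> starl (map P \<phi>s)"
      using HN_in_interval[of J K E, OF _ _ ne] up lo by blast
    then show "E \<in> PI (J \<inter> K)" using starl_PI ne by blast
  qed
qed

lemma heart_HN: assumes "E \<in> PI {0<..1}"
  shows "\<exists>\<phi>s. sorted_wrt (>) \<phi>s \<and> set \<phi>s \<subseteq> {0<..1} \<and> E \<in> starl (map P \<phi>s)"
proof -
  have e: "{0<..} \<inter> {..1} = {0<..1::real}" by auto
  have "\<exists>\<phi>s. sorted_wrt (>) \<phi>s \<and> set \<phi>s \<subseteq> {0<..} \<inter> {..1} \<and> E \<in> starl (map P \<phi>s)"
  proof (rule HN_in_interval)
    have c: "- {0<..} = {..0::real}" "- {..1} = {1::real<..}" by auto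
    show "- {0::real<..} \<noteq> {}" "- {..1::real} \<noteq> {}" "{0<..} \<inter> {..1::real} \<noteq> {}" unfolding e c by auto
    show "E \<in> PI {0<..}" by (rule subsetD[OF PI_mono assms]) auto
    show "E \<in> PI {..1}" by (rule subsetD[OF PI_mono assms]) auto
  qed auto
  then show ?thesis unfolding e .
qed

lemma window_open: assumes "a < b" "b \<le> a + 1"
  shows "t_window D (PI {a<..}) (PI {..a}) (PI {b..}) (PI {..<b}) (PI {a<..<b})"
proof
  have c: "- {a<..} = {..a}" "- {b..} = {..<b}" "- {..<b} = {b..}" by auto
  show "t_pair D (PI {a<..}) (PI {..a})" using t_pair_PI[of "{a<..}"] unfolding c by auto
  show "t_pair D (PI {b..}) (PI {..<b})" using t_pair_PI[of "{b..}"] unfolding c by auto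
  show "sh 1 E \<in> PI {b..}" if "E \<in> PI {a<..}" for E
  proof -
    have "(\<lambda>x. x + real_of_int 1) ` {a<..} \<subseteq> {b..}" using assms by auto
    then show ?thesis using PI_shift[OF that, of 1] PI_mono by blast
  qed
  show "PI {b..} \<subseteq> PI {a<..}" by (rule PI_mono) (use assms in auto)
  have "{a<..<b} = {a<..} \<inter> {..<b}" by auto
  moreover have "{a<..} \<inter> {..<b} \<noteq> {}" using dense[OF assms(1)] by auto
  ultimately show "PI {a<..<b} = PI {a<..} \<inter> PI {..<b}"
    using PI_Int[of "{a<..}" "{..<b}"] unfolding c by auto
qed

lemma window_heart: "t_window D (PI {0<..}) (PI {..0}) (PI {1<..}) (PI {..1}) (PI {0<..1})"
proof
  have c: "- {0<..} = {..0::real}" "- {1<..} = {..1::real}" "- {..1} = {1::real<..}" by auto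
  show "t_pair D (PI {0<..}) (PI {..0})" using t_pair_PI[of "{0<..}"] unfolding c by auto
  show "t_pair D (PI {1<..}) (PI {..1})" using t_pair_PI[of "{1<..}"] unfolding c by auto
  show "sh 1 E \<in> PI {1<..}" if "E \<in> PI {0<..}" for E
  proof -
    have "(\<lambda>x. x + real_of_int 1) ` {0<..} \<subseteq> {1<..}" by auto
    then show ?thesis using PI_shift[OF that, of 1] PI_mono by blast
  qed
  show "PI {1<..} \<subseteq> PI {0<..}" by (rule PI_mono) auto
  have "{0<..1} = {0<..} \<inter> {..1::real}" by auto
  moreover have "(1::real) \<in> {0<..} \<inter> {..1}" by simp
  then have "{0<..} \<inter> {..1::real} \<noteq> {}" by blast
  ultimately show "PI {0<..1} = PI {0<..} \<inter> PI {..1}"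
    using PI_Int[of "{0<..}" "{..1}"] unfolding c by auto
qed

text \<open>The width \<open>\<eta>\<close> in the definition of local finiteness may exceed 1/2, and then the
  interval category need not lie between t-structures as in \<open>t_window\<close>. In that case
  the interval is centred at \<open>\<phi> - 1/2\<close> and contains the small interval around \<open>\<phi>\<close>
  together with its shift by \<open>-1\<close>. As it has cokernels, the triangles in the small
  interval split, so they stay short exact in the large one, which then provides the
  chain conditions.\<close>

lemma small_chains:
  assumes "locally_finite D (Z, P)"
  obtains \<epsilon> where "\<epsilon> > 0" "\<epsilon> \<le> 1/2" "\<And>\<phi>. acc_obj D (PI {\<phi> - \<epsilon><..<\<phi> + \<epsilon>})" "\<And>\<phi>. dcc_obj D (PI {\<phi> - \<epsilon><..<\<phi> + \<epsilon>})"
proof -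
  obtain \<eta> where \<eta>: "\<eta> > 0" "\<And>\<phi>. finite_length (full_sub D (PI {\<phi> - \<eta><..<\<phi> + \<eta>}))"
    using assms unfolding locally_finite_def by auto
  show thesis
  proof (cases "\<eta> \<le> 1/2")
    case True
    have "acc_obj D (PI {\<phi> - \<eta><..<\<phi> + \<eta>}) \<and> dcc_obj D (PI {\<phi> - \<eta><..<\<phi> + \<eta>})" for \<phi>
    proof -
      interpret W: t_window D "PI {\<phi> - \<eta><..}" "PI {..\<phi> - \<eta>}" "PI {\<phi> + \<eta>..}" "PI {..<\<phi> + \<eta>}" "PI {\<phi> - \<eta><..<\<phi> + \<eta>}"
        using window_open \<eta>(1) True by simp
      show ?thesis
        by (intro conjI W.finite_length_chains[OF \<eta>(2)[of \<phi>] subset_refl W.T_subset])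
          ((rule W.T_mono; assumption) | (rule W.T_epi; assumption))+
    qed
    then show thesis using that[OF \<eta>(1) True] by blast
  next
    case False
    \<comment> \<open>Such an \<open>\<epsilon>\<close> keeps \<open>\<phi> \<plusminus> \<epsilon>\<close> and \<open>\<phi> - 1 \<plusminus> \<epsilon>\<close> within \<open>\<eta>\<close> of \<open>\<phi> - 1/2\<close>.\<close>
    define \<epsilon> where "\<epsilon> = min (\<eta> - 1/2) (1/2)"
    have \<epsilon>: "\<epsilon> > 0" "\<epsilon> \<le> 1/2" "\<epsilon> \<le> \<eta> - 1/2" using False unfolding \<epsilon>_def min_def by auto
    have "acc_obj D (PI {\<phi> - \<epsilon><..<\<phi> + \<epsilon>}) \<and> dcc_obj D (PI {\<phi> - \<epsilon><..<\<phi> + \<epsilon>})" for \<phi>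
    proof -
      let ?T = "PI {\<phi> - \<epsilon><..<\<phi> + \<epsilon>}" and ?S = "PI {(\<phi> - 1/2) - \<eta><..<(\<phi> - 1/2) + \<eta>}"
      interpret W: t_window D "PI {\<phi> - \<epsilon><..}" "PI {..\<phi> - \<epsilon>}" "PI {\<phi> + \<epsilon>..}" "PI {..<\<phi> + \<epsilon>}" ?T
        using window_open \<epsilon> by simp
      have fl: "finite_length (full_sub D ?S)" using \<eta>(2) by blast
      interpret Q: quasi_abelian_category "full_sub D ?S" using fl unfolding finite_length_def by blast
      have TS: "?T \<subseteq> ?S" by (rule PI_mono) (use \<epsilon> in auto)
      have S: "?S \<subseteq> obj D" using PI_obj by blast
      have split: "h = zr E (sh 1 A)" if t: "tri A B E f g h" "A \<in> ?T" "B \<in> ?T" "E \<in> ?T" for A B E f g h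
      proof (rule cokernel_forces_split[OF S Q.ex_cokernel t(1)])
        have e: "sh (-1) E \<in> PI ((\<lambda>x. x + real_of_int (-1)) ` {\<phi> - \<epsilon><..<\<phi> + \<epsilon>})" using PI_shift t by blast
        moreover have "(\<lambda>x. x + real_of_int (-1)) ` {\<phi> - \<epsilon><..<\<phi> + \<epsilon>} \<subseteq> {(\<phi> - 1/2) - \<eta><..<(\<phi> - 1/2) + \<eta>}"
          using \<epsilon> by auto
        ultimately show "sh (-1) E \<in> ?S" using PI_mono by blast
        have "y < x" if "x \<in> {\<phi> - \<epsilon><..<\<phi> + \<epsilon>}" "y \<in> (\<lambda>x. x + real_of_int (-1)) ` {\<phi> - \<epsilon><..<\<phi> + \<epsilon>}" for x y
          using that \<epsilon> by auto
        then show "hz A (sh (-1) E)" using PI_orth e t(2) by blast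
      qed (use t TS in auto)
      have m: "u = v" if t: "tri A B E f g h" "A \<in> ?T" "B \<in> ?T" "E \<in> ?T"
        and u: "X \<in> ?S" "u \<in> hm X A" "v \<in> hm X A" "f \<cdot> u = f \<cdot> v" for A B E f g h X u v
      proof -
        obtain r where r: "r \<in> hm B A" "r \<cdot> f = idt A" using tri_split_left[OF t(1) split[OF t]] .
        show ?thesis
          using cmp_assoc[OF u(2) triD(2)[OF t(1)] r(1)] cmp_assoc[OF u(3) triD(2)[OF t(1)] r(1)] r u cmp_ident_left by metis
      qed
      have e: "u = v" if t: "tri A B E f g h" "A \<in> ?T" "B \<in> ?T" "E \<in> ?T"
        and u: "X \<in> ?S" "u \<in> hm E X" "v \<in> hm E X" "u \<cdot> g = v \<cdot> g" for A B E f g h X u v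
      proof -
        obtain r where r: "r \<in> hm E B" "g \<cdot> r = idt E" using tri_split_right[OF t(1) split[OF t]] .
        show ?thesis
          using cmp_assoc[OF r(1) triD(3)[OF t(1)] u(2)] cmp_assoc[OF r(1) triD(3)[OF t(1)] u(3)] r u cmp_ident_right by metis
      qed
      show ?thesis
        by (intro conjI W.finite_length_chains[OF fl TS S])
          ((rule m; assumption) | (rule e; assumption))+
    qed
    then show thesis using that[OF \<epsilon>(1,2)] by blast
  qed
qed

end

section \<open>Phases and semistable objects of a heart\<close>

text \<open>The determinant of two vectors in the plane. On the half-plane below, its sign
  compares arguments, and it is linear in each vector, so inequalities between phases
  become linear inequalities between charges.\<close>

definition cross :: "complex \<Rightarrow> complex \<Rightarrow> real" where
  "cross a b = Re a * Im b - Im a * Re b"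

text \<open>The values that a stability function may take on nonzero objects.\<close>

definition semiclosed_upper :: "complex \<Rightarrow> bool" where
  "semiclosed_upper a \<longleftrightarrow> Im a > 0 \<or> (a \<in> \<real> \<and> Re a < 0)"

lemma semiclosed_upper_Arg: assumes "semiclosed_upper a" shows "0 < Arg a" "Arg a \<le> pi" "a \<noteq> 0" "Im a \<ge> 0"
proof -
  show a: "a \<noteq> 0" "Im a \<ge> 0" using assms unfolding semiclosed_upper_def by (auto simp: complex_is_Real_iff)
  show "Arg a \<le> pi" using Arg_le_pi .
  show "0 < Arg a"
    using assms unfolding semiclosed_upper_def Arg_pos_iff by (auto simp: complex_is_Real_iff)
qed

lemma cross_polar: "cross a b = norm a * norm b * sin (Arg b - Arg a)"
proof -
  have p: "Re x = norm x * cos (Arg x)" "Im x = norm x * sin (Arg x)" for x :: complex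
  proof -
    have "x = rcis (norm x) (Arg x)" by (cases "x = 0") (simp_all add: rcis_cmod_Arg)
    then show "Re x = norm x * cos (Arg x)" "Im x = norm x * sin (Arg x)" by (metis Re_rcis, metis Im_rcis)
  qed
  show ?thesis unfolding cross_def p[of a] p[of b] by (simp add: sin_diff algebra_simps)
qed

lemma Arg_less_cross: assumes "semiclosed_upper a" "semiclosed_upper b"
  shows "Arg a < Arg b \<longleftrightarrow> cross a b > 0"
proof -
  note a = semiclosed_upper_Arg[OF assms(1)] and b = semiclosed_upper_Arg[OF assms(2)]
  have "norm a * norm b > 0" using a b by simp
  then have "cross a b > 0 \<longleftrightarrow> sin (Arg b - Arg a) > 0" unfolding cross_polar
    by (metis zero_less_mult_pos mult_pos_pos)
  also have "\<dots> \<longleftrightarrow> Arg b - Arg a > 0"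
  proof
    assume "Arg b - Arg a > 0" then show "sin (Arg b - Arg a) > 0" using a b by (intro sin_gt_zero) auto
  next
    assume s: "sin (Arg b - Arg a) > 0"
    show "Arg b - Arg a > 0"
    proof (rule ccontr)
      assume "\<not> Arg b - Arg a > 0"
      then have "sin (Arg a - Arg b) \<ge> 0" using a b by (intro sin_ge_zero) auto
      moreover have "sin (Arg a - Arg b) = - sin (Arg b - Arg a)" using sin_minus[of "Arg b - Arg a"] by simp
      ultimately show False using s by simp
    qed
  qed
  finally show ?thesis by simp
qed

lemma cross_minus: "cross b a = - cross a b"
  by (simp add: cross_def)

lemma Arg_le_cross: assumes "semiclosed_upper a" "semiclosed_upper b"
  shows "Arg a \<le> Arg b \<longleftrightarrow> cross a b \<ge> 0"
  using Arg_less_cross[OF assms(2,1)] cross_minus[of b a] by auto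

lemma cross_simps: "cross (a + b) x = cross a x + cross b x" "cross x (a + b) = cross x a + cross x b" "cross x x = 0"
  by (simp_all add: cross_def algebra_simps)

lemma semiclosed_upper_cis: assumes "0 < \<phi>" "\<phi> \<le> 1"
  shows "semiclosed_upper (cis (pi * \<phi>))" "Arg (cis (pi * \<phi>)) = pi * \<phi>"
proof -
  show "semiclosed_upper (cis (pi * \<phi>))"
  proof (cases "\<phi> = 1")
    case True then show ?thesis by (simp add: semiclosed_upper_def)
  next
    case False
    then have "0 < sin (pi * \<phi>)" using assms by (intro sin_gt_zero) auto
    then show ?thesis by (simp add: semiclosed_upper_def)
  qed
  have "- pi < pi * \<phi>" using assms pi_gt_zero by (smt (verit) mult_pos_pos)
  moreover have "pi * \<phi> \<le> pi" using assms by simp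
  ultimately show "Arg (cis (pi * \<phi>)) = pi * \<phi>" by (intro Arg_cis) auto
qed

text \<open>The last clause keeps the intermediate objects in view: when the classes \<open>P \<phi>\<close> lie
  in a heart, so does the whole filtration.\<close>

definition HN_filtration where
  "HN_filtration D P \<phi>s E n F Q \<phi> \<longleftrightarrow> zero_object D (F (0::nat)) \<and> F n = E \<and>
     (\<forall>i<n. Q i \<in> P (\<phi> i) \<and> \<not> zero_object D (Q i) \<and> triangle_on D (F i) (F (Suc i)) (Q i) \<and> \<phi> i \<in> set \<phi>s) \<and>
     (\<forall>i j. i < j \<and> j < n \<longrightarrow> (\<phi> i :: real) > \<phi> j) \<and>
     (\<forall>i\<le>n. \<exists>\<psi>s. set \<psi>s \<subseteq> set \<phi>s \<and> F i \<in> star_list D (map P \<psi>s))"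

lemma HN_filtrationD:
  assumes "HN_filtration D P \<phi>s E n F Q \<phi>"
  shows "zero_object D (F 0)" "F n = E"
    "i < n \<Longrightarrow> Q i \<in> P (\<phi> i) \<and> \<not> zero_object D (Q i) \<and> triangle_on D (F i) (F (Suc i)) (Q i) \<and> \<phi> i \<in> set \<phi>s"
    "i < j \<Longrightarrow> j < n \<Longrightarrow> \<phi> i > \<phi> j" "i \<le> n \<Longrightarrow> \<exists>\<psi>s. set \<psi>s \<subseteq> set \<phi>s \<and> F i \<in> star_list D (map P \<psi>s)"
  using assms unfolding HN_filtration_def by simp_all

lemma HN_filtrationI:
  assumes "zero_object D (F 0)" "F n = E"
    "\<And>i. i < n \<Longrightarrow> Q i \<in> P (\<phi> i) \<and> \<not> zero_object D (Q i) \<and> triangle_on D (F i) (F (Suc i)) (Q i) \<and> \<phi> i \<in> set \<phi>s"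
    "\<And>i j. i < j \<Longrightarrow> j < n \<Longrightarrow> \<phi> i > \<phi> j" "\<And>i. i \<le> n \<Longrightarrow> \<exists>\<psi>s. set \<psi>s \<subseteq> set \<phi>s \<and> F i \<in> star_list D (map P \<psi>s)"
  shows "HN_filtration D P \<phi>s E n F Q \<phi>"
  using assms unfolding HN_filtration_def by simp

text \<open>Factors of a product may be zero, while those of a Harder-Narasimhan filtration are
  not; the zero factors are dropped one by one, starting at the end.\<close>

lemma (in triangulated_category) star_list_filtration:
  assumes "\<And>\<phi>. isoc (P \<phi>)" "E \<in> starl (map P \<phi>s)" "sorted_wrt (>) \<phi>s"
  shows "\<exists>n F Q \<phi>. HN_filtration D P \<phi>s E n F Q \<phi>"
  using assms(2,3)
proof (induction \<phi>s arbitrary: E rule: rev_induct)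
  case Nil
  then have "HN_filtration D P [] E 0 (\<lambda>_. E) Q \<phi>" for Q \<phi> by (intro HN_filtrationI) auto
  then show ?case by blast
next
  case (snoc a \<phi>s)
  have srt: "sorted_wrt (>) \<phi>s" "\<And>x. x \<in> set \<phi>s \<Longrightarrow> x > a" using snoc.prems by (auto simp: sorted_wrt_append)
  have "starl (map P (\<phi>s @ [a])) = starl (map P \<phi>s) \<star> P a"
    using starl_append[of "map P \<phi>s" "[P a]"] starl_single[OF assms(1)[of a]] by simp
  then have "E \<in> starl (map P \<phi>s) \<star> P a" using snoc.prems(1) by simp
  then obtain M R where t: "tr M E R" "M \<in> starl (map P \<phi>s)" "R \<in> P a" by (rule starE)
  show ?case
  proof (cases "zero_object D R")
    case True
    then have "E \<in> starl (map P \<phi>s)" using tr_zero_right_iso[OF t(1)] isocD(1)[OF starl_isoc t(2)] by blast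
    from snoc.IH[OF this srt(1)] obtain n F Q \<phi> where H: "HN_filtration D P \<phi>s E n F Q \<phi>" by blast
    note h = HN_filtrationD[OF H]
    have "HN_filtration D P (\<phi>s @ [a]) E n F Q \<phi>"
    proof (rule HN_filtrationI[OF h(1,2) _ h(4)])
      show "\<exists>\<psi>s. set \<psi>s \<subseteq> set (\<phi>s @ [a]) \<and> F i \<in> starl (map P \<psi>s)" if "i \<le> n" for i
        using h(5)[OF that] by auto
    qed (use h(3) in auto)
    then show ?thesis by blast
  next
    case False
    from snoc.IH[OF t(2) srt(1)] obtain n F Q \<phi> where H: "HN_filtration D P \<phi>s M n F Q \<phi>" by blast
    note h = HN_filtrationD[OF H]
    have "HN_filtration D P (\<phi>s @ [a]) E (Suc n) (F(Suc n := E)) (Q(n := R)) (\<phi>(n := a))"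
    proof (rule HN_filtrationI)
      fix i assume i: "i < Suc n"
      show "(Q(n := R)) i \<in> P ((\<phi>(n := a)) i) \<and> \<not> zero_object D ((Q(n := R)) i) \<and>
          tr ((F(Suc n := E)) i) ((F(Suc n := E)) (Suc i)) ((Q(n := R)) i) \<and> (\<phi>(n := a)) i \<in> set (\<phi>s @ [a])"
        using h(2) h(3)[of i] i t False by (cases "i = n") auto
    next
      fix i j assume ij: "i < j" "j < Suc n"
      show "(\<phi>(n := a)) i > (\<phi>(n := a)) j" using h(3)[of i] h(4)[of i j] ij srt(2) by (cases "j = n") auto
    next
      fix i assume i: "i \<le> Suc n"
      show "\<exists>\<psi>s. set \<psi>s \<subseteq> set (\<phi>s @ [a]) \<and> (F(Suc n := E)) i \<in> starl (map P \<psi>s)"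
      proof (cases "i = Suc n")
        case True then show ?thesis using snoc.prems(1) by (intro exI[of _ "\<phi>s @ [a]"]) simp
      next
        case False
        then obtain \<psi>s where "set \<psi>s \<subseteq> set \<phi>s" "F i \<in> starl (map P \<psi>s)" using h(5)[of i] i by auto
        then show ?thesis using False by (intro exI[of _ \<psi>s]) auto
      qed
    qed (use h(1) in auto)
    then show ?thesis by blast
  qed
qed

lemma (in triangulated_category) star_list_first:
  assumes "\<And>\<phi>. isoc (P \<phi>)" "E \<in> starl (map P \<phi>s)" "sorted_wrt (>) (\<phi>s :: real list)" "\<not> zero_object D E"
  obtains \<psi> A R \<phi>s' where "\<psi> \<in> set \<phi>s" "tr A E R" "A \<in> P \<psi>" "\<not> zero_object D A" "R \<in> starl (map P \<phi>s')"
    "sorted_wrt (>) \<phi>s'" "\<And>x. x \<in> set \<phi>s' \<Longrightarrow> x < \<psi>" "set \<phi>s' \<subseteq> set \<phi>s"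
  using assms(2,3)
proof (induction \<phi>s arbitrary: thesis)
  case Nil then show ?case using assms(4) by simp
next
  case (Cons a \<phi>s)
  from Cons.prems(2) obtain A R where t: "tr A E R" "A \<in> P a" "R \<in> starl (map P \<phi>s)" by (auto elim: starE)
  show ?case
  proof (cases "zero_object D A")
    case True
    then have "isomorphic D R E" using tr_zero_left_iso t isomorphic_sym by blast
    then have E: "E \<in> starl (map P \<phi>s)" using isocD(1)[OF starl_isoc t(3)] by blast
    have s: "sorted_wrt (>) \<phi>s" using Cons.prems(3) by simp
    show ?thesis
    proof (rule Cons.IH[OF _ E s])
      fix \<psi> A R \<phi>s' assume "\<psi> \<in> set \<phi>s" "tr A E R" "A \<in> P \<psi>" "\<not> zero_object D A" "R \<in> starl (map P \<phi>s')"
        "sorted_wrt (>) \<phi>s'" "\<And>x. x \<in> set \<phi>s' \<Longrightarrow> x < \<psi>" "set \<phi>s' \<subseteq> set \<phi>s"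
      then show thesis by (intro Cons.prems(1)[of \<psi> A R \<phi>s']) auto
    qed
  next
    case False
    then show ?thesis using Cons.prems(1)[OF _ t(1,2) False t(3)] Cons.prems(3) by auto
  qed
qed

text \<open>The condition \<open>V[-1] \<subseteq> U\<close> gives \<open>V = U[1]\<close>, so that \<open>H\<close> is the heart of the
  t-structure of \<open>U\<close>. The charge is defined on all of \<open>\<D>\<close> and additive on triangles.\<close>

locale heart = t_window D U U' V V' H
  for D :: "('o, 'm, 'z) tricat_scheme" and U U' V V' H +
  fixes z :: "'o \<Rightarrow> complex"
  assumes shift_V_U: "E \<in> V \<Longrightarrow> shift_obj D (-1) E \<in> U"
    and z_tr: "triangle_on D A E B \<Longrightarrow> z E = z A + z B"
    and z_upper: "E \<in> H \<Longrightarrow> \<not> zero_object D E \<Longrightarrow> semiclosed_upper (z E)"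
begin

lemma z_zero: "zero_object D E \<Longrightarrow> z E = 0"
  using z_tr[OF tr_zero_left[OF isomorphic_refl]] zero_objD(1) by fastforce

lemma z_iso: "isomorphic D A B \<Longrightarrow> z A = z B"
  using z_tr tr_zero_left z_zero ex_zero_object by fastforce

lemma z_shift: assumes "A \<in> obj D" shows "z (sh 1 A) = - z A"
proof -
  obtain X where X: "zero_object D X" using ex_zero_object by blast
  have "tr A X (sh 1 A)" using tr_rot_iff[OF assms] tr_zero_left[OF isomorphic_refl X] assms
    using tr_rot[OF tr_unrot[OF tr_rot[OF tr_zero_left[OF isomorphic_refl[OF assms] X]]]]
      tr_unrot[OF tr_zero_left[OF isomorphic_refl[of "sh 1 A"] X]] by simp
  then show ?thesis using z_tr z_zero[OF X] by (metis add_eq_0_iff)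
qed

definition ph :: "'o \<Rightarrow> real" where "ph E = Arg (z E) / pi"

text \<open>The linear functional that vanishes on the ray of phase \<open>\<phi>\<close>; it is nonnegative on
  charges of phase at most \<open>\<phi>\<close>.\<close>

definition lin :: "real \<Rightarrow> complex \<Rightarrow> real" where "lin \<phi> a = cross a (cis (pi * \<phi>))"

lemma lin_add: "lin \<phi> (a + b) = lin \<phi> a + lin \<phi> b" "lin \<phi> 0 = 0"
  unfolding lin_def by (simp_all add: cross_simps) (simp add: cross_def)

lemma ph_range: assumes "E \<in> H" "\<not> zero_object D E" shows "0 < ph E" "ph E \<le> 1"
  using semiclosed_upper_Arg[OF z_upper[OF assms]] by (simp_all add: ph_def)

lemma ph_le_lin: assumes "E \<in> H" "\<not> zero_object D E" "0 < \<phi>" "\<phi> \<le> 1"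
  shows "ph E \<le> \<phi> \<longleftrightarrow> lin \<phi> (z E) \<ge> 0" "\<phi> \<le> ph E \<longleftrightarrow> lin \<phi> (z E) \<le> 0"
proof -
  note c = semiclosed_upper_cis[OF assms(3,4)]
  show "ph E \<le> \<phi> \<longleftrightarrow> lin \<phi> (z E) \<ge> 0"
    using Arg_le_cross[OF z_upper[OF assms(1,2)] c(1)] c(2) unfolding ph_def lin_def
    by (simp add: divide_le_eq mult.commute)
  show "\<phi> \<le> ph E \<longleftrightarrow> lin \<phi> (z E) \<le> 0"
    using Arg_le_cross[OF c(1) z_upper[OF assms(1,2)]] c(2) cross_minus[of "z E"] unfolding ph_def lin_def
    by (simp add: le_divide_eq mult.commute)
qed

lemma lin_ph: assumes "E \<in> H" "\<not> zero_object D E" shows "lin (ph E) (z E) = 0"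
  using ph_le_lin[OF assms ph_range[OF assms]] by auto

lemma ph_iso: "isomorphic D A B \<Longrightarrow> ph A = ph B"
  using z_iso by (simp add: ph_def)

lemma Im_nonneg: "E \<in> H \<Longrightarrow> Im (z E) \<ge> 0"
  using semiclosed_upper_Arg(4)[OF z_upper] z_zero by (cases "zero_object D E") auto

lemma ph_one_iff: assumes "E \<in> H" "\<not> zero_object D E" shows "ph E = 1 \<longleftrightarrow> Im (z E) = 0"
proof -
  have "lin 1 (z E) = Im (z E)" unfolding lin_def cross_def by simp
  then show ?thesis using ph_le_lin[OF assms, of 1] ph_range[OF assms] Im_nonneg[OF assms(1)] by auto
qed

lemma nonzero_ext: assumes "tr A E B" "A \<in> H" "B \<in> H" "\<not> zero_object D A" shows "\<not> zero_object D E"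
proof
  assume E: "zero_object D E"
  have "zero_object D A" using tr_sub_zero[OF assms(1) hz_zero(2)[OF E] T_hz(2)[OF assms(2,3)]] .
  then show False using assms by simp
qed

text \<open>The charge of \<open>E\<close> is the sum of those of \<open>A\<close> and \<open>B\<close>, so its phase lies between
  theirs.\<close>

lemma seesaw: assumes t: "tr A E B" and H: "A \<in> H" "B \<in> H" "\<not> zero_object D A" "\<not> zero_object D B"
  shows "ph A \<le> ph E \<longleftrightarrow> ph E \<le> ph B" "ph A < ph E \<longleftrightarrow> ph E < ph B" "ph A \<le> ph E \<longleftrightarrow> ph A \<le> ph B" "ph A < ph B \<longleftrightarrow> ph E < ph B"
proof -
  have E: "E \<in> H" "\<not> zero_object D E" using T_ext[OF t H(1,2)] nonzero_ext[OF t H(1-3)] by auto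
  have u: "semiclosed_upper (z A)" "semiclosed_upper (z B)" "semiclosed_upper (z E)" using z_upper H E by auto
  have p: "ph X \<le> ph Y \<longleftrightarrow> cross (z X) (z Y) \<ge> 0" "ph X < ph Y \<longleftrightarrow> cross (z X) (z Y) > 0"
    if "semiclosed_upper (z X)" "semiclosed_upper (z Y)" for X Y
    using Arg_le_cross[OF that] Arg_less_cross[OF that] unfolding ph_def by (simp_all add: divide_le_cancel divide_less_cancel)
  show "ph A \<le> ph E \<longleftrightarrow> ph E \<le> ph B" "ph A < ph E \<longleftrightarrow> ph E < ph B" "ph A \<le> ph E \<longleftrightarrow> ph A \<le> ph B" "ph A < ph B \<longleftrightarrow> ph E < ph B"
    unfolding p[OF u(1,3)] p[OF u(3,2)] p[OF u(1,2)] z_tr[OF t] by (simp_all add: cross_simps)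
qed

text \<open>Subobjects in the abelian category \<open>H\<close> are expressed by triangles.\<close>

definition ss :: "'o \<Rightarrow> bool" where
  "ss E \<longleftrightarrow> E \<in> H \<and> \<not> zero_object D E \<and>
     (\<forall>A\<in>H. \<forall>C\<in>H. triangle_on D A E C \<and> \<not> zero_object D A \<longrightarrow> ph A \<le> ph E)"

definition SS :: "real \<Rightarrow> 'o set" where
  "SS \<phi> = {E \<in> H. zero_object D E \<or> ss E \<and> ph E = \<phi>}"

lemma ssD: assumes "ss E" shows "E \<in> H" "\<not> zero_object D E"
    "tr A E C \<Longrightarrow> A \<in> H \<Longrightarrow> C \<in> H \<Longrightarrow> \<not> zero_object D A \<Longrightarrow> ph A \<le> ph E"
    "tr A E C \<Longrightarrow> A \<in> H \<Longrightarrow> C \<in> H \<Longrightarrow> \<not> zero_object D C \<Longrightarrow> ph E \<le> ph C"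
proof -
  show "E \<in> H" "\<not> zero_object D E" using assms unfolding ss_def by auto
  show s: "ph A \<le> ph E" if "tr A E C" "A \<in> H" "C \<in> H" "\<not> zero_object D A" using assms that unfolding ss_def by blast
  show "ph E \<le> ph C" if t: "tr A E C" "A \<in> H" "C \<in> H" "\<not> zero_object D C"
  proof (cases "zero_object D A")
    case True then show ?thesis using tr_zero_left_iso[OF t(1)] ph_iso by simp
  next
    case False then show ?thesis using seesaw(1)[OF t(1-3) False t(4)] s[OF t(1-3) False] by simp
  qed
qed

lemma H_zero: "zero_object D E \<Longrightarrow> E \<in> H"
  by (rule T_zero)

lemma ss_iso: assumes "ss E" "isomorphic D E E'" shows "ss E'"
proof -
  have "ph A \<le> ph E'" if "A \<in> H" "C \<in> H" "tr A E' C" "\<not> zero_object D A" for A C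
  proof -
    have "tr A E C" using tr_iso[OF that(3) _ isomorphic_sym[OF assms(2)]] isomorphic_refl tr_obj[OF that(3)] by blast
    then show ?thesis using ssD(3)[OF assms(1)] that ph_iso[OF assms(2)] by simp
  qed
  moreover have "\<not> zero_object D E'" using isomorphic_zero[OF isomorphic_sym[OF assms(2)]] ssD(2)[OF assms(1)] by blast
  ultimately show ?thesis using T_iso[OF ssD(1)[OF assms(1)] assms(2)] unfolding ss_def by blast
qed

lemma SS_isoc: "isoc (SS \<phi>)"
  unfolding iso_closed_def
proof (intro conjI ballI allI impI)
  show "SS \<phi> \<subseteq> obj D" unfolding SS_def using T_obj by blast
  fix A B assume "A \<in> SS \<phi>" "isomorphic D A B"
  then show "B \<in> SS \<phi>" unfolding SS_def using T_iso isomorphic_zero ss_iso ph_iso by auto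
qed

lemma SS_nonzero: "E \<in> SS \<phi> \<Longrightarrow> \<not> zero_object D E \<Longrightarrow> ss E \<and> ph E = \<phi>"
  unfolding SS_def by blast

lemma SS_H: "E \<in> SS \<phi> \<Longrightarrow> E \<in> H"
  unfolding SS_def by blast

lemma H_image: assumes "f \<in> hm A B" "f \<noteq> zr A B" "A \<in> H" "B \<in> H"
  obtains K I Q where "tr K A I" "tr I B Q" "K \<in> H" "I \<in> H" "Q \<in> H" "\<not> zero_object D I"
proof -
  obtain I Q W i c d p q r where I: "tri I B Q i d p" "tri A I W c q r" "i \<cdot> c = f" "I \<in> H" "Q \<in> H" "W \<in> V"
    "sh (-1) W \<in> V'" using coimage_cokernel[OF assms(1,3,4)] .
  have "sh (-1) W \<in> H" using TI[OF shift_V_U[OF I(6)] I(7)] .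
  moreover have "tr (sh (-1) W) A I" "tr I B Q" using I tr_unrot tr_iff by blast+
  moreover have "\<not> zero_object D I"
  proof
    assume "zero_object D I"
    then have "c = zr A I" using zero_objD(2) triD(2)[OF I(2)] by blast
    then show False using I(3) assms(2) cmp_zero_right[OF triD(2)[OF I(1)]] T_obj[OF assms(3)] by simp
  qed
  ultimately show thesis using that I by blast
qed

lemma ss_hom_zero: assumes "ss A" "ss B" "ph A > ph B" shows "hz A B"
  unfolding hom_zero_def
proof (rule ballI, rule ccontr)
  fix f assume f: "f \<in> hm A B" "f \<noteq> zr A B"
  obtain K I Q where I: "tr K A I" "tr I B Q" "K \<in> H" "I \<in> H" "Q \<in> H" "\<not> zero_object D I"
    using H_image[OF f ssD(1)[OF assms(1)] ssD(1)[OF assms(2)]] .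
  have "ph A \<le> ph I" using ssD(4)[OF assms(1) I(1,3,4,6)] .
  also have "ph I \<le> ph B" using ssD(3)[OF assms(2) I(2,4,5,6)] .
  finally show False using assms(3) by simp
qed

lemma SS_orth: "\<phi> > \<psi> \<Longrightarrow> A \<in> SS \<phi> \<Longrightarrow> B \<in> SS \<psi> \<Longrightarrow> hz A B"
  using ss_hom_zero SS_nonzero hz_zero by metis

lemma sub_of_sub: assumes "tr A B X" "tr B E Y" "X \<in> H" "Y \<in> H"
  obtains S where "tr A E S" "S \<in> H"
  using tr_assoc1[OF assms(1,2)] T_ext assms(3,4) by metis

definition sub_ss :: "'o \<Rightarrow> bool" where
  "sub_ss E \<longleftrightarrow> (\<exists>A\<in>H. \<exists>C\<in>H. triangle_on D A E C \<and> ss A \<and> ph E \<le> ph A)"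

text \<open>A subobject of \<open>E\<close> of larger phase would contain a semistable one of larger phase
  than \<open>A\<close> and \<open>B\<close>, which has no nonzero arrows to \<open>A\<close> or \<open>B\<close>, hence none to \<open>E\<close>.\<close>

lemma SS_ext:
  assumes sub: "\<And>E. E \<in> H \<Longrightarrow> \<not> zero_object D E \<Longrightarrow> sub_ss E"
    and t: "tr A E B" "A \<in> SS \<phi>" "B \<in> SS \<phi>"
  shows "E \<in> SS \<phi>"
proof (cases "zero_object D A \<or> zero_object D B")
  case True
  then have "isomorphic D A E \<or> isomorphic D B E"
    using tr_zero_right_iso[OF t(1)] tr_zero_left_iso[OF t(1)] isomorphic_sym by blast
  then show ?thesis using isocD(1)[OF SS_isoc] t by blast
next
  case False
  have A: "ss A" "ph A = \<phi>" and B: "ss B" "ph B = \<phi>" using SS_nonzero False t by auto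
  have H: "A \<in> H" "B \<in> H" using ssD A B by auto
  have E: "E \<in> H" "\<not> zero_object D E" using T_ext[OF t(1) H] nonzero_ext[OF t(1) H] False by auto
  have "ph A \<le> ph E" using seesaw(3)[OF t(1) H] False A B by simp
  moreover have "ph E \<le> ph B" using seesaw(1)[OF t(1) H] False calculation by simp
  ultimately have pE: "ph E = \<phi>" using A B by simp
  have "ph X \<le> ph E" if X: "X \<in> H" "Y \<in> H" "tr X E Y" "\<not> zero_object D X" for X Y
  proof (rule ccontr)
    assume n: "\<not> ph X \<le> ph E"
    obtain X' R where X': "X' \<in> H" "R \<in> H" "tr X' X R" "ss X'" "ph X \<le> ph X'" using sub[OF X(1,4)] unfolding sub_ss_def by blast
    obtain S where S: "tr X' E S" "S \<in> H" using sub_of_sub[OF X'(3) X(3) X'(2) X(2)] .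
    have "hz X' A" "hz X' B" using ss_hom_zero X' A B n pE by auto
    then have "hz X' E" using hz_tr_right[OF t(1)] by blast
    then have "zero_object D X'" using tr_sub_zero[OF S(1)] T_hz(2)[OF X'(1) S(2)] by blast
    then show False using ssD X' by blast
  qed
  then have "ss E" using E unfolding ss_def by blast
  then show ?thesis unfolding SS_def using E pE by blast
qed

text \<open>What the classes \<open>P \<phi>\<close>, \<open>0 < \<phi> \<le> 1\<close>, of any stability condition with heart \<open>H\<close> and
  charge \<open>z\<close> satisfy. It is used in both directions: to prove that filtrations exist
  by exhibiting candidates for the semistable objects, and to identify the slicing of
  a given stability condition.\<close>

definition HN_data :: "(real \<Rightarrow> 'o set) \<Rightarrow> bool" where
  "HN_data P \<longleftrightarrow> (\<forall>\<phi>. iso_closed D (P \<phi>) \<and> {E. zero_object D E} \<subseteq> P \<phi>) \<and>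
     (\<forall>\<phi>\<in>{0<..1}. P \<phi> \<subseteq> H \<and> (\<forall>E\<in>P \<phi>. \<not> zero_object D E \<longrightarrow> ph E = \<phi>)) \<and>
     (\<forall>\<phi>\<in>{0<..1}. \<forall>\<psi>\<in>{0<..1}. \<phi> > \<psi> \<longrightarrow> orthogonal D (P \<phi>) (P \<psi>)) \<and>
     (\<forall>E\<in>H. \<exists>\<phi>s. sorted_wrt (>) \<phi>s \<and> set \<phi>s \<subseteq> {0<..1} \<and> E \<in> star_list D (map P \<phi>s))"

lemma lin_starl:
  assumes "HN_data P" "E \<in> starl (map P \<phi>s)" "set \<phi>s \<subseteq> {0<..1}" "\<And>x. x \<in> set \<phi>s \<Longrightarrow> x \<le> \<psi>" "\<psi> \<in> {0<..1}"
  shows "lin \<psi> (z E) \<ge> 0 \<and> E \<in> H"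
  using assms(2-4)
proof (induction \<phi>s arbitrary: E)
  case Nil then show ?case using z_zero lin_add H_zero by simp
next
  case (Cons a \<phi>s)
  from Cons.prems(1) obtain A R where t: "tr A E R" "A \<in> P a" "R \<in> starl (map P \<phi>s)" by (auto elim: starE)
  have IH: "lin \<psi> (z R) \<ge> 0" "R \<in> H" using Cons.IH[OF t(3)] Cons.prems by auto
  have A: "A \<in> H" "\<not> zero_object D A \<Longrightarrow> ph A = a" using assms(1) t Cons.prems unfolding HN_data_def by auto
  have "lin \<psi> (z A) \<ge> 0"
  proof (cases "zero_object D A")
    case True then show ?thesis using z_zero lin_add by simp
  next
    case False then show ?thesis using A ph_le_lin(1)[OF A(1) False] Cons.prems(3) assms(5) by auto
  qed
  then show ?case using IH z_tr[OF t(1)] lin_add T_ext[OF t(1) A(1)] by simp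
qed

lemma HN_data_first:
  assumes P: "HN_data P" and E: "E \<in> H" "\<not> zero_object D E"
  obtains \<psi> A R \<phi>s' where "\<psi> \<in> {0<..1}" "tr A E R" "A \<in> P \<psi>" "\<not> zero_object D A" "R \<in> starl (map P \<phi>s')"
    "\<And>x. x \<in> set \<phi>s' \<Longrightarrow> x < \<psi>" "set \<phi>s' \<subseteq> {0<..1}" "R \<in> H" "A \<in> H" "ph A = \<psi>" "ph E \<le> \<psi>"
    "\<not> zero_object D R \<Longrightarrow> ph R < \<psi>"
proof -
  have ic: "isoc (P \<phi>)" for \<phi> using P unfolding HN_data_def by blast
  have first: "\<exists>\<psi> A R \<phi>s'. \<psi> \<in> set \<phi>s \<and> tr A E R \<and> A \<in> P \<psi> \<and> \<not> zero_object D A \<and> R \<in> starl (map P \<phi>s') \<and>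
      sorted_wrt (>) \<phi>s' \<and> (\<forall>x\<in>set \<phi>s'. x < \<psi>) \<and> set \<phi>s' \<subseteq> set \<phi>s \<and> R \<in> H \<and> A \<in> H \<and> ph A = \<psi> \<and> ph E \<le> \<psi>"
    if s: "sorted_wrt (>) \<phi>s" "set \<phi>s \<subseteq> {0<..1}" "E \<in> starl (map P \<phi>s)" "E \<in> H" "\<not> zero_object D E" for E \<phi>s
  proof -
    obtain \<psi> A R \<phi>s' where f: "\<psi> \<in> set \<phi>s" "tr A E R" "A \<in> P \<psi>" "\<not> zero_object D A" "R \<in> starl (map P \<phi>s')"
      "sorted_wrt (>) \<phi>s'" "\<And>x. x \<in> set \<phi>s' \<Longrightarrow> x < \<psi>" "set \<phi>s' \<subseteq> set \<phi>s"
      using star_list_first[OF ic s(3,1,5)] by metis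
    have \<psi>: "\<psi> \<in> {0<..1}" using f s by blast
    have sub: "set \<phi>s' \<subseteq> {0<..1}" using f(8) s(2) by blast
    have R: "lin \<psi> (z R) \<ge> 0" "R \<in> H" using lin_starl[OF P f(5) sub _ \<psi>] f(7) by (auto simp: less_imp_le)
    have A: "A \<in> H" "ph A = \<psi>" using P f(3,4) \<psi> unfolding HN_data_def by auto
    have "lin \<psi> (z A) = 0" using lin_ph[OF A(1) f(4)] A(2) by simp
    then have "ph E \<le> \<psi>" using ph_le_lin(1)[OF s(4,5)] \<psi> R z_tr[OF f(2)] lin_add by simp
    then show ?thesis using f A R by blast
  qed
  obtain \<phi>s where \<phi>s: "sorted_wrt (>) \<phi>s" "set \<phi>s \<subseteq> {0<..1}" "E \<in> starl (map P \<phi>s)"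
    using P E(1) unfolding HN_data_def by blast
  obtain \<psi> A R \<phi>s' where f: "\<psi> \<in> set \<phi>s" "tr A E R" "A \<in> P \<psi>" "\<not> zero_object D A" "R \<in> starl (map P \<phi>s')"
      "sorted_wrt (>) \<phi>s'" "\<forall>x\<in>set \<phi>s'. x < \<psi>" "set \<phi>s' \<subseteq> set \<phi>s" "R \<in> H" "A \<in> H" "ph A = \<psi>" "ph E \<le> \<psi>"
    using first[OF \<phi>s E] by blast
  have "ph R < \<psi>" if Rz: "\<not> zero_object D R"
  proof -
    have "set \<phi>s' \<subseteq> {0<..1}" using f(8) \<phi>s(2) by blast
    then obtain \<psi>' where "\<psi>' \<in> set \<phi>s'" "ph R \<le> \<psi>'" using first[OF f(6) _ f(5,9) Rz] by blast
    then show ?thesis using f(7) by fastforce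
  qed
  then show thesis using that[of \<psi> A R \<phi>s'] f \<phi>s(2) by blast
qed

text \<open>If \<open>E\<close> in \<open>P \<phi>\<close> had a subobject of larger phase, the first factor of that subobject
  would have still larger phase, and orthogonality forbids arrows from it to \<open>E\<close>.
  Conversely, the first factor of a semistable object has the phase of the object, and
  the remainder, of smaller phase, would be a destabilizing quotient unless it is
  zero.\<close>

theorem HN_data_semistable: assumes P: "HN_data P" and \<phi>: "\<phi> \<in> {0<..1}" shows "P \<phi> = SS \<phi>"
proof
  show "P \<phi> \<subseteq> SS \<phi>"
  proof
    fix E assume EP: "E \<in> P \<phi>"
    then have EH: "E \<in> H" using P \<phi> unfolding HN_data_def by blast
    show "E \<in> SS \<phi>"
    proof (cases "zero_object D E")
      case True then show ?thesis unfolding SS_def using EH by blast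
    next
      case False
      then have pE: "ph E = \<phi>" using P \<phi> EP unfolding HN_data_def by blast
      have "ph X \<le> ph E" if X: "X \<in> H" "Y \<in> H" "tr X E Y" "\<not> zero_object D X" for X Y
      proof (rule ccontr)
        assume n: "\<not> ph X \<le> ph E"
        obtain \<psi> A R where A: "\<psi> \<in> {0<..1}" "tr A X R" "A \<in> P \<psi>" "\<not> zero_object D A" "R \<in> H" "A \<in> H" "ph X \<le> \<psi>"
          using HN_data_first[OF P X(1,4)] by metis
        obtain S where S: "tr A E S" "S \<in> H" using sub_of_sub[OF A(2) X(3) A(5) X(2)] .
        have "orthogonal D (P \<psi>) (P \<phi>)" using P \<phi> A(1,7) n pE unfolding HN_data_def by auto
        then have "hz A E" using A(3) EP unfolding orthogonal_def by blast
        then show False using tr_sub_zero[OF S(1)] T_hz(2)[OF A(6) S(2)] A(4) by blast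
      qed
      then have "ss E" unfolding ss_def using EH False by blast
      then show ?thesis unfolding SS_def using EH pE by blast
    qed
  qed
  show "SS \<phi> \<subseteq> P \<phi>"
  proof
    fix E assume ES: "E \<in> SS \<phi>"
    have ic: "isoc (P \<phi>)" using P unfolding HN_data_def by blast
    show "E \<in> P \<phi>"
    proof (cases "zero_object D E")
      case True then show ?thesis using P unfolding HN_data_def by blast
    next
      case False
      have E: "ss E" "ph E = \<phi>" "E \<in> H" using SS_nonzero[OF ES False] SS_H[OF ES] by auto
      obtain \<psi> A R where A: "tr A E R" "A \<in> P \<psi>" "\<not> zero_object D A" "R \<in> H" "A \<in> H" "ph A = \<psi>" "ph E \<le> \<psi>"
        "\<not> zero_object D R \<Longrightarrow> ph R < \<psi>" using HN_data_first[OF P E(3) False] by metis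
      have "ph A \<le> ph E" using ssD(3)[OF E(1) A(1,5,4,3)] .
      then have \<psi>: "\<psi> = \<phi>" using A E by simp
      have "zero_object D R"
      proof (rule ccontr)
        assume R: "\<not> zero_object D R"
        have "ph E \<le> ph R" using ssD(4)[OF E(1) A(1,5,4) R] .
        then show False using A(8)[OF R] E(2) \<psi> by simp
      qed
      then show ?thesis using tr_zero_right_iso[OF A(1)] isocD(1)[OF ic] A(2) \<psi> by blast
    qed
  qed
qed

end

section \<open>From a heart to a stability condition\<close>

context heart
begin

definition HN_all :: bool where
  "HN_all \<longleftrightarrow> (\<forall>E\<in>H. \<exists>\<phi>s. sorted_wrt (>) \<phi>s \<and> set \<phi>s \<subseteq> {0<..1} \<and> E \<in> star_list D (map SS \<phi>s))"

lemma HN_allD: assumes HN_all "E \<in> H"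
  obtains \<phi>s where "sorted_wrt (>) \<phi>s" "set \<phi>s \<subseteq> {0<..1}" "E \<in> starl (map SS \<phi>s)"
  using assms unfolding HN_all_def by blast

lemma HN_data_SS: assumes HN_all shows "HN_data SS"
  unfolding HN_data_def
proof (intro conjI allI ballI impI)
  fix \<phi> \<psi> :: real
  show "isoc (SS \<phi>)" by (rule SS_isoc)
  show "zeros \<subseteq> SS \<phi>" unfolding SS_def using H_zero by blast
  show "SS \<phi> \<subseteq> H" using SS_H by blast
  show "ph E = \<phi>" if "E \<in> SS \<phi>" "\<not> zero_object D E" for E using SS_nonzero that by blast
  show "orthogonal D (SS \<phi>) (SS \<psi>)" if "\<phi> > \<psi>" using SS_orth[OF that] unfolding orthogonal_def by blast
  show "\<exists>\<phi>s. sorted_wrt (>) \<phi>s \<and> set \<phi>s \<subseteq> {0<..1} \<and> E \<in> starl (map SS \<phi>s)" if "E \<in> H" for E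
    using assms that unfolding HN_all_def by blast
qed

lemma HN_data_all: assumes "HN_data P" shows HN_all
  unfolding HN_all_def
proof
  fix E assume "E \<in> H"
  then obtain \<phi>s where p: "sorted_wrt (>) \<phi>s" "set \<phi>s \<subseteq> {0<..1}" "E \<in> starl (map P \<phi>s)"
    using assms unfolding HN_data_def by blast
  have "map P \<phi>s = map SS \<phi>s" using HN_data_semistable[OF assms] p(2) by (intro map_cong refl) blast
  then have "E \<in> starl (map SS \<phi>s)" using p(3) by (simp only:)
  then show "\<exists>\<phi>s. sorted_wrt (>) \<phi>s \<and> set \<phi>s \<subseteq> {0<..1} \<and> E \<in> starl (map SS \<phi>s)" using p(1,2) by blast
qed

lemma HN_all_sub_ss: assumes HN_all "E \<in> H" "\<not> zero_object D E" shows "sub_ss E"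
proof -
  obtain \<psi> A R where "tr A E R" "A \<in> SS \<psi>" "\<not> zero_object D A" "R \<in> H" "A \<in> H" "ph A = \<psi>" "ph E \<le> \<psi>"
    using HN_data_first[OF HN_data_SS[OF assms(1)] assms(2,3)] by metis
  then show ?thesis unfolding sub_ss_def using SS_nonzero by blast
qed

lemma starl_SS_H: "starl (map SS \<phi>s) \<subseteq> H"
proof (rule starl_closed)
  show "zeros \<subseteq> H" using H_zero by blast
  show "X \<subseteq> H" if "X \<in> set (map SS \<phi>s)" for X using that SS_H by auto
qed (rule T_ext)

lemma abelian_H: "abelian_category F"
  by (rule abelian_T) (rule shift_V_U)

lemma zero_H: "zero_object F E \<longleftrightarrow> zero_object D E"
  using zero_object_full_sub[OF T_subset, of E] H_zero by blast

lemma short_exact_rel_H: "(A, B, E) \<in> short_exact_rel F \<Longrightarrow> tr A B E \<and> A \<in> H \<and> B \<in> H \<and> E \<in> H"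
proof -
  assume "(A, B, E) \<in> short_exact_rel F"
  then obtain f g where fg: "short_exact F f g" "A = src D f" "B = tgt D f" "E = tgt D g"
    unfolding short_exact_rel_def by auto
  then have "f \<in> hm A B" "g \<in> hm B E" unfolding short_exact_def is_kernel_def by (auto simp: hom_set_def arr_full_sub)
  then show ?thesis using short_exact_tri[OF fg(1)] tr_iff by blast
qed

lemma heart_charge_exists:
  obtains W where "W \<in> hom (K0_ab F) complex_add_group" "\<And>E. E \<in> H \<Longrightarrow> W (cls_ab F E) = z E"
proof -
  have "short_exact_rel F \<subseteq> H \<times> H \<times> H" using short_exact_rel_H by auto
  then have "\<exists>W\<in>hom (groth_group H (short_exact_rel F)) complex_add_group. \<forall>E\<in>H. W (groth_class H (short_exact_rel F) E) = z E"
    by (rule groth_hom_exists) (use short_exact_rel_H z_tr in blast)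
  then show thesis using that unfolding K0_ab_def cls_ab_def by auto
qed

context
  fixes W assumes W: "W \<in> hom (K0_ab F) complex_add_group" "\<And>E. E \<in> H \<Longrightarrow> W (cls_ab F E) = z E"
begin

lemma heart_stability_function: "stability_function F W"
  unfolding stability_function_def
  using abelian_H W zero_H z_upper unfolding semiclosed_upper_def by auto

lemma heart_phase: "E \<in> H \<Longrightarrow> phase F W E = ph E"
  unfolding phase_def ph_def using W(2) by simp

lemma heart_semistable: "ss E \<Longrightarrow> semistable F W E"
  unfolding semistable_def
proof (intro conjI allI impI)
  assume E: "ss E"
  show "E \<in> obj F" "\<not> zero_object F E" using ssD[OF E] zero_H by auto
  fix m assume m: "monic F m \<and> tgt F m = E \<and> \<not> zero_object F (src F m)"
  then have "m \<in> hm (src D m) E" unfolding monic_def by (simp add: arr_full_sub hom_set_def)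
  then obtain C g h where "tri (src D m) E C m g h" "src D m \<in> H" "C \<in> H"
    using monic_tri[OF shift_V_U] m by blast
  then show "phase F W (src F m) \<le> phase F W E"
    using ssD(3)[OF E, of "src D m" C] m zero_H heart_phase ssD(1)[OF E] tr_iff by auto
qed

theorem heart_HN_property: assumes HN_all shows "HN_property F W"
  unfolding HN_property_def
proof (intro ballI impI)
  fix E assume "E \<in> obj F" "\<not> zero_object F E"
  then have E: "E \<in> H" by simp
  obtain \<phi>s where p: "sorted_wrt (>) \<phi>s" "set \<phi>s \<subseteq> {0<..1}" "E \<in> starl (map SS \<phi>s)" using HN_allD[OF assms E] .
  obtain n F' Q \<phi> where "HN_filtration D SS \<phi>s E n F' Q \<phi>" using star_list_filtration[OF SS_isoc p(3,1)] by blast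
  note h = HN_filtrationD[OF this]
  have FH: "F' i \<in> H" if "i \<le> n" for i using h(5)[OF that] starl_SS_H by blast
  have Q: "ss (Q i)" "ph (Q i) = \<phi> i" "Q i \<in> H" if "i < n" for i
    using h(3)[OF that] SS_nonzero SS_H by blast+
  have "\<exists>f\<in>hom_set F (F' i) (F' (Suc i)). \<exists>g\<in>hom_set F (F' (Suc i)) (Q i). short_exact F f g" if i: "i < n" for i
  proof -
    obtain f g k where t: "tri (F' i) (F' (Suc i)) (Q i) f g k" using h(3)[OF i] tr_iff by blast
    moreover have "F' i \<in> H" "F' (Suc i) \<in> H" using FH i by auto
    ultimately show ?thesis using tri_short_exact[OF t] triD[OF t] Q[OF i] by (auto simp: Bex_def hom_set_full_sub)
  qed
  then show "\<exists>n F'' Q. zero_object F (F'' 0) \<and> F'' n = E \<and>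
           (\<forall>i<n. semistable F W (Q i) \<and>
              (\<exists>f\<in>hom_set F (F'' i) (F'' (Suc i)). \<exists>g\<in>hom_set F (F'' (Suc i)) (Q i). short_exact F f g)) \<and>
           (\<forall>i j. i < j \<and> j < n \<longrightarrow> phase F W (Q j) < phase F W (Q i))"
    using h(1,2,4) heart_semistable[OF Q(1)] heart_phase[OF Q(3)] Q(2) zero_H
    by (intro exI[of _ n] exI[of _ F'] exI[of _ Q]) auto
qed

end

text \<open>The integer \<open>n\<close> with \<open>\<phi>\<close> in \<open>(n, n + 1]\<close>, so that semistable objects of phase \<open>\<phi>\<close>
  lie in \<open>H[n]\<close>.\<close>

definition floor_phase :: "real \<Rightarrow> int" where "floor_phase \<phi> = \<lceil>\<phi>\<rceil> - 1"

definition slice :: "real \<Rightarrow> 'o set" where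
  "slice \<phi> = {E \<in> obj D. shift_obj D (- floor_phase \<phi>) E \<in> SS (\<phi> - real_of_int (floor_phase \<phi>))}"

lemma floor_phase_range: "\<phi> - real_of_int (floor_phase \<phi>) \<in> {0<..1}"
proof -
  have "real_of_int (floor_phase \<phi>) = real_of_int \<lceil>\<phi>\<rceil> - 1" by (simp add: floor_phase_def)
  moreover have "\<phi> \<le> real_of_int \<lceil>\<phi>\<rceil>" "real_of_int \<lceil>\<phi>\<rceil> < \<phi> + 1" by linarith+
  ultimately show ?thesis by auto
qed

lemma floor_phase_eq: "\<phi> \<in> {0<..1} \<Longrightarrow> floor_phase (\<phi> + real_of_int n) = n"
proof -
  assume "\<phi> \<in> {0<..1}"
  then have "\<lceil>\<phi>\<rceil> = 1" by (simp add: ceiling_eq_iff)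
  then show ?thesis by (simp add: floor_phase_def)
qed

lemma slice_shifted: assumes "\<phi> \<in> {0<..1}" shows "E \<in> slice (\<phi> + real_of_int n) \<longleftrightarrow> E \<in> obj D \<and> sh (- n) E \<in> SS \<phi>"
  unfolding slice_def using floor_phase_eq[OF assms] by simp

lemma slice_unit: assumes "\<phi> \<in> {0<..1}" shows "slice \<phi> = SS \<phi>"
  using slice_shifted[OF assms, of _ 0] SS_H T_obj by auto

lemma slice_ex: obtains \<psi> n where "\<psi> \<in> {0<..1}" "\<phi> = \<psi> + real_of_int n"
  using floor_phase_range[of \<phi>] that[of "\<phi> - real_of_int (floor_phase \<phi>)" "floor_phase \<phi>"] by simp

lemma slice_isoc: "isoc (slice \<phi>)"
  unfolding iso_closed_def
proof (intro conjI ballI allI impI)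
  fix A B assume "A \<in> slice \<phi>" "isomorphic D A B"
  then show "B \<in> slice \<phi>"
    using isocD(1)[OF SS_isoc _ shift_isomorphic] isomorphic_obj(2) unfolding slice_def by blast
qed (auto simp: slice_def)

lemma U_shift_nat: "A \<in> U \<Longrightarrow> sh (int k) A \<in> U"
proof (induction k)
  case (Suc k)
  then show ?case using U_shift[OF Suc.IH[OF Suc.prems]] t_pair_obj(1)[OF tU Suc.prems] by (simp add: add.commute)
qed (use t_pair_obj(1)[OF tU] in simp)

lemma V'_shift_nat: "A \<in> V' \<Longrightarrow> sh (- int k) A \<in> V'"
proof (induction k)
  case (Suc k)
  then show ?case using V'_shift[OF Suc.IH[OF Suc.prems]] t_pair_obj(2)[OF tV Suc.prems] by (simp add: add.commute)
qed (use t_pair_obj(2)[OF tV] in simp)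

lemma U_shift_pos: assumes "A \<in> U" "k \<ge> 1" shows "sh k A \<in> V"
proof -
  have "sh (int (nat (k - 1))) A \<in> U" by (rule U_shift_nat[OF assms(1)])
  then have "sh 1 (sh (k - 1) A) \<in> V" using shift_U_V assms(2) by simp
  then show ?thesis using t_pair_obj(1)[OF tU assms(1)] by simp
qed

lemma slice_orth: assumes "\<phi> > \<psi>" "A \<in> slice \<phi>" "B \<in> slice \<psi>" shows "hz A B"
proof -
  obtain a m where a: "a \<in> {0<..1}" "\<phi> = a + real_of_int m" by (rule slice_ex)
  obtain b n where b: "b \<in> {0<..1}" "\<psi> = b + real_of_int n" by (rule slice_ex)
  have A: "A \<in> obj D" "sh (- m) A \<in> SS a" and B: "B \<in> obj D" "sh (- n) B \<in> SS b"
    using assms slice_shifted a b by auto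
  have "real_of_int m > real_of_int n - 1" using assms(1) a b by auto
  then have "m > n - 1" by linarith
  have "hz (sh (- n) A) (sh (- n) B)"
  proof (cases "m = n")
    case True
    then show ?thesis using SS_orth[OF _ A(2)] B(2) a b assms(1) by auto
  next
    case False
    then have "m - n \<ge> 1" using \<open>m > n - 1\<close> by linarith
    then have "sh (m - n) (sh (- m) A) \<in> V" using U_shift_pos TD(1)[OF SS_H[OF A(2)]] by blast
    then have "sh (- n) A \<in> V" using A(1) by simp
    then show ?thesis using t_pair_orth[OF tV] TD(2)[OF SS_H[OF B(2)]] by blast
  qed
  then show ?thesis using hz_shift A B by blast
qed

lemma z_shift_int: assumes "A \<in> obj D" shows "z (sh n A) = cis (pi * real_of_int n) * z A"
proof -
  have p: "z (sh (int k) A) = cis (pi * real k) * z A" if "A \<in> obj D" for k A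
  proof (induction k)
    case (Suc k)
    have "z (sh 1 (sh (int k) A)) = - z (sh (int k) A)" using z_shift[of "sh (int k) A"] that by (simp del: shift_simps(3))
    moreover have "cis (pi * real (Suc k)) = - cis (pi * real k)" by (simp add: distrib_left cis_mult[symmetric])
    ultimately show ?case using Suc that by simp
  qed (use that in simp)
  show ?thesis
  proof (cases "n \<ge> 0")
    case True then show ?thesis using p[OF assms, of "nat n"] by simp
  next
    case False
    define k where "k = nat (- n)"
    have n: "n = - int k" using False by (simp add: k_def)
    have "z (sh (int k) (sh n A)) = cis (pi * real k) * z (sh n A)" using p[of "sh n A" k] assms by simp
    then have "z A = cis (pi * real k) * z (sh n A)" using assms n by simp
    then have "cis (- (pi * real k)) * z A = z (sh n A)"
      by (simp add: mult.assoc[symmetric] cis_mult)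
    then show ?thesis using n by simp
  qed
qed

text \<open>The hypotheses confine the phases of \<open>E\<close> to \<open>(a, a + k]\<close>. Truncation splits off the
  part in the highest unit interval, a shift of an object of \<open>H\<close>, and the remainder is
  treated by induction.\<close>

lemma slice_HN_aux:
  assumes HN_all
  shows "E \<in> obj D \<Longrightarrow> sh (- a) E \<in> U \<Longrightarrow> sh (- (a + int k - 1)) E \<in> V' \<Longrightarrow>
    \<exists>\<phi>s. sorted_wrt (>) \<phi>s \<and> set \<phi>s \<subseteq> {real_of_int a<..real_of_int a + real k} \<and> E \<in> starl (map slice \<phi>s)"
proof (induction k arbitrary: E)
  case 0
  have "sh 1 (sh (- a) E) \<in> V" using shift_U_V 0 by blast
  then have "sh (- a + 1) E \<in> V" using 0(1) by (simp add: add.commute)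
  then have "hz (sh (- a + 1) E) (sh (- a + 1) E)" using t_pair_orth[OF tV] 0(3) by simp
  then have "zero_object D (sh (- a + 1) E)" using hz_ident_zero 0(1) by simp
  then have "zero_object D E" using shift_zero_object[of "sh (- a + 1) E" "a - 1"] 0(1) by simp
  then show ?case by (intro exI[of _ "[]"]) simp
next
  case (Suc k)
  define b where "b = a + int k"
  let ?E = "sh (- b) E"
  have EV: "?E \<in> V'" using Suc.prems(3) by (simp add: b_def)
  have oE: "?E \<in> obj D" using Suc.prems by simp
  obtain X Y where t: "tr X ?E Y" and X: "X \<in> U" and Y: "Y \<in> U'" using t_pairD(3)[OF tU oE] by (rule starE)
  note o = tr_obj[OF t]
  have "X \<in> V'" using t_pair_ext2[OF tV tr_unrot[OF t] V'_shift[OF U'_sub_V'[OF Y]] EV] .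
  then have XH: "X \<in> H" using TI X by blast
  obtain \<psi>s where \<psi>: "sorted_wrt (>) \<psi>s" "set \<psi>s \<subseteq> {0<..1}" "X \<in> starl (map SS \<psi>s)" using HN_allD[OF assms XH] .
  have t': "tr (sh b X) E (sh b Y)" using tr_shift[OF t, of b] Suc.prems(1) by simp
  let ?\<psi>s = "map (\<lambda>x. x + real_of_int b) \<psi>s"
  have "sh b X \<in> starl (map slice (map (\<lambda>x. x + real_of_int b) \<psi>s))" using \<psi>(2,3)
  proof (induction \<psi>s arbitrary: X)
    case Nil then show ?case using shift_zero_object by simp
  next
    case (Cons x xs)
    then obtain A R where r: "tr A X R" "A \<in> SS x" "R \<in> starl (map SS xs)" by (auto elim: starE)
    have "sh b A \<in> slice (x + real_of_int b)"
      using slice_shifted[of x "sh b A" b] Cons.prems(1) r(2) tr_obj[OF r(1)] by simp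
    moreover have "sh b R \<in> starl (map slice (map (\<lambda>x. x + real_of_int b) xs))" using Cons r by simp
    ultimately show ?case using tr_shift[OF r(1), of b] by (auto intro: starI)
  qed
  moreover have "sorted_wrt (>) ?\<psi>s" using \<psi>(1) by (simp add: sorted_wrt_map)
  moreover have sb: "\<And>x. x \<in> set ?\<psi>s \<Longrightarrow> real_of_int b < x \<and> x \<le> real_of_int b + 1" using \<psi>(2) by auto
  moreover have "\<exists>\<phi>s. sorted_wrt (>) \<phi>s \<and> set \<phi>s \<subseteq> {real_of_int a<..real_of_int a + real k} \<and> sh b Y \<in> starl (map slice \<phi>s)"
  proof (rule Suc.IH)
    show "sh b Y \<in> obj D" using o by simp
    have "tr (sh (int k) ?E) (sh (int k) Y) (sh (int k) (sh 1 X))" using tr_shift[OF tr_rot[OF t]] .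
    moreover have "sh (int k) ?E \<in> U" using Suc.prems(1,2) by (simp add: b_def)
    moreover have "sh (int k) (sh 1 X) \<in> U" using U_shift_nat[OF U_shift[OF X]] .
    ultimately have "sh (int k) Y \<in> U" using t_pair_ext1[OF tU] by blast
    then show "sh (- a) (sh b Y) \<in> U" using o by (simp add: b_def)
    have "hz A (sh 1 Y)" if "A \<in> V" for A
      using hz_shift1[of A Y "-1"] t_pair_orth[OF tU shift_V_U[OF that] Y] t_pair_obj(1)[OF tV that] o by simp
    then have "sh 1 Y \<in> V'" using t_pairD(2)[OF tV] o by simp
    then show "sh (- (a + int k - 1)) (sh b Y) \<in> V'" using o by (simp add: b_def)
  qed
  then obtain \<phi>s where p: "sorted_wrt (>) \<phi>s" "set \<phi>s \<subseteq> {real_of_int a<..real_of_int a + real k}" "sh b Y \<in> starl (map slice \<phi>s)"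
    by blast
  ultimately have "E \<in> starl (map slice ?\<psi>s) \<star> starl (map slice \<phi>s)" using t' p by (auto intro: starI)
  then have "E \<in> starl (map slice (?\<psi>s @ \<phi>s))" by (simp only: map_append starl_append)
  moreover have "sorted_wrt (>) (?\<psi>s @ \<phi>s)"
    unfolding sorted_wrt_append
  proof (intro conjI ballI)
    show "sorted_wrt (>) ?\<psi>s" using \<psi>(1) by (simp add: sorted_wrt_map)
    show "x > y" if "x \<in> set ?\<psi>s" "y \<in> set \<phi>s" for x y
    proof -
      have "y \<le> real_of_int b" using subsetD[OF p(2) that(2)] by (simp add: b_def)
      then show ?thesis using sb[OF that(1)] by simp
    qed
  qed (rule p)
  moreover have "set (?\<psi>s @ \<phi>s) \<subseteq> {real_of_int a<..real_of_int a + real (Suc k)}"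
  proof
    fix x assume "x \<in> set (?\<psi>s @ \<phi>s)"
    then consider "x \<in> set ?\<psi>s" | "x \<in> set \<phi>s" by auto
    then show "x \<in> {real_of_int a<..real_of_int a + real (Suc k)}"
    proof cases
      case 1 then show ?thesis using sb[of x] by (simp add: b_def)
    next
      case 2 then show ?thesis using subsetD[OF p(2)] by fastforce
    qed
  qed
  ultimately show ?case by blast
qed

text \<open>The slicing consists of the shifted semistable objects. It is additive because
  semistable objects of one phase are closed under extensions, which uses that
  filtrations exist.\<close>

theorem stability_from_heart:
  assumes HN: HN_all
    and bounded: "\<And>E. E \<in> obj D \<Longrightarrow> \<exists>a b. shift_obj D (- a) E \<in> U \<and> shift_obj D (- b) E \<in> V'"
  shows "\<exists>W. stability_condition D (W, slice) \<and> (\<forall>E\<in>obj D. W (cls_tri D E) = z E) \<and> interval_cat D slice {0<..1} = H"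
proof -
  have "\<exists>W\<in>hom (groth_group (obj D) (triangle_rel D)) complex_add_group. \<forall>E\<in>obj D. W (groth_class (obj D) (triangle_rel D) E) = z E"
    by (rule groth_hom_exists[OF triangle_rel_sub]) (use triangle_rel_tr z_tr in blast)
  then obtain W where W: "W \<in> hom (K0_tri D) complex_add_group" "\<And>E. E \<in> obj D \<Longrightarrow> W (cls_tri D E) = z E"
    unfolding K0_tri_def cls_tri_def by blast
  have HNf: "\<exists>\<phi>s. sorted_wrt (>) \<phi>s \<and> E \<in> starl (map slice \<phi>s)" if E: "E \<in> obj D" for E
  proof -
    obtain a b where ab: "sh (- a) E \<in> U" "sh (- b) E \<in> V'" using bounded[OF E] by blast
    define k where "k = nat (b - a + 1)"
    have "sh (- int (nat (a - 1 - b))) (sh (- b) E) \<in> V'" by (rule V'_shift_nat[OF ab(2)])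
    then have "sh (- (a + int k - 1)) E \<in> V'" using E unfolding k_def by (cases "b \<ge> a - 1") (simp_all add: algebra_simps)
    then show ?thesis using slice_HN_aux[OF HN E ab(1)] by blast
  qed
  have "stability_condition D (W, slice)"
    unfolding stability_condition_def split_conv
  proof (intro conjI allI impI ballI)
    show "W \<in> hom (K0_tri D) complex_add_group" by (rule W)
    show "additive_subcategory D (slice \<phi>)" for \<phi>
      unfolding additive_subcategory_def
    proof (intro conjI allI impI ballI)
      show "slice \<phi> \<subseteq> obj D" by (auto simp: slice_def)
      show "X \<in> slice \<phi>" if "zero_object D X" for X
        using shift_zero_object[OF that] zero_objD(1)[OF that] H_zero unfolding slice_def SS_def by blast
      show "B \<in> slice \<phi>" if "A \<in> slice \<phi>" "isomorphic D A B" for A B using isocD(1)[OF slice_isoc that] .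
      show "B \<in> slice \<phi>" if A: "A1 \<in> slice \<phi>" "A2 \<in> slice \<phi>" and B: "B \<in> obj D" "is_biproduct D A1 A2 B" for A1 A2 B
      proof -
        have "tr A1 B A2" using biproduct_tr[OF B(2)] A unfolding slice_def by blast
        note t = tr_shift[OF this, of "- floor_phase \<phi>"]
        have "sh (- floor_phase \<phi>) B \<in> SS (\<phi> - real_of_int (floor_phase \<phi>))"
          by (rule SS_ext[OF HN_all_sub_ss[OF HN] t]) (use A in \<open>auto simp: slice_def\<close>)
        then show ?thesis using B unfolding slice_def by blast
      qed
    qed
    show "shift_obj D 1 ` slice \<phi> = slice (\<phi> + 1)" for \<phi>
    proof -
      obtain a m where a: "a \<in> {0<..1}" "\<phi> = a + real_of_int m" by (rule slice_ex)
      have e: "\<phi> + 1 = a + real_of_int (m + 1)" using a by simp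
      show ?thesis
      proof
        have "sh 1 E \<in> slice (a + real_of_int (m + 1))" if "E \<in> slice \<phi>" for E
          using that unfolding slice_shifted[OF a(1)] a(2) by simp
        then show "shift_obj D 1 ` slice \<phi> \<subseteq> slice (\<phi> + 1)" unfolding e by blast
        show "slice (\<phi> + 1) \<subseteq> shift_obj D 1 ` slice \<phi>"
        proof
          fix E assume "E \<in> slice (\<phi> + 1)"
          then have "E \<in> obj D \<and> sh (- (m + 1)) E \<in> SS a" unfolding e slice_shifted[OF a(1)] .
          then have E: "E \<in> obj D" "sh (- (m + 1)) E \<in> SS a" by blast+
          then have "sh (-1) E \<in> slice \<phi>" unfolding slice_shifted[OF a(1)] a(2) by simp
          moreover have "E = sh 1 (sh (-1) E)" using E by simp
          ultimately show "E \<in> shift_obj D 1 ` slice \<phi>" by blast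
        qed
      qed
    qed
    show "hom_set D A B = {zr A B}" if "\<psi> < \<phi>" "A \<in> slice \<phi>" "B \<in> slice \<psi>" for \<phi> \<psi> A B
      using slice_orth[OF that] hz_set that unfolding slice_def by blast
    show "\<exists>r>0. W (cls_tri D E) = complex_of_real r * cis (pi * \<phi>)" if E: "E \<in> slice \<phi>" "\<not> zero_object D E" for \<phi> E
    proof -
      obtain a m where a: "a \<in> {0<..1}" "\<phi> = a + real_of_int m" by (rule slice_ex)
      let ?A = "sh (- m) E"
      have A: "E \<in> obj D" "?A \<in> SS a" using E slice_shifted[OF a(1)] a(2) by auto
      have nz: "\<not> zero_object D ?A" using shift_zero_object[of ?A m] E A by auto
      have "ph ?A = a" "?A \<in> H" using SS_nonzero[OF A(2) nz] SS_H[OF A(2)] by auto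
      then have "Arg (z ?A) = pi * a" "z ?A \<noteq> 0" using semiclosed_upper_Arg(3)[OF z_upper[OF _ nz]] by (auto simp: ph_def field_simps)
      then have zA: "z ?A = complex_of_real (norm (z ?A)) * cis (pi * a)" "norm (z ?A) > 0"
        using rcis_cmod_Arg[of "z ?A"] by (auto simp: rcis_def)
      have "z E = cis (pi * real_of_int m) * z ?A" using z_shift_int[of ?A m] A by simp
      also have "\<dots> = complex_of_real (norm (z ?A)) * (cis (pi * real_of_int m) * cis (pi * a))"
        by (subst zA(1)) simp
      also have "\<dots> = complex_of_real (norm (z ?A)) * cis (pi * \<phi>)" using a(2) by (simp add: cis_mult algebra_simps)
      finally show ?thesis using zA(2) W(2)[OF A(1)] by auto
    qed
    show "\<exists>n F Q \<phi>. zero_object D (F 0) \<and> F n = E \<and>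
           (\<forall>i<n. Q i \<in> slice (\<phi> i) \<and> \<not> zero_object D (Q i) \<and>
              (\<exists>f g h. (f, g, h) \<in> distinguished D \<and>
                 src D f = F i \<and> src D g = F (Suc i) \<and> src D h = Q i)) \<and>
           (\<forall>i j. i < j \<and> j < n \<longrightarrow> \<phi> j < \<phi> i)" if E: "E \<in> obj D" "\<not> zero_object D E" for E
    proof -
      obtain \<phi>s where p: "sorted_wrt (>) \<phi>s" "E \<in> starl (map slice \<phi>s)" using HNf[OF E(1)] by blast
      obtain n F Q \<phi> where "HN_filtration D slice \<phi>s E n F Q \<phi>" using star_list_filtration[OF slice_isoc p(2,1)] by blast
      note h = HN_filtrationD[OF this]
      show ?thesis
        by (rule exI[of _ n], rule exI[of _ F], rule exI[of _ Q], rule exI[of _ \<phi>])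
          (use h(1,2,3,4) in \<open>unfold triangle_on_def, simp\<close>)
    qed
  qed
  moreover from this interpret S: stability_on D W slice by unfold_locales
  have "interval_cat D slice {0<..1} = H"
  proof
    show "interval_cat D slice {0<..1} \<subseteq> H"
    proof
      fix E assume "E \<in> interval_cat D slice {0<..1}"
      then show "E \<in> H"
      proof (induction rule: S.PI_induct)
        case (base \<phi> E) then show ?case using slice_unit SS_H by blast
      next
        case (ext A E B) show ?case by (rule T_ext[OF ext(1)]) (rule ext)+
      qed
    qed
    show "H \<subseteq> interval_cat D slice {0<..1}"
    proof
      fix E assume "E \<in> H"
      then obtain \<phi>s where p: "set \<phi>s \<subseteq> {0<..1}" "E \<in> starl (map SS \<phi>s)" using HN_allD[OF HN] by blast
      have "map slice \<phi>s = map SS \<phi>s" using slice_unit p(1) by (intro map_cong refl) blast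
      then have "E \<in> starl (map slice \<phi>s)" using p(2) by (simp only:)
      moreover have "{0<..1::real} \<noteq> {}" by simp
      ultimately show "E \<in> interval_cat D slice {0<..1}" using S.starl_PI[OF p(1)] by blast
    qed
  qed
  ultimately show ?thesis using W(2) by blast
qed

end

section \<open>Harder-Narasimhan filtrations for a discrete imaginary part\<close>

text \<open>By \<open>acc0\<close>, ascending chains of subobjects, recorded by their quotients \<open>C n\<close>,
  stabilize when all subquotients \<open>G n\<close> have real charge.\<close>

locale discrete_heart = heart D U U' V V' H z
  for D :: "('o, 'm, 'z) tricat_scheme" and U U' V V' H z +
  fixes c :: real
  assumes c_pos: "c > 0" and gap: "E \<in> H \<Longrightarrow> Im (z E) = 0 \<or> c \<le> Im (z E)"
    and acc0: "(\<And>n. C n \<in> H \<and> G n \<in> H \<and> Im (z (G n)) = 0 \<and> triangle_on D (G n) (C n) (C (Suc n))) \<Longrightarrow>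
      \<exists>N. \<forall>n\<ge>N. zero_object D (G n)"
begin

lemma Im_tr: "tr A E B \<Longrightarrow> Im (z E) = Im (z A) + Im (z B)"
  using z_tr by simp

definition rank :: "'o \<Rightarrow> nat" where "rank E = nat \<lfloor>Im (z E) / c\<rfloor>"

lemma rank_less: assumes "E \<in> H" "A \<in> H" "Im (z A) \<le> Im (z E) - c" shows "rank A < rank E"
proof -
  have "Im (z A) / c \<le> Im (z E) / c - 1" using assms(3) c_pos by (simp add: field_simps)
  moreover have "0 \<le> Im (z A) / c" using Im_nonneg[OF assms(2)] c_pos by simp
  ultimately show ?thesis unfolding rank_def by linarith
qed

text \<open>Otherwise, subobjects with real charge could be divided out forever.\<close>

lemma torsion_decomposition: assumes "E \<in> H"
  shows "\<exists>T\<in>H. \<exists>F\<in>H. tr T E F \<and> Im (z T) = 0 \<and> (\<forall>A\<in>H. Im (z A) = 0 \<longrightarrow> hz A F)" (is "?good E")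
proof (rule ccontr)
  assume bad: "\<not> ?good E"
  have "\<exists>f. \<forall>n. (f n \<in> H \<and> \<not> ?good (f n)) \<and>
      (\<exists>G\<in>H. Im (z G) = 0 \<and> \<not> zero_object D G \<and> tr G (f n) (f (Suc n)))"
  proof (rule dependent_nat_choice)
    show "\<exists>x. x \<in> H \<and> \<not> ?good x" using bad assms by blast
    fix C n assume C: "C \<in> H \<and> \<not> ?good C"
    obtain X where X: "zero_object D X" using ex_zero_object by blast
    have "tr X C C" using tr_zero_left[OF isomorphic_refl X] C T_obj by blast
    moreover have "Im (z X) = 0" "X \<in> H" using H_zero[OF X] z_zero[OF X] by auto
    ultimately obtain A where A: "A \<in> H" "Im (z A) = 0" "\<not> hz A C" using C by blast
    then obtain f where f: "f \<in> hm A C" "f \<noteq> zr A C" unfolding hom_zero_def by blast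
    obtain K I Q where I: "tr K A I" "tr I C Q" "K \<in> H" "I \<in> H" "Q \<in> H" "\<not> zero_object D I"
      using H_image[OF f A(1)] C by blast
    have I0: "Im (z I) = 0" using Im_tr[OF I(1)] A(2) Im_nonneg[OF I(3)] Im_nonneg[OF I(4)] by simp
    have "\<not> ?good Q"
    proof
      assume "?good Q"
      then obtain T F' where T: "T \<in> H" "F' \<in> H" "tr T Q F'" "Im (z T) = 0" "\<forall>A\<in>H. Im (z A) = 0 \<longrightarrow> hz A F'" by blast
      obtain Y where Y: "tr I Y T" "tr Y C F'" using tr_assoc2[OF I(2) T(3)] .
      have "Y \<in> H" "Im (z Y) = 0" using T_ext[OF Y(1) I(4) T(1)] Im_tr[OF Y(1)] I0 T(4) by auto
      then show False using C Y(2) T(2,5) by blast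
    qed
    then show "\<exists>y. (y \<in> H \<and> \<not> ?good y) \<and> (\<exists>G\<in>H. Im (z G) = 0 \<and> \<not> zero_object D G \<and> tr G C y)"
      using I I0 by blast
  qed
  then obtain f where f: "\<And>n. f n \<in> H" "\<And>n. \<exists>G\<in>H. Im (z G) = 0 \<and> \<not> zero_object D G \<and> tr G (f n) (f (Suc n))" by blast
  then obtain G where G: "\<And>n. G n \<in> H \<and> Im (z (G n)) = 0 \<and> \<not> zero_object D (G n) \<and> tr (G n) (f n) (f (Suc n))" by metis
  then show False using acc0[of f G] f(1) by blast
qed

text \<open>The quotient by a subobject of larger phase has smaller phase than \<open>E\<close>, so less than
  1, and therefore nonzero imaginary part.\<close>

lemma destabilizing_quotient: assumes t: "tr A E C" and H: "A \<in> H" "C \<in> H" "\<not> zero_object D A" and p: "ph A > ph E"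
  shows "\<not> zero_object D C" "Im (z C) \<ge> c" "ph C < ph E"
proof -
  have E: "E \<in> H" "\<not> zero_object D E" using T_ext[OF t H(1,2)] nonzero_ext[OF t H] by auto
  show C: "\<not> zero_object D C" using tr_zero_right_iso[OF t] ph_iso p by fastforce
  show l: "ph C < ph E" using seesaw(1,2)[OF t H C] p by linarith
  then have "ph C \<noteq> 1" using ph_range[OF E] by simp
  then show "Im (z C) \<ge> c" using ph_one_iff[OF H(2) C] gap[OF H(2)] by blast
qed

text \<open>A destabilizing subobject has smaller rank, because its quotient takes away at least
  \<open>c\<close>.\<close>

lemma sub_ss_all: "E \<in> H \<Longrightarrow> \<not> zero_object D E \<Longrightarrow> sub_ss E"
proof (induction "rank E" arbitrary: E rule: less_induct)
  case less
  obtain X where X: "zero_object D X" using ex_zero_object by blast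
  show ?case
  proof (cases "ss E")
    case True
    have "tr E E X" using tr_zero_right[OF isomorphic_refl X] less T_obj by blast
    then show ?thesis unfolding sub_ss_def using True less H_zero[OF X] by blast
  next
    case False
    then obtain A C where A: "A \<in> H" "C \<in> H" "tr A E C" "\<not> zero_object D A" "ph A > ph E"
      using less unfolding ss_def by (auto simp: not_le)
    have "Im (z A) \<le> Im (z E) - c" using destabilizing_quotient(2)[OF A(3,1,2,4,5)] Im_tr[OF A(3)] by simp
    then have "sub_ss A" using less(1)[OF rank_less[OF less(2) A(1)] A(1,4)] by blast
    then obtain B Y where B: "B \<in> H" "Y \<in> H" "tr B A Y" "ss B" "ph A \<le> ph B" unfolding sub_ss_def by blast
    obtain S where "tr B E S" "S \<in> H" using sub_of_sub[OF B(3) A(3) B(2) A(2)] .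
    then show ?thesis unfolding sub_ss_def using B A(5) by fastforce
  qed
qed

text \<open>A maximal destabilizing quotient. Its minimality is expressed by the vanishing of
  arrows to all semistable objects of smaller phase, which passes along extensions
  without keeping track of factorizations.\<close>

definition mdq :: "'o \<Rightarrow> 'o \<Rightarrow> bool" where
  "mdq E B \<longleftrightarrow> (\<exists>K\<in>H. triangle_on D K E B) \<and> ss B \<and> ph B \<le> ph E \<and> (\<forall>B'. ss B' \<longrightarrow> ph B' < ph B \<longrightarrow> hom_zero D E B')"

lemma ss_Im_zero: assumes "E \<in> H" "\<not> zero_object D E" "Im (z E) = 0" shows "ss E" "ph E = 1"
proof -
  show p: "ph E = 1" using ph_one_iff assms by blast
  show "ss E" unfolding ss_def using assms p ph_range by simp
qed

text \<open>The subobject \<open>T\<close> with real charge has phase 1 and is invisible for quotients of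
  smaller phase. If the rest \<open>F'\<close> is not semistable, dividing by a semistable
  destabilizing subobject \<open>A\<close> lowers the rank: as \<open>F'\<close> receives no nonzero arrows from
  objects with real charge, the imaginary part of \<open>A\<close> is at least \<open>c\<close>. A maximal
  destabilizing quotient of \<open>F'/A\<close> also serves for \<open>E\<close>, since its phase is smaller
  than that of \<open>A\<close>.\<close>

lemma mdq_exists: "E \<in> H \<Longrightarrow> \<not> zero_object D E \<Longrightarrow> \<exists>B. mdq E B"
proof (induction "rank E" arbitrary: E rule: less_induct)
  case less
  obtain X where X: "zero_object D X" using ex_zero_object by blast
  have self: "mdq E E" if "ss E"
    using that tr_zero_left[OF isomorphic_refl X] T_obj[OF less(2)] H_zero[OF X] ss_hom_zero unfolding mdq_def by blast
  obtain T F' where T: "T \<in> H" "F' \<in> H" "tr T E F'" "Im (z T) = 0" "\<And>A. A \<in> H \<Longrightarrow> Im (z A) = 0 \<Longrightarrow> hz A F'"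
    using torsion_decomposition[OF less(2)] by blast
  have Thz: "hz T B'" if "ss B'" "ph B' < 1" for B'
  proof (cases "zero_object D T")
    case True then show ?thesis using hz_zero by blast
  next
    case False then show ?thesis using ss_hom_zero[OF ss_Im_zero(1)[OF T(1) False T(4)] that(1)] ss_Im_zero(2)[OF T(1) False T(4)] that by simp
  qed
  show ?case
  proof (cases "zero_object D F'")
    case True
    then have "Im (z E) = 0" using Im_tr[OF T(3)] T(4) z_zero by simp
    then show ?thesis using self ss_Im_zero less by blast
  next
    case F: False
    have pF: "ph F' \<le> ph E"
    proof (cases "zero_object D T")
      case True then show ?thesis using tr_zero_left_iso[OF T(3)] ph_iso by simp
    next
      case False
      have "ph T = 1" using ss_Im_zero[OF T(1) False T(4)] by blast
      then have "ph E \<le> ph T" using ph_range[OF less(2,3)] by simp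
      then show ?thesis using seesaw(2)[OF T(3,1,2) False F] by (meson not_le)
    qed
    show ?thesis
    proof (cases "ss F'")
      case True
      have "hz E B'" if "ss B'" "ph B' < ph F'" for B'
        using hz_tr_left[OF T(3) Thz[OF that(1)] ss_hom_zero[OF True that]] that ph_range[OF T(2) F] by simp
      then show ?thesis using True T pF unfolding mdq_def by blast
    next
      case False
      then obtain A0 C0 where A0: "A0 \<in> H" "C0 \<in> H" "tr A0 F' C0" "\<not> zero_object D A0" "ph A0 > ph F'"
        using T(2) F unfolding ss_def by (auto simp: not_le)
      obtain A Y where A: "A \<in> H" "Y \<in> H" "tr A A0 Y" "ss A" "ph A0 \<le> ph A" using sub_ss_all[OF A0(1,4)] unfolding sub_ss_def by blast
      obtain E' where E': "tr A F' E'" "E' \<in> H" using sub_of_sub[OF A(3) A0(3) A(2) A0(2)] .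
      have pA: "ph A > ph F'" using A A0 by simp
      have An: "\<not> zero_object D A" using ssD(2)[OF A(4)] .
      note dq = destabilizing_quotient[OF E'(1) A(1) E'(2) An pA]
      have "Im (z A) \<noteq> 0"
      proof
        assume "Im (z A) = 0"
        then have "hz A F'" using T(5)[OF A(1)] by blast
        then show False using tr_sub_zero[OF E'(1)] T_hz(2)[OF A(1) E'(2)] An by blast
      qed
      then have "Im (z A) \<ge> c" using gap[OF A(1)] by blast
      then have "Im (z E') \<le> Im (z E) - c" using Im_tr[OF E'(1)] Im_tr[OF T(3)] T(4) by simp
      then obtain B where B: "mdq E' B" using less(1)[OF rank_less[OF less(2) E'(2)] E'(2) dq(1)] by blast
      then obtain K' where K': "K' \<in> H" "tr K' E' B" "ss B" "ph B \<le> ph E'" "\<And>B'. ss B' \<Longrightarrow> ph B' < ph B \<Longrightarrow> hz E' B'"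
        unfolding mdq_def by blast
      obtain W where W: "tr T W A" "tr W E E'" using tr_assoc2[OF T(3) E'(1)] .
      obtain W2 where W2: "tr W W2 K'" "tr W2 E B" using tr_assoc2[OF W(2) K'(2)] .
      have "W2 \<in> H" using T_ext[OF W2(1) T_ext[OF W(1) T(1) A(1)] K'(1)] .
      moreover have "ph B \<le> ph E" using K'(4) dq(3) pF by simp
      moreover have "hz E B'" if b: "ss B'" "ph B' < ph B" for B'
      proof -
        have l: "ph B' < ph A" "ph B' < 1" using b K'(4) dq(3) pA ph_range[OF T(2) F] by auto
        have "hz F' B'" using hz_tr_left[OF E'(1) ss_hom_zero[OF A(4) b(1) l(1)] K'(5)[OF b]] .
        then show ?thesis using hz_tr_left[OF T(3) Thz[OF b(1) l(2)]] by blast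
      qed
      ultimately show ?thesis using W2(2) K'(3) unfolding mdq_def by blast
    qed
  qed
qed

text \<open>A filtration with weakly decreasing phases. The last clause supplies the last factor
  as a quotient of \<open>E\<close> itself, with nonzero semistable \<open>B\<close>, which is what the
  comparison of phases in \<open>weak_HN_exists\<close> needs.\<close>

definition weak_HN :: "'o \<Rightarrow> real list \<Rightarrow> bool" where
  "weak_HN E \<phi>s \<longleftrightarrow> sorted_wrt (\<ge>) \<phi>s \<and> set \<phi>s \<subseteq> {0<..1} \<and> E \<in> star_list D (map SS \<phi>s) \<and>
     (\<phi>s \<noteq> [] \<longrightarrow> (\<exists>K\<in>H. \<exists>B. triangle_on D K E B \<and> ss B \<and> ph B = last \<phi>s))"

lemma weak_HN_single: assumes "ss E" shows "weak_HN E [ph E]"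
proof -
  obtain X where X: "zero_object D X" using ex_zero_object by blast
  have "E \<in> SS (ph E)" unfolding SS_def using assms ssD(1) by blast
  then have "E \<in> starl [SS (ph E)]" using starl_single[OF SS_isoc] by simp
  moreover have "tr X E E" using tr_zero_left[OF isomorphic_refl X] T_obj[OF ssD(1)[OF assms]] by blast
  ultimately show ?thesis unfolding weak_HN_def
    using ph_range[OF ssD(1,2)[OF assms]] H_zero[OF X] assms by auto
qed

text \<open>Split off a maximal destabilizing quotient \<open>B\<close> and filter the kernel \<open>K\<close>, which has
  smaller rank. If the last factor \<open>B1\<close> of \<open>K\<close> had smaller phase than \<open>B\<close>, the
  quotient \<open>Q\<close> of \<open>E\<close> that extends \<open>B\<close> by \<open>B1\<close> would have smaller phase than \<open>B\<close>, and
  so would a maximal destabilizing quotient of \<open>Q\<close>; but \<open>E\<close> has only zero arrows to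
  it.\<close>

lemma weak_HN_exists: "E \<in> H \<Longrightarrow> \<exists>\<phi>s. weak_HN E \<phi>s"
proof (induction "rank E" arbitrary: E rule: less_induct)
  case less
  show ?case
  proof (cases "zero_object D E \<or> ss E")
    case True
    then show ?thesis
    proof
      assume "zero_object D E"
      then have "weak_HN E []" unfolding weak_HN_def by simp
      then show ?thesis by blast
    qed (use weak_HN_single in blast)
  next
    case False
    obtain B where B: "mdq E B" using mdq_exists less(2) False by blast
    then obtain K where K: "K \<in> H" "tr K E B" and b: "ss B" "ph B \<le> ph E" "\<And>B'. ss B' \<Longrightarrow> ph B' < ph B \<Longrightarrow> hz E B'"
      unfolding mdq_def by blast
    note BH = ssD(1,2)[OF b(1)]
    have "Im (z B) \<noteq> 0"
    proof
      assume "Im (z B) = 0"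
      then have "ph B = 1" using ph_one_iff[OF BH] by blast
      then have "ph E = 1" using b(2) ph_range[OF less(2)] False by force
      then show False using ph_one_iff[OF less(2)] ss_Im_zero[OF less(2)] False by blast
    qed
    then have "Im (z B) \<ge> c" using gap[OF BH(1)] by blast
    then have "Im (z K) \<le> Im (z E) - c" using Im_tr[OF K(2)] by simp
    then obtain \<phi>s where p: "weak_HN K \<phi>s" using less(1)[OF rank_less[OF less(2) K(1)] K(1)] by blast
    have le: "x \<ge> ph B" if x: "x \<in> set \<phi>s" for x
    proof -
      have ne: "\<phi>s \<noteq> []" using x by auto
      then obtain K1 B1 where B1: "K1 \<in> H" "tr K1 K B1" "ss B1" "ph B1 = last \<phi>s" using p unfolding weak_HN_def by blast
      have s: "sorted_wrt (\<ge>) (butlast \<phi>s @ [last \<phi>s])" using p ne unfolding weak_HN_def by simp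
      have "x \<in> set (butlast \<phi>s @ [last \<phi>s])" using x ne by simp
      then have "x \<ge> last \<phi>s" using s unfolding sorted_wrt_append by auto
      moreover have "\<not> ph B1 < ph B"
      proof
        assume l: "ph B1 < ph B"
        obtain Q where Q: "tr B1 Q B" "tr K1 E Q" using tr_assoc1[OF B1(2) K(2)] .
        note B1H = ssD(1,2)[OF B1(3)]
        have QH: "Q \<in> H" "\<not> zero_object D Q" using T_ext[OF Q(1) B1H(1) BH(1)] nonzero_ext[OF Q(1) B1H(1) BH(1) B1H(2)] by auto
        have "ph Q < ph B" using seesaw(4)[OF Q(1) B1H(1) BH(1) B1H(2) BH(2)] l by simp
        moreover obtain B2 where "mdq Q B2" using mdq_exists[OF QH] by blast
        then obtain Y where Y: "Y \<in> H" "tr Y Q B2" "ss B2" "ph B2 \<le> ph Q" unfolding mdq_def by blast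
        ultimately have h: "hz E B2" using b(3) by simp
        obtain Y2 where Y2: "tr K1 Y2 Y" "tr Y2 E B2" using tr_assoc2[OF Q(2) Y(2)] .
        have "Y2 \<in> H" using T_ext[OF Y2(1) B1(1) Y(1)] .
        then have "zero_object D B2" using tr_quotient_zero[OF Y2(2) h] T_hz(1) ssD(1)[OF Y(3)] by blast
        then show False using ssD(2)[OF Y(3)] by blast
      qed
      ultimately show ?thesis using B1(4) by simp
    qed
    have "B \<in> starl [SS (ph B)]" using starl_single[OF SS_isoc] b(1) BH unfolding SS_def by auto
    then have "E \<in> starl (map SS \<phi>s) \<star> starl [SS (ph B)]" using K(2) p unfolding weak_HN_def by (auto intro: starI)
    then have "E \<in> starl (map SS (\<phi>s @ [ph B]))" by (simp only: map_append starl_append list.map)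
    moreover have "sorted_wrt (\<ge>) (\<phi>s @ [ph B])" using p le unfolding weak_HN_def by (simp add: sorted_wrt_append)
    moreover have "set (\<phi>s @ [ph B]) \<subseteq> {0<..1}" using p ph_range[OF BH] unfolding weak_HN_def by simp
    ultimately have "weak_HN E (\<phi>s @ [ph B])" unfolding weak_HN_def using K b(1) by auto
    then show ?thesis by blast
  qed
qed

lemma merge_equal_phases:
  "sorted_wrt (\<ge>) \<phi>s \<Longrightarrow> E \<in> starl (map SS \<phi>s) \<Longrightarrow>
    \<exists>\<psi>s. sorted_wrt (>) \<psi>s \<and> set \<psi>s \<subseteq> set \<phi>s \<and> E \<in> starl (map SS \<psi>s)"
proof (induction \<phi>s arbitrary: E)
  case Nil then show ?case by auto
next
  case (Cons a \<phi>s)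
  from Cons.prems(2) obtain A R where t: "tr A E R" "A \<in> SS a" "R \<in> starl (map SS \<phi>s)" by (auto elim: starE)
  obtain \<psi>s where q: "sorted_wrt (>) \<psi>s" "set \<psi>s \<subseteq> set \<phi>s" "R \<in> starl (map SS \<psi>s)" using Cons.IH[OF _ t(3)] Cons.prems(1) by auto
  have ge: "x \<le> a" if "x \<in> set \<psi>s" for x using that q(2) Cons.prems(1) by auto
  show ?case
  proof (cases "\<psi>s \<noteq> [] \<and> hd \<psi>s = a")
    case True
    then obtain r where r: "\<psi>s = a # r" by (cases \<psi>s) auto
    have "E \<in> SS a \<star> (SS a \<star> starl (map SS r))" using t q(3) r by (auto intro: starI)
    then have "E \<in> (SS a \<star> SS a) \<star> starl (map SS r)" by (simp add: star_assoc)
    moreover have "SS a \<star> SS a \<subseteq> SS a" using SS_ext[OF sub_ss_all] by (auto elim!: starE)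
    ultimately have "E \<in> SS a \<star> starl (map SS r)" using star_mono[of "SS a \<star> SS a" "SS a" "starl (map SS r)" "starl (map SS r)" D] by blast
    then have "E \<in> starl (map SS \<psi>s)" using r by simp
    then show ?thesis using q by (intro exI[of _ \<psi>s]) auto
  next
    case False
    have "x < a" if x: "x \<in> set \<psi>s" for x
    proof (cases \<psi>s)
      case Nil then show ?thesis using x by simp
    next
      case (Cons y ys)
      then have "y < a" using False ge[of y] by auto
      moreover have "x \<le> y" using x Cons q(1) by auto
      ultimately show ?thesis by simp
    qed
    then have "sorted_wrt (>) (a # \<psi>s)" using q(1) by simp
    moreover have "E \<in> starl (map SS (a # \<psi>s))" using t q(3) by (auto intro: starI)
    ultimately show ?thesis using q(2) by (intro exI[of _ "a # \<psi>s"]) auto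
  qed
qed

theorem discrete_HN: HN_all
  unfolding HN_all_def
proof
  fix E assume "E \<in> H"
  then obtain \<phi>s where p: "weak_HN E \<phi>s" using weak_HN_exists by blast
  then obtain \<psi>s where "sorted_wrt (>) \<psi>s" "set \<psi>s \<subseteq> set \<phi>s" "E \<in> starl (map SS \<psi>s)"
    using merge_equal_phases unfolding weak_HN_def by blast
  then show "\<exists>\<phi>s. sorted_wrt (>) \<phi>s \<and> set \<phi>s \<subseteq> {0<..1} \<and> E \<in> starl (map SS \<phi>s)"
    using p unfolding weak_HN_def by blast
qed

end

section \<open>Charges, bounds and torsion in interval categories\<close>

lemma semiclosed_upper_add: "semiclosed_upper a \<Longrightarrow> semiclosed_upper b \<Longrightarrow> semiclosed_upper (a + b)"
  unfolding semiclosed_upper_def by (auto simp: complex_is_Real_iff)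

lemma semiclosed_upper_polar: assumes "r > 0" "0 < \<phi>" "\<phi> \<le> 1" shows "semiclosed_upper (complex_of_real r * cis (pi * \<phi>))"
proof (cases "\<phi> = 1")
  case True then show ?thesis using assms by (simp add: semiclosed_upper_def)
next
  case False
  then have "0 < sin (pi * \<phi>)" using assms by (intro sin_gt_zero) auto
  then show ?thesis using assms by (simp add: semiclosed_upper_def)
qed

lemma decreasing_nat_stabilizes:
  fixes r :: "nat \<Rightarrow> nat"
  assumes "\<And>n. r (Suc n) \<le> r n"
  shows "\<exists>N. \<forall>n\<ge>N. r n = r N"
proof -
  obtain N where N: "\<And>n. r N \<le> r n" using ex_has_least_nat[of "\<lambda>_. True" 0 r] by auto
  have "r n \<le> r N" if "n \<ge> N" for n using lift_Suc_antimono_le[of r N n] that assms by blast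
  then show ?thesis using N by (metis le_antisym)
qed

lemma acc_obj_mono: "acc_obj D T \<Longrightarrow> S \<subseteq> T \<Longrightarrow> acc_obj D S"
  unfolding acc_obj_def by (meson subsetD)

lemma dcc_obj_mono: "dcc_obj D T \<Longrightarrow> S \<subseteq> T \<Longrightarrow> dcc_obj D S"
  unfolding dcc_obj_def by (meson subsetD)

lemma int_below_list: "\<exists>a::int. \<forall>x\<in>set xs. real_of_int a < x"
proof (induction xs)
  case (Cons x xs)
  then obtain a where "\<forall>x\<in>set xs. real_of_int a < x" by blast
  moreover have "real_of_int (min a (\<lfloor>x\<rfloor> - 1)) \<le> real_of_int a" "real_of_int (min a (\<lfloor>x\<rfloor> - 1)) < x" by linarith+
  ultimately show ?case by (intro exI[of _ "min a (\<lfloor>x\<rfloor> - 1)"]) fastforce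
qed simp

lemma int_above_list: "\<exists>a::int. \<forall>x\<in>set xs. x \<le> real_of_int a"
proof (induction xs)
  case (Cons x xs)
  then obtain a where "\<forall>x\<in>set xs. x \<le> real_of_int a" by blast
  moreover have "real_of_int (max a \<lceil>x\<rceil>) \<ge> real_of_int a" "real_of_int (max a \<lceil>x\<rceil>) \<ge> x" by linarith+
  ultimately show ?case by (intro exI[of _ "max a \<lceil>x\<rceil>"]) fastforce
qed simp

context stability_on
begin

lemma PI_charge_induct:
  assumes "E \<in> PI I" "\<And>\<phi> r. \<phi> \<in> I \<Longrightarrow> r > 0 \<Longrightarrow> Q (complex_of_real r * cis (pi * \<phi>))" "\<And>a b. Q a \<Longrightarrow> Q b \<Longrightarrow> Q (a + b)"
  shows "zero_object D E \<or> Q (charge E)"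
  using assms(1)
proof (induction rule: PI_induct)
  case (base \<phi> E)
  show ?case
  proof (cases "zero_object D E")
    case False
    then obtain r where "r > 0" "charge E = complex_of_real r * cis (pi * \<phi>)" using P_charge base(2) by blast
    then show ?thesis using assms(2)[OF base(1)] by simp
  qed simp
next
  case (ext A E B)
  show ?case
  proof (cases "zero_object D A")
    case True
    then have "isomorphic D E B" using tr_zero_left_iso[OF ext(1)] by blast
    then show ?thesis using ext(5) charge_simps(3) isomorphic_zero[OF isomorphic_sym] by metis
  next
    case A: False
    show ?thesis
    proof (cases "zero_object D B")
      case True
      then have "isomorphic D A E" using tr_zero_right_iso[OF ext(1)] by blast
      then show ?thesis using ext(4) A charge_simps(3) by metis
    next
      case False
      then show ?thesis using A ext(4,5) assms(3) charge_simps(1)[OF ext(1)] by simp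
    qed
  qed
qed

lemma heart_upper: "E \<in> PI {0<..1} \<Longrightarrow> zero_object D E \<or> semiclosed_upper (charge E)"
  by (erule PI_charge_induct) (auto intro: semiclosed_upper_polar semiclosed_upper_add)

lemma PI_open_Im: "E \<in> PI {0<..<1} \<Longrightarrow> zero_object D E \<or> Im (charge E) > 0"
proof (erule PI_charge_induct)
  fix \<phi> r :: real assume "\<phi> \<in> {0<..<1}" "r > 0"
  moreover from this have "0 < sin (pi * \<phi>)" by (intro sin_gt_zero) auto
  ultimately show "Im (complex_of_real r * cis (pi * \<phi>)) > 0" by simp
qed simp

lemma PI_one_Im: "E \<in> PI {1} \<Longrightarrow> Im (charge E) = 0"
  using PI_charge_induct[of E "{1}" "\<lambda>z. Im z = 0"] charge_simps(2) by auto

lemma bounded_below: "E \<in> obj D \<Longrightarrow> \<exists>a::int. E \<in> PI {real_of_int a<..}"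
proof -
  assume "E \<in> obj D"
  then obtain \<phi>s where p: "E \<in> starl (map P \<phi>s)" using HN_exists by blast
  obtain a :: int where "\<forall>x\<in>set \<phi>s. real_of_int a < x" using int_below_list by blast
  then have "set \<phi>s \<subseteq> {real_of_int a<..}" by auto
  then show ?thesis using starl_PI[of \<phi>s "{real_of_int a<..}"] p by auto
qed

lemma bounded_above: "E \<in> obj D \<Longrightarrow> \<exists>a::int. E \<in> PI {..real_of_int a}"
proof -
  assume "E \<in> obj D"
  then obtain \<phi>s where p: "E \<in> starl (map P \<phi>s)" using HN_exists by blast
  obtain a :: int where "\<forall>x\<in>set \<phi>s. x \<le> real_of_int a" using int_above_list by blast
  then have "set \<phi>s \<subseteq> {..real_of_int a}" by auto
  then show ?thesis using starl_PI[of \<phi>s "{..real_of_int a}"] p by auto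
qed

lemma PI_shift_above: assumes "E \<in> PI {a<..}" shows "sh n E \<in> PI {a + real_of_int n<..}"
proof -
  have "(\<lambda>x. x + real_of_int n) ` {a<..} \<subseteq> {a + real_of_int n<..}" by auto
  then show ?thesis using PI_shift[OF assms, of n] PI_mono by blast
qed

lemma PI_shift_below: assumes "E \<in> PI {..a}" shows "sh n E \<in> PI {..a + real_of_int n}"
proof -
  have "(\<lambda>x. x + real_of_int n) ` {..a} \<subseteq> {..a + real_of_int n}" by auto
  then show ?thesis using PI_shift[OF assms, of n] PI_mono by blast
qed

lemma t_pair_above: "t_pair D (PI {a<..}) (PI {..a})" and t_pair_from: "t_pair D (PI {b..}) (PI {..<b})"
proof -
  have c: "- {a<..} = {..a}" "- {b..} = {..<b}" by auto
  show "t_pair D (PI {a<..}) (PI {..a})" using t_pair_PI[of "{a<..}"] unfolding c by auto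
  show "t_pair D (PI {b..}) (PI {..<b})" using t_pair_PI[of "{b..}"] unfolding c by auto
qed

lemma heart_eq: "PI {0<..1} = PI {0<..} \<inter> PI {..1}"
proof -
  interpret W: t_window D "PI {0<..}" "PI {..0}" "PI {1<..}" "PI {..1}" "PI {0<..1}" by (rule window_heart)
  show ?thesis by (rule W.T_eq)
qed

lemma PI_one: "PI {1} = PI {1..} \<inter> PI {..1}"
proof -
  have c: "- {1::real..} = {..<1}" "- {..1::real} = {1<..}" "{1..} \<inter> {..1} = {1::real}" by auto
  show ?thesis using PI_Int[of "{1..}" "{..1}"] unfolding c by auto
qed

text \<open>Truncation at phase 1 inside the heart.\<close>

lemma heart_torsion: assumes "E \<in> PI {0<..1}"
  obtains T F where "tr T E F" "T \<in> PI {1}" "F \<in> PI {0<..<1}"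
proof -
  interpret W: t_window D "PI {0<..}" "PI {..0}" "PI {1..}" "PI {..<1}" "PI {0<..<1}" by (rule window_open) auto
  have E: "E \<in> PI {0<..}" "E \<in> PI {..1}" using assms heart_eq by auto
  have "E \<in> PI {1..} \<star> PI {..<1}" using t_pairD(3)[OF t_pair_from PI_obj[OF assms]] .
  then obtain T F where t: "tr T E F" "T \<in> PI {1..}" "F \<in> PI {..<1}" by (rule starE)
  have "F \<in> PI {..1}" by (rule subsetD[OF PI_mono t(3)]) auto
  then have "sh (-1) F \<in> PI {..1}" using t_pair_shift[OF t_pair_above] by blast
  then have "T \<in> PI {..1}" using t_pair_ext2[OF t_pair_above tr_unrot[OF t(1)]] E by blast
  then have T: "T \<in> PI {1}" using t PI_one by blast
  have "T \<in> PI {0<..}" by (rule subsetD[OF PI_mono t(2)]) auto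
  then have "sh 1 T \<in> PI {0<..}" using t_pairD(4)[OF t_pair_above] by blast
  then have "F \<in> PI {0<..}" using t_pair_ext1[OF t_pair_above tr_rot[OF t(1)] E(1)] by blast
  then show thesis using that[OF t(1) T] W.TI t(3) by blast
qed

lemma Im_zero_PI_one: assumes "E \<in> PI {0<..1}" "Im (charge E) = 0" shows "E \<in> PI {1}"
proof -
  obtain T F where t: "tr T E F" "T \<in> PI {1}" "F \<in> PI {0<..<1}" using heart_torsion[OF assms(1)] .
  have "Im (charge F) = 0" using charge_simps(1)[OF t(1)] PI_one_Im[OF t(2)] assms(2) by simp
  then have "zero_object D F" using PI_open_Im[OF t(3)] by simp
  then show ?thesis using tr_zero_right_iso[OF t(1)] isocD(1)[OF PI_isoc t(2)] by blast
qed

text \<open>Since \<open>G n\<close> has real charge, it lies in \<open>P(1)\<close>, so passing from \<open>C n\<close> to \<open>C (Suc n)\<close>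
  changes only the part of phase 1: the truncations of the \<open>C n\<close> form a chain in
  \<open>P(1)\<close> with the same subquotients.\<close>

lemma heart_Im_zero_chain:
  assumes acc: "acc_obj D (PI {1})"
    and CG: "\<And>n. C n \<in> PI {0<..1} \<and> G n \<in> PI {0<..1} \<and> Im (charge (G n)) = 0 \<and> triangle_on D (G n) (C n) (C (Suc n))"
  shows "\<exists>N. \<forall>n\<ge>N. zero_object D (G n)"
proof -
  have G: "G n \<in> PI {1}" for n using CG Im_zero_PI_one by blast
  have "\<forall>n. \<exists>T F. tr T (C n) F \<and> T \<in> PI {1} \<and> F \<in> PI {0<..<1}" using heart_torsion CG by metis
  then obtain T F where TF: "\<And>n. tr (T n) (C n) (F n)" "\<And>n. T n \<in> PI {1}" "\<And>n. F n \<in> PI {0<..<1}" by metis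
  have hz1: "hz A B" "hz A (sh (-1) B)" if "A \<in> PI {1}" "B \<in> PI {0<..<1}" for A B
  proof -
    have B: "B \<in> PI {..<1}" by (rule subsetD[OF PI_mono that(2)]) auto
    have A: "A \<in> PI {1..}" using that PI_one by blast
    show "hz A B" "hz A (sh (-1) B)"
      using t_pair_orth[OF t_pair_from A] B t_pair_shift[OF t_pair_from B] by auto
  qed
  have "tr (G n) (T n) (T (Suc n))" for n
  proof -
    have t: "tr (G n) (C n) (C (Suc n))" using CG by blast
    obtain W where W: "tr (G n) W (T (Suc n))" "tr W (C n) (F (Suc n))" using tr_assoc2[OF t TF(1)] .
    have WP: "W \<in> PI {1}" using PI_ext[OF W(1) G TF(2)] .
    have "isomorphic D W (T n)"
      using truncation_unique(1)[OF W(2) TF(1)] hz1[OF WP TF(3)] hz1[OF TF(2) TF(3)] by blast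
    then show ?thesis using tr_iso[OF W(1)] isomorphic_refl tr_obj[OF W(1)] by blast
  qed
  then show ?thesis using acc G TF(2) unfolding acc_obj_def by blast
qed

end

section \<open>Stability conditions on a triangulated subcategory\<close>

text \<open>The interval categories and charges of a stability condition on a triangulated
  subcategory, with triangles, isomorphisms and vanishing of arrows read in the
  ambient category.\<close>

locale sub_stability = triangulated_category D
  for D :: "('o, 'm, 'z) tricat_scheme" +
  fixes S :: "'o set" and Zs :: "('o \<Rightarrow>\<^sub>0 int) set \<Rightarrow> complex" and Ps :: "real \<Rightarrow> 'o set"
  assumes subcat: "triangulated_subcategory D S" and stab_S: "stability_condition (tri_sub D S) (Zs, Ps)"
begin

abbreviation "PS \<equiv> interval_cat (tri_sub D S) Ps"
abbreviation "zs E \<equiv> Zs (cls_tri (tri_sub D S) E)"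

lemma stability_on_S: "stability_on (tri_sub D S) Zs Ps"
proof -
  interpret T: triangulated_category "tri_sub D S" by (rule triangulated_tri_sub[OF subcat])
  show ?thesis by unfold_locales (rule stab_S)
qed

lemmas S_closed = subcategory_closed[OF subcat]

lemma zero_S: "zero_object (tri_sub D S) Z \<longleftrightarrow> zero_object D Z"
  unfolding zero_object_tri_sub zero_object_full_sub[OF S_closed(1)] using S_closed(2)[of Z] by blast

lemma hz_S: "A \<in> S \<Longrightarrow> B \<in> S \<Longrightarrow> hom_zero (tri_sub D S) A B \<longleftrightarrow> hz A B"
  by (simp add: hom_zero_def hom_set_full_sub_eq)

lemma tr_S: "A \<in> S \<Longrightarrow> B \<in> S \<Longrightarrow> triangle_on (tri_sub D S) A E B \<longleftrightarrow> tr A E B"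
  using triangle_on_tri_sub[of D S A E B] S_closed(4)[of A E B] by blast

lemma star_S: "X \<subseteq> S \<Longrightarrow> Y \<subseteq> S \<Longrightarrow> star (tri_sub D S) X Y = star D X Y"
  unfolding star_def using tr_S by blast

lemma star_sub_S: "X \<subseteq> S \<Longrightarrow> Y \<subseteq> S \<Longrightarrow> star D X Y \<subseteq> S"
  unfolding star_def using S_closed(4) by blast

lemma starl_S: "(\<And>X. X \<in> set Xs \<Longrightarrow> X \<subseteq> S) \<Longrightarrow> star_list (tri_sub D S) Xs = starl Xs \<and> starl Xs \<subseteq> S"
proof (induction Xs)
  case Nil then show ?case using zero_S S_closed(2) by auto
next
  case (Cons X Xs) then show ?case using star_S[of X "starl Xs"] star_sub_S[of X "starl Xs"] by simp
qed

lemma PS_S: "E \<in> PS I \<Longrightarrow> E \<in> S"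
  using stability_on.PI_obj[OF stability_on_S] by simp

lemma Ps_S: "E \<in> Ps \<phi> \<Longrightarrow> E \<in> S"
  using stability_on.P_obj[OF stability_on_S] by simp

lemma isoc_S: "X \<subseteq> S \<Longrightarrow> iso_closed (tri_sub D S) X \<Longrightarrow> isoc X"
  unfolding iso_closed_def isomorphic_tri_sub using S_closed(1) isocD(1)[OF S_closed(6)] by (metis subset_eq)

lemma PS_isoc: "I \<noteq> {} \<Longrightarrow> isoc (PS I)"
  using isoc_S[OF _ stability_on.PI_isoc[OF stability_on_S]] PS_S by blast

lemma Ps_isoc: "isoc (Ps \<phi>)"
  using isoc_S[OF _ stability_on.P_isoc[OF stability_on_S]] Ps_S by blast

lemma Ps_zero: "zero_object D E \<Longrightarrow> E \<in> Ps \<phi>"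
  using stability_on.P_zero[OF stability_on_S] zero_S by blast

lemma Ps_PS: "\<phi> \<in> I \<Longrightarrow> E \<in> Ps \<phi> \<Longrightarrow> E \<in> PS I"
  by (rule stability_on.PI_base[OF stability_on_S])

lemma Ps_shift: "E \<in> Ps \<phi> \<Longrightarrow> sh n E \<in> Ps (\<phi> + real_of_int n)"
  using stability_on.P_shift[OF stability_on_S, of E \<phi> n] by simp

lemma PS_shift_above: "E \<in> PS {a<..} \<Longrightarrow> sh n E \<in> PS {a + real_of_int n<..}"
  using stability_on.PI_shift_above[OF stability_on_S, of E a n] by simp

lemma PS_shift_below: "E \<in> PS {..a} \<Longrightarrow> sh n E \<in> PS {..a + real_of_int n}"
  using stability_on.PI_shift_below[OF stability_on_S, of E a n] by simp

lemma PS_mono: "I \<subseteq> J \<Longrightarrow> PS I \<subseteq> PS J"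
  by (rule stability_on.PI_mono[OF stability_on_S])

lemma PS_ext: "tr A E B \<Longrightarrow> A \<in> PS I \<Longrightarrow> B \<in> PS I \<Longrightarrow> E \<in> PS I"
  using stability_on.PI_ext[OF stability_on_S, of A E B I] tr_S[of A B E] PS_S by blast

lemma PS_hz: assumes "\<And>\<phi> \<psi>. \<phi> \<in> I \<Longrightarrow> \<psi> \<in> J \<Longrightarrow> \<phi> > \<psi>" "A \<in> PS I" "B \<in> PS J" shows "hz A B"
  using stability_on.PI_orth[OF stability_on_S assms] hz_S PS_S assms by blast

lemma Ps_hz: assumes "\<phi> > \<psi>" "A \<in> Ps \<phi>" "B \<in> Ps \<psi>" shows "hz A B"
  using stability_on.P_orth[OF stability_on_S assms] hz_S Ps_S assms by blast

lemma S_decompose: "S \<subseteq> star D (PS {a<..}) (PS {..a})"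
proof -
  have "S \<subseteq> star (tri_sub D S) (PS {a<..}) (PS {..a})"
    using stability_on.t_pair_above[OF stability_on_S, of a] unfolding t_pair_def by simp
  then show ?thesis using star_S[of "PS {a<..}" "PS {..a}"] PS_S by blast
qed

lemma heart_eq_S: "PS {0<..1} = PS {0<..} \<inter> PS {..1}"
  by (rule stability_on.heart_eq[OF stability_on_S])

lemma heart_HN_S: assumes "E \<in> PS {0<..1}"
  shows "\<exists>\<phi>s. sorted_wrt (>) \<phi>s \<and> set \<phi>s \<subseteq> {0<..1} \<and> E \<in> starl (map Ps \<phi>s)"
proof -
  obtain \<phi>s where p: "sorted_wrt (>) \<phi>s" "set \<phi>s \<subseteq> {0<..1}" "E \<in> star_list (tri_sub D S) (map Ps \<phi>s)"
    using stability_on.heart_HN[OF stability_on_S assms] by blast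
  have "star_list (tri_sub D S) (map Ps \<phi>s) = starl (map Ps \<phi>s)" using starl_S[of "map Ps \<phi>s"] Ps_S by auto
  then show ?thesis using p by blast
qed

lemma zs_tr: assumes "tr A E B" "A \<in> S" "B \<in> S" shows "zs E = zs A + zs B"
proof -
  interpret T: stability_on "tri_sub D S" Zs Ps by (rule stability_on_S)
  show ?thesis using T.charge_simps(1)[of A E B] tr_S[OF assms(2,3)] assms(1) by blast
qed

lemma zs_zero: assumes "zero_object D A" shows "zs A = 0"
proof -
  interpret T: stability_on "tri_sub D S" Zs Ps by (rule stability_on_S)
  show ?thesis using T.charge_simps(2)[of A] zero_S assms by blast
qed

lemma heart_upper_S: "E \<in> PS {0<..1} \<Longrightarrow> zero_object D E \<or> semiclosed_upper (zs E)"
  using stability_on.heart_upper[OF stability_on_S] zero_S by blast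

lemma heart_Im_S: "E \<in> PS {0<..1} \<Longrightarrow> Im (zs E) \<ge> 0"
  using heart_upper_S[of E] zs_zero semiclosed_upper_Arg(4) by fastforce

lemma Ps_charge: "E \<in> Ps \<phi> \<Longrightarrow> \<exists>r\<ge>0. zs E = of_real r * cis (pi * \<phi>)"
  using stability_on.P_charge[OF stability_on_S, of E \<phi>] zs_zero zero_S by (cases "zero_object D E") (force, fastforce)

lemma acc_S: "T \<subseteq> S \<Longrightarrow> acc_obj (tri_sub D S) T \<Longrightarrow> acc_obj D T"
  unfolding acc_obj_def zero_S by (meson subsetD tr_S)

lemma dcc_S: "T \<subseteq> S \<Longrightarrow> dcc_obj (tri_sub D S) T \<Longrightarrow> dcc_obj D T"
  unfolding dcc_obj_def zero_S by (meson subsetD tr_S)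

lemma small_chains_S:
  assumes "locally_finite (tri_sub D S) (Zs, Ps)"
  obtains \<epsilon> where "\<epsilon> > 0" "\<epsilon> \<le> 1/2" "\<And>\<phi>. acc_obj D (PS {\<phi> - \<epsilon><..<\<phi> + \<epsilon>})" "\<And>\<phi>. dcc_obj D (PS {\<phi> - \<epsilon><..<\<phi> + \<epsilon>})"
proof -
  have sub: "PS I \<subseteq> S" for I using PS_S by blast
  show thesis
    using stability_on.small_chains[OF stability_on_S assms] acc_S[OF sub] dcc_S[OF sub] that by metis
qed

lemma heart_Im_zero_chain_S:
  assumes lf: "locally_finite (tri_sub D S) (Zs, Ps)"
    and CG: "\<And>n. C n \<in> PS {0<..1} \<and> G n \<in> PS {0<..1} \<and> Im (zs (G n)) = 0 \<and> tr (G n) (C n) (C (Suc n))"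
  shows "\<exists>N. \<forall>n\<ge>N. zero_object D (G n)"
proof -
  interpret T: stability_on "tri_sub D S" Zs Ps by (rule stability_on_S)
  obtain \<epsilon> where e: "\<epsilon> > 0" "\<And>\<phi>. acc_obj (tri_sub D S) (PS {\<phi> - \<epsilon><..<\<phi> + \<epsilon>})" using T.small_chains[OF lf] by metis
  have "acc_obj (tri_sub D S) (PS {1})" by (rule acc_obj_mono[OF e(2)[of 1] PS_mono]) (use e(1) in auto)
  moreover have "triangle_on (tri_sub D S) (G n) (C n) (C (Suc n))" for n using CG[of n] CG[of "Suc n"] tr_S PS_S by blast
  ultimately show ?thesis using T.heart_Im_zero_chain[of C G] CG zero_S by blast
qed

end

section \<open>The glued heart\<close>

locale gluing = triangulated_category D
  for D :: "('o, 'm, 'z) tricat_scheme" +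
  fixes D1 D2 :: "'o set" and Z1 Z2 :: "('o \<Rightarrow>\<^sub>0 int) set \<Rightarrow> complex" and P1 P2 :: "real \<Rightarrow> 'o set"
  assumes sod: "semiorthogonal_decomposition D D1 D2"
    and stab1: "stability_condition (tri_sub D D1) (Z1, P1)" and stab2: "stability_condition (tri_sub D D2) (Z2, P2)"
    and vanish: "hom_vanish_le D 0 (interval_cat (tri_sub D D1) P1 {0<..1}) (interval_cat (tri_sub D D2) P2 {0<..1})"
begin

sublocale S1: sub_stability D D1 Z1 P1
  by unfold_locales (use sod stab1 in \<open>auto simp: semiorthogonal_decomposition_def\<close>)

sublocale S2: sub_stability D D2 Z2 P2
  by unfold_locales (use sod stab2 in \<open>auto simp: semiorthogonal_decomposition_def\<close>)

abbreviation "Q1 \<equiv> interval_cat (tri_sub D D1) P1"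
abbreviation "Q2 \<equiv> interval_cat (tri_sub D D2) P2"
abbreviation "lam E \<equiv> lambda1 D D1 D2 E"
abbreviation "rho E \<equiv> rho2 D D1 D2 E"

lemma hz21: "A \<in> D2 \<Longrightarrow> B \<in> D1 \<Longrightarrow> hz A B"
  using sod unfolding semiorthogonal_decomposition_def hom_zero_def by blast

lemma hz21_shift: "A \<in> D2 \<Longrightarrow> B \<in> D1 \<Longrightarrow> hz A (sh n B)"
  using hz21 S1.S_closed(3) by blast

lemma lam_rho_spec: assumes "E \<in> obj D"
  shows "lam E \<in> D1" "rho E \<in> D2" "\<exists>A\<in>D2. tr A E (lam E)" "\<exists>B\<in>D1. tr (rho E) E B"
proof -
  obtain f g h where t: "(f, g, h) \<in> distinguished D" "src D f \<in> D2" "src D g = E" "src D h \<in> D1"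
    using sod assms unfolding semiorthogonal_decomposition_def by blast
  have "lam E \<in> D1 \<and> (\<exists>f g h. (f, g, h) \<in> distinguished D \<and> src D f \<in> D2 \<and> src D g = E \<and> src D h = lam E)"
    unfolding lambda1_def by (rule someI_ex) (use t in blast)
  then show "lam E \<in> D1" "\<exists>A\<in>D2. tr A E (lam E)" unfolding triangle_on_def by blast+
  have "rho E \<in> D2 \<and> (\<exists>f g h. (f, g, h) \<in> distinguished D \<and> src D f = rho E \<and> src D g = E \<and> src D h \<in> D1)"
    unfolding rho2_def by (rule someI_ex) (use t in blast)
  then show "rho E \<in> D2" "\<exists>B\<in>D1. tr (rho E) E B" unfolding triangle_on_def by blast+
qed

lemma decomposition_unique:
  assumes "tr A2 E A1" "A2 \<in> D2" "A1 \<in> D1" "tr B2 E B1" "B2 \<in> D2" "B1 \<in> D1"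
  shows "isomorphic D A2 B2" "isomorphic D A1 B1"
  using truncation_unique[OF assms(1,4)] hz21 hz21_shift assms by blast+

lemma lam_rho_iso: assumes "tr A2 E A1" "A2 \<in> D2" "A1 \<in> D1"
  shows "isomorphic D A2 (rho E)" "isomorphic D A1 (lam E)"
proof -
  note s = lam_rho_spec[OF tr_obj(2)[OF assms(1)]]
  show "isomorphic D A2 (rho E)" "isomorphic D A1 (lam E)" using s decomposition_unique[OF assms] by blast+
qed

lemma lam_rho_tr: assumes "E \<in> obj D" shows "tr (rho E) E (lam E)"
proof -
  note s = lam_rho_spec[OF assms]
  obtain B where B: "B \<in> D1" "tr (rho E) E B" using s by blast
  then have "isomorphic D B (lam E)" using lam_rho_iso s by blast
  then show ?thesis using tr_iso[OF B(2)] isomorphic_refl tr_obj[OF B(2)] by blast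
qed

lemma glue_iff: assumes "isoc X2" "isoc X1" "X2 \<subseteq> D2" "X1 \<subseteq> D1"
  shows "E \<in> star D X2 X1 \<longleftrightarrow> E \<in> obj D \<and> rho E \<in> X2 \<and> lam E \<in> X1"
proof
  assume "E \<in> star D X2 X1"
  then obtain A B where t: "tr A E B" "A \<in> X2" "B \<in> X1" by (rule starE)
  then have "isomorphic D A (rho E)" "isomorphic D B (lam E)" using lam_rho_iso assms by blast+
  then show "E \<in> obj D \<and> rho E \<in> X2 \<and> lam E \<in> X1" using t isocD(1)[OF assms(1)] isocD(1)[OF assms(2)] tr_obj[OF t(1)] by blast
next
  assume "E \<in> obj D \<and> rho E \<in> X2 \<and> lam E \<in> X1"
  then show "E \<in> star D X2 X1" using starI[OF lam_rho_tr] by blast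
qed

text \<open>Decomposing \<open>A\<close> and \<open>B\<close> places \<open>E\<close> in \<open>(\<rho> A \<star> \<lambda> A) \<star> (\<rho> B \<star> \<lambda> B)\<close>. Semiorthogonality
  permits the exchange of the two inner factors, and the decomposition of \<open>E\<close> is
  unique.\<close>

lemma lam_rho_exact: assumes "tr A E B" shows "tr (rho A) (rho E) (rho B)" "tr (lam A) (lam E) (lam B)"
proof -
  note o = tr_obj[OF assms]
  note a = lam_rho_spec[OF o(1)] and b = lam_rho_spec[OF o(3)] and e = lam_rho_spec[OF o(2)]
  have "E \<in> ({rho A} \<star> {lam A}) \<star> ({rho B} \<star> {lam B})"
    using assms lam_rho_tr[OF o(1)] lam_rho_tr[OF o(3)] by (auto intro!: starI)
  then have "E \<in> {rho A} \<star> ({lam A} \<star> {rho B}) \<star> {lam B}" by (simp add: star_assoc)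
  moreover have "{lam A} \<star> {rho B} \<subseteq> {rho B} \<star> {lam A}" by (rule star_swap) (use hz21_shift a b in auto)
  ultimately have "E \<in> {rho A} \<star> ({rho B} \<star> {lam A}) \<star> {lam B}"
    using star_mono[OF subset_refl star_mono[OF _ subset_refl]] by blast
  then have "E \<in> ({rho A} \<star> {rho B}) \<star> ({lam A} \<star> {lam B})" by (simp add: star_assoc)
  then obtain X Y where t: "tr X E Y" "X \<in> {rho A} \<star> {rho B}" "Y \<in> {lam A} \<star> {lam B}" by (rule starE)
  have x: "tr (rho A) X (rho B)" and y: "tr (lam A) Y (lam B)" using t(2,3) by (auto elim: starE)
  have "X \<in> D2" "Y \<in> D1" using S2.S_closed(4)[OF x a(2) b(2)] S1.S_closed(4)[OF y a(1) b(1)] .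
  then have "isomorphic D X (rho E)" "isomorphic D Y (lam E)" using lam_rho_iso[OF t(1)] by blast+
  then show "tr (rho A) (rho E) (rho B)" "tr (lam A) (lam E) (lam B)"
    using tr_iso[OF x] tr_iso[OF y] isomorphic_refl tr_obj[OF x] tr_obj[OF y] by blast+
qed

lemma vanish_hearts: "A \<in> Q1 {0<..1} \<Longrightarrow> B \<in> Q2 {0<..1} \<Longrightarrow> i \<le> 0 \<Longrightarrow> hz A (sh i B)"
  using vanish unfolding hom_vanish_le_def hom_zero_def by blast

text \<open>Both objects are shifted into the hearts; the condition on the ceilings says that
  the remaining degree is at most 0.\<close>

lemma vanish_slices: assumes "A \<in> P1 \<psi>" "B \<in> P2 \<phi>" "\<lceil>\<phi>\<rceil> \<le> \<lceil>\<psi>\<rceil>" shows "hz A B"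
proof -
  define m n where "m = \<lceil>\<psi>\<rceil> - 1" and "n = \<lceil>\<phi>\<rceil> - 1"
  have o: "A \<in> obj D" "B \<in> obj D" using S1.Ps_S S2.Ps_S S1.S_closed(1) S2.S_closed(1) assms by blast+
  have r: "\<psi> - real_of_int m \<in> {0<..1}" "\<phi> - real_of_int n \<in> {0<..1}"
    using ceiling_correct[of \<psi>] ceiling_correct[of \<phi>] unfolding m_def n_def by auto
  have "sh (- m) A \<in> Q1 {0<..1}" using S1.Ps_PS[OF r(1)] S1.Ps_shift[OF assms(1), of "- m"] by simp
  moreover have "sh (- n) B \<in> Q2 {0<..1}" using S2.Ps_PS[OF r(2)] S2.Ps_shift[OF assms(2), of "- n"] by simp
  moreover have "n - m \<le> 0" using assms(3) by (simp add: m_def n_def)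
  ultimately have "hz (sh (- m) A) (sh (n - m) (sh (- n) B))" by (rule vanish_hearts)
  then have "hz (sh (- m) A) (sh (- m) B)" using o by simp
  then show ?thesis using hz_shift o by blast
qed

lemma vanish_intervals: fixes a :: int
  assumes "A \<in> Q1 {real_of_int a<..}" "B \<in> Q2 {..real_of_int a + 1}" shows "hz A B"
proof -
  interpret T1: stability_on "tri_sub D D1" Z1 P1 by (rule S1.stability_on_S)
  interpret T2: stability_on "tri_sub D D2" Z2 P2 by (rule S2.stability_on_S)
  have 1: "hz A B" if A: "A \<in> P1 \<psi>" "\<psi> \<in> {real_of_int a<..}" and B: "B \<in> Q2 {..real_of_int a + 1}" for A B \<psi>
    using B
  proof (induction rule: T2.PI_induct)
    case (base \<phi> E)
    have "\<lceil>\<phi>\<rceil> \<le> a + 1" using base(1) by (simp add: ceiling_le_iff)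
    moreover have "a + 1 \<le> \<lceil>\<psi>\<rceil>" using A(2) by (simp add: less_ceiling_iff add1_zle_eq)
    ultimately show ?case using vanish_slices[OF A(1) base(2)] by simp
  next
    case (ext X E Y)
    then have "tr X E Y" unfolding triangle_on_tri_sub by blast
    then show ?case by (rule hz_tr_right) (rule ext)+
  qed
  show ?thesis using assms(1)
  proof (induction rule: T1.PI_induct)
    case (base \<psi> E) show ?case by (rule 1[OF base(2,1) assms(2)])
  next
    case (ext X E Y)
    then have "tr X E Y" unfolding triangle_on_tri_sub by blast
    then show ?case by (rule hz_tr_left) (rule ext)+
  qed
qed

text \<open>The two sides of the glued t-structure, cut at phase \<open>a\<close>. The glued heart is the
  window between \<open>a = 0\<close> and \<open>a = 1\<close>.\<close>

definition GU :: "int \<Rightarrow> 'o set" where "GU a = star D (Q2 {real_of_int a<..}) (Q1 {real_of_int a<..})"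
definition GV :: "int \<Rightarrow> 'o set" where "GV a = star D (Q2 {..real_of_int a}) (Q1 {..real_of_int a})"

lemma Q_sub: "Q2 I \<subseteq> D2" "Q1 I \<subseteq> D1"
  using S2.PS_S S1.PS_S by blast+

lemma GU_iff: "E \<in> GU a \<longleftrightarrow> E \<in> obj D \<and> rho E \<in> Q2 {real_of_int a<..} \<and> lam E \<in> Q1 {real_of_int a<..}"
  unfolding GU_def by (rule glue_iff[OF S2.PS_isoc S1.PS_isoc Q_sub]) auto

lemma GV_iff: "E \<in> GV a \<longleftrightarrow> E \<in> obj D \<and> rho E \<in> Q2 {..real_of_int a} \<and> lam E \<in> Q1 {..real_of_int a}"
  unfolding GV_def by (rule glue_iff[OF S2.PS_isoc S1.PS_isoc Q_sub]) auto

lemma GU_shift: assumes "E \<in> GU a" shows "sh n E \<in> GU (a + n)"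
proof -
  have "sh n ` Q2 {real_of_int a<..} \<subseteq> Q2 {real_of_int (a + n)<..}" "sh n ` Q1 {real_of_int a<..} \<subseteq> Q1 {real_of_int (a + n)<..}"
    using S2.PS_shift_above[of _ "real_of_int a" n] S1.PS_shift_above[of _ "real_of_int a" n] by auto
  then show ?thesis using subsetD[OF star_mono star_shift[OF assms[unfolded GU_def], of n]] unfolding GU_def by blast
qed

lemma GV_shift: assumes "E \<in> GV a" shows "sh n E \<in> GV (a + n)"
proof -
  have "sh n ` Q2 {..real_of_int a} \<subseteq> Q2 {..real_of_int (a + n)}" "sh n ` Q1 {..real_of_int a} \<subseteq> Q1 {..real_of_int (a + n)}"
    using S2.PS_shift_below[of _ "real_of_int a" n] S1.PS_shift_below[of _ "real_of_int a" n] by auto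
  then show ?thesis using subsetD[OF star_mono star_shift[OF assms[unfolded GV_def], of n]] unfolding GV_def by blast
qed

lemma GU_mono: "a \<le> b \<Longrightarrow> GU b \<subseteq> GU a"
  unfolding GU_def by (intro star_mono S1.PS_mono S2.PS_mono) auto

text \<open>Of the four orthogonalities between the parts, only the one from \<open>\<D>\<^sub>1\<close> to \<open>\<D>\<^sub>2\<close> uses
  the hypothesis on the hearts. The same hypothesis exchanges the inner factors in the
  truncation of \<open>E\<close>: the shift by 1 of an object of \<open>\<D>\<^sub>2\<close> with phases at most \<open>a\<close> has
  phases at most \<open>a + 1\<close>, and it receives no nonzero arrows from objects of \<open>\<D>\<^sub>1\<close> with
  phases above \<open>a\<close>.\<close>

theorem glued_t_pair: "t_pair D (GU a) (GV a)"
proof (rule t_pairI)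
  let ?A2 = "Q2 {real_of_int a<..}" and ?B2 = "Q2 {..real_of_int a}"
  let ?A1 = "Q1 {real_of_int a<..}" and ?B1 = "Q1 {..real_of_int a}"
  show "isoc (GU a)" "isoc (GV a)" unfolding GU_def GV_def by (rule star_isoc)+
  have o2: "orthogonal D ?A2 ?B2" unfolding orthogonal_def by (intro ballI S2.PS_hz[where I="{real_of_int a<..}" and J="{..real_of_int a}"]) auto
  have o1: "orthogonal D ?A1 ?B1" unfolding orthogonal_def by (intro ballI S1.PS_hz[where I="{real_of_int a<..}" and J="{..real_of_int a}"]) auto
  have o21: "orthogonal D ?A2 ?B1" unfolding orthogonal_def using hz21 Q_sub by blast
  have "?B2 \<subseteq> Q2 {..real_of_int a + 1}" by (rule S2.PS_mono) auto
  then have o12: "orthogonal D ?A1 ?B2" unfolding orthogonal_def using vanish_intervals by blast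
  show "orthogonal D (GU a) (GV a)" unfolding GU_def GV_def
    by (intro orth_star_left orth_star_right o1 o2 o21 o12)
  show "obj D \<subseteq> GU a \<star> GV a"
  proof
    fix E assume "E \<in> obj D"
    then have "E \<in> star D D2 D1" using lam_rho_tr lam_rho_spec by (blast intro: starI)
    moreover have "star D D2 D1 \<subseteq> star D (star D ?A2 ?B2) (star D ?A1 ?B1)"
      by (rule star_mono[OF S2.S_decompose S1.S_decompose])
    ultimately have "E \<in> ?A2 \<star> (?B2 \<star> ?A1) \<star> ?B1" unfolding star_assoc by blast
    moreover have "?B2 \<star> ?A1 \<subseteq> ?A1 \<star> ?B2"
    proof (rule star_swap)
      fix A B assume "A \<in> ?B2" "B \<in> ?A1"
      then show "hz B (sh 1 A)" using vanish_intervals[of B a "sh 1 A"] S2.PS_shift_below[of A "real_of_int a" 1] by simp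
    qed
    ultimately have "E \<in> ?A2 \<star> (?A1 \<star> ?B2) \<star> ?B1"
      using star_mono[OF subset_refl star_mono[OF _ subset_refl]] by blast
    then show "E \<in> GU a \<star> GV a" unfolding GU_def GV_def star_assoc .
  qed
  show "sh 1 E \<in> GU a" if "E \<in> GU a" for E using GU_shift[OF that, of 1] GU_mono[of a "a + 1"] by auto
qed

definition H :: "'o set" where
  "H = glued_heart D D1 D2 (Q1 {0<..1}) (Q2 {0<..1})"

definition zc :: "'o \<Rightarrow> complex" where
  "zc E = glued_charge D D1 D2 (Z1, P1) (Z2, P2) E"

lemma zc_eq: "zc E = S1.zs (lam E) + S2.zs (rho E)"
  by (simp add: zc_def glued_charge_def)

lemma H_iff: "E \<in> H \<longleftrightarrow> E \<in> obj D \<and> lam E \<in> Q1 {0<..1} \<and> rho E \<in> Q2 {0<..1}"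
  unfolding H_def glued_heart_def by blast

lemma H_star: "H = star D (Q2 {0<..1}) (Q1 {0<..1})"
proof -
  have "isoc (Q2 {0<..1})" "isoc (Q1 {0<..1})" by (rule S2.PS_isoc S1.PS_isoc; simp)+
  then show ?thesis using glue_iff[OF _ _ Q_sub] H_iff by blast
qed

sublocale G: heart D "GU 0" "GV 0" "GU 1" "GV 1" H zc
proof
  show "t_pair D (GU 0) (GV 0)" "t_pair D (GU 1) (GV 1)" by (rule glued_t_pair)+
  show "sh 1 E \<in> GU 1" if "E \<in> GU 0" for E using GU_shift[OF that, of 1] by simp
  show "GU 1 \<subseteq> GU 0" by (rule GU_mono) simp
  show "H = GU 0 \<inter> GV 1" using H_iff GU_iff[of _ 0] GV_iff[of _ 1] S1.heart_eq_S S2.heart_eq_S by auto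
  show "sh (-1) E \<in> GU 0" if "E \<in> GU 1" for E using GU_shift[OF that, of "-1"] by simp
  show "zc E = zc A + zc B" if t: "tr A E B" for A E B
  proof -
    note e = lam_rho_exact[OF t] and a = lam_rho_spec[OF tr_obj(1)[OF t]] and b = lam_rho_spec[OF tr_obj(3)[OF t]]
    show ?thesis unfolding zc_eq using S2.zs_tr[OF e(1) a(2) b(2)] S1.zs_tr[OF e(2) a(1) b(1)] by simp
  qed
  show "semiclosed_upper (zc E)" if E: "E \<in> H" "\<not> zero_object D E" for E
  proof -
    have e: "E \<in> obj D" "lam E \<in> Q1 {0<..1}" "rho E \<in> Q2 {0<..1}" using E H_iff by auto
    have u: "zero_object D (lam E) \<or> semiclosed_upper (S1.zs (lam E))" "zero_object D (rho E) \<or> semiclosed_upper (S2.zs (rho E))"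
      using S1.heart_upper_S[OF e(2)] S2.heart_upper_S[OF e(3)] by auto
    have "\<not> (zero_object D (lam E) \<and> zero_object D (rho E))" using tr_zero_zero[OF lam_rho_tr[OF e(1)]] E(2) by blast
    then show ?thesis unfolding zc_eq using u S1.zs_zero S2.zs_zero semiclosed_upper_add by fastforce
  qed
qed

lemma glued_bounded: assumes "E \<in> obj D" shows "\<exists>a b. sh (- a) E \<in> GU 0 \<and> sh (- b) E \<in> GV 1"
proof -
  note s = lam_rho_spec[OF assms]
  interpret T1: stability_on "tri_sub D D1" Z1 P1 by (rule S1.stability_on_S)
  interpret T2: stability_on "tri_sub D D2" Z2 P2 by (rule S2.stability_on_S)
  obtain a1 a2 b1 b2 :: int where a: "lam E \<in> Q1 {real_of_int a1<..}" "rho E \<in> Q2 {real_of_int a2<..}"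
    and b: "lam E \<in> Q1 {..real_of_int b1}" "rho E \<in> Q2 {..real_of_int b2}"
    using T1.bounded_below[of "lam E"] T1.bounded_above[of "lam E"] T2.bounded_below[of "rho E"] T2.bounded_above[of "rho E"] s by auto
  let ?a = "min a1 a2" and ?b = "max b1 b2"
  have "lam E \<in> Q1 {real_of_int ?a<..}" by (rule subsetD[OF S1.PS_mono a(1)]) auto
  moreover have "rho E \<in> Q2 {real_of_int ?a<..}" by (rule subsetD[OF S2.PS_mono a(2)]) auto
  ultimately have "E \<in> GU ?a" using GU_iff assms by blast
  then have "sh (- ?a) E \<in> GU 0" using GU_shift[of E ?a "- ?a"] by simp
  moreover have "lam E \<in> Q1 {..real_of_int ?b}" by (rule subsetD[OF S1.PS_mono b(1)]) auto
  moreover have "rho E \<in> Q2 {..real_of_int ?b}" by (rule subsetD[OF S2.PS_mono b(2)]) auto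
  ultimately have "E \<in> GV ?b" using GV_iff assms by blast
  then have "sh (- (?b - 1)) E \<in> GV 1" using GV_shift[of E ?b "- (?b - 1)"] by simp
  then show ?thesis using \<open>sh (- ?a) E \<in> GU 0\<close> by blast
qed

theorem glued_from_HN:
  assumes "G.HN_all"
  shows "\<exists>W. stability_function (full_sub D H) W \<and>
      (\<forall>E \<in> H. W (cls_ab (full_sub D H) E) = glued_charge D D1 D2 (Z1, P1) (Z2, P2) E) \<and> HN_property (full_sub D H) W"
    and "\<exists>\<sigma>. stability_condition D \<sigma> \<and> glued_from D D1 D2 (Z1, P1) (Z2, P2) \<sigma>"
proof -
  obtain W where W: "W \<in> hom (K0_ab (full_sub D H)) complex_add_group" "\<And>E. E \<in> H \<Longrightarrow> W (cls_ab (full_sub D H) E) = zc E"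
    using G.heart_charge_exists by blast
  show "\<exists>W. stability_function (full_sub D H) W \<and>
      (\<forall>E \<in> H. W (cls_ab (full_sub D H) E) = glued_charge D D1 D2 (Z1, P1) (Z2, P2) E) \<and> HN_property (full_sub D H) W"
    using G.heart_stability_function[OF W] G.heart_HN_property[OF W assms] W(2) unfolding zc_def by blast
  obtain Z where Z: "stability_condition D (Z, G.slice)" "\<forall>E\<in>obj D. Z (cls_tri D E) = zc E"
    "interval_cat D G.slice {0<..1} = H"
    using G.stability_from_heart[OF assms glued_bounded] by blast
  have "glued_from D D1 D2 (Z1, P1) (Z2, P2) (Z, G.slice)"
    unfolding glued_from_def stab_heart_def using vanish Z unfolding H_def zc_def by simp
  then show "\<exists>\<sigma>. stability_condition D \<sigma> \<and> glued_from D D1 D2 (Z1, P1) (Z2, P2) \<sigma>" using Z(1) by blast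
qed

lemma ph_of_polar: assumes "E \<in> H" "\<not> zero_object D E" "zc E = complex_of_real r * cis (pi * \<phi>)" "\<phi> \<in> {0<..1}"
  shows "G.ph E = \<phi>"
proof -
  have "G.lin \<phi> (zc E) = 0" unfolding G.lin_def cross_def assms(3) by simp
  then show ?thesis using G.ph_le_lin[OF assms(1,2), of \<phi>] assms(4) by auto
qed

text \<open>By \<open>HN_data_semistable\<close> this determines the slicing of every glued stability
  condition, so a single description of the semistable objects of \<open>H\<close> covers all of
  them.\<close>

lemma glued_HN_data:
  assumes st: "stability_condition D (Z, P)" and g: "glued_from D D1 D2 (Z1, P1) (Z2, P2) (Z, P)"
  shows "G.HN_data P" "\<And>E. E \<in> obj D \<Longrightarrow> Z (cls_tri D E) = zc E" "interval_cat D P {0<..1} = H"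
proof -
  interpret S: stability_on D Z P by unfold_locales (rule st)
  show z: "\<And>E. E \<in> obj D \<Longrightarrow> Z (cls_tri D E) = zc E" using g unfolding glued_from_def zc_def by simp
  show h: "interval_cat D P {0<..1} = H" using g unfolding glued_from_def H_def stab_heart_def by simp
  have PH: "P \<phi> \<subseteq> H" if "\<phi> \<in> {0<..1}" for \<phi> using S.PI_base[OF that] h by blast
  show "G.HN_data P"
    unfolding G.HN_data_def
  proof (intro conjI allI ballI impI)
    show "isoc (P \<phi>)" for \<phi> by (rule S.P_isoc)
    show "zeros \<subseteq> P \<phi>" for \<phi> using S.P_zero by blast
    show "P \<phi> \<subseteq> H" if "\<phi> \<in> {0<..1}" for \<phi> using PH[OF that] .
    show "G.ph E = \<phi>" if p: "\<phi> \<in> {0<..1}" and E: "E \<in> P \<phi>" "\<not> zero_object D E" for \<phi> E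
    proof -
      obtain r where "Z (cls_tri D E) = complex_of_real r * cis (pi * \<phi>)" using S.P_charge[OF E] by blast
      then have "zc E = complex_of_real r * cis (pi * \<phi>)" using z[OF S.P_obj[OF E(1)]] by simp
      then show ?thesis using ph_of_polar[OF subsetD[OF PH[OF p] E(1)] E(2) _ p] by blast
    qed
    show "orthogonal D (P \<phi>) (P \<psi>)" if "\<psi> < \<phi>" for \<phi> \<psi> using S.P_orth[OF that] unfolding orthogonal_def by blast
    show "\<exists>\<phi>s. sorted_wrt (>) \<phi>s \<and> set \<phi>s \<subseteq> {0<..1} \<and> E \<in> starl (map P \<phi>s)" if "E \<in> H" for E
      using S.heart_HN h that by blast
  qed
qed

section \<open>Gluing with discrete imaginary parts\<close>

lemma gap_of_isolated:
  fixes f :: "'o \<Rightarrow> real"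
  assumes "0 isolated_in (f ` X)" "\<And>E. E \<in> X \<Longrightarrow> f E \<ge> 0"
  shows "\<exists>c>0. \<forall>E\<in>X. f E = 0 \<or> c \<le> f E"
proof -
  obtain e where e: "e > 0" "\<forall>y\<in>f ` X. dist 0 y < e \<longrightarrow> y = 0"
    using assms(1) unfolding isolated_in_dist_Ex_iff by blast
  have "f E = 0 \<or> e \<le> f E" if "E \<in> X" for E
    using e(2) assms(2)[OF that] that by (auto simp: dist_real_def not_le)
  then show ?thesis using e(1) by blast
qed

text \<open>The imaginary parts of both summands are nonnegative, so the smaller of the two gaps
  is a gap for the sum.\<close>

lemma discrete_gap:
  assumes "0 isolated_in ((\<lambda>E. Im (S1.zs E)) ` Q1 {0<..1})" "0 isolated_in ((\<lambda>E. Im (S2.zs E)) ` Q2 {0<..1})"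
  obtains c where "c > 0" "\<And>E. E \<in> H \<Longrightarrow> Im (zc E) = 0 \<or> c \<le> Im (zc E)"
proof -
  obtain c1 where c1: "c1 > 0" "\<forall>E\<in>Q1 {0<..1}. Im (S1.zs E) = 0 \<or> c1 \<le> Im (S1.zs E)"
    using gap_of_isolated[OF assms(1)] S1.heart_Im_S by blast
  obtain c2 where c2: "c2 > 0" "\<forall>E\<in>Q2 {0<..1}. Im (S2.zs E) = 0 \<or> c2 \<le> Im (S2.zs E)"
    using gap_of_isolated[OF assms(2)] S2.heart_Im_S by blast
  have "Im (zc E) = 0 \<or> min c1 c2 \<le> Im (zc E)" if "E \<in> H" for E
  proof -
    have e: "lam E \<in> Q1 {0<..1}" "rho E \<in> Q2 {0<..1}" using that H_iff by auto
    have "Im (zc E) = Im (S1.zs (lam E)) + Im (S2.zs (rho E))" unfolding zc_eq by simp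
    moreover have "Im (S1.zs (lam E)) = 0 \<or> c1 \<le> Im (S1.zs (lam E))" "Im (S2.zs (rho E)) = 0 \<or> c2 \<le> Im (S2.zs (rho E))"
      using c1(2) c2(2) e by blast+
    ultimately show ?thesis using S1.heart_Im_S[OF e(1)] S2.heart_Im_S[OF e(2)] by linarith
  qed
  then show thesis using that[of "min c1 c2"] c1(1) c2(1) by simp
qed

text \<open>A chain in \<open>H\<close> whose subquotients have real charge is mapped by \<open>\<lambda>\<^sub>1\<close> and \<open>\<rho>\<^sub>2\<close> to
  such chains in the two hearts, which stabilize by local finiteness.\<close>

theorem discrete_glued_HN:
  assumes "locally_finite (tri_sub D D1) (Z1, P1)" "locally_finite (tri_sub D D2) (Z2, P2)"
    and "0 isolated_in ((\<lambda>E. Im (S1.zs E)) ` Q1 {0<..1})" "0 isolated_in ((\<lambda>E. Im (S2.zs E)) ` Q2 {0<..1})"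
  shows "G.HN_all"
proof -
  obtain c where c: "c > 0" "\<And>E. E \<in> H \<Longrightarrow> Im (zc E) = 0 \<or> c \<le> Im (zc E)" using discrete_gap[OF assms(3,4)] by blast
  have "discrete_heart_axioms D H zc c"
  proof
    show "c > 0" by (rule c)
    show "Im (zc E) = 0 \<or> c \<le> Im (zc E)" if "E \<in> H" for E by (rule c(2)[OF that])
    fix C G' :: "nat \<Rightarrow> 'o" assume CG: "\<And>n. C n \<in> H \<and> G' n \<in> H \<and> Im (zc (G' n)) = 0 \<and> tr (G' n) (C n) (C (Suc n))"
    have i: "Im (S1.zs (lam (G' n))) = 0" "Im (S2.zs (rho (G' n))) = 0" for n
    proof -
      have e: "lam (G' n) \<in> Q1 {0<..1}" "rho (G' n) \<in> Q2 {0<..1}" using CG H_iff by auto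
      have "Im (S1.zs (lam (G' n))) + Im (S2.zs (rho (G' n))) = 0" using CG[of n] unfolding zc_eq by simp
      then show "Im (S1.zs (lam (G' n))) = 0" "Im (S2.zs (rho (G' n))) = 0"
        using S1.heart_Im_S[OF e(1)] S2.heart_Im_S[OF e(2)] by linarith+
    qed
    have "\<exists>N. \<forall>n\<ge>N. zero_object D (lam (G' n))"
      by (rule S1.heart_Im_zero_chain_S[OF assms(1), of "\<lambda>n. lam (C n)"]) (use CG H_iff i lam_rho_exact in blast)
    then obtain N1 where N1: "\<And>n. n \<ge> N1 \<Longrightarrow> zero_object D (lam (G' n))" by blast
    have "\<exists>N. \<forall>n\<ge>N. zero_object D (rho (G' n))"
      by (rule S2.heart_Im_zero_chain_S[OF assms(2), of "\<lambda>n. rho (C n)"]) (use CG H_iff i lam_rho_exact in blast)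
    then obtain N2 where N2: "\<And>n. n \<ge> N2 \<Longrightarrow> zero_object D (rho (G' n))" by blast
    have "zero_object D (G' n)" if "n \<ge> max N1 N2" for n
      using tr_zero_zero[OF lam_rho_tr[of "G' n"] N2 N1] that CG H_iff by simp
    then show "\<exists>N. \<forall>n\<ge>N. zero_object D (G' n)" by blast
  qed
  then interpret d: discrete_heart D "GU 0" "GV 0" "GU 1" "GV 1" H zc c
    by (rule discrete_heart.intro[OF G.heart_axioms])
  show ?thesis by (rule d.discrete_HN)
qed

text \<open>Each nonzero subquotient of a chain in \<open>P(0,1)\<close> lowers the imaginary part by at
  least \<open>c\<close>. Both kinds of chains satisfy the same relation between imaginary parts,
  so one bound serves for both.\<close>

theorem discrete_finite_length:
  assumes st: "stability_condition D (Z, P)" and g: "glued_from D D1 D2 (Z1, P1) (Z2, P2) (Z, P)"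
    and iso: "0 isolated_in ((\<lambda>E. Im (S1.zs E)) ` Q1 {0<..1})" "0 isolated_in ((\<lambda>E. Im (S2.zs E)) ` Q2 {0<..1})"
  shows "finite_length (full_sub D (interval_cat D P {0<..<1}))"
proof -
  interpret S: stability_on D Z P by unfold_locales (rule st)
  interpret W: t_window D "S.PI {0<..}" "S.PI {..0}" "S.PI {1..}" "S.PI {..<1}" "S.PI {0<..<1}" by (rule S.window_open) auto
  obtain c where c: "c > 0" "\<And>E. E \<in> H \<Longrightarrow> Im (zc E) = 0 \<or> c \<le> Im (zc E)" using discrete_gap[OF iso] by blast
  note d = glued_HN_data[OF st g]
  have sub: "S.PI {0<..<1} \<subseteq> H" unfolding d(3)[symmetric] by (rule S.PI_mono) auto
  have pos: "zero_object D E \<or> c \<le> Im (zc E)" if "E \<in> S.PI {0<..<1}" for E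
    using S.PI_open_Im[OF that] d(2)[OF S.PI_obj[OF that]] c(2) sub that by fastforce
  define r where "r E = nat \<lfloor>Im (zc E) / c\<rfloor>" for E
  have r: "r A \<le> r E" "\<not> zero_object D B \<Longrightarrow> r A < r E"
    if t: "Im (zc E) = Im (zc A) + Im (zc B)" "A \<in> S.PI {0<..<1}" "B \<in> S.PI {0<..<1}" for A E B
  proof -
    have nn: "Im (zc A) \<ge> 0" "Im (zc B) \<ge> 0" using G.Im_nonneg sub t by blast+
    then have "Im (zc A) / c \<le> Im (zc E) / c" using t(1) c(1) by (simp add: divide_right_mono)
    then show "r A \<le> r E" unfolding r_def by (intro nat_mono floor_mono)
    assume "\<not> zero_object D B"
    then have "Im (zc A) / c \<le> Im (zc E) / c - 1" using pos[OF t(3)] t(1) c(1) by (simp add: field_simps)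
    moreover have "0 \<le> Im (zc A) / c" using nn c(1) by simp
    ultimately show "r A < r E" unfolding r_def by linarith
  qed
  have st: "\<exists>N. \<forall>n\<ge>N. zero_object D (G' n)"
    if C: "\<And>n. C n \<in> S.PI {0<..<1} \<and> G' n \<in> S.PI {0<..<1} \<and> Im (zc (C n)) = Im (zc (C (Suc n))) + Im (zc (G' n))" for C G' :: "nat \<Rightarrow> 'o"
  proof -
    obtain N where N: "\<forall>n\<ge>N. r (C n) = r (C N)" using decreasing_nat_stabilizes[of "\<lambda>n. r (C n)"] r(1) C by blast
    have "zero_object D (G' n)" if "n \<ge> N" for n
    proof (rule ccontr)
      assume "\<not> zero_object D (G' n)"
      then have "r (C (Suc n)) < r (C n)" using r(2)[of "C n" "C (Suc n)" "G' n"] C by blast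
      then show False using N that by (metis le_SucI less_irrefl)
    qed
    then show ?thesis by blast
  qed
  show ?thesis
  proof (rule W.finite_lengthI)
    show "acc_obj D (S.PI {0<..<1})" unfolding acc_obj_def
    proof (intro allI impI)
      fix C G' assume h: "\<forall>n. C n \<in> S.PI {0<..<1} \<and> G' n \<in> S.PI {0<..<1} \<and> tr (G' n) (C n) (C (Suc n))"
      have "Im (zc (C n)) = Im (zc (C (Suc n))) + Im (zc (G' n))" for n using G.z_tr[of "G' n" "C n" "C (Suc n)"] h by simp
      then show "\<exists>N. \<forall>n\<ge>N. zero_object D (G' n)" using st[of C G'] h by blast
    qed
    show "dcc_obj D (S.PI {0<..<1})" unfolding dcc_obj_def
    proof (intro allI impI)
      fix C G' assume h: "\<forall>n. C n \<in> S.PI {0<..<1} \<and> G' n \<in> S.PI {0<..<1} \<and> tr (C (Suc n)) (C n) (G' n)"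
      have "Im (zc (C n)) = Im (zc (C (Suc n))) + Im (zc (G' n))" for n using G.z_tr[of "C (Suc n)" "C n" "G' n"] h by simp
      then show "\<exists>N. \<forall>n\<ge>N. zero_object D (G' n)" using st[of C G'] h by blast
    qed
  qed
qed

section \<open>Gluing with vanishing first extensions\<close>

text \<open>For \<open>0 < \<phi> \<le> 1\<close> these turn out to be the semistable objects of phase \<open>\<phi>\<close>, once the
  first extensions vanish.\<close>

definition PG :: "real \<Rightarrow> 'o set" where "PG \<phi> = star D (P2 \<phi>) (P1 \<phi>)"

lemma PG_sub: "P2 \<phi> \<subseteq> PG \<phi>" "P1 \<phi> \<subseteq> PG \<phi>"
proof -
  show "P2 \<phi> \<subseteq> PG \<phi>" unfolding PG_def using star_left_mem[OF S2.Ps_isoc] S1.Ps_zero by blast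
  show "P1 \<phi> \<subseteq> PG \<phi>" unfolding PG_def using star_right_mem[OF S1.Ps_isoc] S2.Ps_zero by blast
qed

text \<open>Merging two decreasing lists. The larger of the two leading phases comes first: a
  leading factor in \<open>P1 \<psi>\<close> is moved to the front past all factors in \<open>P2 x\<close> with
  \<open>x < \<psi>\<close>, and for equal leading phases the two factors combine to one in \<open>PG \<phi>\<close>.\<close>

lemma merge_HN:
  assumes b: "\<And>A B \<phi> \<psi>. \<phi> \<in> {0<..1} \<Longrightarrow> \<psi> \<in> {0<..1} \<Longrightarrow> \<phi> < \<psi> \<Longrightarrow> A \<in> P2 \<phi> \<Longrightarrow> B \<in> P1 \<psi> \<Longrightarrow> hz B (sh 1 A)"
  shows "sorted_wrt (>) \<phi>s \<Longrightarrow> sorted_wrt (>) \<psi>s \<Longrightarrow> set \<phi>s \<subseteq> {0<..1} \<Longrightarrow> set \<psi>s \<subseteq> {0<..1} \<Longrightarrow>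
    E \<in> starl (map P2 \<phi>s) \<star> starl (map P1 \<psi>s) \<Longrightarrow>
    \<exists>\<chi>s. sorted_wrt (>) \<chi>s \<and> set \<chi>s \<subseteq> set \<phi>s \<union> set \<psi>s \<and> E \<in> starl (map PG \<chi>s)"
proof (induction "length \<phi>s + length \<psi>s" arbitrary: \<phi>s \<psi>s E rule: less_induct)
  case less
  have swap: "starl (map P2 xs) \<star> P1 \<psi> \<subseteq> P1 \<psi> \<star> starl (map P2 xs)"
    if sw: "set xs \<subseteq> {0<..1}" "\<psi> \<in> {0<..1}" "\<And>x. x \<in> set xs \<Longrightarrow> x < \<psi>" for xs \<psi>
  proof (rule star_swap)
    fix A B assume A: "A \<in> starl (map P2 xs)" and B: "B \<in> P1 \<psi>"
    have oB: "B \<in> obj D" using S1.Ps_S[OF B] S1.S_closed(1) by blast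
    have "orthogonal D {sh (-1) B} (starl (map P2 xs))"
    proof (rule starl_orth_right)
      fix X assume "X \<in> set (map P2 xs)"
      then obtain x where x: "x \<in> set xs" "X = P2 x" by auto
      have "hz (sh (-1) B) A" if A: "A \<in> P2 x" for A
      proof -
        have "hz B (sh 1 A)" using b[of x \<psi> A B] sw x(1) A B by blast
        then show ?thesis using hz_shift1[of B A "-1"] oB S2.Ps_S[OF A] S2.S_closed(1) by auto
      qed
      then show "orthogonal D {sh (-1) B} X" unfolding orthogonal_def x(2) by blast
    qed
    then have "hz (sh (-1) B) A" using A unfolding orthogonal_def by blast
    then show "hz B (sh 1 A)" using hz_shift1[of B A "-1"] oB isocD(2)[OF starl_isoc A] by simp
  qed
  show ?case
  proof (cases \<phi>s)
    case Nil
    then have "E \<in> starl (map P1 \<psi>s)" using less.prems(5) star_zeros_left[OF starl_isoc] by simp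
    moreover have "starl (map P1 \<psi>s) \<subseteq> starl (map PG \<psi>s)"
      by (rule starl_mono) (auto simp: zip_map_map zip_same PG_sub subsetD[OF PG_sub(2)])
    ultimately show ?thesis using less.prems(2) by (intro exI[of _ \<psi>s]) auto
  next
    case (Cons \<phi> \<phi>s')
    note \<phi> = Cons
    show ?thesis
    proof (cases \<psi>s)
      case Nil
      then have "E \<in> starl (map P2 \<phi>s)" using less.prems(5) star_zeros_right[OF starl_isoc] by simp
      moreover have "starl (map P2 \<phi>s) \<subseteq> starl (map PG \<phi>s)"
        by (rule starl_mono) (auto simp: zip_map_map zip_same PG_sub subsetD[OF PG_sub(1)])
      ultimately show ?thesis using less.prems(1) by (intro exI[of _ \<phi>s]) auto
    next
      case (Cons \<psi> \<psi>s')
      note \<psi> = Cons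
      have in01: "\<phi> \<in> {0<..1}" "\<psi> \<in> {0<..1}" using less.prems \<phi> \<psi> by auto
      have s': "sorted_wrt (>) \<phi>s'" "sorted_wrt (>) \<psi>s'" "set \<phi>s' \<subseteq> {0<..1}" "set \<psi>s' \<subseteq> {0<..1}" using less.prems \<phi> \<psi> by auto
      have lt: "\<And>x. x \<in> set \<phi>s' \<Longrightarrow> x < \<phi>" "\<And>x. x \<in> set \<psi>s' \<Longrightarrow> x < \<psi>" using less.prems \<phi> \<psi> by auto
      have step: "\<exists>\<chi>s. sorted_wrt (>) \<chi>s \<and> set \<chi>s \<subseteq> set \<phi>s \<union> set \<psi>s \<and> E \<in> starl (map PG \<chi>s)"
        if E: "E \<in> X \<star> (starl (map P2 xs) \<star> starl (map P1 ys))" and X: "X \<subseteq> PG a" "a \<in> set \<phi>s \<union> set \<psi>s"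
          and xy: "sorted_wrt (>) xs" "sorted_wrt (>) ys" "set xs \<subseteq> set \<phi>s" "set ys \<subseteq> set \<psi>s"
            "length xs + length ys < length \<phi>s + length \<psi>s" "\<And>x. x \<in> set xs \<union> set ys \<Longrightarrow> x < a" for X a xs ys
      proof -
        obtain A R where t: "tr A E R" "A \<in> X" "R \<in> starl (map P2 xs) \<star> starl (map P1 ys)" using E by (rule starE)
        have "set xs \<subseteq> {0<..1}" "set ys \<subseteq> {0<..1}" using xy less.prems by blast+
        then obtain \<chi>s where c: "sorted_wrt (>) \<chi>s" "set \<chi>s \<subseteq> set xs \<union> set ys" "R \<in> starl (map PG \<chi>s)"
          using less(1)[OF xy(5,1,2) _ _ t(3)] by blast
        have "sorted_wrt (>) (a # \<chi>s)" using c(1,2) xy(6) by auto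
        moreover have "set (a # \<chi>s) \<subseteq> set \<phi>s \<union> set \<psi>s" using c(2) xy(3,4) X(2) by auto
        moreover have "E \<in> starl (map PG (a # \<chi>s))" using t c(3) X(1) by (auto intro: starI)
        ultimately show ?thesis by blast
      qed
      have E: "E \<in> P2 \<phi> \<star> (starl (map P2 \<phi>s') \<star> (P1 \<psi> \<star> starl (map P1 \<psi>s')))"
        using less.prems(5) \<phi> \<psi> by (simp add: star_assoc)
      consider "\<phi> > \<psi>" | "\<phi> < \<psi>" | "\<phi> = \<psi>" by linarith
      then show ?thesis
      proof cases
        case 1
        show ?thesis
        proof (rule step[of "P2 \<phi>" \<phi>s' \<psi>s \<phi>])
          show "E \<in> P2 \<phi> \<star> (starl (map P2 \<phi>s') \<star> starl (map P1 \<psi>s))" using E \<psi> by simp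
          show "\<And>x. x \<in> set \<phi>s' \<union> set \<psi>s \<Longrightarrow> x < \<phi>" using lt \<psi> 1 by fastforce
        qed (use PG_sub s' less.prems \<phi> in auto)
      next
        case 2
        have "E \<in> (starl (map P2 \<phi>s) \<star> P1 \<psi>) \<star> starl (map P1 \<psi>s')" using E \<phi> by (simp add: star_assoc)
        moreover have "starl (map P2 \<phi>s) \<star> P1 \<psi> \<subseteq> P1 \<psi> \<star> starl (map P2 \<phi>s)"
        proof (rule swap)
          show "\<And>x. x \<in> set \<phi>s \<Longrightarrow> x < \<psi>" using lt \<phi> 2 by fastforce
        qed (use less.prems in01 in auto)
        ultimately have "E \<in> (P1 \<psi> \<star> starl (map P2 \<phi>s)) \<star> starl (map P1 \<psi>s')" using star_mono[OF _ subset_refl] by blast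
        then have E2: "E \<in> P1 \<psi> \<star> (starl (map P2 \<phi>s) \<star> starl (map P1 \<psi>s'))" by (simp add: star_assoc)
        show ?thesis
        proof (rule step[OF E2])
          show "\<And>x. x \<in> set \<phi>s \<union> set \<psi>s' \<Longrightarrow> x < \<psi>" using lt \<phi> 2 by fastforce
        qed (use PG_sub s' less.prems \<psi> in auto)
      next
        case 3
        have "starl (map P2 \<phi>s') \<star> P1 \<psi> \<subseteq> P1 \<psi> \<star> starl (map P2 \<phi>s')"
          by (rule swap) (use s' in01 lt 3 in auto)
        moreover have "E \<in> P2 \<phi> \<star> ((starl (map P2 \<phi>s') \<star> P1 \<psi>) \<star> starl (map P1 \<psi>s'))" using E by (simp add: star_assoc)
        ultimately have "E \<in> P2 \<phi> \<star> ((P1 \<psi> \<star> starl (map P2 \<phi>s')) \<star> starl (map P1 \<psi>s'))"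
          using star_mono[OF subset_refl star_mono[OF _ subset_refl]] by blast
        then have E2: "E \<in> PG \<phi> \<star> (starl (map P2 \<phi>s') \<star> starl (map P1 \<psi>s'))" unfolding PG_def using 3 by (simp add: star_assoc)
        show ?thesis
        proof (rule step[OF E2])
          show "\<And>x. x \<in> set \<phi>s' \<union> set \<psi>s' \<Longrightarrow> x < \<phi>" using lt 3 by fastforce
        qed (use s' \<phi> \<psi> in auto)
      qed
    qed
  qed
qed

lemma PG_HN_data:
  assumes b: "hom_vanish_le D 1 (Q1 {0<..1}) (Q2 {0<..<1})"
  shows "G.HN_data PG"
proof -
  have b': "hz B (sh 1 A)" if "\<phi> \<in> {0<..1}" "\<psi> \<in> {0<..1}" "\<phi> < \<psi>" "A \<in> P2 \<phi>" "B \<in> P1 \<psi>" for A B \<phi> \<psi>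
  proof -
    \<comment> \<open>A phase \<open>\<phi>\<close> that is smaller than some \<open>\<psi> \<le> 1\<close> is not 1, so \<open>P2 \<phi>\<close> lies in
        \<open>P\<^sub>2(0,1)\<close>.\<close>
    have "A \<in> Q2 {0<..<1}" "B \<in> Q1 {0<..1}" using S2.Ps_PS[of \<phi> "{0<..<1}" A] S1.Ps_PS[of \<psi> "{0<..1}" B] that by auto
    then show ?thesis using b unfolding hom_vanish_le_def hom_zero_def by auto
  qed
  have PH: "PG \<phi> \<subseteq> H" if "\<phi> \<in> {0<..1}" for \<phi>
    unfolding PG_def H_star by (rule star_mono) (use S2.Ps_PS S1.Ps_PS that in blast)+
  show ?thesis
    unfolding G.HN_data_def
  proof (intro conjI allI ballI impI)
    show "isoc (PG \<phi>)" for \<phi> unfolding PG_def by (rule star_isoc)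
    show "zeros \<subseteq> PG \<phi>" for \<phi> using PG_sub S1.Ps_zero by blast
    show "PG \<phi> \<subseteq> H" if "\<phi> \<in> {0<..1}" for \<phi> using PH[OF that] .
    show "G.ph E = \<phi>" if p: "\<phi> \<in> {0<..1}" and E: "E \<in> PG \<phi>" "\<not> zero_object D E" for \<phi> E
    proof -
      have EH: "E \<in> H" using PH[OF p] E by blast
      have "rho E \<in> P2 \<phi>" "lam E \<in> P1 \<phi>" using E(1) glue_iff[OF S2.Ps_isoc S1.Ps_isoc] S2.Ps_S S1.Ps_S unfolding PG_def by blast+
      then obtain r1 r2 where "S1.zs (lam E) = complex_of_real r1 * cis (pi * \<phi>)" "S2.zs (rho E) = complex_of_real r2 * cis (pi * \<phi>)"
        using S1.Ps_charge S2.Ps_charge by blast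
      then have "zc E = complex_of_real (r1 + r2) * cis (pi * \<phi>)" unfolding zc_eq by (simp add: distrib_right)
      then show ?thesis using ph_of_polar[OF EH E(2) _ p] by blast
    qed
    show "orthogonal D (PG \<phi>) (PG \<psi>)" if p: "\<phi> \<in> {0<..1}" "\<psi> \<in> {0<..1}" "\<psi> < \<phi>" for \<phi> \<psi>
    proof -
      have c: "\<lceil>\<psi>\<rceil> \<le> \<lceil>\<phi>\<rceil>" using p by (intro ceiling_mono) simp
      have "orthogonal D (P2 \<phi>) (P2 \<psi>)" "orthogonal D (P1 \<phi>) (P1 \<psi>)" "orthogonal D (P2 \<phi>) (P1 \<psi>)" "orthogonal D (P1 \<phi>) (P2 \<psi>)"
        unfolding orthogonal_def using S2.Ps_hz[OF p(3)] S1.Ps_hz[OF p(3)] hz21 S2.Ps_S S1.Ps_S vanish_slices c by blast+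
      then show ?thesis unfolding PG_def by (intro orth_star_left orth_star_right)
    qed
    show "\<exists>\<phi>s. sorted_wrt (>) \<phi>s \<and> set \<phi>s \<subseteq> {0<..1} \<and> E \<in> starl (map PG \<phi>s)" if "E \<in> H" for E
    proof -
      have e: "E \<in> obj D" "lam E \<in> Q1 {0<..1}" "rho E \<in> Q2 {0<..1}" using that H_iff by auto
      obtain \<phi>s where p: "sorted_wrt (>) \<phi>s" "set \<phi>s \<subseteq> {0<..1}" "rho E \<in> starl (map P2 \<phi>s)" using S2.heart_HN_S[OF e(3)] by blast
      obtain \<psi>s where q: "sorted_wrt (>) \<psi>s" "set \<psi>s \<subseteq> {0<..1}" "lam E \<in> starl (map P1 \<psi>s)" using S1.heart_HN_S[OF e(2)] by blast
      have "E \<in> starl (map P2 \<phi>s) \<star> starl (map P1 \<psi>s)" using lam_rho_tr[OF e(1)] p q by (auto intro: starI)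
      then obtain \<chi>s where "sorted_wrt (>) \<chi>s" "set \<chi>s \<subseteq> set \<phi>s \<union> set \<psi>s" "E \<in> starl (map PG \<chi>s)"
        using merge_HN[of \<phi>s \<psi>s E] b' p q by blast
      then show ?thesis using p q by blast
    qed
  qed
qed

text \<open>The semistable objects of \<open>H\<close> are known, so \<open>\<lambda>\<^sub>1\<close> and \<open>\<rho>\<^sub>2\<close> preserve phases on the
  whole slicing, hence interval categories. Being exact, they send chains to chains,
  and an object killed by both is zero.\<close>

theorem vanishing_locally_finite:
  assumes lf: "locally_finite (tri_sub D D1) (Z1, P1)" "locally_finite (tri_sub D D2) (Z2, P2)"
    and b: "hom_vanish_le D 1 (Q1 {0<..1}) (Q2 {0<..<1})"
    and st: "stability_condition D (Z, P)" and g: "glued_from D D1 D2 (Z1, P1) (Z2, P2) (Z, P)"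
  shows "locally_finite D (Z, P)"
proof -
  interpret S: stability_on D Z P by unfold_locales (rule st)
  have eq: "P \<phi> = PG \<phi>" if "\<phi> \<in> {0<..1}" for \<phi>
    using G.HN_data_semistable[OF glued_HN_data(1)[OF st g] that] G.HN_data_semistable[OF PG_HN_data[OF b] that] by simp
  have PP: "rho E \<in> P2 \<phi> \<and> lam E \<in> P1 \<phi>" if E: "E \<in> P \<phi>" for E \<phi>
  proof -
    define n where "n = \<lceil>\<phi>\<rceil> - 1"
    have r: "\<phi> - real_of_int n \<in> {0<..1}" using ceiling_correct[of \<phi>] unfolding n_def by auto
    have "sh (- n) E \<in> star D (P2 (\<phi> - real_of_int n)) (P1 (\<phi> - real_of_int n))"
      using S.P_shift[OF E, of "- n"] eq[OF r] unfolding PG_def by simp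
    note s = star_shift[OF this, of n]
    have "sh n ` P2 (\<phi> - real_of_int n) \<subseteq> P2 \<phi>" "sh n ` P1 (\<phi> - real_of_int n) \<subseteq> P1 \<phi>"
      using S2.Ps_shift[of _ "\<phi> - real_of_int n" n] S1.Ps_shift[of _ "\<phi> - real_of_int n" n] by auto
    then have "sh n (sh (- n) E) \<in> star D (P2 \<phi>) (P1 \<phi>)" by (rule subsetD[OF star_mono s])
    then have "E \<in> star D (P2 \<phi>) (P1 \<phi>)" using S.P_obj[OF E] by simp
    then show ?thesis using glue_iff[OF S2.Ps_isoc S1.Ps_isoc] S2.Ps_S S1.Ps_S by blast
  qed
  have PI: "rho E \<in> Q2 I \<and> lam E \<in> Q1 I" if "E \<in> S.PI I" for E I
    using that
  proof (induction rule: S.PI_induct)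
    case (base \<phi> E) then show ?case using PP[OF base(2)] S2.Ps_PS[OF base(1)] S1.Ps_PS[OF base(1)] by blast
  next
    case (ext A E B) then show ?case using S2.PS_ext[OF lam_rho_exact(1)[OF ext(1)]] S1.PS_ext[OF lam_rho_exact(2)[OF ext(1)]] by blast
  qed
  obtain e1 where e1: "e1 > 0" "e1 \<le> 1/2" "\<And>\<phi>. acc_obj D (Q1 {\<phi> - e1<..<\<phi> + e1})" "\<And>\<phi>. dcc_obj D (Q1 {\<phi> - e1<..<\<phi> + e1})"
    using S1.small_chains_S[OF lf(1)] by blast
  obtain e2 where e2: "e2 > 0" "e2 \<le> 1/2" "\<And>\<phi>. acc_obj D (Q2 {\<phi> - e2<..<\<phi> + e2})" "\<And>\<phi>. dcc_obj D (Q2 {\<phi> - e2<..<\<phi> + e2})"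
    using S2.small_chains_S[OF lf(2)] by blast
  define e where "e = min e1 e2"
  have e: "e > 0" "e \<le> 1/2" "e \<le> e1" "e \<le> e2" using e1 e2 unfolding e_def by auto
  have "finite_length (full_sub D (S.PI {\<phi> - e<..<\<phi> + e}))" for \<phi>
  proof -
    let ?I = "{\<phi> - e<..<\<phi> + e}"
    interpret W: t_window D "S.PI {\<phi> - e<..}" "S.PI {..\<phi> - e}" "S.PI {\<phi> + e..}" "S.PI {..<\<phi> + e}" "S.PI ?I"
      using S.window_open e by simp
    have a: "acc_obj D (Q1 ?I)" "dcc_obj D (Q1 ?I)" "acc_obj D (Q2 ?I)" "dcc_obj D (Q2 ?I)"
    proof -
      have s1: "Q1 ?I \<subseteq> Q1 {\<phi> - e1<..<\<phi> + e1}" by (rule S1.PS_mono) (use e in auto)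
      have s2: "Q2 ?I \<subseteq> Q2 {\<phi> - e2<..<\<phi> + e2}" by (rule S2.PS_mono) (use e in auto)
      show "acc_obj D (Q1 ?I)" "dcc_obj D (Q1 ?I)" "acc_obj D (Q2 ?I)" "dcc_obj D (Q2 ?I)"
        using acc_obj_mono[OF e1(3) s1] dcc_obj_mono[OF e1(4) s1] acc_obj_mono[OF e2(3) s2] dcc_obj_mono[OF e2(4) s2] .
    qed
    have fin: "\<exists>N. \<forall>n\<ge>N. zero_object D (G' n)"
      if g: "\<exists>N. \<forall>n\<ge>N. zero_object D (lam (G' n))" "\<exists>N. \<forall>n\<ge>N. zero_object D (rho (G' n))" "\<And>n. G' n \<in> obj D" for G' :: "nat \<Rightarrow> 'o"
    proof -
      obtain N1 N2 where N: "\<And>n. n \<ge> N1 \<Longrightarrow> zero_object D (lam (G' n))" "\<And>n. n \<ge> N2 \<Longrightarrow> zero_object D (rho (G' n))" using g(1,2) by blast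
      have "zero_object D (G' n)" if "n \<ge> max N1 N2" for n
        using tr_zero_zero[OF lam_rho_tr[OF g(3)] N(2,1)] that by simp
      then show ?thesis by blast
    qed
    show ?thesis
    proof (rule W.finite_lengthI)
      show "acc_obj D (S.PI ?I)" unfolding acc_obj_def
      proof (intro allI impI)
        fix C G' assume h: "\<forall>n. C n \<in> S.PI ?I \<and> G' n \<in> S.PI ?I \<and> tr (G' n) (C n) (C (Suc n))"
        have "\<forall>n. lam (C n) \<in> Q1 ?I \<and> lam (G' n) \<in> Q1 ?I \<and> tr (lam (G' n)) (lam (C n)) (lam (C (Suc n)))"
          using h PI lam_rho_exact(2) by blast
        then have 1: "\<exists>N. \<forall>n\<ge>N. zero_object D (lam (G' n))"
          using a(1)[unfolded acc_obj_def, rule_format, of "\<lambda>n. lam (C n)" "\<lambda>n. lam (G' n)"] by blast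
        have "\<forall>n. rho (C n) \<in> Q2 ?I \<and> rho (G' n) \<in> Q2 ?I \<and> tr (rho (G' n)) (rho (C n)) (rho (C (Suc n)))"
          using h PI lam_rho_exact(1) by blast
        then have 2: "\<exists>N. \<forall>n\<ge>N. zero_object D (rho (G' n))"
          using a(3)[unfolded acc_obj_def, rule_format, of "\<lambda>n. rho (C n)" "\<lambda>n. rho (G' n)"] by blast
        show "\<exists>N. \<forall>n\<ge>N. zero_object D (G' n)" using fin[OF 1 2] h S.PI_obj by blast
      qed
      show "dcc_obj D (S.PI ?I)" unfolding dcc_obj_def
      proof (intro allI impI)
        fix C G' assume h: "\<forall>n. C n \<in> S.PI ?I \<and> G' n \<in> S.PI ?I \<and> tr (C (Suc n)) (C n) (G' n)"
        have "\<forall>n. lam (C n) \<in> Q1 ?I \<and> lam (G' n) \<in> Q1 ?I \<and> tr (lam (C (Suc n))) (lam (C n)) (lam (G' n))"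
          using h PI lam_rho_exact(2) by blast
        then have 1: "\<exists>N. \<forall>n\<ge>N. zero_object D (lam (G' n))"
          using a(2)[unfolded dcc_obj_def, rule_format, of "\<lambda>n. lam (C n)" "\<lambda>n. lam (G' n)"] by blast
        have "\<forall>n. rho (C n) \<in> Q2 ?I \<and> rho (G' n) \<in> Q2 ?I \<and> tr (rho (C (Suc n))) (rho (C n)) (rho (G' n))"
          using h PI lam_rho_exact(1) by blast
        then have 2: "\<exists>N. \<forall>n\<ge>N. zero_object D (rho (G' n))"
          using a(4)[unfolded dcc_obj_def, rule_format, of "\<lambda>n. rho (C n)" "\<lambda>n. rho (G' n)"] by blast
        show "\<exists>N. \<forall>n\<ge>N. zero_object D (G' n)" using fin[OF 1 2] h S.PI_obj by blast
      qed
    qed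
  qed
  then show ?thesis unfolding locally_finite_def using e(1) by auto
qed

end

section \<open>The glued stability condition\<close>

theorem proposition3p5:
  fixes D :: "('o, 'm) tricat"
    and D1 D2 H1 H2 H :: "'o set"
    and \<sigma>1 \<sigma>2 :: "'o stab"
    and Z1 Z2 :: "('o \<Rightarrow>\<^sub>0 int) set \<Rightarrow> complex"
    and P1 P2 :: "real \<Rightarrow> 'o set"
    and cond_a cond_b :: bool
  assumes "triangulated_category D"
    and "semiorthogonal_decomposition D D1 D2"
    and "\<sigma>1 = (Z1, P1)" and "\<sigma>2 = (Z2, P2)"
    and "stability_condition (tri_sub D D1) \<sigma>1" and "locally_finite (tri_sub D D1) \<sigma>1"
    and "stability_condition (tri_sub D D2) \<sigma>2" and "locally_finite (tri_sub D D2) \<sigma>2"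
    and "H1 = stab_heart (tri_sub D D1) \<sigma>1" and "H2 = stab_heart (tri_sub D D2) \<sigma>2"
    and "hom_vanish_le D 0 H1 H2"
    and "H = glued_heart D D1 D2 H1 H2"
    and cond_a: "cond_a \<longleftrightarrow>
          0 isolated_in ((\<lambda>E. Im (Z1 (cls_tri (tri_sub D D1) E))) ` H1) \<and>
          0 isolated_in ((\<lambda>E. Im (Z2 (cls_tri (tri_sub D D2) E))) ` H2)"
    and cond_b: "cond_b \<longleftrightarrow>
          hom_vanish_le D 1 H1 (interval_cat (tri_sub D D2) P2 {0<..<1})"
    and "cond_a \<or> cond_b"
  shows "(\<exists>W. stability_function (full_sub D H) W \<and>
            (\<forall>E \<in> H. W (cls_ab (full_sub D H) E) = glued_charge D D1 D2 \<sigma>1 \<sigma>2 E) \<and>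
            HN_property (full_sub D H) W)
       \<and> (\<exists>\<sigma>. stability_condition D \<sigma> \<and> glued_from D D1 D2 \<sigma>1 \<sigma>2 \<sigma>)
       \<and> (\<forall>\<sigma>. stability_condition D \<sigma> \<and> glued_from D D1 D2 \<sigma>1 \<sigma>2 \<sigma> \<longrightarrow>
            (cond_a \<longrightarrow> finite_length (full_sub D (interval_cat D (snd \<sigma>) {0<..<1}))) \<and>
            (cond_b \<longrightarrow> locally_finite D \<sigma>))"
proof -
  note P = assms(5,7)[unfolded assms(3,4)]
  note lf = assms(6,8)[unfolded assms(3,4)]
  have H12: "H1 = interval_cat (tri_sub D D1) P1 {0<..1}" "H2 = interval_cat (tri_sub D D2) P2 {0<..1}"
    using assms(3,4,9,10) by (simp_all add: stab_heart_def)
  have gl: "gluing D D1 D2 Z1 Z2 P1 P2"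
    using assms(2,11) P unfolding H12 by (intro gluing.intro[OF assms(1)] gluing_axioms.intro)
  interpret g: gluing D D1 D2 Z1 Z2 P1 P2 by (rule gl)
  have H: "H = g.H" unfolding g.H_def assms(12) H12 ..
  note ca = cond_a[unfolded H12] and cb = cond_b[unfolded H12]
  have HN: "g.G.HN_all"
    using assms(15)
  proof
    assume cond_a then show ?thesis using g.discrete_glued_HN[OF lf] ca by blast
  next
    assume cond_b then show ?thesis using g.G.HN_data_all[OF g.PG_HN_data] cb by blast
  qed
  show ?thesis
  proof (intro conjI allI impI)
    show "\<exists>W. stability_function (full_sub D H) W \<and>
            (\<forall>E \<in> H. W (cls_ab (full_sub D H) E) = glued_charge D D1 D2 \<sigma>1 \<sigma>2 E) \<and>
            HN_property (full_sub D H) W"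
      unfolding H assms(3,4) by (rule g.glued_from_HN(1)[OF HN])
    show "\<exists>\<sigma>. stability_condition D \<sigma> \<and> glued_from D D1 D2 \<sigma>1 \<sigma>2 \<sigma>"
      unfolding assms(3,4) by (rule g.glued_from_HN(2)[OF HN])
  next
    fix \<sigma> assume "stability_condition D \<sigma> \<and> glued_from D D1 D2 \<sigma>1 \<sigma>2 \<sigma>"
    moreover obtain Z P where \<sigma>: "\<sigma> = (Z, P)" by (cases \<sigma>)
    ultimately have st: "stability_condition D (Z, P)" "glued_from D D1 D2 (Z1, P1) (Z2, P2) (Z, P)"
      using assms(3,4) by auto
    show "finite_length (full_sub D (interval_cat D (snd \<sigma>) {0<..<1}))" if cond_a
      using g.discrete_finite_length[OF st] ca that unfolding \<sigma> by simp
    show "locally_finite D \<sigma>" if cond_b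
      using g.vanishing_locally_finite[OF lf _ st] cb that unfolding \<sigma> by simp
  qed
qed

end
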